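(* Let $Q$ be a finite tree quiver, $A=\Bbbk Q$ its path algebra, and $\mathscr{D}_A$ the $2$-category defined in the context. Let $\mathcal{Q}^{(1)}$ be the quiver whose vertices are the indecomposable ideals of $A$, with exactly one arrow from $I$ to $J$ if $I$ covers $J$ in the poset (with respect to inclusion) of all indecomposable ideals of $A$, and no arrows from $I$ to $J$ otherwise. Then $\mathcal{Q}^{(1)}$ is the quiver of the underlying algebra of the principal $2$-representation $\mathbf{P}_{\mathtt{i}}$ of $\mathscr{D}_A$, and the relations are exactly all commutativity relations: the underlying algebra is the quotient of the path algebra $\Bbbk\mathcal{Q}^{(1)}$ by the ideal generated by all differences $p-q$, where $p$ and $q$ are paths in $\mathcal{Q}^{(1)}$ with the same source and the same target.
   Context: $\Bbbk$ is an algebraically closed field; all categories and functors are $\Bbbk$-linear; modules are finitely generated left modules. A finite tree quiver is a finite quiver whose underlying graph is a tree. Paths are composed right to left. "Ideal" means two-sided ideal; ideals of $A$ are identified with subbimodules of ${}_AA_A$, and an ideal is indecomposable if it is (nonzero and) indecomposable as an $A$-$A$-bimodule. In a poset, $I$ covers $J$ if $J<I$ and there is no element strictly between them. For an ideal $I$, $\mathrm{Dp}_I$ is the functor $I\otimes_A{}_-:A\text{-mod}\to A\text{-mod}$. The $2$-category $\mathscr{D}_A$ has one object $\mathtt{i}$ (identified with a small category equivalent to $A$-mod); its $1$-morphisms are the functors given, up to equivalence with $A$-mod, by functors in the additive closure of all $\mathrm{Dp}_I$, $I$ an ideal of $A$; its $2$-morphisms are all natural transformations. The principal $2$-representation is $\mathbf{P}_{\mathtt{i}}=\mathscr{D}_A(\mathtt{i},{}_-)$.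 Its underlying algebra is the basic finite dimensional algebra $R$ such that $\overline{\mathbf{P}}_{\mathtt{i}}(\mathtt{i})\simeq R\text{-mod}$, where $\overline{\mathbf{P}}_{\mathtt{i}}(\mathtt{i})$ is the abelian category whose objects are diagrams $X\overset{\alpha}{\to}Y$ in $\mathscr{D}_A(\mathtt{i},\mathtt{i})$ and whose morphisms from $X\overset{\alpha}{\to}Y$ to $X'\overset{\alpha'}{\to}Y'$ are pairs $(f:X\to X',g:Y\to Y')$ with $g\alpha=\alpha'f$, modulo those pairs for which $g=\alpha'h$ for some $h:Y\to X'$. The vertex of $\mathcal{Q}^{(1)}$ given by an indecomposable ideal $I$ corresponds to the indecomposable projective object $P_{\mathrm{Dp}_I}=(0\to\mathrm{Dp}_I)$; arrows in the quiver go in the direction opposite to that of homomorphisms between the corresponding projective objects. *)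

theory Defs
  imports
    "HOL-Computational_Algebra.Polynomial"
    "HOL-Algebra.Module"
    "HOL-Algebra.QuotRing"
    "HOL-Algebra.Free_Abelian_Groups"
    "HOL-Algebra.Ideal_Product"
    "Graph_Theory.Digraph_Component"
begin

hide_const (open) Polynomial.smult

section \<open>Quivers and path algebras\<close>

text \<open>
  A quiver is a \<^typ>\<open>('v, 'e) pre_digraph\<close>, which allows loops and parallel arcs. Neither
  \<^const>\<open>forest\<close> nor \<^const>\<open>mk_symmetric\<close> describes the underlying multigraph of a quiver
  (directed cycles only, resp. parallel arcs identified). In the following doubled quiver, where
  the second component of an arc is a direction of travel, the cycles of the underlying multigraph
  are the cycles that use no arc twice; loops and pairs of parallel arcs give such cycles.
\<close>

definition double_quiver :: "('v, 'e) pre_digraph \<Rightarrow> ('v, 'e \<times> bool) pre_digraph" where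
  "double_quiver Q = \<lparr>verts = verts Q, arcs = arcs Q \<times> UNIV,
     tail = (\<lambda>(a, d). if d then tail Q a else head Q a),
     head = (\<lambda>(a, d). if d then head Q a else tail Q a)\<rparr>"

definition tree_quiver :: "('v, 'e) pre_digraph \<Rightarrow> bool" where
  "tree_quiver Q \<longleftrightarrow> fin_digraph Q \<and> Digraph_Component.connected Q \<and>
     \<not> (\<exists>p. pre_digraph.cycle (double_quiver Q) p \<and> distinct (map fst p))"

text \<open>
  A path is its source together with the list of its arcs, in the order in which they are
  traversed. Composition in the algebra is right to left: in \<open>p \<otimes> q\<close> the path \<open>q\<close> comes first.
\<close>

type_synonym ('v, 'e) qpath = "'v \<times> 'e list"

definition qpaths :: "('v, 'e) pre_digraph \<Rightarrow> ('v, 'e) qpath set" where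
  "qpaths Q = {(u, p). \<exists>v. pre_digraph.awalk Q u p v}"

definition qtarget :: "('v, 'e) pre_digraph \<Rightarrow> ('v, 'e) qpath \<Rightarrow> 'v" where
  "qtarget Q p = last (pre_digraph.awalk_verts Q (fst p) (snd p))"

definition path_algebra ::
    "('v, 'e) pre_digraph \<Rightarrow> ('k::field, ('v, 'e) qpath \<Rightarrow>\<^sub>0 'k) module" where
  "path_algebra Q = \<lparr>
     carrier = {f. Poly_Mapping.keys f \<subseteq> qpaths Q},
     monoid.mult = (\<lambda>f g. \<Sum>p\<in>Poly_Mapping.keys f. \<Sum>q\<in>Poly_Mapping.keys g.
        if fst p = qtarget Q q
        then Poly_Mapping.single (fst q, snd q @ snd p)
               (Poly_Mapping.lookup f p * Poly_Mapping.lookup g q)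
        else 0),
     monoid.one = (\<Sum>v\<in>verts Q. Poly_Mapping.single (v, []) 1),
     ring.zero = 0,
     ring.add = (+),
     module.smult = (\<lambda>c f. Poly_Mapping.map ((*) c) f)\<rparr>"

section \<open>Algebras over a field\<close>

text \<open>
  Algebras over the field \<open>'k\<close> are records whose ring part is the algebra and whose \<open>smult\<close> is the
  scalar multiplication by elements of the type \<open>'k\<close>. (The library's \<open>algebra\<close> is commutative.)
\<close>

definition k_algebra :: "('k::field, 'r) module \<Rightarrow> bool" where
  "k_algebra R \<longleftrightarrow> ring R \<and>
     (\<forall>c. \<forall>x\<in>carrier R. c \<odot>\<^bsub>R\<^esub> x \<in> carrier R) \<and>
     (\<forall>c d. \<forall>x\<in>carrier R. (c + d) \<odot>\<^bsub>R\<^esub> x = c \<odot>\<^bsub>R\<^esub> x \<oplus>\<^bsub>R\<^esub> d \<odot>\<^bsub>R\<^esub> x) \<and>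
     (\<forall>c. \<forall>x\<in>carrier R. \<forall>y\<in>carrier R. c \<odot>\<^bsub>R\<^esub> (x \<oplus>\<^bsub>R\<^esub> y) = c \<odot>\<^bsub>R\<^esub> x \<oplus>\<^bsub>R\<^esub> c \<odot>\<^bsub>R\<^esub> y) \<and>
     (\<forall>c d. \<forall>x\<in>carrier R. (c * d) \<odot>\<^bsub>R\<^esub> x = c \<odot>\<^bsub>R\<^esub> (d \<odot>\<^bsub>R\<^esub> x)) \<and>
     (\<forall>x\<in>carrier R. 1 \<odot>\<^bsub>R\<^esub> x = x) \<and>
     (\<forall>c. \<forall>x\<in>carrier R. \<forall>y\<in>carrier R.
        (c \<odot>\<^bsub>R\<^esub> x) \<otimes>\<^bsub>R\<^esub> y = c \<odot>\<^bsub>R\<^esub> (x \<otimes>\<^bsub>R\<^esub> y) \<and> x \<otimes>\<^bsub>R\<^esub> (c \<odot>\<^bsub>R\<^esub> y) = c \<odot>\<^bsub>R\<^esub> (x \<otimes>\<^bsub>R\<^esub> y))"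

definition fin_dim :: "('k::field, 'r) module \<Rightarrow> bool" where
  "fin_dim R \<longleftrightarrow> (\<exists>B. finite B \<and> B \<subseteq> carrier R \<and>
     (\<forall>x\<in>carrier R. \<exists>c. x = finsum R (\<lambda>b. c b \<odot>\<^bsub>R\<^esub> b) B))"

definition quot_algebra :: "('k, 'r) module \<Rightarrow> 'r set \<Rightarrow> ('k, 'r set) module" where
  "quot_algebra R I = \<lparr>
     carrier = carrier (R Quot I), monoid.mult = monoid.mult (R Quot I),
     monoid.one = monoid.one (R Quot I),
     ring.zero = ring.zero (R Quot I), ring.add = ring.add (R Quot I),
     module.smult = (\<lambda>c C. \<Union>x\<in>C. I +>\<^bsub>R\<^esub> (c \<odot>\<^bsub>R\<^esub> x))\<rparr>"

definition commutativity_relations ::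
    "('v, 'e) pre_digraph \<Rightarrow> (('v, 'e) qpath \<Rightarrow>\<^sub>0 'k::field) set" where
  "commutativity_relations Q = {Poly_Mapping.single p 1 - Poly_Mapping.single q 1 | p q.
     p \<in> qpaths Q \<and> q \<in> qpaths Q \<and> fst p = fst q \<and> qtarget Q p = qtarget Q q}"

definition commutativity_ideal ::
    "('v, 'e) pre_digraph \<Rightarrow> (('v, 'e) qpath \<Rightarrow>\<^sub>0 'k::field) set" where
  "commutativity_ideal Q = genideal (path_algebra Q) (commutativity_relations Q)"

definition commutative_path_algebra ::
    "('v, 'e) pre_digraph \<Rightarrow> ('k::field, (('v, 'e) qpath \<Rightarrow>\<^sub>0 'k) set) module" where
  "commutative_path_algebra Q = quot_algebra (path_algebra Q) (commutativity_ideal Q)"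

definition vertex_idem ::
    "('v, 'e) pre_digraph \<Rightarrow> 'v \<Rightarrow> (('v, 'e) qpath \<Rightarrow>\<^sub>0 'k::field) set" where
  "vertex_idem Q v =
     commutativity_ideal Q +>\<^bsub>path_algebra Q\<^esub> Poly_Mapping.single (v, []) 1"

section \<open>The quiver of indecomposable ideals\<close>

text \<open>
  The subbimodules of an ideal \<open>I\<close> are the ideals contained in \<open>I\<close>, so a decomposition of the
  bimodule \<open>I\<close> is a decomposition into a direct sum of two ideals.
\<close>

definition indecomposable_ideal :: "('r, 'm) ring_scheme \<Rightarrow> 'r set \<Rightarrow> bool" where
  "indecomposable_ideal A I \<longleftrightarrow> ideal I A \<and> I \<noteq> {\<zero>\<^bsub>A\<^esub>} \<and>
     (\<forall>J K. ideal J A \<and> ideal K A \<and> J <+>\<^bsub>A\<^esub> K = I \<and> J \<inter> K = {\<zero>\<^bsub>A\<^esub>} \<longrightarrow>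
        J = {\<zero>\<^bsub>A\<^esub>} \<or> K = {\<zero>\<^bsub>A\<^esub>})"

definition covers_in :: "'a set set \<Rightarrow> 'a set \<Rightarrow> 'a set \<Rightarrow> bool" where
  "covers_in P I J \<longleftrightarrow> I \<in> P \<and> J \<in> P \<and> J \<subset> I \<and> \<not> (\<exists>K\<in>P. J \<subset> K \<and> K \<subset> I)"

definition ideal_quiver :: "('r, 'm) ring_scheme \<Rightarrow> ('r set, 'r set \<times> 'r set) pre_digraph" where
  "ideal_quiver A = \<lparr>
     verts = {I. indecomposable_ideal A I},
     arcs = {(I, J). covers_in {I. indecomposable_ideal A I} I J},
     tail = fst, head = snd\<rparr>"

section \<open>Modules\<close>

text \<open>
  Modules over a not necessarily commutative ring. As in the library's locale \<open>module\<close>, the fields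
  \<open>mult\<close> and \<open>one\<close> of the record \<open>M\<close> play no role.
\<close>

definition left_module :: "('r, 'm) ring_scheme \<Rightarrow> ('r, 'u) module \<Rightarrow> bool" where
  "left_module R M \<longleftrightarrow> ring R \<and> abelian_group M \<and>
     (\<forall>r\<in>carrier R. \<forall>x\<in>carrier M. r \<odot>\<^bsub>M\<^esub> x \<in> carrier M) \<and>
     (\<forall>r\<in>carrier R. \<forall>s\<in>carrier R. \<forall>x\<in>carrier M.
        (r \<oplus>\<^bsub>R\<^esub> s) \<odot>\<^bsub>M\<^esub> x = r \<odot>\<^bsub>M\<^esub> x \<oplus>\<^bsub>M\<^esub> s \<odot>\<^bsub>M\<^esub> x) \<and>
     (\<forall>r\<in>carrier R. \<forall>x\<in>carrier M. \<forall>y\<in>carrier M.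
        r \<odot>\<^bsub>M\<^esub> (x \<oplus>\<^bsub>M\<^esub> y) = r \<odot>\<^bsub>M\<^esub> x \<oplus>\<^bsub>M\<^esub> r \<odot>\<^bsub>M\<^esub> y) \<and>
     (\<forall>r\<in>carrier R. \<forall>s\<in>carrier R. \<forall>x\<in>carrier M. (r \<otimes>\<^bsub>R\<^esub> s) \<odot>\<^bsub>M\<^esub> x = r \<odot>\<^bsub>M\<^esub> (s \<odot>\<^bsub>M\<^esub> x)) \<and>
     (\<forall>x\<in>carrier M. \<one>\<^bsub>R\<^esub> \<odot>\<^bsub>M\<^esub> x = x)"

definition fin_gen :: "('r, 'm) ring_scheme \<Rightarrow> ('r, 'u) module \<Rightarrow> bool" where
  "fin_gen R M \<longleftrightarrow> (\<exists>S. finite S \<and> S \<subseteq> carrier M \<and>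
     (\<forall>x\<in>carrier M. \<exists>c\<in>S \<rightarrow> carrier R. x = finsum M (\<lambda>s. c s \<odot>\<^bsub>M\<^esub> s) S))"

text \<open>
  Homomorphisms are taken extensional, so that equality of homomorphisms is equality on the
  carrier.
\<close>

definition mod_hom ::
    "('r, 'm) ring_scheme \<Rightarrow> ('r, 'u) module \<Rightarrow> ('r, 'w) module \<Rightarrow> ('u \<Rightarrow> 'w) set" where
  "mod_hom R M N = {f. f \<in> carrier M \<rightarrow>\<^sub>E carrier N \<and>
     (\<forall>x\<in>carrier M. \<forall>y\<in>carrier M. f (x \<oplus>\<^bsub>M\<^esub> y) = f x \<oplus>\<^bsub>N\<^esub> f y) \<and>
     (\<forall>r\<in>carrier R. \<forall>x\<in>carrier M. f (r \<odot>\<^bsub>M\<^esub> x) = r \<odot>\<^bsub>N\<^esub> f x)}"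

definition mod_iso ::
    "('r, 'm) ring_scheme \<Rightarrow> ('r, 'u) module \<Rightarrow> ('r, 'w) module \<Rightarrow> ('u \<Rightarrow> 'w) set" where
  "mod_iso R M N = {f \<in> mod_hom R M N. bij_betw f (carrier M) (carrier N)}"

definition left_ideal :: "('r, 'm) ring_scheme \<Rightarrow> 'r set \<Rightarrow> bool" where
  "left_ideal R L \<longleftrightarrow> additive_subgroup L R \<and> (\<forall>r\<in>carrier R. \<forall>x\<in>L. r \<otimes>\<^bsub>R\<^esub> x \<in> L)"

definition jacobson_radical :: "('r, 'm) ring_scheme \<Rightarrow> 'r set" where
  "jacobson_radical R = carrier R \<inter> \<Inter>{L. left_ideal R L \<and> L \<noteq> carrier R \<and>
     (\<forall>L'. left_ideal R L' \<and> L \<subseteq> L' \<longrightarrow> L' = L \<or> L' = carrier R)}"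

definition left_principal :: "('k, 'r) module \<Rightarrow> 'r \<Rightarrow> ('r, 'r) module" where
  "left_principal R e = \<lparr>
     carrier = {x \<otimes>\<^bsub>R\<^esub> e | x. x \<in> carrier R}, monoid.mult = monoid.mult R, monoid.one = monoid.one R,
     ring.zero = ring.zero R, ring.add = ring.add R, module.smult = monoid.mult R\<rparr>"

section \<open>Basic algebras and their quivers\<close>

definition idem :: "('r, 'm) ring_scheme \<Rightarrow> 'r \<Rightarrow> bool" where
  "idem R e \<longleftrightarrow> e \<in> carrier R \<and> e \<otimes>\<^bsub>R\<^esub> e = e"

definition primitive_idem :: "('r, 'm) ring_scheme \<Rightarrow> 'r \<Rightarrow> bool" where
  "primitive_idem R e \<longleftrightarrow> idem R e \<and> e \<noteq> \<zero>\<^bsub>R\<^esub> \<and>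
     (\<forall>f g. idem R f \<and> idem R g \<and> f \<otimes>\<^bsub>R\<^esub> g = \<zero>\<^bsub>R\<^esub> \<and> g \<otimes>\<^bsub>R\<^esub> f = \<zero>\<^bsub>R\<^esub> \<and> f \<oplus>\<^bsub>R\<^esub> g = e \<longrightarrow>
        f = \<zero>\<^bsub>R\<^esub> \<or> g = \<zero>\<^bsub>R\<^esub>)"

definition complete_primitive_idems :: "('r, 'm) ring_scheme \<Rightarrow> 'r set \<Rightarrow> bool" where
  "complete_primitive_idems R E \<longleftrightarrow> finite E \<and> (\<forall>e\<in>E. primitive_idem R e) \<and>
     (\<forall>e\<in>E. \<forall>f\<in>E. e \<noteq> f \<longrightarrow> e \<otimes>\<^bsub>R\<^esub> f = \<zero>\<^bsub>R\<^esub>) \<and> finsum R (\<lambda>e. e) E = \<one>\<^bsub>R\<^esub>"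

definition basic_fd_algebra :: "('k::field, 'r) module \<Rightarrow> bool" where
  "basic_fd_algebra R \<longleftrightarrow> k_algebra R \<and> fin_dim R \<and>
     (\<exists>E. complete_primitive_idems R E \<and>
        (\<forall>e\<in>E. \<forall>f\<in>E. e \<noteq> f \<longrightarrow> mod_iso R (left_principal R e) (left_principal R f) = {}))"

text \<open>For subspaces \<open>W \<subseteq> U\<close> of \<open>R\<close>: the quotient space \<open>U / W\<close> has dimension \<open>n\<close>.\<close>

definition quot_dim :: "('k, 'r) module \<Rightarrow> 'r set \<Rightarrow> 'r set \<Rightarrow> nat \<Rightarrow> bool" where
  "quot_dim R U W n \<longleftrightarrow> (\<exists>B. finite B \<and> card B = n \<and> B \<subseteq> U \<and>
     (\<forall>x\<in>U. \<exists>!c. c \<in> B \<rightarrow>\<^sub>E UNIV \<and> x \<ominus>\<^bsub>R\<^esub> finsum R (\<lambda>b. c b \<odot>\<^bsub>R\<^esub> b) B \<in> W))"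

definition corner :: "('r, 'm) ring_scheme \<Rightarrow> 'r \<Rightarrow> 'r set \<Rightarrow> 'r \<Rightarrow> 'r set" where
  "corner R e U f = {e \<otimes>\<^bsub>R\<^esub> x \<otimes>\<^bsub>R\<^esub> f | x. x \<in> U}"

text \<open>
  \<open>G\<close> is the (Gabriel) quiver of \<open>R\<close>, with the vertex \<open>v\<close> given by the primitive idempotent \<open>e v\<close>.
  Since paths are composed right to left, the arrows from \<open>u\<close> to \<open>v\<close> are counted by
  \<open>e v (rad R / rad\<^sup>2 R) e u\<close>; this corresponds to homomorphisms from \<open>R (e v)\<close> to \<open>R (e u)\<close>.
\<close>

definition quiver_of_algebra ::
    "('k::field, 'r) module \<Rightarrow> ('v, 'e) pre_digraph \<Rightarrow> ('v \<Rightarrow> 'r) \<Rightarrow> bool" where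
  "quiver_of_algebra R G e \<longleftrightarrow> fin_digraph G \<and> inj_on e (verts G) \<and>
     complete_primitive_idems R (e ` verts G) \<and>
     (\<forall>u\<in>verts G. \<forall>v\<in>verts G.
        quot_dim R
          (corner R (e v) (jacobson_radical R) (e u))
          (corner R (e v) (ideal_prod R (jacobson_radical R) (jacobson_radical R)) (e u))
          (card {a \<in> arcs G. tail G a = u \<and> head G a = v}))"

section \<open>Linear categories\<close>

text \<open>
  Morphism sets of different pairs of objects need not be disjoint, so all operations take the
  objects involved as arguments; \<open>cmp C X Y Z g f\<close> is the composite of \<open>f : X \<rightarrow> Y\<close> and
  \<open>g : Y \<rightarrow> Z\<close>.
\<close>

record ('k, 'o, 'm) lincat =
  ob :: "'o set"
  mor :: "'o \<Rightarrow> 'o \<Rightarrow> 'm set"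
  cmp :: "'o \<Rightarrow> 'o \<Rightarrow> 'o \<Rightarrow> 'm \<Rightarrow> 'm \<Rightarrow> 'm"
  idm :: "'o \<Rightarrow> 'm"
  madd :: "'o \<Rightarrow> 'o \<Rightarrow> 'm \<Rightarrow> 'm \<Rightarrow> 'm"
  mzero :: "'o \<Rightarrow> 'o \<Rightarrow> 'm"
  mscale :: "'o \<Rightarrow> 'o \<Rightarrow> 'k \<Rightarrow> 'm \<Rightarrow> 'm"

record ('o, 'm, 'o2, 'm2) cfunctor =
  fob :: "'o \<Rightarrow> 'o2"
  fmor :: "'o \<Rightarrow> 'o \<Rightarrow> 'm \<Rightarrow> 'm2"

definition linear_functor ::
    "('k, 'o, 'm) lincat \<Rightarrow> ('k, 'o2, 'm2) lincat \<Rightarrow> ('o, 'm, 'o2, 'm2) cfunctor \<Rightarrow> bool" where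
  "linear_functor C D F \<longleftrightarrow>
     (\<forall>X\<in>ob C. fob F X \<in> ob D \<and> fmor F X X (idm C X) = idm D (fob F X)) \<and>
     (\<forall>X\<in>ob C. \<forall>Y\<in>ob C. \<forall>f\<in>mor C X Y. fmor F X Y f \<in> mor D (fob F X) (fob F Y)) \<and>
     (\<forall>X\<in>ob C. \<forall>Y\<in>ob C. \<forall>Z\<in>ob C. \<forall>f\<in>mor C X Y. \<forall>g\<in>mor C Y Z.
        fmor F X Z (cmp C X Y Z g f) =
          cmp D (fob F X) (fob F Y) (fob F Z) (fmor F Y Z g) (fmor F X Y f)) \<and>
     (\<forall>X\<in>ob C. \<forall>Y\<in>ob C. \<forall>f\<in>mor C X Y. \<forall>g\<in>mor C X Y.
        fmor F X Y (madd C X Y f g) =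
          madd D (fob F X) (fob F Y) (fmor F X Y f) (fmor F X Y g)) \<and>
     (\<forall>X\<in>ob C. \<forall>Y\<in>ob C. \<forall>c. \<forall>f\<in>mor C X Y.
        fmor F X Y (mscale C X Y c f) = mscale D (fob F X) (fob F Y) c (fmor F X Y f))"

text \<open>The functor with the given values on \<open>C\<close> and the default value \<open>undefined\<close> elsewhere.\<close>

definition mk_functor ::
    "('k, 'o, 'm) lincat \<Rightarrow> ('o \<Rightarrow> 'o2) \<Rightarrow> ('o \<Rightarrow> 'o \<Rightarrow> 'm \<Rightarrow> 'm2) \<Rightarrow> ('o, 'm, 'o2, 'm2) cfunctor" where
  "mk_functor C fo fm = \<lparr>fob = (\<lambda>X\<in>ob C. fo X),
     fmor = (\<lambda>X\<in>ob C. \<lambda>Y\<in>ob C. \<lambda>f\<in>mor C X Y. fm X Y f)\<rparr>"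

definition id_functor :: "('k, 'o, 'm) lincat \<Rightarrow> ('o, 'm, 'o, 'm) cfunctor" where
  "id_functor C = mk_functor C (\<lambda>X. X) (\<lambda>X Y f. f)"

definition comp_functor ::
    "('k, 'o, 'm) lincat \<Rightarrow> ('o2, 'm2, 'o3, 'm3) cfunctor \<Rightarrow> ('o, 'm, 'o2, 'm2) cfunctor \<Rightarrow>
     ('o, 'm, 'o3, 'm3) cfunctor" where
  "comp_functor C G F = mk_functor C (\<lambda>X. fob G (fob F X))
     (\<lambda>X Y f. fmor G (fob F X) (fob F Y) (fmor F X Y f))"

definition nat_trans ::
    "('k, 'o, 'm) lincat \<Rightarrow> ('k, 'o2, 'm2) lincat \<Rightarrow> ('o, 'm, 'o2, 'm2) cfunctor \<Rightarrow>
     ('o, 'm, 'o2, 'm2) cfunctor \<Rightarrow> ('o \<Rightarrow> 'm2) set" where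
  "nat_trans C D F G = {\<eta>. \<eta> \<in> extensional (ob C) \<and>
     (\<forall>X\<in>ob C. \<eta> X \<in> mor D (fob F X) (fob G X)) \<and>
     (\<forall>X\<in>ob C. \<forall>Y\<in>ob C. \<forall>f\<in>mor C X Y.
        cmp D (fob F X) (fob F Y) (fob G Y) (\<eta> Y) (fmor F X Y f) =
        cmp D (fob F X) (fob G X) (fob G Y) (fmor G X Y f) (\<eta> X))}"

definition cat_iso :: "('k, 'o, 'm) lincat \<Rightarrow> 'o \<Rightarrow> 'o \<Rightarrow> 'm \<Rightarrow> bool" where
  "cat_iso C X Y f \<longleftrightarrow> f \<in> mor C X Y \<and>
     (\<exists>g\<in>mor C Y X. cmp C X Y X g f = idm C X \<and> cmp C Y X Y f g = idm C Y)"

definition nat_isomorphic ::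
    "('k, 'o, 'm) lincat \<Rightarrow> ('k, 'o2, 'm2) lincat \<Rightarrow> ('o, 'm, 'o2, 'm2) cfunctor \<Rightarrow>
     ('o, 'm, 'o2, 'm2) cfunctor \<Rightarrow> bool" where
  "nat_isomorphic C D F G \<longleftrightarrow>
     (\<exists>\<eta>\<in>nat_trans C D F G. \<forall>X\<in>ob C. cat_iso D (fob F X) (fob G X) (\<eta> X))"

definition linear_equivalence ::
    "('k, 'o, 'm) lincat \<Rightarrow> ('k, 'o2, 'm2) lincat \<Rightarrow> ('o, 'm, 'o2, 'm2) cfunctor \<Rightarrow> bool" where
  "linear_equivalence C D F \<longleftrightarrow> linear_functor C D F \<and>
     (\<exists>G. linear_functor D C G \<and>
        nat_isomorphic C C (id_functor C) (comp_functor C G F) \<and>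
        nat_isomorphic D D (comp_functor D F G) (id_functor D))"

definition full_subcat :: "('k, 'o, 'm) lincat \<Rightarrow> 'o set \<Rightarrow> ('k, 'o, 'm) lincat" where
  "full_subcat C S = C\<lparr>ob := ob C \<inter> S\<rparr>"

definition functor_cat ::
    "('k, 'o, 'm) lincat \<Rightarrow> ('k, 'o2, 'm2) lincat \<Rightarrow>
     ('k, ('o, 'm, 'o2, 'm2) cfunctor, 'o \<Rightarrow> 'm2) lincat" where
  "functor_cat C D = \<lparr>
     ob = {F. linear_functor C D F \<and> mk_functor C (fob F) (fmor F) = F},
     mor = nat_trans C D,
     cmp = (\<lambda>F G H \<beta> \<alpha>. \<lambda>X\<in>ob C. cmp D (fob F X) (fob G X) (fob H X) (\<beta> X) (\<alpha> X)),
     idm = (\<lambda>F. \<lambda>X\<in>ob C. idm D (fob F X)),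
     madd = (\<lambda>F G \<alpha> \<beta>. \<lambda>X\<in>ob C. madd D (fob F X) (fob G X) (\<alpha> X) (\<beta> X)),
     mzero = (\<lambda>F G. \<lambda>X\<in>ob C. mzero D (fob F X) (fob G X)),
     mscale = (\<lambda>F G c \<alpha>. \<lambda>X\<in>ob C. mscale D (fob F X) (fob G X) c (\<alpha> X))\<rparr>"

definition is_biproduct :: "('k, 'o, 'm) lincat \<Rightarrow> 'o list \<Rightarrow> 'o \<Rightarrow> bool" where
  "is_biproduct C Ys B \<longleftrightarrow> set Ys \<subseteq> ob C \<and> B \<in> ob C \<and>
     (\<exists>\<iota> \<pi>.
        (\<forall>i<length Ys. \<iota> i \<in> mor C (Ys ! i) B \<and> \<pi> i \<in> mor C B (Ys ! i)) \<and>
        (\<forall>i<length Ys. \<forall>j<length Ys. cmp C (Ys ! i) B (Ys ! j) (\<pi> j) (\<iota> i) =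
           (if i = j then idm C (Ys ! i) else mzero C (Ys ! i) (Ys ! j))) \<and>
        foldr (madd C B B) (map (\<lambda>i. cmp C B (Ys ! i) B (\<iota> i) (\<pi> i)) [0..<length Ys])
          (mzero C B B) = idm C B)"

text \<open>All direct summands of finite direct sums of objects from \<open>S\<close>; closed under isomorphism.\<close>

definition add_closure :: "('k, 'o, 'm) lincat \<Rightarrow> 'o set \<Rightarrow> 'o set" where
  "add_closure C S = {X. \<exists>Ys B X'. set Ys \<subseteq> S \<and> is_biproduct C Ys B \<and> is_biproduct C [X, X'] B}"

definition zero_ob :: "('k, 'o, 'm) lincat \<Rightarrow> 'o" where
  "zero_ob C = (SOME Z. Z \<in> ob C \<and> idm C Z = mzero C Z Z)"

text \<open>
  The abelianization of \<open>C\<close>, as the category of arrows of \<open>C\<close> modulo an ideal of morphisms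
  (given by the subspaces \<open>N X Y\<close> of the morphism spaces).
\<close>

definition arrow_cat ::
    "('k, 'o, 'm) lincat \<Rightarrow> ('k, 'o \<times> 'o \<times> 'm, 'm \<times> 'm) lincat" where
  "arrow_cat C = \<lparr>
     ob = {(X, Y, \<alpha>). X \<in> ob C \<and> Y \<in> ob C \<and> \<alpha> \<in> mor C X Y},
     mor = (\<lambda>(X, Y, \<alpha>) (X', Y', \<alpha>'). {(f, g). f \<in> mor C X X' \<and> g \<in> mor C Y Y' \<and>
        cmp C X Y Y' g \<alpha> = cmp C X X' Y' \<alpha>' f}),
     cmp = (\<lambda>(X, Y, \<alpha>) (X', Y', \<alpha>') (X'', Y'', \<alpha>'') (f', g') (f, g).
        (cmp C X X' X'' f' f, cmp C Y Y' Y'' g' g)),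
     idm = (\<lambda>(X, Y, \<alpha>). (idm C X, idm C Y)),
     madd = (\<lambda>(X, Y, \<alpha>) (X', Y', \<alpha>') (f, g) (f', g'). (madd C X X' f f', madd C Y Y' g g')),
     mzero = (\<lambda>(X, Y, \<alpha>) (X', Y', \<alpha>'). (mzero C X X', mzero C Y Y')),
     mscale = (\<lambda>(X, Y, \<alpha>) (X', Y', \<alpha>') c (f, g). (mscale C X X' c f, mscale C Y Y' c g))\<rparr>"

definition mor_coset ::
    "('k, 'o, 'm) lincat \<Rightarrow> ('o \<Rightarrow> 'o \<Rightarrow> 'm set) \<Rightarrow> 'o \<Rightarrow> 'o \<Rightarrow> 'm \<Rightarrow> 'm set" where
  "mor_coset C N X Y f = madd C X Y f ` N X Y"

definition quot_cat ::
    "('k, 'o, 'm) lincat \<Rightarrow> ('o \<Rightarrow> 'o \<Rightarrow> 'm set) \<Rightarrow> ('k, 'o, 'm set) lincat" where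
  "quot_cat C N = \<lparr>
     ob = ob C,
     mor = (\<lambda>X Y. mor_coset C N X Y ` mor C X Y),
     cmp = (\<lambda>X Y Z B A. \<Union>a\<in>A. \<Union>b\<in>B. mor_coset C N X Z (cmp C X Y Z b a)),
     idm = (\<lambda>X. mor_coset C N X X (idm C X)),
     madd = (\<lambda>X Y A B. \<Union>a\<in>A. \<Union>b\<in>B. mor_coset C N X Y (madd C X Y a b)),
     mzero = (\<lambda>X Y. mor_coset C N X Y (mzero C X Y)),
     mscale = (\<lambda>X Y c A. \<Union>a\<in>A. mor_coset C N X Y (mscale C X Y c a))\<rparr>"

definition null_maps ::
    "('k, 'o, 'm) lincat \<Rightarrow> 'o \<times> 'o \<times> 'm \<Rightarrow> 'o \<times> 'o \<times> 'm \<Rightarrow> ('m \<times> 'm) set" where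
  "null_maps C = (\<lambda>(X, Y, \<alpha>) (X', Y', \<alpha>').
     {(f, g) \<in> mor (arrow_cat C) (X, Y, \<alpha>) (X', Y', \<alpha>').
        \<exists>h\<in>mor C Y X'. g = cmp C Y X' Y' \<alpha>' h})"

definition abelianization ::
    "('k, 'o, 'm) lincat \<Rightarrow> ('k, 'o \<times> 'o \<times> 'm, ('m \<times> 'm) set) lincat" where
  "abelianization C = quot_cat (arrow_cat C) (null_maps C)"

text \<open>The object \<open>0 \<rightarrow> X\<close> of the abelianization.\<close>

definition proj_ob :: "('k, 'o, 'm) lincat \<Rightarrow> 'o \<Rightarrow> 'o \<times> 'o \<times> 'm" where
  "proj_ob C X = (zero_ob C, X, mzero C (zero_ob C) X)"

section \<open>Module categories and tensor products\<close>

text \<open>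
  Finitely generated left \<open>R\<close>-modules, for a finite dimensional algebra \<open>R\<close>. The carriers are
  subsets of the type \<open>nat \<Rightarrow> 'k\<close>, which contains vector spaces of every finite dimension; so this
  is a small category equivalent to that of all finitely generated \<open>R\<close>-modules. The field acts on
  a module through the multiples of the unit of \<open>R\<close>.
\<close>

type_synonym ('k, 'r) smod = "('r, nat \<Rightarrow> 'k) module"

type_synonym 'k smor = "(nat \<Rightarrow> 'k) \<Rightarrow> (nat \<Rightarrow> 'k)"

definition mod_cat ::
    "('k, 'r) module \<Rightarrow> ('k, ('k, 'r) smod, 'k smor) lincat" where
  "mod_cat R = \<lparr>
     ob = {M. left_module R M \<and> fin_gen R M},
     mor = mod_hom R,
     cmp = (\<lambda>L M N g f. compose (carrier L) g f),
     idm = (\<lambda>M. \<lambda>x\<in>carrier M. x),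
     madd = (\<lambda>M N f g. \<lambda>x\<in>carrier M. f x \<oplus>\<^bsub>N\<^esub> g x),
     mzero = (\<lambda>M N. \<lambda>x\<in>carrier M. \<zero>\<^bsub>N\<^esub>),
     mscale = (\<lambda>M N c f. \<lambda>x\<in>carrier M. (c \<odot>\<^bsub>R\<^esub> \<one>\<^bsub>R\<^esub>) \<odot>\<^bsub>N\<^esub> f x)\<rparr>"

text \<open>
  The tensor product \<open>I \<otimes>\<^sub>R M\<close> of an ideal \<open>I\<close> with a left module \<open>M\<close>: the free abelian group on
  \<open>I \<times> M\<close> modulo the usual relations, with \<open>R\<close> acting on the left factor.
\<close>

definition tensor_rels :: "('r, 'm) ring_scheme \<Rightarrow> 'r set \<Rightarrow> ('r, 'u) module \<Rightarrow>
    (('r \<times> 'u) \<Rightarrow>\<^sub>0 int) set" where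
  "tensor_rels R I M =
     {frag_of (x \<oplus>\<^bsub>R\<^esub> y, m) - frag_of (x, m) - frag_of (y, m) | x y m.
        x \<in> I \<and> y \<in> I \<and> m \<in> carrier M} \<union>
     {frag_of (x, m \<oplus>\<^bsub>M\<^esub> n) - frag_of (x, m) - frag_of (x, n) | x m n.
        x \<in> I \<and> m \<in> carrier M \<and> n \<in> carrier M} \<union>
     {frag_of (x \<otimes>\<^bsub>R\<^esub> r, m) - frag_of (x, r \<odot>\<^bsub>M\<^esub> m) | x r m.
        x \<in> I \<and> r \<in> carrier R \<and> m \<in> carrier M}"

definition tensor_class :: "('r, 'm) ring_scheme \<Rightarrow> 'r set \<Rightarrow> ('r, 'u) module \<Rightarrow>
    (('r \<times> 'u) \<Rightarrow>\<^sub>0 int) \<Rightarrow> (('r \<times> 'u) \<Rightarrow>\<^sub>0 int) set" where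
  "tensor_class R I M f =
     generate (free_Abelian_group (I \<times> carrier M)) (tensor_rels R I M)
       #>\<^bsub>free_Abelian_group (I \<times> carrier M)\<^esub> f"

definition tensor :: "('r, 'm) ring_scheme \<Rightarrow> 'r set \<Rightarrow> ('r, 'u) module \<Rightarrow>
    ('r, (('r \<times> 'u) \<Rightarrow>\<^sub>0 int) set) module" where
  "tensor R I M =
     (let T = free_Abelian_group (I \<times> carrier M) Mod
                generate (free_Abelian_group (I \<times> carrier M)) (tensor_rels R I M)
      in \<lparr>carrier = carrier T, monoid.mult = undefined, monoid.one = undefined,
          ring.zero = monoid.one T, ring.add = monoid.mult T,
          module.smult = (\<lambda>r C. \<Union>c\<in>C. tensor_class R I M
                      (frag_extend (\<lambda>(x, m). frag_of (r \<otimes>\<^bsub>R\<^esub> x, m)) c))\<rparr>)"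

definition tensor_map :: "('r, 'm) ring_scheme \<Rightarrow> 'r set \<Rightarrow> ('r, 'u) module \<Rightarrow> ('r, 'w) module \<Rightarrow>
    ('u \<Rightarrow> 'w) \<Rightarrow> (('r \<times> 'u) \<Rightarrow>\<^sub>0 int) set \<Rightarrow> (('r \<times> 'w) \<Rightarrow>\<^sub>0 int) set" where
  "tensor_map R I M N f = (\<lambda>C\<in>carrier (tensor R I M).
     \<Union>c\<in>C. tensor_class R I N (frag_extend (\<lambda>(x, m). frag_of (x, f m)) c))"

text \<open>
  Transport to the small category \<^const>\<open>mod_cat\<close>: an isomorphic copy of a finitely generated
  module, with a chosen isomorphism onto it.
\<close>

definition small_copy :: "('k, 'r) module \<Rightarrow> ('r, 'w) module \<Rightarrow> ('k, 'r) smod" where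
  "small_copy R T = (SOME M. M \<in> ob (mod_cat R) \<and> mod_iso R T M \<noteq> {})"

definition small_iso :: "('k, 'r) module \<Rightarrow> ('r, 'w) module \<Rightarrow> 'w \<Rightarrow> (nat \<Rightarrow> 'k)" where
  "small_iso R T = (SOME \<phi>. \<phi> \<in> mod_iso R T (small_copy R T))"

definition Dp :: "('k, 'r) module \<Rightarrow> 'r set \<Rightarrow>
    (('k, 'r) smod, 'k smor, ('k, 'r) smod, 'k smor) cfunctor" where
  "Dp R I = mk_functor (mod_cat R)
     (\<lambda>M. small_copy R (tensor R I M))
     (\<lambda>M N f. \<lambda>x\<in>carrier (small_copy R (tensor R I M)).
        small_iso R (tensor R I N) (tensor_map R I M N f
          (inv_into (carrier (tensor R I M)) (small_iso R (tensor R I M)) x)))"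

section \<open>The 2-category and its principal 2-representation\<close>

text \<open>
  Linear 2-categories: \<open>comp1 D i j k G F\<close> is the composite of \<open>F : i \<rightarrow> j\<close> and \<open>G : j \<rightarrow> k\<close>, and
  \<open>comp2 D i j k F F' G G' \<beta> \<alpha>\<close> the horizontal composite of \<open>\<alpha> : F \<Rightarrow> F'\<close> and \<open>\<beta> : G \<Rightarrow> G'\<close>.
\<close>

record ('k, 'x, 'o, 'm) lin2cat =
  ob2 :: "'x set"
  homcat :: "'x \<Rightarrow> 'x \<Rightarrow> ('k, 'o, 'm) lincat"
  comp1 :: "'x \<Rightarrow> 'x \<Rightarrow> 'x \<Rightarrow> 'o \<Rightarrow> 'o \<Rightarrow> 'o"
  unit1 :: "'x \<Rightarrow> 'o"
  comp2 :: "'x \<Rightarrow> 'x \<Rightarrow> 'x \<Rightarrow> 'o \<Rightarrow> 'o \<Rightarrow> 'o \<Rightarrow> 'o \<Rightarrow> 'm \<Rightarrow> 'm \<Rightarrow> 'm"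

record ('k, 'x, 'f, 't, 'o, 'm) two_rep =
  rep_ob :: "'x \<Rightarrow> ('k, 'o, 'm) lincat"
  rep_one :: "'x \<Rightarrow> 'x \<Rightarrow> 'f \<Rightarrow> ('o, 'm, 'o, 'm) cfunctor"
  rep_two :: "'x \<Rightarrow> 'x \<Rightarrow> 'f \<Rightarrow> 'f \<Rightarrow> 't \<Rightarrow> 'o \<Rightarrow> 'm"

definition principal_rep ::
    "('k, 'x, 'o, 'm) lin2cat \<Rightarrow> 'x \<Rightarrow> ('k, 'x, 'o, 'm, 'o, 'm) two_rep" where
  "principal_rep D i = \<lparr>
     rep_ob = (\<lambda>j. homcat D i j),
     rep_one = (\<lambda>j k G. mk_functor (homcat D i j) (\<lambda>X. comp1 D i j k G X)
        (\<lambda>X Y \<alpha>. comp2 D i j k X Y G G (idm (homcat D j k) G) \<alpha>)),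
     rep_two = (\<lambda>j k G G' \<beta>. \<lambda>X\<in>ob (homcat D i j).
        comp2 D i j k X X G G' \<beta> (idm (homcat D i j) X))\<rparr>"

definition projection_2cat :: "('k, 'r) module \<Rightarrow> ('k, unit,
    (('k, 'r) smod, 'k smor, ('k, 'r) smod, 'k smor) cfunctor,
    ('k, 'r) smod \<Rightarrow> 'k smor) lin2cat" where
  "projection_2cat A =
     (let C = mod_cat A; E = functor_cat C C in \<lparr>
        ob2 = {()},
        homcat = (\<lambda>_ _. full_subcat E (add_closure E {Dp A I | I. ideal I A})),
        comp1 = (\<lambda>_ _ _ G F. comp_functor C G F),
        unit1 = (\<lambda>_. id_functor C),
        comp2 = (\<lambda>_ _ _ F F' G G' \<beta> \<alpha>. \<lambda>X\<in>ob C.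
           cmp C (fob G (fob F X)) (fob G (fob F' X)) (fob G' (fob F' X))
             (\<beta> (fob F' X)) (fmor G (fob F X) (fob F' X) (\<alpha> X)))\<rparr>)"

text \<open>
  \<open>R\<close> is the underlying algebra of the 2-representation \<open>P\<close> at \<open>i\<close>, by means of the equivalence
  \<open>\<Phi>\<close>. Such an \<open>R\<close> is unique up to isomorphism, by Morita theory for basic algebras.
\<close>

definition underlying_algebra_via ::
    "('k::field, 'x, 'f, 't, 'o, 'm) two_rep \<Rightarrow> 'x \<Rightarrow> ('k, 'r) module \<Rightarrow>
     ('o \<times> 'o \<times> 'm, ('m \<times> 'm) set, ('k, 'r) smod, 'k smor) cfunctor \<Rightarrow> bool" where
  "underlying_algebra_via P i R \<Phi> \<longleftrightarrow> basic_fd_algebra R \<and>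
     linear_equivalence (abelianization (rep_ob P i)) (mod_cat R) \<Phi>"

end

theory Submission
  imports Defs
begin

text \<open>
  Since \<open>Q\<close> is a tree, there is at most one path between two vertices, so \<open>A\<close> is an incidence
  algebra and every bimodule homomorphism of ideals acts on the basis vectors by scalars. By the
  Eilenberg--Watts argument the transformations \<open>Dp\<^sub>I \<Rightarrow> Dp\<^sub>J\<close> are the bimodule homomorphisms
  \<open>I \<rightarrow> J\<close>. For indecomposable \<open>I\<close> and \<open>J\<close> these are the multiples of the inclusion if
  \<open>I \<subseteq> J\<close>, and zero otherwise. Hence the endomorphism algebra of the direct sum \<open>G\<close> of all \<open>Dp\<^sub>I\<close>
  is the incidence algebra of the poset of indecomposable ideals, which is its commutative path
  algebra. The cokernel of \<open>Hom(G, X) \<rightarrow> Hom(G, Y)\<close> defines an equivalence from the category of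
  diagrams \<open>X \<rightarrow> Y\<close> to the modules over this algebra; it is dense because the algebra is finite
  dimensional, and it sends \<open>0 \<rightarrow> Dp\<^sub>I\<close> to the projective module of the vertex \<open>I\<close>.
\<close>

section \<open>Module theory over a ring and over the ground field\<close>

section \<open>Modules\<close>

text \<open>One notion of incidence algebra, given by coefficient functions, serves twice: for the
  path algebra of the tree, ordered by paths, and for the commutative path algebra of the ideal
  quiver, ordered by reverse inclusion. In the latter the relations generate the kernel of the map
  that sums, for each pair of vertices, the coefficients of the paths between them. Directions need
  care. An arrow from \<open>I\<close> to \<open>J\<close> means that \<open>J\<close> lies in
  \<open>I\<close>, hence gives a transformation from \<open>Dp J\<close> to \<open>Dp I\<close>.
  The algebra is thus the opposite of the endomorphism algebra of \<open>G\<close>, which is what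
  makes \<open>Hom(G, Y)\<close> a left module. That \<open>G\<close> generates is expressed by
  identities being sums of morphisms through \<open>G\<close>. This property is inherited by direct
  sums and summands, so it is enough to decompose ideals. The small module category forces tensor
  products and cokernels to be replaced by isomorphic copies, chosen without any naturality.
  Morphisms are conjugated by the chosen isomorphisms, and equations are proved for the original
  modules.\<close>

locale lmod = R: ring R + M: abelian_group M
 for R :: "('r, 'm) ring_scheme" and M :: "('r, 'u) module" +
 assumes smult_closed [simp, intro]:
   "r \<in> carrier R ==> x \<in> carrier M ==> r \<odot>\<^bsub>M\<^esub> x \<in> carrier M"
  and add_smult: "r \<in> carrier R ==> s \<in> carrier R ==> x \<in> carrier M ==>
   (r \<oplus>\<^bsub>R\<^esub> s) \<odot>\<^bsub>M\<^esub> x = r \<odot>\<^bsub>M\<^esub> x \<oplus>\<^bsub>M\<^esub> s \<odot>\<^bsub>M\<^esub> x"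
  and smult_add: "r \<in> carrier R ==> x \<in> carrier M ==> y \<in> carrier M ==>
   r \<odot>\<^bsub>M\<^esub> (x \<oplus>\<^bsub>M\<^esub> y) = r \<odot>\<^bsub>M\<^esub> x \<oplus>\<^bsub>M\<^esub> r \<odot>\<^bsub>M\<^esub> y"
  and mult_smult: "r \<in> carrier R ==> s \<in> carrier R ==> x \<in> carrier M ==>
   (r \<otimes>\<^bsub>R\<^esub> s) \<odot>\<^bsub>M\<^esub> x = r \<odot>\<^bsub>M\<^esub> (s \<odot>\<^bsub>M\<^esub> x)"
  and one_smult [simp]: "x \<in> carrier M ==> \<one>\<^bsub>R\<^esub> \<odot>\<^bsub>M\<^esub> x = x"

lemma lmod_iff: "left_module R M \<longleftrightarrow> lmod R M"
 unfolding left_module_def lmod_def lmod_axioms_def by (safe; simp)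

text \<open>Negatives are not demanded, being multiples by minus one
  (\<open>lsubmodule_neg\<close>). Over \<open>field_ring\<close> these are the linear
  subspaces.\<close>

definition lsubmodule :: "('r, 'm) ring_scheme => ('r, 'u) module => 'u set => bool" where
 "lsubmodule R M N \<longleftrightarrow> N \<subseteq> carrier M \<and> \<zero>\<^bsub>M\<^esub> \<in> N \<and> (\<forall>x\<in>N. \<forall>y\<in>N. x \<oplus>\<^bsub>M\<^esub> y \<in> N) \<and>
   (\<forall>r\<in>carrier R. \<forall>x\<in>N. r \<odot>\<^bsub>M\<^esub> x \<in> N)"

context lmod begin

lemma zero_smult [simp]: assumes "x \<in> carrier M" shows "\<zero>\<^bsub>R\<^esub> \<odot>\<^bsub>M\<^esub> x = \<zero>\<^bsub>M\<^esub>"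
proof -
 have "\<zero>\<^bsub>R\<^esub> \<odot>\<^bsub>M\<^esub> x \<oplus>\<^bsub>M\<^esub> \<zero>\<^bsub>R\<^esub> \<odot>\<^bsub>M\<^esub> x = \<zero>\<^bsub>R\<^esub> \<odot>\<^bsub>M\<^esub> x"
  using add_smult[of "\<zero>\<^bsub>R\<^esub>" "\<zero>\<^bsub>R\<^esub>" x] assms by simp
 then show ?thesis using assms by (metis R.zero_closed smult_closed M.add.l_cancel_one)
qed

lemma smult_zero [simp]: assumes "r \<in> carrier R" shows "r \<odot>\<^bsub>M\<^esub> \<zero>\<^bsub>M\<^esub> = \<zero>\<^bsub>M\<^esub>"
proof -
 have "r \<odot>\<^bsub>M\<^esub> \<zero>\<^bsub>M\<^esub> \<oplus>\<^bsub>M\<^esub> r \<odot>\<^bsub>M\<^esub> \<zero>\<^bsub>M\<^esub> = r \<odot>\<^bsub>M\<^esub> \<zero>\<^bsub>M\<^esub>"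
  using smult_add[of r "\<zero>\<^bsub>M\<^esub>" "\<zero>\<^bsub>M\<^esub>"] assms by simp
 then show ?thesis using assms by (metis M.zero_closed smult_closed M.add.l_cancel_one)
qed

lemma neg_smult: assumes "r \<in> carrier R" "x \<in> carrier M"
 shows "(\<ominus>\<^bsub>R\<^esub> r) \<odot>\<^bsub>M\<^esub> x = \<ominus>\<^bsub>M\<^esub> (r \<odot>\<^bsub>M\<^esub> x)"
proof -
 have "(\<ominus>\<^bsub>R\<^esub> r) \<odot>\<^bsub>M\<^esub> x \<oplus>\<^bsub>M\<^esub> r \<odot>\<^bsub>M\<^esub> x = \<zero>\<^bsub>M\<^esub>"
  using add_smult[of "\<ominus>\<^bsub>R\<^esub> r" r x] assms by (simp add: R.l_neg)
 then show ?thesis using assms by (metis M.minus_equality R.a_inv_closed smult_closed)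
qed

lemma smult_neg: assumes "r \<in> carrier R" "x \<in> carrier M"
 shows "r \<odot>\<^bsub>M\<^esub> (\<ominus>\<^bsub>M\<^esub> x) = \<ominus>\<^bsub>M\<^esub> (r \<odot>\<^bsub>M\<^esub> x)"
proof -
 have "r \<odot>\<^bsub>M\<^esub> (\<ominus>\<^bsub>M\<^esub> x) \<oplus>\<^bsub>M\<^esub> r \<odot>\<^bsub>M\<^esub> x = \<zero>\<^bsub>M\<^esub>"
  using smult_add[of r "\<ominus>\<^bsub>M\<^esub> x" x] assms by (simp add: M.l_neg)
 then show ?thesis using assms by (metis M.minus_equality M.a_inv_closed smult_closed)
qed

lemma lsubmodule_neg: "lsubmodule R M N ==> x \<in> N ==> \<ominus>\<^bsub>M\<^esub> x \<in> N"
proof -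
 assume N: "lsubmodule R M N" "x \<in> N"
 then have "(\<ominus>\<^bsub>R\<^esub> \<one>\<^bsub>R\<^esub>) \<odot>\<^bsub>M\<^esub> x \<in> N" by (simp add: lsubmodule_def)
 moreover have "x \<in> carrier M" using N by (auto simp: lsubmodule_def)
 ultimately show ?thesis by (simp add: neg_smult)
qed

lemma lsubmodule_finsum:
 assumes "lsubmodule R M N" "!!s. s \<in> S ==> f s \<in> N"
 shows "finsum M f S \<in> N"
 using assms(2)
proof (induction S rule: infinite_finite_induct)
 case (infinite A) then show ?case using assms(1) by (simp add: M.finsum_infinite lsubmodule_def)
next
 case empty then show ?case using assms(1) by (simp add: lsubmodule_def)
next
 case (insert x F)
 have "N \<subseteq> carrier M" using assms(1) by (simp add: lsubmodule_def)
 then have "finsum M f (insert x F) = f x \<oplus>\<^bsub>M\<^esub> finsum M f F"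
  using insert by (intro M.finsum_insert) auto
 then show ?case using insert assms(1) by (simp add: lsubmodule_def)
qed

lemma smult_finsum:
 assumes "r \<in> carrier R" "f \<in> S \<rightarrow> carrier M"
 shows "r \<odot>\<^bsub>M\<^esub> finsum M f S = finsum M (%s. r \<odot>\<^bsub>M\<^esub> f s) S"
 using assms(2)
proof (induction S rule: infinite_finite_induct)
 case (insert x F)
 then show ?case using assms(1) by (subst (1 2) M.finsum_insert) (auto simp: smult_add)
qed (use assms in "auto simp: M.finsum_infinite")

lemma lsubmodule_combinations:
 assumes S: "finite S" "S \<subseteq> carrier M"
 defines "N \<equiv> {finsum M (%s. c s \<odot>\<^bsub>M\<^esub> s) S | c. c \<in> S \<rightarrow> carrier R}"
 shows "lsubmodule R M N" "S \<subseteq> N"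
proof -
 show "lsubmodule R M N" unfolding lsubmodule_def
 proof (intro conjI ballI)
  show "N \<subseteq> carrier M" using S by (auto simp: N_def intro!: M.finsum_closed)
  have "finsum M (%s. \<zero>\<^bsub>R\<^esub> \<odot>\<^bsub>M\<^esub> s) S = finsum M (%s. \<zero>\<^bsub>M\<^esub>) S"
   using S by (intro M.finsum_cong') auto
  then have "\<zero>\<^bsub>M\<^esub> = finsum M (%s. \<zero>\<^bsub>R\<^esub> \<odot>\<^bsub>M\<^esub> s) S" by simp
  then show "\<zero>\<^bsub>M\<^esub> \<in> N" unfolding N_def by (intro CollectI exI[of _ "%s. \<zero>\<^bsub>R\<^esub>"]) auto
 next
  fix x y assume "x \<in> N" "y \<in> N"
  then obtain c d where c: "c \<in> S \<rightarrow> carrier R" "x = finsum M (%s. c s \<odot>\<^bsub>M\<^esub> s) S"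
   and d: "d \<in> S \<rightarrow> carrier R" "y = finsum M (%s. d s \<odot>\<^bsub>M\<^esub> s) S" unfolding N_def by blast
  have "finsum M (%s. (c s \<oplus>\<^bsub>R\<^esub> d s) \<odot>\<^bsub>M\<^esub> s) S = finsum M (%s. c s \<odot>\<^bsub>M\<^esub> s \<oplus>\<^bsub>M\<^esub> d s \<odot>\<^bsub>M\<^esub> s) S"
   using S c d by (intro M.finsum_cong') (auto intro!: add_smult smult_closed M.a_closed)
  also have "... = x \<oplus>\<^bsub>M\<^esub> y" using S c d by (subst M.finsum_addf) auto
  finally show "x \<oplus>\<^bsub>M\<^esub> y \<in> N" unfolding N_def using c d
   by (intro CollectI exI[of _ "%s. c s \<oplus>\<^bsub>R\<^esub> d s"]) auto
 next
  fix r x assume r: "r \<in> carrier R" and "x \<in> N"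
  then obtain c where c: "c \<in> S \<rightarrow> carrier R" "x = finsum M (%s. c s \<odot>\<^bsub>M\<^esub> s) S"
   unfolding N_def by blast
  have "r \<odot>\<^bsub>M\<^esub> x = finsum M (%s. r \<odot>\<^bsub>M\<^esub> (c s \<odot>\<^bsub>M\<^esub> s)) S"
   unfolding c using c S r by (intro smult_finsum) auto
  also have "... = finsum M (%s. (r \<otimes>\<^bsub>R\<^esub> c s) \<odot>\<^bsub>M\<^esub> s) S"
   using S c r by (intro M.finsum_cong') (auto intro!: mult_smult[symmetric] smult_closed)
  finally show "r \<odot>\<^bsub>M\<^esub> x \<in> N" unfolding N_def using c r
   by (intro CollectI exI[of _ "%s. r \<otimes>\<^bsub>R\<^esub> c s"]) auto
 qed
 show "S \<subseteq> N"
 proof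
  fix t assume t: "t \<in> S"
  have "finsum M (%s. (if t = s then \<one>\<^bsub>R\<^esub> else \<zero>\<^bsub>R\<^esub>) \<odot>\<^bsub>M\<^esub> s) S = finsum M (%s. if t = s then s else \<zero>\<^bsub>M\<^esub>) S"
   using S by (intro M.finsum_cong') auto
  also have "... = t" using t S by (intro M.finsum_singleton) auto
  finally show "t \<in> N" unfolding N_def
   by (intro CollectI exI[of _ "%s. if t = s then \<one>\<^bsub>R\<^esub> else \<zero>\<^bsub>R\<^esub>"]) auto
 qed
qed

text \<open>The combinations of \<open>S\<close> form the least submodule containing
  \<open>S\<close>. In this form a generation claim needs no coefficients: it is enough that the
  elements with a suitable property form a submodule.\<close>

lemma fin_gen_iff:
 "fin_gen R M \<longleftrightarrow> (\<exists>S. finite S \<and> S \<subseteq> carrier M \<and>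
   (\<forall>N. lsubmodule R M N --> S \<subseteq> N --> carrier M \<subseteq> N))"
proof
 assume "fin_gen R M"
 then obtain S where S: "finite S" "S \<subseteq> carrier M"
  "\<forall>x\<in>carrier M. \<exists>c\<in>S \<rightarrow> carrier R. x = finsum M (%s. c s \<odot>\<^bsub>M\<^esub> s) S"
  unfolding fin_gen_def by blast
 have "x \<in> N" if N: "lsubmodule R M N" "S \<subseteq> N" and x: "x \<in> carrier M" for N x
 proof -
  obtain c where c: "c \<in> S \<rightarrow> carrier R" "x = finsum M (%s. c s \<odot>\<^bsub>M\<^esub> s) S" using S x by blast
  show ?thesis unfolding c(2) using N c(1)
   by (intro lsubmodule_finsum) (auto simp: lsubmodule_def Pi_iff)
 qed
 then show "\<exists>S. finite S \<and> S \<subseteq> carrier M \<and>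
   (\<forall>N. lsubmodule R M N --> S \<subseteq> N --> carrier M \<subseteq> N)"
  using S(1,2) by (intro exI[of _ S]) auto
next
 assume "\<exists>S. finite S \<and> S \<subseteq> carrier M \<and>
   (\<forall>N. lsubmodule R M N --> S \<subseteq> N --> carrier M \<subseteq> N)"
 then obtain S where S: "finite S" "S \<subseteq> carrier M" "\<forall>N. lsubmodule R M N --> S \<subseteq> N --> carrier M \<subseteq> N" by blast
 have "carrier M \<subseteq> {finsum M (%s. c s \<odot>\<^bsub>M\<^esub> s) S | c. c \<in> S \<rightarrow> carrier R}"
  using S lsubmodule_combinations[OF S(1,2)] by blast
 then show "fin_gen R M" unfolding fin_gen_def using S by blast
qed

end

lemma mod_homD:
 assumes "f \<in> mod_hom R M N"
 shows "x \<in> carrier M ==> f x \<in> carrier N"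
  and "x \<in> carrier M ==> y \<in> carrier M ==> f (x \<oplus>\<^bsub>M\<^esub> y) = f x \<oplus>\<^bsub>N\<^esub> f y"
  and "r \<in> carrier R ==> x \<in> carrier M ==> f (r \<odot>\<^bsub>M\<^esub> x) = r \<odot>\<^bsub>N\<^esub> f x"
  and "f \<in> extensional (carrier M)"
 using assms unfolding mod_hom_def by (auto simp: PiE_def)

lemma mod_homI:
 assumes "!!x. x \<in> carrier M ==> f x \<in> carrier N"
  and "!!x y. x \<in> carrier M ==> y \<in> carrier M ==> f (x \<oplus>\<^bsub>M\<^esub> y) = f x \<oplus>\<^bsub>N\<^esub> f y"
  and "!!r x. r \<in> carrier R ==> x \<in> carrier M ==> f (r \<odot>\<^bsub>M\<^esub> x) = r \<odot>\<^bsub>N\<^esub> f x"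
  and "f \<in> extensional (carrier M)"
 shows "f \<in> mod_hom R M N"
 using assms unfolding mod_hom_def by (auto simp: PiE_def)

lemma mod_hom_eqI:
 assumes "f \<in> mod_hom R M N" "g \<in> mod_hom R M N'" "!!x. x \<in> carrier M ==> f x = g x"
 shows "f = g"
 using assms by (meson extensionalityI mod_homD(4))

lemma mod_hom_zero:
 assumes "left_module R M" "left_module R N" "f \<in> mod_hom R M N" shows "f \<zero>\<^bsub>M\<^esub> = \<zero>\<^bsub>N\<^esub>"
proof -
 interpret M: lmod R M using assms by (simp add: lmod_iff)
 interpret N: lmod R N using assms by (simp add: lmod_iff)
 have "f \<zero>\<^bsub>M\<^esub> = f (\<zero>\<^bsub>R\<^esub> \<odot>\<^bsub>M\<^esub> \<zero>\<^bsub>M\<^esub>)" using M.zero_smult[OF M.M.zero_closed] by (rule arg_cong[OF sym])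
 also have "... = \<zero>\<^bsub>R\<^esub> \<odot>\<^bsub>N\<^esub> f \<zero>\<^bsub>M\<^esub>" by (simp add: mod_homD(3)[OF assms(3)] del: M.smult_zero M.zero_smult)
 also have "... = \<zero>\<^bsub>N\<^esub>" using mod_homD(1)[OF assms(3)] by simp
 finally show ?thesis .
qed

lemma mod_hom_minus:
 assumes "left_module R M" "left_module R N" "f \<in> mod_hom R M N" "x \<in> carrier M"
 shows "f (\<ominus>\<^bsub>M\<^esub> x) = \<ominus>\<^bsub>N\<^esub> f x"
proof -
 interpret M: lmod R M using assms by (simp add: lmod_iff)
 interpret N: lmod R N using assms by (simp add: lmod_iff)
 have "f (\<ominus>\<^bsub>M\<^esub> x) \<oplus>\<^bsub>N\<^esub> f x = \<zero>\<^bsub>N\<^esub>"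
  using assms(4) mod_hom_zero[OF assms(1-3)]
  by (simp add: mod_homD(2)[OF assms(3), symmetric] M.M.l_neg)
 then show ?thesis using assms by (metis N.M.minus_equality M.M.a_inv_closed mod_homD(1))
qed

lemma mod_hom_finsum:
 assumes "left_module R M" "left_module R N" "f \<in> mod_hom R M N" "g \<in> S \<rightarrow> carrier M"
 shows "f (finsum M g S) = finsum N (%s. f (g s)) S"
proof -
 interpret M: lmod R M using assms by (simp add: lmod_iff)
 interpret N: lmod R N using assms by (simp add: lmod_iff)
 show ?thesis using assms(4)
 proof (induction S rule: infinite_finite_induct)
  case (insert x F)
  then have "f (finsum M g (insert x F)) = f (g x) \<oplus>\<^bsub>N\<^esub> f (finsum M g F)"
   using assms(3) by (subst M.M.finsum_insert) (auto simp: mod_homD M.M.finsum_closed)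
  then show ?case using insert assms(3) by (subst N.M.finsum_insert) (auto intro: mod_homD(1))
 qed (use assms in "auto simp: M.M.finsum_infinite N.M.finsum_infinite mod_hom_zero")
qed

lemma mod_hom_compose:
 assumes "left_module R L" "f \<in> mod_hom R L M" "g \<in> mod_hom R M N"
 shows "compose (carrier L) g f \<in> mod_hom R L N"
proof -
 interpret L: lmod R L using assms by (simp add: lmod_iff)
 show ?thesis using assms(2,3) by (intro mod_homI) (auto simp: compose_def mod_homD)
qed

lemma mod_iso_hom: "f \<in> mod_iso R M N ==> f \<in> mod_hom R M N"
 by (simp add: mod_iso_def)

lemma mod_iso_bij: "f \<in> mod_iso R M N ==> bij_betw f (carrier M) (carrier N)"
 by (simp add: mod_iso_def)

lemma mod_iso_inverse:
 assumes "left_module R M" "f \<in> mod_iso R M N"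
 shows "(\<lambda>y\<in>carrier N. inv_into (carrier M) f y) \<in> mod_iso R N M"
proof -
 interpret M: lmod R M using assms by (simp add: lmod_iff)
 let ?g = "inv_into (carrier M) f"
 have f: "f \<in> mod_hom R M N" and b: "bij_betw f (carrier M) (carrier N)"
  using assms(2) by (auto simp: mod_iso_def)
 have g: "?g y \<in> carrier M" "f (?g y) = y" if "y \<in> carrier N" for y
  using that b by (auto simp: bij_betw_def inv_into_into f_inv_into_f)
 have gf: "?g (f x) = x" if "x \<in> carrier M" for x
  using that b by (auto simp: bij_betw_def inv_into_f_f)
 have eq: "?g y = x" if "x \<in> carrier M" "f x = y" for x y using that gf by blast
 have add: "?g (x \<oplus>\<^bsub>N\<^esub> y) = ?g x \<oplus>\<^bsub>M\<^esub> ?g y \<and> x \<oplus>\<^bsub>N\<^esub> y \<in> carrier N"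
  if "x \<in> carrier N" "y \<in> carrier N" for x y
 proof -
  have *: "f (?g x \<oplus>\<^bsub>M\<^esub> ?g y) = x \<oplus>\<^bsub>N\<^esub> y" using mod_homD(2)[OF f g(1)[OF that(1)] g(1)[OF that(2)]] g that by simp
  moreover have "?g x \<oplus>\<^bsub>M\<^esub> ?g y \<in> carrier M" using g that by simp
  ultimately show ?thesis using eq mod_homD(1)[OF f] by metis
 qed
 have smult: "?g (r \<odot>\<^bsub>N\<^esub> x) = r \<odot>\<^bsub>M\<^esub> ?g x \<and> r \<odot>\<^bsub>N\<^esub> x \<in> carrier N"
  if "r \<in> carrier R" "x \<in> carrier N" for r x
 proof -
  have *: "f (r \<odot>\<^bsub>M\<^esub> ?g x) = r \<odot>\<^bsub>N\<^esub> x" using mod_homD(3)[OF f that(1) g(1)[OF that(2)]] g that by simp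
  moreover have "r \<odot>\<^bsub>M\<^esub> ?g x \<in> carrier M" using g that by simp
  ultimately show ?thesis using eq mod_homD(1)[OF f] by metis
 qed
 show ?thesis unfolding mod_iso_def
 proof (intro CollectI conjI)
  show "(\<lambda>y\<in>carrier N. ?g y) \<in> mod_hom R N M"
   using g add smult by (intro mod_homI) auto
  have "bij_betw ?g (carrier N) (carrier M)" using b by (rule bij_betw_inv_into)
  then show "bij_betw (\<lambda>y\<in>carrier N. ?g y) (carrier N) (carrier M)"
   by (simp cong: bij_betw_cong)
 qed
qed

lemma mod_iso_compose:
 assumes "left_module R L" "f \<in> mod_iso R L M" "g \<in> mod_iso R M N"
 shows "compose (carrier L) g f \<in> mod_iso R L N"
 using assms mod_hom_compose[OF assms(1)] by (auto simp: mod_iso_def intro: bij_betw_compose)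

text \<open>Each axiom for \<open>N\<close> is the image under \<open>f\<close> of the axiom for
  \<open>M\<close>. Compatibility with zero is a separate assumption, since the zero of
  \<open>N\<close> is so far an arbitrary field of a record.\<close>

lemma left_module_transport:
 assumes M: "left_module R M" and b: "bij_betw f (carrier M) (carrier N)"
  and add: "!!x y. x \<in> carrier M ==> y \<in> carrier M ==> f (x \<oplus>\<^bsub>M\<^esub> y) = f x \<oplus>\<^bsub>N\<^esub> f y"
  and smult: "!!r x. r \<in> carrier R ==> x \<in> carrier M ==> f (r \<odot>\<^bsub>M\<^esub> x) = r \<odot>\<^bsub>N\<^esub> f x"
  and zero: "f \<zero>\<^bsub>M\<^esub> = \<zero>\<^bsub>N\<^esub>"
 shows "left_module R N"
proof -
 interpret M: lmod R M using M by (simp add: lmod_iff)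
 have im: "carrier N = f ` carrier M" using b by (simp add: bij_betw_def)
 have "abelian_group N"
 proof (rule abelian_groupI; unfold im)
  fix x y assume "x \<in> f ` carrier M" "y \<in> f ` carrier M"
  then show "x \<oplus>\<^bsub>N\<^esub> y \<in> f ` carrier M" "x \<oplus>\<^bsub>N\<^esub> y = y \<oplus>\<^bsub>N\<^esub> x"
   by (auto simp flip: add simp: M.M.a_comm)
 next
  show "\<zero>\<^bsub>N\<^esub> \<in> f ` carrier M" using zero by force
 next
  fix x y z assume "x \<in> f ` carrier M" "y \<in> f ` carrier M" "z \<in> f ` carrier M"
  then show "x \<oplus>\<^bsub>N\<^esub> y \<oplus>\<^bsub>N\<^esub> z = x \<oplus>\<^bsub>N\<^esub> (y \<oplus>\<^bsub>N\<^esub> z)" by (auto simp flip: add simp: M.M.a_assoc)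
 next
  fix x assume "x \<in> f ` carrier M"
  then obtain a where a: "a \<in> carrier M" "x = f a" by blast
  then show "\<zero>\<^bsub>N\<^esub> \<oplus>\<^bsub>N\<^esub> x = x" by (simp flip: add zero)
  have "f (\<ominus>\<^bsub>M\<^esub> a) \<oplus>\<^bsub>N\<^esub> x = \<zero>\<^bsub>N\<^esub>" using a by (simp flip: add zero add: M.M.l_neg)
  then show "\<exists>y\<in>f ` carrier M. y \<oplus>\<^bsub>N\<^esub> x = \<zero>\<^bsub>N\<^esub>" using a by blast
 qed
 moreover have "lmod_axioms R N"
 proof (unfold_locales; unfold im)
  fix r s x y assume "r \<in> carrier R" "s \<in> carrier R" "x \<in> f ` carrier M" "y \<in> f ` carrier M"
  then show "r \<odot>\<^bsub>N\<^esub> x \<in> f ` carrier M"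
   "(r \<oplus>\<^bsub>R\<^esub> s) \<odot>\<^bsub>N\<^esub> x = r \<odot>\<^bsub>N\<^esub> x \<oplus>\<^bsub>N\<^esub> s \<odot>\<^bsub>N\<^esub> x"
   "r \<odot>\<^bsub>N\<^esub> (x \<oplus>\<^bsub>N\<^esub> y) = r \<odot>\<^bsub>N\<^esub> x \<oplus>\<^bsub>N\<^esub> r \<odot>\<^bsub>N\<^esub> y"
   "(r \<otimes>\<^bsub>R\<^esub> s) \<odot>\<^bsub>N\<^esub> x = r \<odot>\<^bsub>N\<^esub> (s \<odot>\<^bsub>N\<^esub> x)"
   by (auto simp flip: add smult simp: M.add_smult M.smult_add M.mult_smult)
 next
  fix x assume "x \<in> f ` carrier M"
  then show "\<one>\<^bsub>R\<^esub> \<odot>\<^bsub>N\<^esub> x = x" by (auto simp flip: smult)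
 qed
 ultimately show ?thesis
  by (simp add: lmod_iff lmod_def M.R.ring_axioms)
qed

text \<open>Preimages of submodules are submodules, so the images of generators generate.\<close>

lemma fin_gen_surj:
 assumes M: "left_module R M" and N: "left_module R N" and f: "f \<in> mod_hom R M N"
  and surj: "f ` carrier M = carrier N" and fg: "fin_gen R M"
 shows "fin_gen R N"
proof -
 interpret M: lmod R M using M by (simp add: lmod_iff)
 interpret N: lmod R N using N by (simp add: lmod_iff)
 obtain S where S: "finite S" "S \<subseteq> carrier M"
   "!!U. lsubmodule R M U ==> S \<subseteq> U ==> carrier M \<subseteq> U"
  using fg unfolding M.fin_gen_iff by blast
 have "carrier N \<subseteq> U" if U: "lsubmodule R N U" "f ` S \<subseteq> U" for U
 proof -
  have "lsubmodule R M {x \<in> carrier M. f x \<in> U}"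
   using U(1) mod_homD(1-3)[OF f] by (auto simp: lsubmodule_def mod_hom_zero[OF M N f])
  then have "carrier M \<subseteq> {x \<in> carrier M. f x \<in> U}" using S(2) U(2) by (intro S(3)) auto
  then show ?thesis by (auto simp flip: surj)
 qed
 then show ?thesis unfolding N.fin_gen_iff using S(1,2) surj
  by (intro exI[of _ "f ` S"]) auto
qed

section \<open>Algebras over a field and vector spaces\<close>

text \<open>The ground field as a ring record, so that vector spaces are modules and the lemmas of
  \<open>lmod\<close> cover subspaces and spanning sets.\<close>

definition field_ring :: "'k::field ring" where
 "field_ring = \<lparr>carrier = UNIV, monoid.mult = (*), monoid.one = 1, ring.zero = 0, ring.add = (+)\<rparr>"

lemma field_ring_simps [simp]:
 "carrier field_ring = UNIV" "x \<otimes>\<^bsub>field_ring\<^esub> y = x * y" "\<one>\<^bsub>field_ring\<^esub> = 1"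
 "\<zero>\<^bsub>field_ring\<^esub> = 0" "x \<oplus>\<^bsub>field_ring\<^esub> y = x + y"
 by (simp_all add: field_ring_def)

lemma ring_field_ring: "ring (field_ring :: 'k::field ring)"
proof (rule ringI)
 show "abelian_group (field_ring :: 'k::field ring)"
 proof (rule abelian_groupI)
  fix x :: 'k
  show "\<exists>y\<in>carrier field_ring. y \<oplus>\<^bsub>field_ring\<^esub> x = \<zero>\<^bsub>field_ring\<^esub>"
   by (intro bexI[of _ "- x"]) auto
 qed (auto simp: algebra_simps)
 show "monoid (field_ring :: 'k::field ring)" by (rule monoidI) (auto simp: algebra_simps)
qed (auto simp: algebra_simps)

lemma field_ring_minus [simp]: "\<ominus>\<^bsub>field_ring\<^esub> x = - x"
proof -
 interpret ring "field_ring :: 'a ring" by (rule ring_field_ring)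
 show ?thesis by (rule minus_equality) auto
qed

text \<open>The vector space underlying an \<open>R\<close>-module, in the convention of
  \<open>mod_cat\<close>, where scalars act through multiples of the unit.\<close>

definition kmod :: "('k::field, 'r) module => ('r, 'u) module => ('k, 'u) module" where
 "kmod R M = \<lparr>carrier = carrier M, monoid.mult = undefined, monoid.one = undefined,
   ring.zero = ring.zero M, ring.add = ring.add M,
   module.smult = (%c x. (c \<odot>\<^bsub>R\<^esub> \<one>\<^bsub>R\<^esub>) \<odot>\<^bsub>M\<^esub> x)\<rparr>"

lemma kmod_simps [simp]:
 "carrier (kmod R M) = carrier M" "\<zero>\<^bsub>kmod R M\<^esub> = \<zero>\<^bsub>M\<^esub>" "x \<oplus>\<^bsub>kmod R M\<^esub> y = x \<oplus>\<^bsub>M\<^esub> y"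
 "c \<odot>\<^bsub>kmod R M\<^esub> x = (c \<odot>\<^bsub>R\<^esub> \<one>\<^bsub>R\<^esub>) \<odot>\<^bsub>M\<^esub> x" "finsum (kmod R M) = finsum M"
 by (auto simp: kmod_def finsum_def finprod_def fun_eq_iff)

locale kalg = fixes R :: "('k::field, 'r) module" (structure)
 assumes k_algebra: "k_algebra R"
begin

sublocale ring R using k_algebra by (simp add: k_algebra_def)

lemma
 shows ksmult_closed [simp, intro]: "x \<in> carrier R ==> c \<odot> x \<in> carrier R"
  and kadd_smult: "x \<in> carrier R ==> (c + d) \<odot> x = c \<odot> x \<oplus> d \<odot> x"
  and ksmult_add: "x \<in> carrier R ==> y \<in> carrier R ==> c \<odot> (x \<oplus> y) = c \<odot> x \<oplus> c \<odot> y"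
  and kmult_smult: "x \<in> carrier R ==> (c * d) \<odot> x = c \<odot> (d \<odot> x)"
  and kone_smult: "x \<in> carrier R ==> 1 \<odot> x = x"
  and ksmult_mult: "x \<in> carrier R ==> y \<in> carrier R ==> (c \<odot> x) \<otimes> y = c \<odot> (x \<otimes> y)"
  and kmult_ksmult: "x \<in> carrier R ==> y \<in> carrier R ==> x \<otimes> (c \<odot> y) = c \<odot> (x \<otimes> y)"
 using k_algebra unfolding k_algebra_def by auto

sublocale kvec: lmod field_ring R
 by (intro lmod.intro ring_field_ring abelian_group_axioms lmod_axioms.intro)
  (auto simp: kadd_smult ksmult_add kmult_smult kone_smult)

lemma sc_closed [simp, intro]: "c \<odot> \<one> \<in> carrier R" by simp

lemma sc_mult: "x \<in> carrier R ==> (c \<odot> \<one>) \<otimes> x = c \<odot> x" by (simp add: ksmult_mult)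

lemma mult_sc: "x \<in> carrier R ==> x \<otimes> (c \<odot> \<one>) = c \<odot> x" by (simp add: kmult_ksmult)

lemma sc_add: "(c + d) \<odot> \<one> = c \<odot> \<one> \<oplus> d \<odot> \<one>" by (simp add: kadd_smult)

lemma sc_sc: "(c * d) \<odot> \<one> = (c \<odot> \<one>) \<otimes> (d \<odot> \<one>)" by (simp add: kmult_smult sc_mult)

lemma sc_one: "1 \<odot> \<one> = \<one>" by (simp add: kone_smult)

lemma fin_dim_iff: "fin_dim R \<longleftrightarrow> fin_gen field_ring R"
 by (simp add: fin_dim_def fin_gen_def)

lemma lmod_kmod: assumes "lmod R M" shows "lmod field_ring (kmod R M)"
proof -
 interpret M: lmod R M by fact
 have "abelian_group (kmod R M)"
 proof (rule abelian_groupI)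
  fix x assume "x \<in> carrier (kmod R M)"
  then show "\<exists>y\<in>carrier (kmod R M). y \<oplus>\<^bsub>kmod R M\<^esub> x = \<zero>\<^bsub>kmod R M\<^esub>"
   by (intro bexI[of _ "\<ominus>\<^bsub>M\<^esub> x"]) (auto simp: M.M.l_neg)
 qed (auto simp: M.M.a_ac)
 then show ?thesis
  by (intro lmod.intro ring_field_ring lmod_axioms.intro)
   (auto simp: sc_add sc_sc sc_one M.add_smult M.smult_add M.mult_smult)
qed

text \<open>The products of a spanning set \<open>B\<close> of \<open>R\<close> with a generating
  set \<open>S\<close> of \<open>M\<close> span: for fixed \<open>s\<close> the \<open>r\<close>
  with \<open>r s\<close> in a given subspace \<open>N\<close> form a subspace containing
  \<open>B\<close>, hence all of \<open>R\<close>.\<close>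

lemma fin_gen_kmod:
 assumes M: "lmod R M" and fg: "fin_gen R M" and fd: "fin_dim R"
 shows "fin_gen field_ring (kmod R M)"
proof -
 interpret M: lmod R M by fact
 interpret V: lmod field_ring "kmod R M" by (rule lmod_kmod[OF M])
 obtain S where S: "finite S" "S \<subseteq> carrier M" "!!N. lsubmodule R M N ==> S \<subseteq> N ==> carrier M \<subseteq> N"
  using fg unfolding M.fin_gen_iff by blast
 obtain B where B: "finite B" "B \<subseteq> carrier R"
  "!!N. lsubmodule field_ring R N ==> B \<subseteq> N ==> carrier R \<subseteq> N"
  using fd unfolding fin_dim_iff kvec.fin_gen_iff by blast
 let ?T = "(%(b, s). b \<odot>\<^bsub>M\<^esub> s) ` (B \<times> S)"
 have "carrier M \<subseteq> N" if N: "lsubmodule field_ring (kmod R M) N" "?T \<subseteq> N" for N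
 proof -
  have NM: "N \<subseteq> carrier M" "\<zero>\<^bsub>M\<^esub> \<in> N" "!!x y. x \<in> N ==> y \<in> N ==> x \<oplus>\<^bsub>M\<^esub> y \<in> N"
   "!!c x. x \<in> N ==> (c \<odot> \<one>) \<odot>\<^bsub>M\<^esub> x \<in> N"
   using N(1) by (auto simp: lsubmodule_def)
  have *: "r \<odot>\<^bsub>M\<^esub> s \<in> N" if "s \<in> S" "r \<in> carrier R" for r s
  proof -
   have s: "s \<in> carrier M" using that S by blast
   have "lsubmodule field_ring R {r \<in> carrier R. r \<odot>\<^bsub>M\<^esub> s \<in> N}"
    unfolding lsubmodule_def
   proof (intro conjI ballI)
    fix c x assume x: "x \<in> {r \<in> carrier R. r \<odot>\<^bsub>M\<^esub> s \<in> N}"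
    have "(c \<odot> x) \<odot>\<^bsub>M\<^esub> s = (c \<odot> \<one>) \<odot>\<^bsub>M\<^esub> (x \<odot>\<^bsub>M\<^esub> s)"
     using x s by (subst M.mult_smult[symmetric]) (auto simp: sc_mult)
    then show "c \<odot> x \<in> {r \<in> carrier R. r \<odot>\<^bsub>M\<^esub> s \<in> N}" using x NM by auto
   qed (use NM s in "auto simp: M.add_smult")
   then have "carrier R \<subseteq> {r \<in> carrier R. r \<odot>\<^bsub>M\<^esub> s \<in> N}" using that N(2) B(2)
    by (intro B(3)) auto
   then show ?thesis using that by blast
  qed
  \<comment> \<open>\<open>N\<close> is only a subspace, but the elements \<open>x\<close> with
    \<open>R x\<close> inside \<open>N\<close> form a submodule, and it contains
    \<open>S\<close>.\<close>
  have "lsubmodule R M {x \<in> carrier M. \<forall>r\<in>carrier R. r \<odot>\<^bsub>M\<^esub> x \<in> N}"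
   unfolding lsubmodule_def using NM(2,3) by (auto simp: M.smult_add simp flip: M.mult_smult)
  then have "carrier M \<subseteq> {x \<in> carrier M. \<forall>r\<in>carrier R. r \<odot>\<^bsub>M\<^esub> x \<in> N}"
   using * S(2) by (intro S(3)) auto
  then show ?thesis using M.one_smult one_closed by fastforce
 qed
 then show ?thesis unfolding V.fin_gen_iff using B(1,2) S(1,2)
  by (intro exI[of _ ?T]) (auto simp: subset_iff)
qed

end

section \<open>Copies of modules in the small module category\<close>

text \<open>
  A finitely generated module is injected into \<^typ>\<open>nat \<Rightarrow> 'k\<close> by choosing coefficients of its
  elements with respect to a finite spanning set.
\<close>


context kalg begin

lemma small_copy_exists:
 fixes T :: "('r, 'w) module"
 assumes T: "left_module R T" and fg: "fin_gen R T" and fd: "fin_dim R"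
 shows "\<exists>M. M \<in> ob (mod_cat R) \<and> mod_iso R T M ~= {}"
proof -
 interpret T: lmod R T using T by (simp add: lmod_iff)
 have "fin_gen field_ring (kmod R T)"
  using T fg fd by (intro fin_gen_kmod) (simp_all add: lmod_iff)
 then obtain S where S: "finite S" "S \<subseteq> carrier T" and comb: "\<forall>x\<in>carrier T. \<exists>c. x = finsum T (%s. (c s \<odot> \<one>) \<odot>\<^bsub>T\<^esub> s) S"
  unfolding fin_gen_def by (auto simp: Pi_UNIV)
 \<comment> \<open>The coefficients are chosen arbitrarily and need not depend linearly on
   \<open>x\<close>. Injectivity of the choice is enough, since the module structure is then
   transported along it.\<close>
 define c where "c x = (SOME c. x = finsum T (%s. (c s \<odot> \<one>) \<odot>\<^bsub>T\<^esub> s) S)" for x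
 have c: "x = finsum T (%s. (c x s \<odot> \<one>) \<odot>\<^bsub>T\<^esub> s) S" if "x \<in> carrier T" for x
  using bspec[OF comb that] unfolding c_def by (rule someI_ex)
 obtain e where e: "bij_betw e S {..<card S}"
  using S(1) ex_bij_betw_finite_nat[of S] by (auto simp: atLeast0LessThan)
 define j where "j x i = (if i < card S then c x (inv_into S e i) else 0)" for x i
 have jS: "j x (e s) = c x s" if "s \<in> S" for x s
  using that e by (auto simp: j_def bij_betw_def)
 have inj: "inj_on j (carrier T)"
 proof (rule inj_onI)
  fix x y assume x: "x \<in> carrier T" and y: "y \<in> carrier T" and "j x = j y"
  then have *: "c x s = c y s" if "s \<in> S" for s using jS[OF that, of x] jS[OF that, of y] by simp
  have "x = finsum T (%s. (c x s \<odot> \<one>) \<odot>\<^bsub>T\<^esub> s) S" by (rule c[OF x])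
  also have "... = finsum T (%s. (c y s \<odot> \<one>) \<odot>\<^bsub>T\<^esub> s) S"
   using * S(2) by (intro T.M.finsum_cong') auto
  also have "... = y" by (rule c[OF y, symmetric])
  finally show "x = y" .
 qed
 define i where "i = inv_into (carrier T) j"
 have i: "i (j x) = x" if "x \<in> carrier T" for x using that inj by (simp add: i_def)
 define M :: "('k, 'r) smod" where "M = \<lparr>carrier = j ` carrier T, monoid.mult = undefined,
  monoid.one = undefined, ring.zero = j \<zero>\<^bsub>T\<^esub>, ring.add = (%x y. j (i x \<oplus>\<^bsub>T\<^esub> i y)),
  module.smult = (%r x. j (r \<odot>\<^bsub>T\<^esub> i x))\<rparr>"
 have b: "bij_betw j (carrier T) (carrier M)" using inj by (simp add: bij_betw_def M_def)
 have M: "left_module R M"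
  by (rule left_module_transport[OF T b]) (simp_all add: M_def i)
 have hom: "restrict j (carrier T) \<in> mod_hom R T M"
  by (rule mod_homI) (auto simp: M_def i)
 have iso: "restrict j (carrier T) \<in> mod_iso R T M" unfolding mod_iso_def
  using hom b by (simp cong: bij_betw_cong)
 have "fin_gen R M"
  by (rule fin_gen_surj[OF T M hom _ fg]) (simp add: M_def)
 then have "M \<in> ob (mod_cat R)" using M by (simp add: mod_cat_def)
 then show ?thesis using iso by blast
qed

end

text \<open>The formula for morphisms in \<open>Dp\<close>, for arbitrary modules: conjugation by
  the chosen isomorphisms. It serves for tensor products and for cokernels alike.\<close>

definition small_mor :: "('k, 'r) module => ('r, 'w) module => ('r, 'w2) module =>
  ('w => 'w2) => 'k smor" where
 "small_mor R T T' f = (\<lambda>x\<in>carrier (small_copy R T).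
   small_iso R T' (f (inv_into (carrier T) (small_iso R T) x)))"

definition fgmod :: "('k, 'r) module => ('r, 'w) module => bool" where
 "fgmod R T \<longleftrightarrow> left_module R T \<and> fin_gen R T"

locale fd_kalg = kalg R for R :: "('k::field, 'r) module" (structure) +
 assumes fin_dim: "fin_dim R"
begin

lemma
 assumes "fgmod R T"
 shows small_copy_ob: "small_copy R T \<in> ob (mod_cat R)"
  and small_iso_iso: "small_iso R T \<in> mod_iso R T (small_copy R T)"
proof -
 have *: "small_copy R T \<in> ob (mod_cat R) \<and> mod_iso R T (small_copy R T) ~= {}"
  unfolding small_copy_def using assms fin_dim
  by (intro someI_ex[OF small_copy_exists]) (auto simp: fgmod_def)
 then show "small_copy R T \<in> ob (mod_cat R)" by blast
 show "small_iso R T \<in> mod_iso R T (small_copy R T)"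
  unfolding small_iso_def using * by (simp add: some_in_eq)
qed

lemma small_copy_module: "fgmod R T ==> left_module R (small_copy R T)"
 using small_copy_ob[of T] by (simp add: mod_cat_def)

lemma small_iso_hom: "fgmod R T ==> small_iso R T \<in> mod_hom R T (small_copy R T)"
 using small_iso_iso mod_iso_hom by blast

lemma small_iso_bij: "fgmod R T ==> bij_betw (small_iso R T) (carrier T) (carrier (small_copy R T))"
 using small_iso_iso mod_iso_bij by blast

lemma small_iso_closed: "fgmod R T ==> x \<in> carrier T ==> small_iso R T x \<in> carrier (small_copy R T)"
 using small_iso_bij bij_betwE by blast

lemma small_copy_cases:
 assumes "fgmod R T" "y \<in> carrier (small_copy R T)"
 obtains x where "x \<in> carrier T" "y = small_iso R T x"
 using small_iso_bij[OF assms(1)] assms(2) by (auto simp: bij_betw_def)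

lemma small_iso_inj: "fgmod R T ==> x \<in> carrier T ==> y \<in> carrier T ==>
  small_iso R T x = small_iso R T y \<longleftrightarrow> x = y"
 using small_iso_bij[of T] by (auto simp: bij_betw_def inj_on_def)

lemma small_iso_inv: "fgmod R T ==> x \<in> carrier T ==> inv_into (carrier T) (small_iso R T) (small_iso R T x) = x"
 using small_iso_bij[of T] by (auto simp: bij_betw_def)

lemma small_mor_apply:
 "fgmod R T ==> x \<in> carrier T ==> small_mor R T T' f (small_iso R T x) = small_iso R T' (f x)"
 by (simp add: small_mor_def small_iso_closed small_iso_inv)

lemma small_mor_ext: "small_mor R T T' f \<in> extensional (carrier (small_copy R T))"
 by (simp add: small_mor_def)

lemma small_copy_eqI:
 assumes "fgmod R T" "f \<in> extensional (carrier (small_copy R T))"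
  "g \<in> extensional (carrier (small_copy R T))"
  "!!x. x \<in> carrier T ==> f (small_iso R T x) = g (small_iso R T x)"
 shows "f = g"
 using assms by (metis extensionalityI small_copy_cases)

lemma small_mor_hom:
 assumes "fgmod R T" "fgmod R T'" "f \<in> mod_hom R T T'"
 shows "small_mor R T T' f \<in> mod_hom R (small_copy R T) (small_copy R T')"
proof -
 interpret T: lmod R T using assms by (simp add: fgmod_def lmod_iff)
 note h = small_iso_hom[OF assms(1)] and h' = small_iso_hom[OF assms(2)]
 note f = mod_homD(1-3)[OF assms(3)]
 show ?thesis
 proof (rule mod_homI)
  fix x assume x: "x \<in> carrier (small_copy R T)"
  then obtain a where a: "a \<in> carrier T" "x = small_iso R T a" using small_copy_cases assms(1) by blast
  show "small_mor R T T' f x \<in> carrier (small_copy R T')"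
   using a assms f by (simp add: small_mor_apply small_iso_closed)
  fix r assume r: "r \<in> carrier R"
  have "r \<odot>\<^bsub>small_copy R T\<^esub> x = small_iso R T (r \<odot>\<^bsub>T\<^esub> a)"
   using a r by (simp add: mod_homD(3)[OF h])
  then show "small_mor R T T' f (r \<odot>\<^bsub>small_copy R T\<^esub> x) = r \<odot>\<^bsub>small_copy R T'\<^esub> small_mor R T T' f x"
   using a r assms f by (simp add: small_mor_apply mod_homD(3)[OF h'])
 next
  fix x y assume xy: "x \<in> carrier (small_copy R T)" "y \<in> carrier (small_copy R T)"
  obtain a where a: "a \<in> carrier T" "x = small_iso R T a" using xy small_copy_cases assms(1) by blast
  obtain b where b: "b \<in> carrier T" "y = small_iso R T b" using xy small_copy_cases assms(1) by blast
  have "x \<oplus>\<^bsub>small_copy R T\<^esub> y = small_iso R T (a \<oplus>\<^bsub>T\<^esub> b)"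
   using a b by (simp add: mod_homD(2)[OF h])
  then show "small_mor R T T' f (x \<oplus>\<^bsub>small_copy R T\<^esub> y) =
    small_mor R T T' f x \<oplus>\<^bsub>small_copy R T'\<^esub> small_mor R T T' f y"
   using a b assms f by (simp add: small_mor_apply mod_homD(2)[OF h'])
 qed (rule small_mor_ext)
qed

lemma small_mor_inj:
 assumes "fgmod R T" "fgmod R T'" "f \<in> mod_hom R T T'" "g \<in> mod_hom R T T'"
  "small_mor R T T' f = small_mor R T T' g"
 shows "f = g"
proof (rule mod_hom_eqI[OF assms(3,4)])
 fix x assume x: "x \<in> carrier T"
 then have "small_iso R T' (f x) = small_iso R T' (g x)"
  using assms small_mor_apply by metis
 then show "f x = g x" using x assms mod_homD(1) small_iso_inj by metis
qed

text \<open>Conjugating \<open>g\<close> back by the chosen isomorphisms gives the preimage. With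
  \<open>small_mor_inj\<close>, nothing about hom spaces is lost in passing to copies.\<close>

lemma small_mor_surj:
 assumes "fgmod R T" "fgmod R T'" "g \<in> mod_hom R (small_copy R T) (small_copy R T')"
 shows "\<exists>f \<in> mod_hom R T T'. g = small_mor R T T' f"
proof -
 define j where "j = (\<lambda>y\<in>carrier (small_copy R T'). inv_into (carrier T') (small_iso R T') y)"
 have j: "j \<in> mod_hom R (small_copy R T') T'"
  unfolding j_def using assms by (intro mod_iso_hom mod_iso_inverse small_iso_iso) (auto simp: fgmod_def)
 have T: "left_module R T" "left_module R (small_copy R T)" using assms small_copy_module by (auto simp: fgmod_def)
 let ?f = "compose (carrier T) j (compose (carrier T) g (small_iso R T))"
 have f: "?f \<in> mod_hom R T T'" by (rule mod_hom_compose[OF T(1) mod_hom_compose[OF T(1) small_iso_hom[OF assms(1)] assms(3)] j])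
 have "g = small_mor R T T' ?f"
 proof (rule small_copy_eqI[OF assms(1) mod_homD(4)[OF assms(3)] small_mor_ext])
  fix x assume x: "x \<in> carrier T"
  let ?y = "g (small_iso R T x)"
  have y: "?y \<in> carrier (small_copy R T')" using x assms small_iso_closed mod_homD(1) by metis
  then have "small_iso R T' (j ?y) = ?y" using small_iso_bij[OF assms(2)]
   by (auto simp: j_def bij_betw_def f_inv_into_f)
  then show "?y = small_mor R T T' ?f (small_iso R T x)"
   using x assms(1) by (simp add: small_mor_apply compose_def)
 qed
 then show ?thesis using f by blast
qed

end

section \<open>Linear categories: biproducts, equivalences, quotients and functor categories\<close>

section \<open>Linear categories\<close>

text \<open>Negatives are not among the axioms: scaling by minus one provides them, as
  \<open>lmod_homv\<close> shows.\<close>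

locale lin_cat = fixes C :: "('k::field, 'o, 'm) lincat"
 assumes cmp_mor: "X \<in> ob C ==> Y \<in> ob C ==> Z \<in> ob C ==> f \<in> mor C X Y ==> g \<in> mor C Y Z ==>
   cmp C X Y Z g f \<in> mor C X Z"
  and idm_mor: "X \<in> ob C ==> idm C X \<in> mor C X X"
  and madd_mor: "X \<in> ob C ==> Y \<in> ob C ==> f \<in> mor C X Y ==> g \<in> mor C X Y ==> madd C X Y f g \<in> mor C X Y"
  and mzero_mor: "X \<in> ob C ==> Y \<in> ob C ==> mzero C X Y \<in> mor C X Y"
  and mscale_mor: "X \<in> ob C ==> Y \<in> ob C ==> f \<in> mor C X Y ==> mscale C X Y c f \<in> mor C X Y"
  and cmp_assoc: "X \<in> ob C ==> Y \<in> ob C ==> Z \<in> ob C ==> W \<in> ob C ==>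
   f \<in> mor C X Y ==> g \<in> mor C Y Z ==> h \<in> mor C Z W ==>
   cmp C X Y W (cmp C Y Z W h g) f = cmp C X Z W h (cmp C X Y Z g f)"
  and idm_cmp: "X \<in> ob C ==> Y \<in> ob C ==> f \<in> mor C X Y ==> cmp C X Y Y (idm C Y) f = f"
  and cmp_idm: "X \<in> ob C ==> Y \<in> ob C ==> f \<in> mor C X Y ==> cmp C X X Y f (idm C X) = f"
  and madd_assoc: "X \<in> ob C ==> Y \<in> ob C ==> f \<in> mor C X Y ==> g \<in> mor C X Y ==> h \<in> mor C X Y ==>
   madd C X Y (madd C X Y f g) h = madd C X Y f (madd C X Y g h)"
  and madd_comm: "X \<in> ob C ==> Y \<in> ob C ==> f \<in> mor C X Y ==> g \<in> mor C X Y ==>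
   madd C X Y f g = madd C X Y g f"
  and mzero_madd: "X \<in> ob C ==> Y \<in> ob C ==> f \<in> mor C X Y ==> madd C X Y (mzero C X Y) f = f"
  and mscale_zero: "X \<in> ob C ==> Y \<in> ob C ==> f \<in> mor C X Y ==> mscale C X Y 0 f = mzero C X Y"
  and mscale_one: "X \<in> ob C ==> Y \<in> ob C ==> f \<in> mor C X Y ==> mscale C X Y 1 f = f"
  and mscale_mscale: "X \<in> ob C ==> Y \<in> ob C ==> f \<in> mor C X Y ==>
   mscale C X Y (c * d) f = mscale C X Y c (mscale C X Y d f)"
  and mscale_add: "X \<in> ob C ==> Y \<in> ob C ==> f \<in> mor C X Y ==>
   mscale C X Y (c + d) f = madd C X Y (mscale C X Y c f) (mscale C X Y d f)"
  and mscale_madd: "X \<in> ob C ==> Y \<in> ob C ==> f \<in> mor C X Y ==> g \<in> mor C X Y ==>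
   mscale C X Y c (madd C X Y f g) = madd C X Y (mscale C X Y c f) (mscale C X Y c g)"
  and cmp_madd_left: "X \<in> ob C ==> Y \<in> ob C ==> Z \<in> ob C ==> f \<in> mor C X Y ==> g \<in> mor C Y Z ==>
   g' \<in> mor C Y Z ==>
   cmp C X Y Z (madd C Y Z g g') f = madd C X Z (cmp C X Y Z g f) (cmp C X Y Z g' f)"
  and cmp_madd_right: "X \<in> ob C ==> Y \<in> ob C ==> Z \<in> ob C ==> f \<in> mor C X Y ==> f' \<in> mor C X Y ==>
   g \<in> mor C Y Z ==>
   cmp C X Y Z g (madd C X Y f f') = madd C X Z (cmp C X Y Z g f) (cmp C X Y Z g f')"
  and cmp_mscale_left: "X \<in> ob C ==> Y \<in> ob C ==> Z \<in> ob C ==> f \<in> mor C X Y ==> g \<in> mor C Y Z ==>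
   cmp C X Y Z (mscale C Y Z c g) f = mscale C X Z c (cmp C X Y Z g f)"
  and cmp_mscale_right: "X \<in> ob C ==> Y \<in> ob C ==> Z \<in> ob C ==> f \<in> mor C X Y ==> g \<in> mor C Y Z ==>
   cmp C X Y Z g (mscale C X Y c f) = mscale C X Z c (cmp C X Y Z g f)"

text \<open>Presenting a hom space as a module record gives finite sums of morphisms, written
  \<open>msum\<close>, from \<open>finsum\<close>.\<close>

definition homv :: "('k, 'o, 'm) lincat => 'o => 'o => ('k, 'm) module" where
 "homv C X Y = \<lparr>carrier = mor C X Y, monoid.mult = undefined, monoid.one = undefined,
   ring.zero = mzero C X Y, ring.add = madd C X Y, module.smult = mscale C X Y\<rparr>"

lemma homv_simps [simp]:
 "carrier (homv C X Y) = mor C X Y" "\<zero>\<^bsub>homv C X Y\<^esub> = mzero C X Y"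
 "f \<oplus>\<^bsub>homv C X Y\<^esub> g = madd C X Y f g" "c \<odot>\<^bsub>homv C X Y\<^esub> f = mscale C X Y c f"
 by (simp_all add: homv_def)

abbreviation msum :: "('k, 'o, 'm) lincat => 'o => 'o => ('i => 'm) => 'i set => 'm" where
 "msum C X Y \<equiv> finsum (homv C X Y)"

context lin_cat begin

lemma lmod_homv: assumes "X \<in> ob C" "Y \<in> ob C" shows "lmod field_ring (homv C X Y)"
proof -
 have "abelian_group (homv C X Y)"
 proof (rule abelian_groupI)
  fix f assume f: "f \<in> carrier (homv C X Y)"
  have "madd C X Y (mscale C X Y (- 1) f) (mscale C X Y 1 f) = mzero C X Y"
   using f assms mscale_add[of X Y f "- 1" 1] by (simp add: mscale_zero)
  then show "\<exists>g\<in>carrier (homv C X Y). g \<oplus>\<^bsub>homv C X Y\<^esub> f = \<zero>\<^bsub>homv C X Y\<^esub>"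
   using f assms by (intro bexI[of _ "mscale C X Y (- 1) f"]) (simp_all add: mscale_one mscale_mor)
 next
  fix f g assume "f \<in> carrier (homv C X Y)" "g \<in> carrier (homv C X Y)"
  then show "f \<oplus>\<^bsub>homv C X Y\<^esub> g = g \<oplus>\<^bsub>homv C X Y\<^esub> f" using assms madd_comm[of X Y f g] by simp
 qed (use assms in "simp_all add: madd_mor mzero_mor madd_assoc mzero_madd")
 then show ?thesis using assms
  by (intro lmod.intro ring_field_ring lmod_axioms.intro)
   (simp_all add: mscale_mor mscale_add mscale_madd mscale_mscale mscale_one)
qed

lemma cmp_mzero_left: "X \<in> ob C ==> Y \<in> ob C ==> Z \<in> ob C ==> f \<in> mor C X Y ==>
  cmp C X Y Z (mzero C Y Z) f = mzero C X Z"
 using cmp_mscale_left[of X Y Z f "mzero C Y Z" 0]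
 by (simp add: mscale_zero mzero_mor cmp_mor)

lemma cmp_mzero_right: "X \<in> ob C ==> Y \<in> ob C ==> Z \<in> ob C ==> g \<in> mor C Y Z ==>
  cmp C X Y Z g (mzero C X Y) = mzero C X Z"
 using cmp_mscale_right[of X Y Z "mzero C X Y" g 0]
 by (simp add: mscale_zero mzero_mor cmp_mor)

lemma madd_mzero: "X \<in> ob C ==> Y \<in> ob C ==> f \<in> mor C X Y ==> madd C X Y f (mzero C X Y) = f"
 using madd_comm[of X Y f "mzero C X Y"] by (simp add: mzero_madd mzero_mor)

lemma msum_mor: assumes "X \<in> ob C" "Y \<in> ob C" "!!i. i \<in> S ==> f i \<in> mor C X Y"
 shows "msum C X Y f S \<in> mor C X Y"
proof -
 interpret H: lmod field_ring "homv C X Y" using assms by (intro lmod_homv)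
 show ?thesis using assms H.M.finsum_closed[of f S] by auto
qed

lemma msum_infinite: assumes "X \<in> ob C" "Y \<in> ob C" "infinite S"
 shows "msum C X Y f S = mzero C X Y"
proof -
 interpret H: lmod field_ring "homv C X Y" using assms by (intro lmod_homv)
 show ?thesis using assms by (simp add: H.M.finsum_infinite)
qed

lemma msum_empty: assumes "X \<in> ob C" "Y \<in> ob C"
 shows "msum C X Y f {} = mzero C X Y"
proof -
 interpret H: lmod field_ring "homv C X Y" using assms by (intro lmod_homv)
 show ?thesis by simp
qed

lemma msum_insert: assumes "X \<in> ob C" "Y \<in> ob C" "finite S" "j \<notin> S" "f j \<in> mor C X Y" "!!i. i \<in> S ==> f i \<in> mor C X Y"
 shows "msum C X Y f (insert j S) = madd C X Y (f j) (msum C X Y f S)"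
proof -
 interpret H: lmod field_ring "homv C X Y" using assms by (intro lmod_homv)
 show ?thesis using assms by (subst H.M.finsum_insert) auto
qed

lemma msum_cong: assumes "X \<in> ob C" "Y \<in> ob C" "!!i. i \<in> S ==> g i \<in> mor C X Y" "!!i. i \<in> S ==> f i = g i"
 shows "msum C X Y f S = msum C X Y g S"
proof -
 interpret H: lmod field_ring "homv C X Y" using assms by (intro lmod_homv)
 show ?thesis using assms by (intro H.M.finsum_cong') auto
qed

lemma msum_zero: assumes "X \<in> ob C" "Y \<in> ob C" "!!i. i \<in> S ==> f i = mzero C X Y"
 shows "msum C X Y f S = mzero C X Y"
proof -
 interpret H: lmod field_ring "homv C X Y" using assms by (intro lmod_homv)
 have "msum C X Y f S = msum C X Y (%i. \<zero>\<^bsub>homv C X Y\<^esub>) S"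
  using assms by (intro msum_cong) (auto simp: mzero_mor)
 also have "... = \<zero>\<^bsub>homv C X Y\<^esub>" by (rule H.M.finsum_zero)
 finally show ?thesis by simp
qed

lemma msum_delta: assumes "X \<in> ob C" "Y \<in> ob C" "finite S" "j \<in> S" "f j \<in> mor C X Y"
 "!!i. i \<in> S ==> i ~= j ==> f i = mzero C X Y"
 shows "msum C X Y f S = f j"
proof -
 have "msum C X Y f (insert j (S - {j})) = madd C X Y (f j) (msum C X Y f (S - {j}))"
  using assms mzero_mor by (intro msum_insert) auto
 also have "msum C X Y f (S - {j}) = mzero C X Y" using assms by (intro msum_zero) auto
 finally show ?thesis using assms by (simp add: madd_mzero insert_absorb)
qed

lemma msum_pair: assumes "X \<in> ob C" "Y \<in> ob C" "i ~= j" "f i \<in> mor C X Y" "f j \<in> mor C X Y"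
 shows "msum C X Y f {i, j} = madd C X Y (f i) (f j)"
proof -
 have "msum C X Y f {i, j} = madd C X Y (f i) (msum C X Y f {j})"
  using assms by (intro msum_insert) auto
 also have "msum C X Y f {j} = f j" using assms by (intro msum_delta) auto
 finally show ?thesis .
qed

lemma cmp_msum_left:
 assumes "X \<in> ob C" "Y \<in> ob C" "Z \<in> ob C" "f \<in> mor C X Y" "!!i. i \<in> S ==> g i \<in> mor C Y Z"
 shows "cmp C X Y Z (msum C Y Z g S) f = msum C X Z (%i. cmp C X Y Z (g i) f) S"
 using assms(5)
proof (induction S rule: infinite_finite_induct)
 case (insert j S)
 then show ?case using assms(1-4)
  by (simp add: msum_insert cmp_madd_left msum_mor cmp_mor)
qed (use assms in "auto simp: msum_infinite msum_empty cmp_mzero_left")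

lemma cmp_msum_right:
 assumes "X \<in> ob C" "Y \<in> ob C" "Z \<in> ob C" "g \<in> mor C Y Z" "!!i. i \<in> S ==> f i \<in> mor C X Y"
 shows "cmp C X Y Z g (msum C X Y f S) = msum C X Z (%i. cmp C X Y Z g (f i)) S"
 using assms(5)
proof (induction S rule: infinite_finite_induct)
 case (insert j S)
 then show ?case using assms(1-4)
  by (simp add: msum_insert cmp_madd_right msum_mor cmp_mor)
qed (use assms in "auto simp: msum_infinite msum_empty cmp_mzero_right")

text \<open>Replaces the nested additions in the definition of \<open>is_biproduct\<close> by an
  unordered sum.\<close>

lemma foldr_madd:
 assumes "X \<in> ob C" "Y \<in> ob C" "distinct xs" "!!i. i \<in> set xs ==> f i \<in> mor C X Y"
 shows "foldr (madd C X Y) (map f xs) (mzero C X Y) = msum C X Y f (set xs)"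
 using assms(3,4)
 by (induction xs) (use assms(1,2) in "auto simp: msum_empty msum_insert")

end

section \<open>Biproducts\<close>

text \<open>\<open>is_biproduct\<close> with explicit structure maps and a family indexed by
  numbers, which suits matrices and the constant family of copies of a generator.\<close>

definition biprod_data :: "('k, 'o, 'm) lincat => nat => (nat => 'o) => 'o => (nat => 'm) => (nat => 'm) => bool" where
 "biprod_data C n Y B \<iota> \<pi> \<longleftrightarrow> B \<in> ob C \<and> (\<forall>i<n. Y i \<in> ob C) \<and>
   (\<forall>i<n. \<iota> i \<in> mor C (Y i) B \<and> \<pi> i \<in> mor C B (Y i)) \<and>
   (\<forall>i<n. \<forall>j<n. cmp C (Y i) B (Y j) (\<pi> j) (\<iota> i) = (if i = j then idm C (Y i) else mzero C (Y i) (Y j))) \<and>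
   msum C B B (%i. cmp C B (Y i) B (\<iota> i) (\<pi> i)) {..<n} = idm C B"

definition pair_data :: "('k, 'o, 'm) lincat => 'o => 'o => 'o => 'm => 'm => 'm => 'm => bool" where
 "pair_data C X Y B i j p q \<longleftrightarrow> X \<in> ob C \<and> Y \<in> ob C \<and> B \<in> ob C \<and>
  i \<in> mor C X B \<and> j \<in> mor C Y B \<and> p \<in> mor C B X \<and> q \<in> mor C B Y \<and>
  cmp C X B X p i = idm C X \<and> cmp C Y B Y q j = idm C Y \<and>
  cmp C X B Y q i = mzero C X Y \<and> cmp C Y B X p j = mzero C Y X \<and>
  madd C B B (cmp C B X B i p) (cmp C B Y B j q) = idm C B"

context lin_cat begin

lemma is_biproduct_iff:
 "is_biproduct C Ys B \<longleftrightarrow> (\<exists>\<iota> \<pi>. biprod_data C (length Ys) (%i. Ys ! i) B \<iota> \<pi>)"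
proof -
 have sub: "set Ys \<subseteq> ob C \<longleftrightarrow> (\<forall>i<length Ys. Ys ! i \<in> ob C)"
  by (auto simp: subset_iff in_set_conv_nth)
 have "(set Ys \<subseteq> ob C \<and> B \<in> ob C \<and>
    (\<forall>i<length Ys. \<iota> i \<in> mor C (Ys ! i) B \<and> \<pi> i \<in> mor C B (Ys ! i)) \<and>
    (\<forall>i<length Ys. \<forall>j<length Ys. cmp C (Ys ! i) B (Ys ! j) (\<pi> j) (\<iota> i) =
      (if i = j then idm C (Ys ! i) else mzero C (Ys ! i) (Ys ! j))) \<and>
    foldr (madd C B B) (map (%i. cmp C B (Ys ! i) B (\<iota> i) (\<pi> i)) [0..<length Ys])
     (mzero C B B) = idm C B) \<longleftrightarrow> biprod_data C (length Ys) (%i. Ys ! i) B \<iota> \<pi>" for \<iota> \<pi>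
 proof (cases "set Ys \<subseteq> ob C \<and> B \<in> ob C \<and> (\<forall>i<length Ys. \<iota> i \<in> mor C (Ys ! i) B \<and> \<pi> i \<in> mor C B (Ys ! i))")
  case True
  then have "foldr (madd C B B) (map (%i. cmp C B (Ys ! i) B (\<iota> i) (\<pi> i)) [0..<length Ys]) (mzero C B B)
   = msum C B B (%i. cmp C B (Ys ! i) B (\<iota> i) (\<pi> i)) {..<length Ys}"
   by (subst foldr_madd) (auto simp: cmp_mor atLeast0LessThan subset_iff)
  then show ?thesis using True by (simp add: biprod_data_def sub)
 qed (auto simp: biprod_data_def sub)
 then show ?thesis unfolding is_biproduct_def by blast
qed

lemma is_biproduct_pairE:
 assumes "is_biproduct C [X, Y] B"
 shows "\<exists>i j p q. pair_data C X Y B i j p q"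
proof -
 obtain \<iota> \<pi> where d: "biprod_data C 2 (%i. [X, Y] ! i) B \<iota> \<pi>" using assms is_biproduct_iff[of "[X, Y]"]
  by (auto simp: numeral_2_eq_2)
 have m: "X \<in> ob C" "Y \<in> ob C" "B \<in> ob C" "\<iota> 0 \<in> mor C X B" "\<iota> 1 \<in> mor C Y B" "\<pi> 0 \<in> mor C B X" "\<pi> 1 \<in> mor C B Y"
  using d by (auto simp: biprod_data_def dest: spec[of _ 0] spec[of _ 1])
 have delta: "cmp C ([X, Y] ! i) B ([X, Y] ! k) (\<pi> k) (\<iota> i) =
   (if i = k then idm C ([X, Y] ! i) else mzero C ([X, Y] ! i) ([X, Y] ! k))" if "i < 2" "k < 2" for i k
  using d that by (auto simp: biprod_data_def)
 have "msum C B B (%i. cmp C B ([X, Y] ! i) B (\<iota> i) (\<pi> i)) {0, 1} = idm C B"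
  using d by (simp add: biprod_data_def lessThan_Suc numeral_2_eq_2 insert_commute)
 moreover have "msum C B B (%i. cmp C B ([X, Y] ! i) B (\<iota> i) (\<pi> i)) {0, 1} =
    madd C B B (cmp C B X B (\<iota> 0) (\<pi> 0)) (cmp C B Y B (\<iota> 1) (\<pi> 1))"
  using m by (subst msum_pair) (auto simp: cmp_mor)
 ultimately show ?thesis unfolding pair_data_def using m delta[of 0 0] delta[of 1 1] delta[of 0 1] delta[of 1 0]
  by (intro exI[of _ "\<iota> 0"] exI[of _ "\<iota> 1"] exI[of _ "\<pi> 0"] exI[of _ "\<pi> 1"]) simp
qed

text \<open>The structure maps of \<open>B\<close> and \<open>B'\<close> are composed with those of
  \<open>[B, B']\<close>; an index beyond the length of \<open>Ys\<close> is shifted into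
  \<open>Zs\<close>.\<close>

lemma is_biproduct_append:
 assumes 1: "is_biproduct C Ys B" and 2: "is_biproduct C Zs B'" and 3: "is_biproduct C [B, B'] D"
 shows "is_biproduct C (Ys @ Zs) D"
proof -
 obtain \<iota> \<pi> where d1: "biprod_data C (length Ys) (%i. Ys ! i) B \<iota> \<pi>" using 1 is_biproduct_iff by blast
 obtain \<iota>' \<pi>' where d2: "biprod_data C (length Zs) (%i. Zs ! i) B' \<iota>' \<pi>'" using 2 is_biproduct_iff by blast
 obtain j k p q where d3: "pair_data C B B' D j k p q" using is_biproduct_pairE[OF 3] by blast
 note d = d1[unfolded biprod_data_def] d2[unfolded biprod_data_def]
 have D: "D \<in> ob C" "j \<in> mor C B D" "p \<in> mor C D B" "k \<in> mor C B' D" "q \<in> mor C D B'" and B: "B \<in> ob C" "B' \<in> ob C"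
  and delta: "cmp C B D B p j = idm C B" "cmp C B' D B' q k = idm C B'"
   "cmp C B D B' q j = mzero C B B'" "cmp C B' D B p k = mzero C B' B"
  and id: "madd C D D (cmp C D B D j p) (cmp C D B' D k q) = idm C D"
  using d3 by (auto simp: pair_data_def)
 let ?n = "length Ys" and ?m = "length Zs"
 let ?I = "%i. if i < ?n then cmp C (Ys ! i) B D j (\<iota> i) else cmp C (Zs ! (i - ?n)) B' D k (\<iota>' (i - ?n))"
 let ?P = "%i. if i < ?n then cmp C D B (Ys ! i) (\<pi> i) p else cmp C D B' (Zs ! (i - ?n)) (\<pi>' (i - ?n)) q"
 let ?Y = "%i. (Ys @ Zs) ! i"
 have Y: "!!i. i < ?n ==> Ys ! i \<in> ob C \<and> \<iota> i \<in> mor C (Ys ! i) B \<and> \<pi> i \<in> mor C B (Ys ! i)" using d by auto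
 have Z: "!!i. i < ?m ==> Zs ! i \<in> ob C \<and> \<iota>' i \<in> mor C (Zs ! i) B' \<and> \<pi>' i \<in> mor C B' (Zs ! i)" using d by auto
 have dY: "!!i k. i < ?n ==> k < ?n ==> cmp C (Ys ! i) B (Ys ! k) (\<pi> k) (\<iota> i) =
   (if i = k then idm C (Ys ! i) else mzero C (Ys ! i) (Ys ! k))" using d by auto
 have dZ: "!!i k. i < ?m ==> k < ?m ==> cmp C (Zs ! i) B' (Zs ! k) (\<pi>' k) (\<iota>' i) =
   (if i = k then idm C (Zs ! i) else mzero C (Zs ! i) (Zs ! k))" using d by auto
 \<comment> \<open>Regrouping \<open>(r pp) (jj i)\<close> as \<open>r (pp jj) i\<close> exposes a
   composite of structure maps of \<open>D\<close>, which is an identity or zero.\<close>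
 have mid: "cmp C U D V (cmp C D W V r pp) (cmp C U T D jj i) = cmp C U W V r (cmp C U T W (cmp C T D W pp jj) i)"
  if "U \<in> ob C" "V \<in> ob C" "W \<in> ob C" "T \<in> ob C" "r \<in> mor C W V" "pp \<in> mor C D W" "jj \<in> mor C T D" "i \<in> mor C U T"
  for U V W T r pp jj i
  using that D by (simp add: cmp_assoc cmp_mor)
 have "biprod_data C (length (Ys @ Zs)) ?Y D ?I ?P"
  unfolding biprod_data_def
 proof (intro conjI allI impI)
  fix i assume "i < length (Ys @ Zs)"
  then show "?Y i \<in> ob C" "?I i \<in> mor C (?Y i) D" "?P i \<in> mor C D (?Y i)"
   using Y Z B D by (auto simp: nth_append cmp_mor)
 next
  fix i l assume "i < length (Ys @ Zs)" "l < length (Ys @ Zs)"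
  then have i: "i < ?n \<or> \<not> i < ?n \<and> i - ?n < ?m" and l: "l < ?n \<or> \<not> l < ?n \<and> l - ?n < ?m" by auto
  show "cmp C (?Y i) D (?Y l) (?P l) (?I i) = (if i = l then idm C (?Y i) else mzero C (?Y i) (?Y l))"
   using i l
  proof (elim disjE conjE)
   assume *: "i < ?n" "l < ?n"
   then show ?thesis using Y[of i] Y[of l] B D
    by (simp add: nth_append mid delta idm_cmp dY)
  next
   assume *: "i < ?n" "\<not> l < ?n" "l - ?n < ?m"
   then show ?thesis using Y[of i] Z[of "l - ?n"] B D delta
    by (auto simp add: nth_append mid cmp_mzero_left cmp_mzero_right)
  next
   assume *: "l < ?n" "\<not> i < ?n" "i - ?n < ?m"
   then show ?thesis using Y[of l] Z[of "i - ?n"] B D delta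
    by (auto simp add: nth_append mid cmp_mzero_left cmp_mzero_right)
  next
   assume *: "\<not> l < ?n" "l - ?n < ?m" "\<not> i < ?n" "i - ?n < ?m"
   then have "i - ?n = l - ?n \<longleftrightarrow> i = l" by auto
   then show ?thesis using * Z[of "l - ?n"] Z[of "i - ?n"] B D delta
    by (simp add: nth_append mid idm_cmp dZ)
  qed
 next
  interpret H: lmod field_ring "homv C D D" using D by (intro lmod_homv)
  define F where "F i = cmp C D (?Y i) D (?I i) (?P i)" for i
  have fm: "F i \<in> mor C D D" if "i < ?n + ?m" for i using that Y Z B D by (auto simp: F_def nth_append cmp_mor)
  have F1: "F i = cmp C D B D j (cmp C D B B (cmp C B (Ys ! i) B (\<iota> i) (\<pi> i)) p)" if "i < ?n" for i
   using that Y[OF that] B D by (auto simp: F_def nth_append cmp_assoc cmp_mor)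
  have F2: "F (?n + i) = cmp C D B' D k (cmp C D B' B' (cmp C B' (Zs ! i) B' (\<iota>' i) (\<pi>' i)) q)" if "i < ?m" for i
   using that Z[OF that] B D by (auto simp: F_def nth_append cmp_assoc cmp_mor)
  have un: "{..<?n + ?m} = {..<?n} \<union> (%i. ?n + i) ` {..<?m}"
  proof
   show "{..<?n + ?m} \<subseteq> {..<?n} \<union> (%i. ?n + i) ` {..<?m}"
   proof
    fix i assume "i \<in> {..<?n + ?m}"
    then show "i \<in> {..<?n} \<union> (%i. ?n + i) ` {..<?m}"
     by (cases "i < ?n") (auto intro!: image_eqI[of _ _ "i - ?n"])
   qed
  qed auto
  have "msum C D D F {..<?n + ?m} = madd C D D (msum C D D F {..<?n}) (msum C D D F ((%i. ?n + i) ` {..<?m}))"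
   unfolding un using fm by (subst H.M.finsum_Un_disjoint) auto
  also have "msum C D D F {..<?n} = msum C D D (%i. cmp C D B D j (cmp C D B B (cmp C B (Ys ! i) B (\<iota> i) (\<pi> i)) p)) {..<?n}"
   using Y B D F1 by (intro msum_cong) (auto simp: cmp_mor)
  also have "... = cmp C D B D j (msum C D B (%i. cmp C D B B (cmp C B (Ys ! i) B (\<iota> i) (\<pi> i)) p) {..<?n})"
   using Y B D by (subst cmp_msum_right) (auto simp: cmp_mor)
  also have "... = cmp C D B D j (cmp C D B B (msum C B B (%i. cmp C B (Ys ! i) B (\<iota> i) (\<pi> i)) {..<?n}) p)"
   using Y B D by (subst cmp_msum_left) (auto simp: cmp_mor)
  also have "... = cmp C D B D j p" using d1 D B by (simp add: biprod_data_def idm_cmp)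
  also have "msum C D D F ((%i. ?n + i) ` {..<?m}) = msum C D D (%i. F (?n + i)) {..<?m}"
   using fm by (intro H.M.finsum_reindex) auto
  also have "... = msum C D D (%i. cmp C D B' D k (cmp C D B' B' (cmp C B' (Zs ! i) B' (\<iota>' i) (\<pi>' i)) q)) {..<?m}"
   using Z B D F2 by (intro msum_cong) (auto simp: cmp_mor)
  also have "... = cmp C D B' D k (msum C D B' (%i. cmp C D B' B' (cmp C B' (Zs ! i) B' (\<iota>' i) (\<pi>' i)) q) {..<?m})"
   using Z B D by (subst cmp_msum_right) (auto simp: cmp_mor)
  also have "... = cmp C D B' D k (cmp C D B' B' (msum C B' B' (%i. cmp C B' (Zs ! i) B' (\<iota>' i) (\<pi>' i)) {..<?m}) q)"
   using Z B D by (subst cmp_msum_left) (auto simp: cmp_mor)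
  also have "... = cmp C D B' D k q" using d2 D B by (simp add: biprod_data_def idm_cmp)
  finally show "msum C D D (%i. cmp C D (?Y i) D (?I i) (?P i)) {..<length (Ys @ Zs)} = idm C D"
   using id by (simp add: F_def[abs_def])
 qed (use D in auto)
 then show ?thesis unfolding is_biproduct_iff by blast
qed

lemma is_biproduct_single: assumes "Y \<in> ob C" shows "is_biproduct C [Y] Y"
proof -
 have "biprod_data C 1 (%i. [Y] ! i) Y (%_. idm C Y) (%_. idm C Y)"
  using assms by (auto simp: biprod_data_def idm_mor idm_cmp lessThan_Suc intro: msum_delta[where j = 0, THEN trans])
 then show ?thesis using is_biproduct_iff[of "[Y]"] by auto
qed

lemma is_biproduct_Nil: "is_biproduct C [] Z \<longleftrightarrow> Z \<in> ob C \<and> idm C Z = mzero C Z Z"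
 by (auto simp: is_biproduct_def)

text \<open>\<open>add_closure\<close> asks for a complementary summand; a zero object serves as one
  when a direct sum itself is to be a member.\<close>

lemma is_biproduct_zero: assumes "Y \<in> ob C" "Z \<in> ob C" "idm C Z = mzero C Z Z"
 shows "is_biproduct C [Y, Z] Y"
proof -
 let ?i = "%i::nat. if i = 0 then idm C Y else mzero C Z Y"
 let ?p = "%i::nat. if i = 0 then idm C Y else mzero C Y Z"
 have "msum C Y Y (%i. cmp C Y ([Y, Z] ! i) Y (?i i) (?p i)) {0, 1} = idm C Y"
  using assms by (subst msum_pair)
   (auto simp: idm_mor idm_cmp cmp_mor mzero_mor cmp_mzero_left madd_mzero)
 then have "biprod_data C 2 (%i. [Y, Z] ! i) Y ?i ?p"
  using assms by (auto simp: biprod_data_def idm_mor idm_cmp lessThan_Suc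
    numeral_2_eq_2 less_Suc_eq mzero_mor cmp_mzero_left cmp_mzero_right insert_commute)
 then show ?thesis using is_biproduct_iff[of "[Y, Z]"] by (auto simp: numeral_2_eq_2)
qed

text \<open>The identity is inserted as a sum. No orthogonality of the \<open>a i\<close> and
  \<open>b i\<close> is assumed, so that the expansion also applies to a mere generator.\<close>

lemma biprod_expand:
 assumes X: "X \<in> ob C" "Z \<in> ob C" and W: "\<forall>i<n. W i \<in> ob C \<and> a i \<in> mor C (W i) X \<and> b i \<in> mor C X (W i)"
  and id: "msum C X X (%i. cmp C X (W i) X (a i) (b i)) {..<n} = idm C X"
 shows "y \<in> mor C Z X ==> msum C Z X (%i. cmp C Z (W i) X (a i) (cmp C Z X (W i) (b i) y)) {..<n} = y"
  and "k \<in> mor C X Z ==> msum C X Z (%i. cmp C X (W i) Z (cmp C (W i) X Z k (a i)) (b i)) {..<n} = k"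
proof -
 assume y: "y \<in> mor C Z X"
 have "msum C Z X (%i. cmp C Z (W i) X (a i) (cmp C Z X (W i) (b i) y)) {..<n} = msum C Z X (%i. cmp C Z X X (cmp C X (W i) X (a i) (b i)) y) {..<n}"
  using y X W by (intro msum_cong) (auto simp: cmp_mor cmp_assoc)
 also have "... = cmp C Z X X (idm C X) y"
  unfolding id[symmetric] using y X W by (intro cmp_msum_left[symmetric]) (auto simp: cmp_mor)
 finally show "msum C Z X (%i. cmp C Z (W i) X (a i) (cmp C Z X (W i) (b i) y)) {..<n} = y" using y X by (simp add: idm_cmp)
next
 assume k: "k \<in> mor C X Z"
 have "msum C X Z (%i. cmp C X (W i) Z (cmp C (W i) X Z k (a i)) (b i)) {..<n} = msum C X Z (%i. cmp C X X Z k (cmp C X (W i) X (a i) (b i))) {..<n}"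
  using k X W by (intro msum_cong) (auto simp: cmp_mor cmp_assoc)
 also have "... = cmp C X X Z k (idm C X)"
  unfolding id[symmetric] using k X W by (intro cmp_msum_right[symmetric]) (auto simp: cmp_mor)
 finally show "msum C X Z (%i. cmp C X (W i) Z (cmp C (W i) X Z k (a i)) (b i)) {..<n} = k" using k X by (simp add: cmp_idm)
qed

text \<open>Expanding the identity of \<open>B\<close> at the target turns equality of entries into
  equality of columns, and expanding it at the source turns that into equality of morphisms.\<close>

lemma biprod_matrix_unique:
 assumes "biprod_data C n Y B \<iota> \<pi>" "f \<in> mor C B B" "g \<in> mor C B B"
  "!!i j. i < n ==> j < n ==>
   cmp C (Y i) B (Y j) (\<pi> j) (cmp C (Y i) B B f (\<iota> i)) = cmp C (Y i) B (Y j) (\<pi> j) (cmp C (Y i) B B g (\<iota> i))"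
 shows "f = g"
proof -
 note d = assms(1)[unfolded biprod_data_def]
 have B: "B \<in> ob C" and Y: "!!i. i < n ==> Y i \<in> ob C" "!!i. i < n ==> \<iota> i \<in> mor C (Y i) B" "!!i. i < n ==> \<pi> i \<in> mor C B (Y i)"
  and id: "msum C B B (%i. cmp C B (Y i) B (\<iota> i) (\<pi> i)) {..<n} = idm C B" using d by auto
 have W: "\<forall>i<n. Y i \<in> ob C \<and> \<iota> i \<in> mor C (Y i) B \<and> \<pi> i \<in> mor C B (Y i)" using Y by blast
 have left: "h = h'" if X: "X \<in> ob C" and h: "h \<in> mor C X B" "h' \<in> mor C X B"
  and e: "!!j. j < n ==> cmp C X B (Y j) (\<pi> j) h = cmp C X B (Y j) (\<pi> j) h'" for X h h'
 proof -
  have "msum C X B (%i. cmp C X (Y i) B (\<iota> i) (cmp C X B (Y i) (\<pi> i) h)) {..<n} =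
    msum C X B (%i. cmp C X (Y i) B (\<iota> i) (cmp C X B (Y i) (\<pi> i) h')) {..<n}"
   using X h e B Y by (intro msum_cong) (auto simp: cmp_mor)
  then show ?thesis unfolding biprod_expand(1)[OF B X W id h(1)] biprod_expand(1)[OF B X W id h(2)] .
 qed
 have fg: "cmp C (Y i) B B f (\<iota> i) = cmp C (Y i) B B g (\<iota> i)" if "i < n" for i
  by (rule left[of "Y i"]) (use that assms(2,3) assms(4)[OF that] B Y in "simp_all add: cmp_mor")
 have "msum C B B (%i. cmp C B (Y i) B (cmp C (Y i) B B f (\<iota> i)) (\<pi> i)) {..<n} =
   msum C B B (%i. cmp C B (Y i) B (cmp C (Y i) B B g (\<iota> i)) (\<pi> i)) {..<n}"
  using assms B Y fg by (intro msum_cong) (auto simp: cmp_mor)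
 then show ?thesis unfolding biprod_expand(2)[OF B B W id assms(2)] biprod_expand(2)[OF B B W id assms(3)] .
qed

lemma biprod_matrix_exists:
 assumes "biprod_data C n Y B \<iota> \<pi>" "!!i j. i < n ==> j < n ==> m i j \<in> mor C (Y i) (Y j)"
 shows "\<exists>f \<in> mor C B B. \<forall>i<n. \<forall>j<n. cmp C (Y i) B (Y j) (\<pi> j) (cmp C (Y i) B B f (\<iota> i)) = m i j"
proof -
 note d = assms(1)[unfolded biprod_data_def]
 have B: "B \<in> ob C" and Y: "!!i. i < n ==> Y i \<in> ob C" "!!i. i < n ==> \<iota> i \<in> mor C (Y i) B" "!!i. i < n ==> \<pi> i \<in> mor C B (Y i)"
  and delta: "!!i j. i < n ==> j < n ==> cmp C (Y i) B (Y j) (\<pi> j) (\<iota> i) =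
   (if i = j then idm C (Y i) else mzero C (Y i) (Y j))" using d by auto
 \<comment> \<open>\<open>r i\<close> is the column with entries \<open>m i j\<close>, a morphism
   out of \<open>Y i\<close>; the columns are then glued along the projections.\<close>
 define r where "r i = msum C (Y i) B (%j. cmp C (Y i) (Y j) B (\<iota> j) (m i j)) {..<n}" for i
 define f where "f = msum C B B (%i. cmp C B (Y i) B (r i) (\<pi> i)) {..<n}"
 have r: "r i \<in> mor C (Y i) B" if "i < n" for i
  unfolding r_def using that B Y assms(2) by (intro msum_mor) (auto simp: cmp_mor)
 have f: "f \<in> mor C B B" unfolding f_def using B Y r by (intro msum_mor) (auto simp: cmp_mor)
 have fi: "cmp C (Y i) B B f (\<iota> i) = r i" if i: "i < n" for i
 proof -
  have "cmp C (Y i) B B f (\<iota> i) = msum C (Y i) B (%k. cmp C (Y i) B B (cmp C B (Y k) B (r k) (\<pi> k)) (\<iota> i)) {..<n}"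
   unfolding f_def using B Y r i by (intro cmp_msum_left) (auto simp: cmp_mor)
  also have "... = msum C (Y i) B (%k. if k = i then r i else mzero C (Y i) B) {..<n}"
   using B Y r i by (intro msum_cong) (auto simp: cmp_mor cmp_assoc delta cmp_idm cmp_mzero_right mzero_mor)
  also have "... = r i" using B Y r i by (subst msum_delta[where j = i]) auto
  finally show ?thesis .
 qed
 have "cmp C (Y i) B (Y j) (\<pi> j) (r i) = m i j" if i: "i < n" and j: "j < n" for i j
 proof -
  have "cmp C (Y i) B (Y j) (\<pi> j) (r i) = msum C (Y i) (Y j) (%k. cmp C (Y i) B (Y j) (\<pi> j) (cmp C (Y i) (Y k) B (\<iota> k) (m i k))) {..<n}"
   unfolding r_def using B Y i j assms(2) by (intro cmp_msum_right) (auto simp: cmp_mor)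
  also have "... = msum C (Y i) (Y j) (%k. if k = j then m i j else mzero C (Y i) (Y j)) {..<n}"
   using B Y i j assms(2)
   by (intro msum_cong) (auto simp: cmp_assoc[symmetric] delta idm_cmp cmp_mzero_left mzero_mor)
  also have "... = m i j" using B Y i j assms(2) by (subst msum_delta[where j = j]) auto
  finally show ?thesis .
 qed
 then show ?thesis using f fi by (intro bexI[of _ f]) auto
qed

end

section \<open>Equivalences of linear categories\<close>

lemma linear_functorD:
 assumes "linear_functor C D F"
 shows "X \<in> ob C ==> fob F X \<in> ob D"
  and "X \<in> ob C ==> fmor F X X (idm C X) = idm D (fob F X)"
  and "X \<in> ob C ==> Y \<in> ob C ==> f \<in> mor C X Y ==> fmor F X Y f \<in> mor D (fob F X) (fob F Y)"
  and "X \<in> ob C ==> Y \<in> ob C ==> Z \<in> ob C ==> f \<in> mor C X Y ==> g \<in> mor C Y Z ==>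
    fmor F X Z (cmp C X Y Z g f) =
     cmp D (fob F X) (fob F Y) (fob F Z) (fmor F Y Z g) (fmor F X Y f)"
  and "X \<in> ob C ==> Y \<in> ob C ==> f \<in> mor C X Y ==> g \<in> mor C X Y ==>
    fmor F X Y (madd C X Y f g) = madd D (fob F X) (fob F Y) (fmor F X Y f) (fmor F X Y g)"
  and "X \<in> ob C ==> Y \<in> ob C ==> f \<in> mor C X Y ==>
    fmor F X Y (mscale C X Y c f) = mscale D (fob F X) (fob F Y) c (fmor F X Y f)"
 using assms unfolding linear_functor_def by auto

lemma linear_functorI:
 assumes "!!X. X \<in> ob C ==> fob F X \<in> ob D"
  and "!!X. X \<in> ob C ==> fmor F X X (idm C X) = idm D (fob F X)"
  and "!!X Y f. X \<in> ob C ==> Y \<in> ob C ==> f \<in> mor C X Y ==> fmor F X Y f \<in> mor D (fob F X) (fob F Y)"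
  and "!!X Y Z f g. X \<in> ob C ==> Y \<in> ob C ==> Z \<in> ob C ==> f \<in> mor C X Y ==> g \<in> mor C Y Z ==>
    fmor F X Z (cmp C X Y Z g f) =
     cmp D (fob F X) (fob F Y) (fob F Z) (fmor F Y Z g) (fmor F X Y f)"
  and "!!X Y f g. X \<in> ob C ==> Y \<in> ob C ==> f \<in> mor C X Y ==> g \<in> mor C X Y ==>
    fmor F X Y (madd C X Y f g) = madd D (fob F X) (fob F Y) (fmor F X Y f) (fmor F X Y g)"
  and "!!X Y c f. X \<in> ob C ==> Y \<in> ob C ==> f \<in> mor C X Y ==>
    fmor F X Y (mscale C X Y c f) = mscale D (fob F X) (fob F Y) c (fmor F X Y f)"
 shows "linear_functor C D F"
 using assms unfolding linear_functor_def by auto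

lemma mk_functor_simps [simp]:
 "X \<in> ob C ==> fob (mk_functor C fo fm) X = fo X"
 "X \<in> ob C ==> Y \<in> ob C ==> f \<in> mor C X Y ==> fmor (mk_functor C fo fm) X Y f = fm X Y f"
 by (simp_all add: mk_functor_def)

lemma comp_functor_simps [simp]:
 "X \<in> ob C ==> fob (comp_functor C G F) X = fob G (fob F X)"
 "X \<in> ob C ==> Y \<in> ob C ==> f \<in> mor C X Y ==>
  fmor (comp_functor C G F) X Y f = fmor G (fob F X) (fob F Y) (fmor F X Y f)"
 by (simp_all add: comp_functor_def)

lemma id_functor_simps [simp]:
 "X \<in> ob C ==> fob (id_functor C) X = X"
 "X \<in> ob C ==> Y \<in> ob C ==> f \<in> mor C X Y ==> fmor (id_functor C) X Y f = f"
 by (simp_all add: id_functor_def)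

text \<open>
  The laws of a category are only required of \<open>D\<close>; they hold in \<open>C\<close> because \<open>F\<close> is faithful.
\<close>

lemma linear_equivalence_if_fully_faithful:
 assumes D: "lin_cat D" and F: "linear_functor C D F"
  and clC: "!!X Y Z f g. X \<in> ob C ==> Y \<in> ob C ==> Z \<in> ob C ==> f \<in> mor C X Y ==> g \<in> mor C Y Z ==>
   cmp C X Y Z g f \<in> mor C X Z"
   "!!X. X \<in> ob C ==> idm C X \<in> mor C X X"
   "!!X Y f g. X \<in> ob C ==> Y \<in> ob C ==> f \<in> mor C X Y ==> g \<in> mor C X Y ==> madd C X Y f g \<in> mor C X Y"
   "!!X Y c f. X \<in> ob C ==> Y \<in> ob C ==> f \<in> mor C X Y ==> mscale C X Y c f \<in> mor C X Y"
  and inj: "!!X Y f g. X \<in> ob C ==> Y \<in> ob C ==> f \<in> mor C X Y ==> g \<in> mor C X Y ==>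
   fmor F X Y f = fmor F X Y g ==> f = g"
  and full: "!!X Y g. X \<in> ob C ==> Y \<in> ob C ==> g \<in> mor D (fob F X) (fob F Y) ==>
   \<exists>f\<in>mor C X Y. fmor F X Y f = g"
  and dense: "!!M. M \<in> ob D ==> \<exists>X\<in>ob C. \<exists>e. cat_iso D (fob F X) M e"
 shows "linear_equivalence C D F"
proof -
 interpret D: lin_cat D by fact
 note Fd = linear_functorD[OF F]
 have "\<forall>M. \<exists>X e e'. M \<in> ob D --> X \<in> ob C \<and> e \<in> mor D (fob F X) M \<and> e' \<in> mor D M (fob F X) \<and>
   cmp D (fob F X) M (fob F X) e' e = idm D (fob F X) \<and> cmp D M (fob F X) M e e' = idm D M"
  using dense unfolding cat_iso_def by blast
 then obtain H e e' where He: "!!M. M \<in> ob D --> H M \<in> ob C \<and> e M \<in> mor D (fob F (H M)) M \<and> e' M \<in> mor D M (fob F (H M)) \<and>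
   cmp D (fob F (H M)) M (fob F (H M)) (e' M) (e M) = idm D (fob F (H M)) \<and> cmp D M (fob F (H M)) M (e M) (e' M) = idm D M"
  by (simp only: choice_iff) blast
 have H: "M \<in> ob D ==> H M \<in> ob C" and e: "M \<in> ob D ==> e M \<in> mor D (fob F (H M)) M"
  and e': "M \<in> ob D ==> e' M \<in> mor D M (fob F (H M))"
  and e'e: "M \<in> ob D ==> cmp D (fob F (H M)) M (fob F (H M)) (e' M) (e M) = idm D (fob F (H M))"
  and ee': "M \<in> ob D ==> cmp D M (fob F (H M)) M (e M) (e' M) = idm D M" for M
  using He by auto
 have FH: "M \<in> ob D ==> fob F (H M) \<in> ob D" for M using H Fd(1) by blast
 note mors = D.cmp_mor D.idm_mor D.madd_mor D.mscale_mor H e e' FH Fd(1,3)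
 define L where "L X Y g = (SOME f. f \<in> mor C X Y \<and> fmor F X Y f = g)" for X Y g
 have L: "L X Y g \<in> mor C X Y" "fmor F X Y (L X Y g) = g"
  if "X \<in> ob C" "Y \<in> ob C" "g \<in> mor D (fob F X) (fob F Y)" for X Y g
  using someI_ex[of "%f. f \<in> mor C X Y \<and> fmor F X Y f = g"] full[OF that] unfolding L_def by blast+
 \<comment> \<open>The conjugate of \<open>g\<close> by the chosen isomorphisms is a morphism
   between values of \<open>F\<close>; the quasi-inverse \<open>G\<close> sends \<open>g\<close> to
   a preimage of it under \<open>F\<close>.\<close>
 define c where "c M N g = cmp D (fob F (H M)) M (fob F (H N)) (cmp D M N (fob F (H N)) (e' N) g) (e M)" for M N g
 have c: "c M N g \<in> mor D (fob F (H M)) (fob F (H N))" if "M \<in> ob D" "N \<in> ob D" "g \<in> mor D M N" for M N g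
  using that by (simp add: c_def mors)
 have ec: "cmp D (fob F (H M)) (fob F (H N)) N (e N) (c M N g) = cmp D (fob F (H M)) M N g (e M)"
  if "M \<in> ob D" "N \<in> ob D" "g \<in> mor D M N" for M N g
 proof -
  have "cmp D (fob F (H M)) (fob F (H N)) N (e N) (c M N g) =
    cmp D (fob F (H M)) M N (cmp D M N N (cmp D N (fob F (H N)) N (e N) (e' N)) g) (e M)"
   using that unfolding c_def by (simp add: mors D.cmp_assoc)
  then show ?thesis using that by (simp add: ee' D.idm_cmp)
 qed
 define G where "G = \<lparr>fob = H, fmor = (%M N g. L (H M) (H N) (c M N g))\<rparr>"
 have G [simp]: "fob G = H" "fmor G M N g = L (H M) (H N) (c M N g)" for M N g by (simp_all add: G_def)
 have LG: "L (H M) (H N) (c M N g) \<in> mor C (H M) (H N)" "fmor F (H M) (H N) (L (H M) (H N) (c M N g)) = c M N g"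
  if "M \<in> ob D" "N \<in> ob D" "g \<in> mor D M N" for M N g
  using that L[of "H M" "H N"] c H by auto
 \<comment> \<open>Each law for \<open>G\<close> is an equation in \<open>C\<close> and is verified
   after applying the faithful functor \<open>F\<close>.\<close>
 have G_fun: "linear_functor D C G"
 proof (rule linear_functorI; unfold G)
  fix M assume M: "M \<in> ob D"
  then show "H M \<in> ob C" by (rule H)
  show "L (H M) (H M) (c M M (idm D M)) = idm C (H M)"
  proof (rule inj)
   show "fmor F (H M) (H M) (L (H M) (H M) (c M M (idm D M))) = fmor F (H M) (H M) (idm C (H M))"
    using M by (simp add: LG mors Fd(2)) (simp add: c_def D.cmp_idm mors e'e)
  qed (use M LG clC H D.idm_mor in auto)
 next
  fix M N g assume MN: "M \<in> ob D" "N \<in> ob D" "g \<in> mor D M N"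
  then show "L (H M) (H N) (c M N g) \<in> mor C (H M) (H N)" using LG by blast
 next
  fix M N K f g assume a: "M \<in> ob D" "N \<in> ob D" "K \<in> ob D" "f \<in> mor D M N" "g \<in> mor D N K"
  have "cmp D (fob F (H M)) (fob F (H N)) (fob F (H K)) (c N K g) (c M N f) =
    cmp D (fob F (H M)) N (fob F (H K)) (cmp D N K (fob F (H K)) (e' K) g)
     (cmp D (fob F (H M)) (fob F (H N)) N (e N) (c M N f))"
   using a c[OF a(1,2,4)] unfolding c_def[of N K g] by (simp add: mors D.cmp_assoc)
  also have "... = cmp D (fob F (H M)) N (fob F (H K)) (cmp D N K (fob F (H K)) (e' K) g)
     (cmp D (fob F (H M)) M N f (e M))" by (simp only: ec[OF a(1,2,4)])
  also have "... = c M K (cmp D M N K g f)" using a unfolding c_def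
   by (simp add: mors D.cmp_assoc)
  finally have *: "c M K (cmp D M N K g f) = cmp D (fob F (H M)) (fob F (H N)) (fob F (H K)) (c N K g) (c M N f)" ..
  show "L (H M) (H K) (c M K (cmp D M N K g f)) = cmp C (H M) (H N) (H K) (L (H N) (H K) (c N K g)) (L (H M) (H N) (c M N f))"
  proof (rule inj)
   show "fmor F (H M) (H K) (L (H M) (H K) (c M K (cmp D M N K g f))) =
     fmor F (H M) (H K) (cmp C (H M) (H N) (H K) (L (H N) (H K) (c N K g)) (L (H M) (H N) (c M N f)))"
    unfolding LG(2)[OF a(1,3) D.cmp_mor[OF a(1,2,3,4,5)]] using a by (simp add: LG mors Fd(4) *)
  qed (use a LG clC H D.cmp_mor in auto)
 next
  fix M N f g assume a: "M \<in> ob D" "N \<in> ob D" "f \<in> mor D M N" "g \<in> mor D M N"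
  have *: "c M N (madd D M N f g) = madd D (fob F (H M)) (fob F (H N)) (c M N f) (c M N g)"
   using a by (simp add: c_def mors D.cmp_madd_left D.cmp_madd_right)
  show "L (H M) (H N) (c M N (madd D M N f g)) = madd C (H M) (H N) (L (H M) (H N) (c M N f)) (L (H M) (H N) (c M N g))"
  proof (rule inj)
   show "fmor F (H M) (H N) (L (H M) (H N) (c M N (madd D M N f g))) =
    fmor F (H M) (H N) (madd C (H M) (H N) (L (H M) (H N) (c M N f)) (L (H M) (H N) (c M N g)))"
    unfolding LG(2)[OF a(1,2) D.madd_mor[OF a]] using a by (simp add: LG mors Fd(5) *)
  qed (use a LG clC H D.madd_mor in auto)
 next
  fix M N k f assume a: "M \<in> ob D" "N \<in> ob D" "f \<in> mor D M N"
  have *: "c M N (mscale D M N k f) = mscale D (fob F (H M)) (fob F (H N)) k (c M N f)"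
   using a by (simp add: c_def mors D.cmp_mscale_left D.cmp_mscale_right)
  show "L (H M) (H N) (c M N (mscale D M N k f)) = mscale C (H M) (H N) k (L (H M) (H N) (c M N f))"
  proof (rule inj)
   show "fmor F (H M) (H N) (L (H M) (H N) (c M N (mscale D M N k f))) =
    fmor F (H M) (H N) (mscale C (H M) (H N) k (L (H M) (H N) (c M N f)))"
    unfolding LG(2)[OF a(1,2) D.mscale_mor[OF a]] using a by (simp add: LG mors Fd(6) *)
  qed (use a LG clC H D.mscale_mor in auto)
 qed
 have iso2: "nat_isomorphic D D (comp_functor D F G) (id_functor D)"
  unfolding nat_isomorphic_def
 proof (intro bexI ballI)
  show "restrict e (ob D) \<in> nat_trans D D (comp_functor D F G) (id_functor D)"
   unfolding nat_trans_def using ec by (auto simp: LG mors)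
  fix M assume "M \<in> ob D"
  then show "cat_iso D (fob (comp_functor D F G) M) (fob (id_functor D) M) (restrict e (ob D) M)"
   using e e' e'e ee' by (auto simp: cat_iso_def intro!: bexI[of _ "e' M"])
 qed
 \<comment> \<open>The unit and, below, its inverse are preimages under \<open>F\<close> of the
   inverse pair \<open>e'\<close> and \<open>e\<close>.\<close>
 define \<eta> where "\<eta> X = L X (H (fob F X)) (e' (fob F X))" for X
 have \<eta>: "\<eta> X \<in> mor C X (H (fob F X))" "fmor F X (H (fob F X)) (\<eta> X) = e' (fob F X)" if "X \<in> ob C" for X
  using L[of X "H (fob F X)" "e' (fob F X)"] that by (simp_all add: \<eta>_def mors)
 define \<theta> where "\<theta> X = L (H (fob F X)) X (e (fob F X))" for X
 have \<theta>: "\<theta> X \<in> mor C (H (fob F X)) X" "fmor F (H (fob F X)) X (\<theta> X) = e (fob F X)" if "X \<in> ob C" for X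
  using L[of "H (fob F X)" X "e (fob F X)"] that by (simp_all add: \<theta>_def mors)
 have iso1: "nat_isomorphic C C (id_functor C) (comp_functor C G F)"
  unfolding nat_isomorphic_def
 proof (intro bexI ballI)
  show "restrict \<eta> (ob C) \<in> nat_trans C C (id_functor C) (comp_functor C G F)"
   unfolding nat_trans_def
  proof (intro CollectI conjI ballI)
   fix X assume X: "X \<in> ob C"
   then show "restrict \<eta> (ob C) X \<in> mor C (fob (id_functor C) X) (fob (comp_functor C G F) X)"
    by (simp add: \<eta>)
   fix Y f assume Y: "Y \<in> ob C" and f: "f \<in> mor C X Y"
   let ?FX = "fob F X" and ?FY = "fob F Y" and ?g = "fmor F X Y f"
   have ob: "?FX \<in> ob D" "?FY \<in> ob D" "H ?FX \<in> ob C" "H ?FY \<in> ob C" and g: "?g \<in> mor D ?FX ?FY"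
    using X Y f by (auto simp: mors)
   have *: "cmp D ?FX (fob F (H ?FX)) (fob F (H ?FY)) (c ?FX ?FY ?g) (e' ?FX) = cmp D ?FX ?FY (fob F (H ?FY)) (e' ?FY) ?g"
    using ob g unfolding c_def by (simp add: D.cmp_assoc mors ee' D.cmp_idm)
   have "cmp C X Y (H ?FY) (\<eta> Y) f = cmp C X (H ?FX) (H ?FY) (L (H ?FX) (H ?FY) (c ?FX ?FY ?g)) (\<eta> X)"
   proof (rule inj)
    show "fmor F X (H ?FY) (cmp C X Y (H ?FY) (\<eta> Y) f) =
     fmor F X (H ?FY) (cmp C X (H ?FX) (H ?FY) (L (H ?FX) (H ?FY) (c ?FX ?FY ?g)) (\<eta> X))"
     using X Y f ob g by (simp add: Fd(4) \<eta> LG *)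
   qed (use X Y f ob g clC \<eta> LG in auto)
   then show "cmp C (fob (id_functor C) X) (fob (id_functor C) Y) (fob (comp_functor C G F) Y) (restrict \<eta> (ob C) Y)
     (fmor (id_functor C) X Y f) =
     cmp C (fob (id_functor C) X) (fob (comp_functor C G F) X) (fob (comp_functor C G F) Y)
     (fmor (comp_functor C G F) X Y f) (restrict \<eta> (ob C) X)" using X Y f by simp
  qed auto
  fix X assume X: "X \<in> ob C"
  let ?FX = "fob F X"
  have ob: "?FX \<in> ob D" "H ?FX \<in> ob C" using X by (auto simp: mors)
  have "cmp C X (H ?FX) X (\<theta> X) (\<eta> X) = idm C X"
   by (rule inj[of X X]) (use X ob in \<open>simp_all add: clC \<eta> \<theta> Fd(2,4) ee'\<close>)
  moreover have "cmp C (H ?FX) X (H ?FX) (\<eta> X) (\<theta> X) = idm C (H ?FX)"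
   by (rule inj[of "H ?FX" "H ?FX"]) (use X ob in \<open>simp_all add: clC \<eta> \<theta> Fd(2,4) e'e\<close>)
  ultimately show "cat_iso C (fob (id_functor C) X) (fob (comp_functor C G F) X) (restrict \<eta> (ob C) X)"
   using X \<eta> \<theta> by (auto simp: cat_iso_def)
 qed
 show ?thesis unfolding linear_equivalence_def using F G_fun iso1 iso2 by blast
qed

text \<open>The value on a coset is taken at an arbitrary representative; it does not depend on the
  choice when \<open>F\<close> annihilates \<open>N\<close>.\<close>

definition quot_functor :: "('o, 'm, 'o2, 'm2) cfunctor => ('o, 'm set, 'o2, 'm2) cfunctor" where
 "quot_functor F = \<lparr>fob = fob F, fmor = (%X Y S. fmor F X Y (SOME f. f \<in> S))\<rparr>"

text \<open>Since \<open>N\<close> is the whole kernel of \<open>F\<close>, the cosets are the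
  fibres of \<open>F\<close> on morphisms. This makes the operations on cosets well defined and the
  induced functor faithful; fullness and density are inherited.\<close>

lemma linear_equivalence_quot_cat:
 assumes C: "lin_cat C" and D: "lin_cat D" and F: "linear_functor C D F"
  and ker: "!!X Y. X \<in> ob C ==> Y \<in> ob C ==>
   N X Y = {f \<in> mor C X Y. fmor F X Y f = mzero D (fob F X) (fob F Y)}"
  and full: "!!X Y g. X \<in> ob C ==> Y \<in> ob C ==> g \<in> mor D (fob F X) (fob F Y) ==>
   \<exists>f\<in>mor C X Y. fmor F X Y f = g"
  and dense: "!!M. M \<in> ob D ==> \<exists>X\<in>ob C. \<exists>e. cat_iso D (fob F X) M e"
 shows "linear_equivalence (quot_cat C N) D (quot_functor F)"
proof -
 interpret C: lin_cat C by fact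
 interpret D: lin_cat D by fact
 note Fd = linear_functorD[OF F]
 define cl where "cl X Y v = {f \<in> mor C X Y. fmor F X Y f = v}" for X Y v
 have coset: "mor_coset C N X Y f = cl X Y (fmor F X Y f)"
  if X: "X \<in> ob C" and Y: "Y \<in> ob C" and f: "f \<in> mor C X Y" for X Y f
 proof -
  interpret H: lmod field_ring "homv C X Y" using X Y by (rule C.lmod_homv)
  interpret H': lmod field_ring "homv D (fob F X) (fob F Y)" using X Y Fd by (intro D.lmod_homv)
  have "madd C X Y f n \<in> cl X Y (fmor F X Y f)" if "n \<in> N X Y" for n
   using that X Y f by (simp add: ker cl_def C.madd_mor Fd D.madd_mzero)
  moreover have "g \<in> mor_coset C N X Y f" if g: "g \<in> cl X Y (fmor F X Y f)" for g
  proof -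
   have gm: "g \<in> mor C X Y" and eq: "fmor F X Y g = fmor F X Y f" using g by (auto simp: cl_def)
   \<comment> \<open>The difference of \<open>g\<close> and \<open>f\<close>, the element of
     \<open>N\<close> that carries \<open>f\<close> to \<open>g\<close>.\<close>
   let ?n = "madd C X Y (mscale C X Y (- 1) f) g"
   have m: "mscale C X Y (- 1) f \<in> mor C X Y" using X Y f by (simp add: C.mscale_mor)
   have z: "madd C X Y f (mscale C X Y (- 1) f) = mzero C X Y"
    using C.mscale_add[of X Y f 1 "- 1"] X Y f by (simp add: C.mscale_one C.mscale_zero)
   have z': "madd D (fob F X) (fob F Y) (mscale D (fob F X) (fob F Y) (- 1) (fmor F X Y f)) (fmor F X Y f) = mzero D (fob F X) (fob F Y)"
    using D.mscale_add[of "fob F X" "fob F Y" "fmor F X Y f" "- 1" 1] X Y f by (simp add: D.mscale_one D.mscale_zero Fd)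
   have "madd C X Y f ?n = g"
    using X Y f gm m z by (simp add: C.madd_assoc[symmetric] C.mzero_madd)
   moreover have "?n \<in> N X Y" using X Y f gm m z' eq by (simp add: ker C.madd_mor Fd)
   ultimately show ?thesis unfolding mor_coset_def by (intro image_eqI[of _ _ ?n]) simp_all
  qed
  ultimately show ?thesis unfolding mor_coset_def by blast
 qed
 let ?Q = "quot_cat C N"
 have Q: "ob ?Q = ob C" "idm ?Q = (%X. mor_coset C N X X (idm C X))"
  "mzero ?Q = (%X Y. mor_coset C N X Y (mzero C X Y))"
  "cmp ?Q = (%X Y Z B A. \<Union>a\<in>A. \<Union>b\<in>B. mor_coset C N X Z (cmp C X Y Z b a))"
  "madd ?Q = (%X Y A B. \<Union>a\<in>A. \<Union>b\<in>B. mor_coset C N X Y (madd C X Y a b))"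
  "mscale ?Q = (%X Y c A. \<Union>a\<in>A. mor_coset C N X Y (mscale C X Y c a))"
  by (simp_all add: quot_cat_def)
 have mem: "f \<in> cl X Y (fmor F X Y f)" if "f \<in> mor C X Y" for X Y f using that by (simp add: cl_def)
 have Qmor: "S \<in> mor ?Q X Y \<longleftrightarrow> (\<exists>f\<in>mor C X Y. S = cl X Y (fmor F X Y f))"
  if "X \<in> ob C" "Y \<in> ob C" for S X Y
  using that coset by (auto simp: quot_cat_def)
 have un: "(\<Union>a\<in>A. \<Union>b\<in>B. f a b) = c" if "a0 \<in> A" "b0 \<in> B" "!!a b. a \<in> A ==> b \<in> B ==> f a b = c"
  for A B :: "'c set" and a0 b0 c and f :: "'c => 'c => 'c set"
  using that by fastforce
 have Qcmp: "cmp ?Q X Y Z (cl Y Z (fmor F Y Z g)) (cl X Y (fmor F X Y f)) = cl X Z (fmor F X Z (cmp C X Y Z g f))"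
  if "X \<in> ob C" "Y \<in> ob C" "Z \<in> ob C" "f \<in> mor C X Y" "g \<in> mor C Y Z" for X Y Z f g
 proof -
  have "mor_coset C N X Z (cmp C X Y Z b a) = cl X Z (fmor F X Z (cmp C X Y Z g f))"
   if "a \<in> cl X Y (fmor F X Y f)" "b \<in> cl Y Z (fmor F Y Z g)" for a b
  proof -
   have "a \<in> mor C X Y" "b \<in> mor C Y Z" "fmor F X Y a = fmor F X Y f" "fmor F Y Z b = fmor F Y Z g"
    using that by (auto simp: cl_def)
   then show ?thesis
    using \<open>X \<in> ob C\<close> \<open>Y \<in> ob C\<close> \<open>Z \<in> ob C\<close> \<open>f \<in> mor C X Y\<close> \<open>g \<in> mor C Y Z\<close>
    by (simp add: coset C.cmp_mor Fd)
  qed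
  then show ?thesis unfolding Q by (intro un[OF mem[OF that(4)] mem[OF that(5)]])
 qed
 have Qadd: "madd ?Q X Y (cl X Y (fmor F X Y f)) (cl X Y (fmor F X Y g)) = cl X Y (fmor F X Y (madd C X Y f g))"
  if "X \<in> ob C" "Y \<in> ob C" "f \<in> mor C X Y" "g \<in> mor C X Y" for X Y f g
 proof -
  have "mor_coset C N X Y (madd C X Y a b) = cl X Y (fmor F X Y (madd C X Y f g))"
   if "a \<in> cl X Y (fmor F X Y f)" "b \<in> cl X Y (fmor F X Y g)" for a b
  proof -
   have "a \<in> mor C X Y" "b \<in> mor C X Y" "fmor F X Y a = fmor F X Y f" "fmor F X Y b = fmor F X Y g"
    using that by (auto simp: cl_def)
   then show ?thesis
    using \<open>X \<in> ob C\<close> \<open>Y \<in> ob C\<close> \<open>f \<in> mor C X Y\<close> \<open>g \<in> mor C X Y\<close> by (simp add: coset C.madd_mor Fd)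
  qed
  then show ?thesis unfolding Q by (intro un[OF mem[OF that(3)] mem[OF that(4)]])
 qed
 have Qscale: "mscale ?Q X Y c (cl X Y (fmor F X Y f)) = cl X Y (fmor F X Y (mscale C X Y c f))"
  if "X \<in> ob C" "Y \<in> ob C" "f \<in> mor C X Y" for X Y f c
 proof -
  have "mor_coset C N X Y (mscale C X Y c a) = cl X Y (fmor F X Y (mscale C X Y c f))"
   if "a \<in> cl X Y (fmor F X Y f)" for a
  proof -
   have "a \<in> mor C X Y" "fmor F X Y a = fmor F X Y f"
    using that by (auto simp: cl_def)
   then show ?thesis
    using \<open>X \<in> ob C\<close> \<open>Y \<in> ob C\<close> \<open>f \<in> mor C X Y\<close> by (simp add: coset C.mscale_mor Fd)
  qed
  then show ?thesis unfolding Q using mem that by blast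
 qed
 have Qid: "idm ?Q X = cl X X (fmor F X X (idm C X))" if "X \<in> ob C" for X
  using that by (simp add: Q coset C.idm_mor)
 have val: "fmor (quot_functor F) X Y (cl X Y (fmor F X Y f)) = fmor F X Y f" if "f \<in> mor C X Y" for X Y f
  using someI[of "%h. h \<in> cl X Y (fmor F X Y f)", OF mem[OF that]] by (simp add: quot_functor_def cl_def)
 have fob: "fob (quot_functor F) = fob F" by (simp add: quot_functor_def)
 show ?thesis
 proof (rule linear_equivalence_if_fully_faithful[OF D])
  show "linear_functor ?Q D (quot_functor F)"
  proof (rule linear_functorI; unfold Q(1) fob)
   fix X assume X: "X \<in> ob C"
   then show "fob F X \<in> ob D" by (rule Fd)
   show "fmor (quot_functor F) X X (idm ?Q X) = idm D (fob F X)"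
    unfolding Qid[OF X] val[OF C.idm_mor[OF X]] using X by (rule Fd)
  next
   fix X Y S assume "X \<in> ob C" "Y \<in> ob C" "S \<in> mor ?Q X Y"
   then show "fmor (quot_functor F) X Y S \<in> mor D (fob F X) (fob F Y)" by (auto simp: Qmor val Fd)
  next
   fix X Y Z S T assume "X \<in> ob C" "Y \<in> ob C" "Z \<in> ob C" "S \<in> mor ?Q X Y" "T \<in> mor ?Q Y Z"
   then show "fmor (quot_functor F) X Z (cmp ?Q X Y Z T S) =
    cmp D (fob F X) (fob F Y) (fob F Z) (fmor (quot_functor F) Y Z T) (fmor (quot_functor F) X Y S)"
    by (auto simp: Qmor val Qcmp C.cmp_mor intro: Fd)
  next
   fix X Y S T assume "X \<in> ob C" "Y \<in> ob C" "S \<in> mor ?Q X Y" "T \<in> mor ?Q X Y"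
   then show "fmor (quot_functor F) X Y (madd ?Q X Y S T) =
    madd D (fob F X) (fob F Y) (fmor (quot_functor F) X Y S) (fmor (quot_functor F) X Y T)"
    by (auto simp: Qmor val Qadd C.madd_mor intro: Fd)
  next
   fix X Y c S assume "X \<in> ob C" "Y \<in> ob C" "S \<in> mor ?Q X Y"
   then show "fmor (quot_functor F) X Y (mscale ?Q X Y c S) =
    mscale D (fob F X) (fob F Y) c (fmor (quot_functor F) X Y S)"
    by (auto simp: Qmor val Qscale C.mscale_mor intro: Fd)
  qed
 next
  fix X Y Z f g assume "X \<in> ob ?Q" "Y \<in> ob ?Q" "Z \<in> ob ?Q" "f \<in> mor ?Q X Y" "g \<in> mor ?Q Y Z"
  then show "cmp ?Q X Y Z g f \<in> mor ?Q X Z" unfolding Q(1) by (auto simp: Qmor Qcmp intro: C.cmp_mor)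
 next
  fix X assume "X \<in> ob ?Q"
  then show "idm ?Q X \<in> mor ?Q X X" unfolding Q(1) by (auto simp: Qmor Qid intro: C.idm_mor)
 next
  fix X Y f g assume "X \<in> ob ?Q" "Y \<in> ob ?Q" "f \<in> mor ?Q X Y" "g \<in> mor ?Q X Y"
  then show "madd ?Q X Y f g \<in> mor ?Q X Y" unfolding Q(1) by (auto simp: Qmor Qadd intro: C.madd_mor)
 next
  fix X Y c f assume "X \<in> ob ?Q" "Y \<in> ob ?Q" "f \<in> mor ?Q X Y"
  then show "mscale ?Q X Y c f \<in> mor ?Q X Y" unfolding Q(1) by (auto simp: Qmor Qscale intro: C.mscale_mor)
 next
  fix X Y f g assume "X \<in> ob ?Q" "Y \<in> ob ?Q" "f \<in> mor ?Q X Y" "g \<in> mor ?Q X Y"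
   "fmor (quot_functor F) X Y f = fmor (quot_functor F) X Y g"
  then show "f = g" unfolding Q(1) by (auto simp: Qmor val)
 next
  fix X Y g assume XY: "X \<in> ob ?Q" "Y \<in> ob ?Q" "g \<in> mor D (fob (quot_functor F) X) (fob (quot_functor F) Y)"
  then obtain f where f: "f \<in> mor C X Y" "fmor F X Y f = g" using full unfolding Q(1) fob by blast
  then show "\<exists>f\<in>mor ?Q X Y. fmor (quot_functor F) X Y f = g"
   using XY val[OF f(1)] f by (intro bexI[of _ "cl X Y (fmor F X Y f)"]) (auto simp: Qmor Q(1))
 next
  fix M assume "M \<in> ob D"
  then show "\<exists>X\<in>ob ?Q. \<exists>e. cat_iso D (fob (quot_functor F) X) M e" unfolding Q(1) fob by (rule dense)
 qed
qed

section \<open>Categories of arrows, full subcategories and functor categories\<close>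

lemma arrow_cat_simps:
 "ob (arrow_cat C) = {(X, Y, \<alpha>). X \<in> ob C \<and> Y \<in> ob C \<and> \<alpha> \<in> mor C X Y}"
 "mor (arrow_cat C) (X, Y, \<alpha>) (X', Y', \<alpha>') = {(f, g). f \<in> mor C X X' \<and> g \<in> mor C Y Y' \<and>
    cmp C X Y Y' g \<alpha> = cmp C X X' Y' \<alpha>' f}"
 "cmp (arrow_cat C) (X, Y, \<alpha>) (X', Y', \<alpha>') (X'', Y'', \<alpha>'') (f', g') (f, g) = (cmp C X X' X'' f' f, cmp C Y Y' Y'' g' g)"
 "idm (arrow_cat C) (X, Y, \<alpha>) = (idm C X, idm C Y)"
 "madd (arrow_cat C) (X, Y, \<alpha>) (X', Y', \<alpha>') (f, g) (h, k) = (madd C X X' f h, madd C Y Y' g k)"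
 "mzero (arrow_cat C) (X, Y, \<alpha>) (X', Y', \<alpha>') = (mzero C X X', mzero C Y Y')"
 "mscale (arrow_cat C) (X, Y, \<alpha>) (X', Y', \<alpha>') c (f, g) = (mscale C X X' c f, mscale C Y Y' c g)"
 by (simp_all add: arrow_cat_def)

text \<open>Commutative squares paste by associativity and add up by bilinearity; all other laws
  hold componentwise.\<close>

lemma (in lin_cat) lin_cat_arrow_cat: "lin_cat (arrow_cat C)"
proof
 fix A B D f g assume "A \<in> ob (arrow_cat C)" "B \<in> ob (arrow_cat C)" "D \<in> ob (arrow_cat C)"
  "f \<in> mor (arrow_cat C) A B" "g \<in> mor (arrow_cat C) B D"
 moreover obtain X Y \<alpha> where "A = (X, Y, \<alpha>)" by (cases A)
 moreover obtain X' Y' \<alpha>' where "B = (X', Y', \<alpha>')" by (cases B)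
 moreover obtain X'' Y'' \<alpha>'' where "D = (X'', Y'', \<alpha>'')" by (cases D)
 moreover obtain f1 f2 where "f = (f1, f2)" by (cases f)
 moreover obtain g1 g2 where "g = (g1, g2)" by (cases g)
 ultimately show "cmp (arrow_cat C) A B D g f \<in> mor (arrow_cat C) A D"
  by (simp add: arrow_cat_simps cmp_mor) (metis cmp_assoc)
qed (auto simp: arrow_cat_simps cmp_mor idm_mor madd_mor mzero_mor mscale_mor cmp_assoc idm_cmp cmp_idm
  madd_assoc mzero_madd mscale_zero mscale_one mscale_mscale mscale_add mscale_madd
  cmp_madd_left cmp_madd_right cmp_mscale_left cmp_mscale_right cmp_mzero_left cmp_mzero_right
  intro: madd_comm)

lemma full_subcat_simps [simp]:
 "ob (full_subcat C S) = ob C \<inter> S" "mor (full_subcat C S) = mor C" "cmp (full_subcat C S) = cmp C"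
 "idm (full_subcat C S) = idm C" "madd (full_subcat C S) = madd C" "mzero (full_subcat C S) = mzero C"
 "mscale (full_subcat C S) = mscale C"
 by (simp_all add: full_subcat_def)

lemma (in lin_cat) lin_cat_full_subcat: "lin_cat (full_subcat C S)"
 by unfold_locales
  (auto simp: cmp_mor idm_mor madd_mor mzero_mor mscale_mor cmp_assoc idm_cmp cmp_idm
  madd_assoc mzero_madd mscale_zero mscale_one mscale_mscale mscale_add mscale_madd
  cmp_madd_left cmp_madd_right cmp_mscale_left cmp_mscale_right intro: madd_comm)

lemma homv_full_subcat [simp]: "homv (full_subcat C S) = homv C"
 by (simp add: homv_def fun_eq_iff)

lemma functor_cat_simps [simp]:
 "F \<in> ob (functor_cat C D) \<longleftrightarrow> linear_functor C D F \<and> mk_functor C (fob F) (fmor F) = F"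
 "mor (functor_cat C D) = nat_trans C D"
 "cmp (functor_cat C D) F G H \<beta> \<alpha> = (\<lambda>X\<in>ob C. cmp D (fob F X) (fob G X) (fob H X) (\<beta> X) (\<alpha> X))"
 "idm (functor_cat C D) F = (\<lambda>X\<in>ob C. idm D (fob F X))"
 "madd (functor_cat C D) F G \<alpha> \<gamma> = (\<lambda>X\<in>ob C. madd D (fob F X) (fob G X) (\<alpha> X) (\<gamma> X))"
 "mzero (functor_cat C D) F G = (\<lambda>X\<in>ob C. mzero D (fob F X) (fob G X))"
 "mscale (functor_cat C D) F G c \<alpha> = (\<lambda>X\<in>ob C. mscale D (fob F X) (fob G X) c (\<alpha> X))"
 by (simp_all add: functor_cat_def)

lemma nat_transD:
 assumes "\<eta> \<in> nat_trans C D F G"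
 shows "\<eta> \<in> extensional (ob C)"
  and "X \<in> ob C ==> \<eta> X \<in> mor D (fob F X) (fob G X)"
  and "X \<in> ob C ==> Y \<in> ob C ==> f \<in> mor C X Y ==>
   cmp D (fob F X) (fob F Y) (fob G Y) (\<eta> Y) (fmor F X Y f) =
   cmp D (fob F X) (fob G X) (fob G Y) (fmor G X Y f) (\<eta> X)"
 using assms unfolding nat_trans_def by auto

lemma nat_transI:
 assumes "\<eta> \<in> extensional (ob C)"
  and "!!X. X \<in> ob C ==> \<eta> X \<in> mor D (fob F X) (fob G X)"
  and "!!X Y f. X \<in> ob C ==> Y \<in> ob C ==> f \<in> mor C X Y ==>
   cmp D (fob F X) (fob F Y) (fob G Y) (\<eta> Y) (fmor F X Y f) =
   cmp D (fob F X) (fob G X) (fob G Y) (fmor G X Y f) (\<eta> X)"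
 shows "\<eta> \<in> nat_trans C D F G"
 using assms unfolding nat_trans_def by auto

text \<open>All operations are pointwise, and transformations are extensional, so equations can be
  tested at the objects of \<open>C\<close>.\<close>

lemma lin_cat_functor_cat:
 assumes "lin_cat D" shows "lin_cat (functor_cat C D)"
proof -
 interpret D: lin_cat D by fact
 let ?E = "functor_cat C D"
 note Fd = linear_functorD
 show ?thesis
 proof (unfold_locales)
  fix F G H \<alpha> \<beta> assume a: "F \<in> ob ?E" "G \<in> ob ?E" "H \<in> ob ?E" "\<alpha> \<in> mor ?E F G" "\<beta> \<in> mor ?E G H"
  then have F: "linear_functor C D F" "linear_functor C D G" "linear_functor C D H" by auto
  note n = nat_transD[OF a(4)[unfolded functor_cat_simps]] nat_transD[OF a(5)[unfolded functor_cat_simps]]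
  note Fs = Fd[OF F(1)] Fd[OF F(2)] Fd[OF F(3)]
  show "cmp ?E F G H \<beta> \<alpha> \<in> mor ?E F H" unfolding functor_cat_simps
  proof (rule nat_transI)
   fix X Y f assume XY: "X \<in> ob C" "Y \<in> ob C" "f \<in> mor C X Y"
   have "cmp D (fob F X) (fob F Y) (fob H Y) (cmp D (fob F Y) (fob G Y) (fob H Y) (\<beta> Y) (\<alpha> Y)) (fmor F X Y f) =
     cmp D (fob F X) (fob G Y) (fob H Y) (\<beta> Y) (cmp D (fob F X) (fob G X) (fob G Y) (fmor G X Y f) (\<alpha> X))"
    using XY by (simp add: D.cmp_assoc Fs n(2,3,5))
   also have "... = cmp D (fob F X) (fob G X) (fob H Y) (cmp D (fob G X) (fob G Y) (fob H Y) (\<beta> Y) (fmor G X Y f)) (\<alpha> X)"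
    using XY by (simp add: D.cmp_assoc Fs n(2,5))
   also have "... = cmp D (fob F X) (fob H X) (fob H Y) (fmor H X Y f) (cmp D (fob F X) (fob G X) (fob H X) (\<beta> X) (\<alpha> X))"
    using XY by (simp add: D.cmp_assoc Fs n(2,5,6))
   finally show "cmp D (fob F X) (fob F Y) (fob H Y) ((\<lambda>X\<in>ob C. cmp D (fob F X) (fob G X) (fob H X) (\<beta> X) (\<alpha> X)) Y) (fmor F X Y f) =
     cmp D (fob F X) (fob H X) (fob H Y) (fmor H X Y f) ((\<lambda>X\<in>ob C. cmp D (fob F X) (fob G X) (fob H X) (\<beta> X) (\<alpha> X)) X)"
    using XY by simp
  qed (use Fs n in "auto simp: D.cmp_mor")
 next
  fix F assume "F \<in> ob ?E"
  then have F: "linear_functor C D F" by auto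
  show "idm ?E F \<in> mor ?E F F" unfolding functor_cat_simps
   by (rule nat_transI) (use Fd[OF F] in "auto simp: D.idm_mor D.idm_cmp D.cmp_idm")
 next
  fix F G \<alpha> \<beta> assume a: "F \<in> ob ?E" "G \<in> ob ?E" "\<alpha> \<in> mor ?E F G" "\<beta> \<in> mor ?E F G"
  then have F: "linear_functor C D F" "linear_functor C D G" by auto
  note n = nat_transD[OF a(3)[unfolded functor_cat_simps]] nat_transD[OF a(4)[unfolded functor_cat_simps]]
  note Fs = Fd[OF F(1)] Fd[OF F(2)]
  show "madd ?E F G \<alpha> \<beta> \<in> mor ?E F G" unfolding functor_cat_simps
   by (rule nat_transI) (use Fs n in "auto simp: D.madd_mor D.cmp_madd_left D.cmp_madd_right")
 next
  fix F G assume a: "F \<in> ob ?E" "G \<in> ob ?E"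
  then have F: "linear_functor C D F" "linear_functor C D G" by auto
  note Fs = Fd[OF F(1)] Fd[OF F(2)]
  show "mzero ?E F G \<in> mor ?E F G" unfolding functor_cat_simps
   by (rule nat_transI) (use Fs in "auto simp: D.mzero_mor D.cmp_mzero_left D.cmp_mzero_right")
 next
  fix F G \<alpha> c assume a: "F \<in> ob ?E" "G \<in> ob ?E" "\<alpha> \<in> mor ?E F G"
  then have F: "linear_functor C D F" "linear_functor C D G" by auto
  note n = nat_transD[OF a(3)[unfolded functor_cat_simps]]
  note Fs = Fd[OF F(1)] Fd[OF F(2)]
  show "mscale ?E F G c \<alpha> \<in> mor ?E F G" unfolding functor_cat_simps
   by (rule nat_transI) (use Fs n in "auto simp: D.mscale_mor D.cmp_mscale_left D.cmp_mscale_right")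
 next
  fix F G H K f g h assume "F \<in> ob ?E" "G \<in> ob ?E" "H \<in> ob ?E" "K \<in> ob ?E" "f \<in> mor ?E F G" "g \<in> mor ?E G H" "h \<in> mor ?E H K"
  then show "cmp ?E F G K (cmp ?E G H K h g) f = cmp ?E F H K h (cmp ?E F G H g f)"
   by (auto simp: fun_eq_iff restrict_def Fd nat_transD D.cmp_assoc)
 next
  fix F G f assume a: "F \<in> ob ?E" "G \<in> ob ?E" "f \<in> mor ?E F G"
  then have f: "f = restrict f (ob C)" by (simp add: extensional_restrict nat_transD(1))
  have X: "fob F X \<in> ob D" "fob G X \<in> ob D" "f X \<in> mor D (fob F X) (fob G X)" if "X \<in> ob C" for X
   using a that by (auto simp: Fd nat_transD)
  show "cmp ?E F G G (idm ?E G) f = f" "cmp ?E F F G f (idm ?E F) = f"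
   "madd ?E F G (mzero ?E F G) f = f" "mscale ?E F G 1 f = f"
   by (subst (2) f, simp add: X D.idm_cmp D.cmp_idm D.mzero_madd D.mscale_one cong: restrict_cong)+
  show "mscale ?E F G 0 f = mzero ?E F G" by (simp add: X D.mscale_zero cong: restrict_cong)
  fix c d
  show "mscale ?E F G (c * d) f = mscale ?E F G c (mscale ?E F G d f)"
   "mscale ?E F G (c + d) f = madd ?E F G (mscale ?E F G c f) (mscale ?E F G d f)"
   by (simp_all add: X D.mscale_mscale D.mscale_add cong: restrict_cong)
 next
  fix F G f g assume a: "F \<in> ob ?E" "G \<in> ob ?E" "f \<in> mor ?E F G" "g \<in> mor ?E F G"
  have X: "fob F X \<in> ob D" "fob G X \<in> ob D" "f X \<in> mor D (fob F X) (fob G X)" "g X \<in> mor D (fob F X) (fob G X)" if "X \<in> ob C" for X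
   using a that by (auto simp: Fd nat_transD)
  show "madd ?E F G f g = madd ?E F G g f" using X D.madd_comm by (auto intro!: restrict_ext)
  fix c
  show "mscale ?E F G c (madd ?E F G f g) = madd ?E F G (mscale ?E F G c f) (mscale ?E F G c g)"
   by (simp add: X D.mscale_madd cong: restrict_cong)
  fix h assume h: "h \<in> mor ?E F G"
  have "h X \<in> mor D (fob F X) (fob G X)" if "X \<in> ob C" for X
   using h that by (auto simp: nat_transD)
  then show "madd ?E F G (madd ?E F G f g) h = madd ?E F G f (madd ?E F G g h)"
   by (simp add: X D.madd_assoc cong: restrict_cong)
 next
  fix F G H f g g' assume a: "F \<in> ob ?E" "G \<in> ob ?E" "H \<in> ob ?E" "f \<in> mor ?E F G" "g \<in> mor ?E G H" "g' \<in> mor ?E G H"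
  then show "cmp ?E F G H (madd ?E G H g g') f = madd ?E F H (cmp ?E F G H g f) (cmp ?E F G H g' f)"
   by (auto simp: fun_eq_iff restrict_def Fd nat_transD D.cmp_madd_left)
 next
  fix F G H f f' g assume a: "F \<in> ob ?E" "G \<in> ob ?E" "H \<in> ob ?E" "f \<in> mor ?E F G" "f' \<in> mor ?E F G" "g \<in> mor ?E G H"
  then show "cmp ?E F G H g (madd ?E F G f f') = madd ?E F H (cmp ?E F G H g f) (cmp ?E F G H g f')"
   by (auto simp: fun_eq_iff restrict_def Fd nat_transD D.cmp_madd_right)
 next
  fix F G H f g c assume a: "F \<in> ob ?E" "G \<in> ob ?E" "H \<in> ob ?E" "f \<in> mor ?E F G" "g \<in> mor ?E G H"
  then show "cmp ?E F G H (mscale ?E G H c g) f = mscale ?E F H c (cmp ?E F G H g f)"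
   "cmp ?E F G H g (mscale ?E F G c f) = mscale ?E F H c (cmp ?E F G H g f)"
   by (auto simp: fun_eq_iff restrict_def Fd nat_transD D.cmp_mscale_left D.cmp_mscale_right)
 qed
qed

lemma (in lin_cat) is_biproduct_pairI:
 assumes "pair_data C X Y B i j p q"
 shows "is_biproduct C [X, Y] B"
proof -
 note a = assms[unfolded pair_data_def]
 let ?i = "%k::nat. if k = 0 then i else j" and ?p = "%k::nat. if k = 0 then p else q"
 have "msum C B B (%k. cmp C B ([X, Y] ! k) B (?i k) (?p k)) {0, 1} = idm C B"
  using a by (subst msum_pair) (auto simp: cmp_mor)
 then have "biprod_data C 2 (%k. [X, Y] ! k) B ?i ?p"
  using a by (auto simp: biprod_data_def lessThan_Suc numeral_2_eq_2 less_Suc_eq insert_commute)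
 then show ?thesis using is_biproduct_iff[of "[X, Y]"] by (auto simp: numeral_2_eq_2)
qed

text \<open>Objects of \<open>functor_cat\<close> are required to take default values outside
  \<open>C\<close>; functors made by \<open>mk_functor\<close> do.\<close>

lemma mk_functor_idem: "mk_functor C (fob (mk_functor C fo fm)) (fmor (mk_functor C fo fm)) = mk_functor C fo fm"
 by (simp add: mk_functor_def restrict_def fun_eq_iff)

locale additive_cat = lin_cat +
 assumes zero_exists: "\<exists>Z\<in>ob C. idm C Z = mzero C Z Z"
  and biproduct_exists: "X \<in> ob C ==> Y \<in> ob C ==> \<exists>B. is_biproduct C [X, Y] B"
begin

lemma biproduct_list_exists: "set Ys \<subseteq> ob C ==> \<exists>B. is_biproduct C Ys B"
proof (induction Ys)
 case Nil
 then show ?case using zero_exists is_biproduct_Nil by blast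
next
 case (Cons Y Ys)
 then obtain B where B: "is_biproduct C Ys B" by auto
 then obtain D where "is_biproduct C [Y, B] D" using biproduct_exists[of Y B] Cons by (auto simp: is_biproduct_def)
 then have "is_biproduct C ([Y] @ Ys) D" using Cons B by (intro is_biproduct_append[OF is_biproduct_single B]) auto
 then show ?case by auto
qed

end

text \<open>Direct sums are chosen object by object, and a morphism \<open>f\<close> acts as the
  diagonal \<open>i (F f) p + j (G f) q\<close>.\<close>

lemma additive_functor_cat:
 assumes "lin_cat C" "additive_cat D" shows "additive_cat (functor_cat C D)"
proof -
 interpret C: lin_cat C by fact
 interpret D: additive_cat D by fact
 let ?E = "functor_cat C D"
 interpret E: lin_cat ?E by (rule lin_cat_functor_cat) unfold_locales
 show ?thesis
 proof unfold_locales
  obtain Z where Z: "Z \<in> ob D" "idm D Z = mzero D Z Z" using D.zero_exists by blast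
  let ?Z = "mk_functor C (%_. Z) (%_ _ _. idm D Z)"
  have id: "cmp D Z Z Z (idm D Z) (idm D Z) = idm D Z" "madd D Z Z (idm D Z) (idm D Z) = idm D Z"
   "mscale D Z Z c (idm D Z) = idm D Z" for c
   using Z D.idm_cmp[of Z Z "idm D Z"] D.mzero_madd[of Z Z "mzero D Z Z"] D.mscale_mscale[of Z Z "mzero D Z Z" c 0]
   by (auto simp: D.idm_mor D.mzero_mor D.mscale_zero)
  have "linear_functor C D ?Z"
   by (rule linear_functorI)
    (simp_all add: Z(1) id D.idm_mor C.cmp_mor C.idm_mor C.madd_mor C.mscale_mor)
  then have "?Z \<in> ob ?E" by (simp add: mk_functor_idem)
  moreover have "idm ?E ?Z = mzero ?E ?Z ?Z" using Z(2) by (simp cong: restrict_cong)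
  ultimately show "\<exists>Z\<in>ob ?E. idm ?E Z = mzero ?E Z Z" by blast
 next
  fix F G assume FG: "F \<in> ob ?E" "G \<in> ob ?E"
  then have F: "linear_functor C D F" and G: "linear_functor C D G" by auto
  note Fd = linear_functorD[OF F] and Gd = linear_functorD[OF G]
  have "\<exists>B i j p q. pair_data D (fob F X) (fob G X) B i j p q" if X: "X \<in> ob C" for X
  proof -
   obtain B where "is_biproduct D [fob F X, fob G X] B" using D.biproduct_exists[OF Fd(1)[OF X] Gd(1)[OF X]] ..
   from D.is_biproduct_pairE[OF this] show ?thesis by blast
  qed
  then obtain B i j p q where *: "!!X. X \<in> ob C ==> pair_data D (fob F X) (fob G X) (B X) (i X) (j X) (p X) (q X)"
   by metis
  note b = *[unfolded pair_data_def, THEN conjunct2, THEN conjunct2]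
  note b = b[THEN conjunct1] b[THEN conjunct2, THEN conjunct1] b[THEN conjunct2, THEN conjunct2, THEN conjunct1]
   b[THEN conjunct2, THEN conjunct2, THEN conjunct2, THEN conjunct1]
   b[THEN conjunct2, THEN conjunct2, THEN conjunct2, THEN conjunct2, THEN conjunct1]
   and e = b[THEN conjunct2, THEN conjunct2, THEN conjunct2, THEN conjunct2, THEN conjunct2]
  note e = e[THEN conjunct1] e[THEN conjunct2, THEN conjunct1] e[THEN conjunct2, THEN conjunct2, THEN conjunct1]
   e[THEN conjunct2, THEN conjunct2, THEN conjunct2, THEN conjunct1] e[THEN conjunct2, THEN conjunct2, THEN conjunct2, THEN conjunct2]
  define hF where "hF X Y f = cmp D (B X) (fob F Y) (B Y) (i Y) (cmp D (B X) (fob F X) (fob F Y) (fmor F X Y f) (p X))" for X Y f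
  define hG where "hG X Y f = cmp D (B X) (fob G Y) (B Y) (j Y) (cmp D (B X) (fob G X) (fob G Y) (fmor G X Y f) (q X))" for X Y f
  define H where "H = mk_functor C B (%X Y f. madd D (B X) (B Y) (hF X Y f) (hG X Y f))"
  have Ho: "fob H X = B X" if "X \<in> ob C" for X using that by (simp add: H_def)
  have Hm: "fmor H X Y f = madd D (B X) (B Y) (hF X Y f) (hG X Y f)" if "X \<in> ob C" "Y \<in> ob C" "f \<in> mor C X Y" for X Y f
   using that by (simp add: H_def)
  note mors = D.cmp_mor D.idm_mor D.madd_mor D.mscale_mor D.mzero_mor b Fd(1,3) Gd(1,3)
  have hm: "hF X Y f \<in> mor D (B X) (B Y)" "hG X Y f \<in> mor D (B X) (B Y)" if "X \<in> ob C" "Y \<in> ob C" "f \<in> mor C X Y" for X Y f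
   using that by (simp_all add: hF_def hG_def mors)
  have pH: "cmp D (B X) (B Y) (fob F Y) (p Y) (fmor H X Y f) = cmp D (B X) (fob F X) (fob F Y) (fmor F X Y f) (p X)"
   "cmp D (B X) (B Y) (fob G Y) (q Y) (fmor H X Y f) = cmp D (B X) (fob G X) (fob G Y) (fmor G X Y f) (q X)"
   if "X \<in> ob C" "Y \<in> ob C" "f \<in> mor C X Y" for X Y f
   using that by (simp_all add: Hm hF_def hG_def D.cmp_madd_right mors e D.cmp_assoc[symmetric] D.idm_cmp D.cmp_mzero_left
    D.madd_mzero D.mzero_madd)
  have iH: "cmp D (fob F X) (B X) (B Y) (fmor H X Y f) (i X) = cmp D (fob F X) (fob F Y) (B Y) (i Y) (fmor F X Y f)"
   "cmp D (fob G X) (B X) (B Y) (fmor H X Y f) (j X) = cmp D (fob G X) (fob G Y) (B Y) (j Y) (fmor G X Y f)"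
   if "X \<in> ob C" "Y \<in> ob C" "f \<in> mor C X Y" for X Y f
   using that by (simp_all add: Hm hF_def hG_def D.cmp_madd_left mors e D.cmp_assoc D.cmp_idm D.cmp_mzero_right
    D.madd_mzero D.mzero_madd)
  have Hmor: "fmor H X Y f \<in> mor D (B X) (B Y)" if "X \<in> ob C" "Y \<in> ob C" "f \<in> mor C X Y" for X Y f
   using that by (simp add: Hm hm mors)
  have split: "u = madd D A (B X) (cmp D A (fob F X) (B X) (i X) (cmp D A (B X) (fob F X) (p X) u))
     (cmp D A (fob G X) (B X) (j X) (cmp D A (B X) (fob G X) (q X) u))"
   if "X \<in> ob C" "A \<in> ob D" "u \<in> mor D A (B X)" for X A u
  proof -
   have "u = cmp D A (B X) (B X) (idm D (B X)) u" using that by (simp add: D.idm_cmp mors)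
   also have "... = cmp D A (B X) (B X) (madd D (B X) (B X) (cmp D (B X) (fob F X) (B X) (i X) (p X)) (cmp D (B X) (fob G X) (B X) (j X) (q X))) u"
    using that by (simp add: e)
   also have "... = madd D A (B X) (cmp D A (fob F X) (B X) (i X) (cmp D A (B X) (fob F X) (p X) u))
     (cmp D A (fob G X) (B X) (j X) (cmp D A (B X) (fob G X) (q X) u))"
    using that by (simp add: D.cmp_madd_left D.cmp_assoc mors)
   finally show ?thesis .
  qed
  \<comment> \<open>A morphism into \<open>B X\<close> is determined by its composites with
    \<open>p\<close> and \<open>q\<close>, and \<open>pH\<close> computes these; functoriality of
    \<open>H\<close> thus reduces to that of \<open>F\<close> and \<open>G\<close>.\<close>
  have eqI: "u = v" if "X \<in> ob C" "A \<in> ob D" "u \<in> mor D A (B X)" "v \<in> mor D A (B X)"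
   "cmp D A (B X) (fob F X) (p X) u = cmp D A (B X) (fob F X) (p X) v"
   "cmp D A (B X) (fob G X) (q X) u = cmp D A (B X) (fob G X) (q X) v" for X A u v
   using split[OF that(1,2,3)] split[OF that(1,2,4)] that(5,6) by simp
  have H: "linear_functor C D H"
  proof (rule linear_functorI)
   fix X assume X: "X \<in> ob C"
   then show "fob H X \<in> ob D" by (simp add: Ho mors)
   show "fmor H X X (idm C X) = idm D (fob H X)" unfolding Ho[OF X]
    by (rule eqI[OF X, of "B X"])
     (use X in "simp_all add: mors Hmor C.idm_mor pH Fd(2) Gd(2) D.idm_cmp D.cmp_idm")
  next
   fix X Y f assume "X \<in> ob C" "Y \<in> ob C" "f \<in> mor C X Y"
   then show "fmor H X Y f \<in> mor D (fob H X) (fob H Y)" by (simp add: Ho Hmor)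
  next
   fix X Y Z f g assume a: "X \<in> ob C" "Y \<in> ob C" "Z \<in> ob C" "f \<in> mor C X Y" "g \<in> mor C Y Z"
   show "fmor H X Z (cmp C X Y Z g f) = cmp D (fob H X) (fob H Y) (fob H Z) (fmor H Y Z g) (fmor H X Y f)"
    unfolding Ho[OF a(1)] Ho[OF a(2)] Ho[OF a(3)]
    by (rule eqI[OF a(3), of "B X"])
     (use a in "simp_all add: mors Hmor C.cmp_mor pH Fd(4) Gd(4) D.cmp_assoc,
      simp_all add: mors Hmor pH D.cmp_assoc[symmetric],
      simp_all add: mors Hmor pH D.cmp_assoc")
  next
   fix X Y f g assume a: "X \<in> ob C" "Y \<in> ob C" "f \<in> mor C X Y" "g \<in> mor C X Y"
   show "fmor H X Y (madd C X Y f g) = madd D (fob H X) (fob H Y) (fmor H X Y f) (fmor H X Y g)"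
    unfolding Ho[OF a(1)] Ho[OF a(2)]
    by (rule eqI[OF a(2), of "B X"])
     (use a in "simp_all add: mors Hmor C.madd_mor pH Fd(5) Gd(5) D.cmp_madd_left D.cmp_madd_right")
  next
   fix X Y c f assume a: "X \<in> ob C" "Y \<in> ob C" "f \<in> mor C X Y"
   show "fmor H X Y (mscale C X Y c f) = mscale D (fob H X) (fob H Y) c (fmor H X Y f)"
    unfolding Ho[OF a(1)] Ho[OF a(2)]
    by (rule eqI[OF a(2), of "B X"])
     (use a in "simp_all add: mors Hmor C.mscale_mor pH Fd(6) Gd(6) D.cmp_mscale_left D.cmp_mscale_right")
  qed
  have HE: "H \<in> ob ?E" using H by (simp add: H_def mk_functor_idem)
  have "is_biproduct ?E [F, G] H"
  proof (rule E.is_biproduct_pairI)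
   have "restrict i (ob C) \<in> mor ?E F H" "restrict j (ob C) \<in> mor ?E G H"
    "restrict p (ob C) \<in> mor ?E H F" "restrict q (ob C) \<in> mor ?E H G"
    unfolding functor_cat_simps by (auto intro!: nat_transI simp: Ho b iH pH)
   then show "pair_data ?E F G H (restrict i (ob C)) (restrict j (ob C)) (restrict p (ob C)) (restrict q (ob C))"
    unfolding pair_data_def using FG HE e by (simp add: Ho fun_eq_iff restrict_def)
  qed
  then show "\<exists>B. is_biproduct ?E [F, G] B" by blast
 qed
qed


section \<open>The category of finitely generated modules\<close>

lemma mod_cat_simps [simp]:
 "M \<in> ob (mod_cat R) \<longleftrightarrow> left_module R M \<and> fin_gen R M" "mor (mod_cat R) = mod_hom R"
 "cmp (mod_cat R) L M N g f = compose (carrier L) g f"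
 "idm (mod_cat R) M = (\<lambda>x\<in>carrier M. x)"
 "madd (mod_cat R) M N f g = (\<lambda>x\<in>carrier M. f x \<oplus>\<^bsub>N\<^esub> g x)"
 "mzero (mod_cat R) M N = (\<lambda>x\<in>carrier M. \<zero>\<^bsub>N\<^esub>)"
 "mscale (mod_cat R) M N c f = (\<lambda>x\<in>carrier M. (c \<odot>\<^bsub>R\<^esub> \<one>\<^bsub>R\<^esub>) \<odot>\<^bsub>N\<^esub> f x)"
 by (simp_all add: mod_cat_def)

context kalg begin

lemma mod_hom_madd:
 assumes "left_module R M" "left_module R N" "f \<in> mod_hom R M N" "g \<in> mod_hom R M N"
 shows "(\<lambda>x\<in>carrier M. f x \<oplus>\<^bsub>N\<^esub> g x) \<in> mod_hom R M N"
proof -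
 interpret M: lmod R M using assms by (simp add: lmod_iff)
 interpret N: lmod R N using assms by (simp add: lmod_iff)
 note f = mod_homD(1-3)[OF assms(3)] mod_homD(1-3)[OF assms(4)]
 show ?thesis
  by (rule mod_homI) (simp_all add: f N.smult_add N.M.a_ac)
qed

lemma mod_hom_mscale:
 assumes "left_module R M" "left_module R N" "f \<in> mod_hom R M N"
 shows "(\<lambda>x\<in>carrier M. (c \<odot> \<one>) \<odot>\<^bsub>N\<^esub> f x) \<in> mod_hom R M N"
proof -
 interpret M: lmod R M using assms by (simp add: lmod_iff)
 interpret N: lmod R N using assms by (simp add: lmod_iff)
 note f = mod_homD(1-3)[OF assms(3)]
 show ?thesis
  by (rule mod_homI) (simp_all add: f N.smult_add N.mult_smult[symmetric] sc_mult mult_sc)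
qed

lemma mod_hom_mzero:
 assumes "left_module R M" "left_module R N"
 shows "(\<lambda>x\<in>carrier M. \<zero>\<^bsub>N\<^esub>) \<in> mod_hom R M N"
proof -
 interpret M: lmod R M using assms by (simp add: lmod_iff)
 interpret N: lmod R N using assms by (simp add: lmod_iff)
 show ?thesis by (rule mod_homI) simp_all
qed

lemma mod_hom_id:
 assumes "left_module R M"
 shows "(\<lambda>x\<in>carrier M. x) \<in> mod_hom R M M"
proof -
 interpret M: lmod R M using assms by (simp add: lmod_iff)
 show ?thesis by (rule mod_homI) simp_all
qed

lemma lin_cat_mod_cat: "lin_cat (mod_cat R)"
proof (unfold_locales; unfold mod_cat_simps; (elim conjE)?)
 fix L M N :: "('k, 'r) smod" and f g assume "left_module R L" "f \<in> mod_hom R L M" "g \<in> mod_hom R M N"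
 then show "compose (carrier L) g f \<in> mod_hom R L N" by (intro mod_hom_compose)
next
 fix M :: "('k, 'r) smod" assume "left_module R M"
 then show "(\<lambda>x\<in>carrier M. x) \<in> mod_hom R M M" by (rule mod_hom_id)
next
 fix M N :: "('k, 'r) smod" assume M: "left_module R M" and N: "left_module R N"
 interpret N: lmod R N using N by (simp add: lmod_iff)
 show "(\<lambda>x\<in>carrier M. \<zero>\<^bsub>N\<^esub>) \<in> mod_hom R M N" using M N by (rule mod_hom_mzero)
 fix f assume f: "f \<in> mod_hom R M N"
 note fc = mod_homD(1)[OF f]
 show "compose (carrier M) (\<lambda>x\<in>carrier N. x) f = f" "compose (carrier M) f (\<lambda>x\<in>carrier M. x) = f"
  using fc by (auto intro!: extensionalityI[OF _ mod_homD(4)[OF f]] simp: compose_def)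
 show "(\<lambda>x\<in>carrier M. (\<lambda>x\<in>carrier M. \<zero>\<^bsub>N\<^esub>) x \<oplus>\<^bsub>N\<^esub> f x) = f" "(\<lambda>x\<in>carrier M. (1 \<odot> \<one>) \<odot>\<^bsub>N\<^esub> f x) = f"
  using fc by (auto intro!: extensionalityI[OF _ mod_homD(4)[OF f]] simp: sc_one)
 show "(\<lambda>x\<in>carrier M. (0 \<odot> \<one>) \<odot>\<^bsub>N\<^esub> f x) = (\<lambda>x\<in>carrier M. \<zero>\<^bsub>N\<^esub>)"
  using fc kvec.zero_smult[of \<one>] by (auto intro!: restrict_ext)
 fix c show "(\<lambda>x\<in>carrier M. (c \<odot> \<one>) \<odot>\<^bsub>N\<^esub> f x) \<in> mod_hom R M N" using M N f by (rule mod_hom_mscale)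
 fix d show "(\<lambda>x\<in>carrier M. ((c * d) \<odot> \<one>) \<odot>\<^bsub>N\<^esub> f x) = (\<lambda>x\<in>carrier M. (c \<odot> \<one>) \<odot>\<^bsub>N\<^esub> (\<lambda>x\<in>carrier M. (d \<odot> \<one>) \<odot>\<^bsub>N\<^esub> f x) x)"
  "(\<lambda>x\<in>carrier M. ((c + d) \<odot> \<one>) \<odot>\<^bsub>N\<^esub> f x) = (\<lambda>x\<in>carrier M. (\<lambda>x\<in>carrier M. (c \<odot> \<one>) \<odot>\<^bsub>N\<^esub> f x) x \<oplus>\<^bsub>N\<^esub> (\<lambda>x\<in>carrier M. (d \<odot> \<one>) \<odot>\<^bsub>N\<^esub> f x) x)"
  using fc by (auto intro!: restrict_ext simp: sc_sc sc_add N.mult_smult N.add_smult)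
 fix g assume g: "g \<in> mod_hom R M N"
 note gc = mod_homD(1)[OF g]
 show "(\<lambda>x\<in>carrier M. f x \<oplus>\<^bsub>N\<^esub> g x) \<in> mod_hom R M N" using M N f g by (rule mod_hom_madd)
 show "(\<lambda>x\<in>carrier M. f x \<oplus>\<^bsub>N\<^esub> g x) = (\<lambda>x\<in>carrier M. g x \<oplus>\<^bsub>N\<^esub> f x)"
  "(\<lambda>x\<in>carrier M. (c \<odot> \<one>) \<odot>\<^bsub>N\<^esub> (\<lambda>x\<in>carrier M. f x \<oplus>\<^bsub>N\<^esub> g x) x) =
   (\<lambda>x\<in>carrier M. (\<lambda>x\<in>carrier M. (c \<odot> \<one>) \<odot>\<^bsub>N\<^esub> f x) x \<oplus>\<^bsub>N\<^esub> (\<lambda>x\<in>carrier M. (c \<odot> \<one>) \<odot>\<^bsub>N\<^esub> g x) x)"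
  using fc gc by (auto intro!: restrict_ext simp: N.M.a_comm N.smult_add)
 fix h assume h: "h \<in> mod_hom R M N"
 show "(\<lambda>x\<in>carrier M. (\<lambda>x\<in>carrier M. f x \<oplus>\<^bsub>N\<^esub> g x) x \<oplus>\<^bsub>N\<^esub> h x) = (\<lambda>x\<in>carrier M. f x \<oplus>\<^bsub>N\<^esub> (\<lambda>x\<in>carrier M. g x \<oplus>\<^bsub>N\<^esub> h x) x)"
  using fc gc mod_homD(1)[OF h] by (auto intro!: restrict_ext simp: N.M.a_assoc)
next
 fix K L M N :: "('k, 'r) smod" and f g h assume "f \<in> mod_hom R K L"
 then show "compose (carrier K) (compose (carrier L) h g) f = compose (carrier K) h (compose (carrier K) g f)"
  by (auto simp: compose_def mod_homD(1) intro!: restrict_ext)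
next
 fix L M N :: "('k, 'r) smod" and f f' g g' assume a: "left_module R N" "left_module R M" "f \<in> mod_hom R L M" "g \<in> mod_hom R M N"
 interpret N: lmod R N using a by (simp add: lmod_iff)
 interpret M: lmod R M using a by (simp add: lmod_iff)
 note fc = mod_homD(1)[OF a(3)] and gc = mod_homD(1-3)[OF a(4)]
 show "compose (carrier L) (\<lambda>x\<in>carrier M. g x \<oplus>\<^bsub>N\<^esub> g' x) f = (\<lambda>x\<in>carrier L. compose (carrier L) g f x \<oplus>\<^bsub>N\<^esub> compose (carrier L) g' f x)"
  using fc by (auto simp: compose_def intro!: restrict_ext)
 fix c
 show "compose (carrier L) (\<lambda>x\<in>carrier M. (c \<odot> \<one>) \<odot>\<^bsub>N\<^esub> g x) f = (\<lambda>x\<in>carrier L. (c \<odot> \<one>) \<odot>\<^bsub>N\<^esub> compose (carrier L) g f x)"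
  "compose (carrier L) g (\<lambda>x\<in>carrier L. (c \<odot> \<one>) \<odot>\<^bsub>M\<^esub> f x) = (\<lambda>x\<in>carrier L. (c \<odot> \<one>) \<odot>\<^bsub>N\<^esub> compose (carrier L) g f x)"
  using fc gc by (auto simp: compose_def intro!: restrict_ext)
 assume f': "f' \<in> mod_hom R L M"
 show "compose (carrier L) g (\<lambda>x\<in>carrier L. f x \<oplus>\<^bsub>M\<^esub> f' x) = (\<lambda>x\<in>carrier L. compose (carrier L) g f x \<oplus>\<^bsub>N\<^esub> compose (carrier L) g f' x)"
  using fc gc mod_homD(1)[OF f'] by (auto simp: compose_def intro!: restrict_ext)
qed

end

definition prod_module :: "('r, 'u) module => ('r, 'w) module => ('r, 'u \<times> 'w) module" where
 "prod_module M N = \<lparr>carrier = carrier M \<times> carrier N, monoid.mult = undefined, monoid.one = undefined,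
   ring.zero = (\<zero>\<^bsub>M\<^esub>, \<zero>\<^bsub>N\<^esub>), ring.add = (%(x, y) (x', y'). (x \<oplus>\<^bsub>M\<^esub> x', y \<oplus>\<^bsub>N\<^esub> y')),
   module.smult = (%r (x, y). (r \<odot>\<^bsub>M\<^esub> x, r \<odot>\<^bsub>N\<^esub> y))\<rparr>"

lemma prod_module_simps [simp]:
 "carrier (prod_module M N) = carrier M \<times> carrier N" "\<zero>\<^bsub>prod_module M N\<^esub> = (\<zero>\<^bsub>M\<^esub>, \<zero>\<^bsub>N\<^esub>)"
 "(x, y) \<oplus>\<^bsub>prod_module M N\<^esub> (x', y') = (x \<oplus>\<^bsub>M\<^esub> x', y \<oplus>\<^bsub>N\<^esub> y')"
 "r \<odot>\<^bsub>prod_module M N\<^esub> (x, y) = (r \<odot>\<^bsub>M\<^esub> x, r \<odot>\<^bsub>N\<^esub> y)"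
 by (simp_all add: prod_module_def)

lemma left_module_prod:
 assumes "left_module R M" "left_module R N" shows "left_module R (prod_module M N)"
proof -
 interpret M: lmod R M using assms by (simp add: lmod_iff)
 interpret N: lmod R N using assms by (simp add: lmod_iff)
 have "abelian_group (prod_module M N)"
 proof (rule abelian_groupI)
  fix x assume "x \<in> carrier (prod_module M N)"
  then show "\<exists>y\<in>carrier (prod_module M N). y \<oplus>\<^bsub>prod_module M N\<^esub> x = \<zero>\<^bsub>prod_module M N\<^esub>"
   by (intro bexI[of _ "(\<ominus>\<^bsub>M\<^esub> fst x, \<ominus>\<^bsub>N\<^esub> snd x)"]) (auto simp: M.M.l_neg N.M.l_neg)
 qed (auto simp: M.M.a_ac N.M.a_ac)
 then show ?thesis unfolding lmod_iff
  by (intro lmod.intro lmod_axioms.intro M.R.ring_axioms)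
   (auto simp: M.add_smult N.add_smult M.smult_add N.smult_add M.mult_smult N.mult_smult)
qed

text \<open>Generators are placed on the two axes. The part of a submodule \<open>U\<close> on each
  axis is a submodule of the factor, and every pair is a sum of two axis elements.\<close>

lemma fin_gen_prod:
 assumes "left_module R M" "left_module R N" "fin_gen R M" "fin_gen R N"
 shows "fin_gen R (prod_module M N)"
proof -
 interpret M: lmod R M using assms by (simp add: lmod_iff)
 interpret N: lmod R N using assms by (simp add: lmod_iff)
 interpret P: lmod R "prod_module M N" using assms left_module_prod by (simp add: lmod_iff)
 obtain S where S: "finite S" "S \<subseteq> carrier M"
   "!!U. lsubmodule R M U ==> S \<subseteq> U ==> carrier M \<subseteq> U"
  using assms(3) unfolding M.fin_gen_iff by blast
 obtain T where T: "finite T" "T \<subseteq> carrier N"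
   "!!U. lsubmodule R N U ==> T \<subseteq> U ==> carrier N \<subseteq> U"
  using assms(4) unfolding N.fin_gen_iff by blast
 let ?A = "(%x. (x, \<zero>\<^bsub>N\<^esub>)) ` S \<union> (%y. (\<zero>\<^bsub>M\<^esub>, y)) ` T"
 have "carrier (prod_module M N) \<subseteq> U" if U: "lsubmodule R (prod_module M N) U" "?A \<subseteq> U" for U
 proof -
  have u: "!!p q. p \<in> U ==> q \<in> U ==> p \<oplus>\<^bsub>prod_module M N\<^esub> q \<in> U" "(\<zero>\<^bsub>M\<^esub>, \<zero>\<^bsub>N\<^esub>) \<in> U"
   "!!r p. r \<in> carrier R ==> p \<in> U ==> r \<odot>\<^bsub>prod_module M N\<^esub> p \<in> U" using U(1) by (auto simp: lsubmodule_def)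
  have "lsubmodule R M {x \<in> carrier M. (x, \<zero>\<^bsub>N\<^esub>) \<in> U}"
   using u(2) u(1)[of "(x, \<zero>\<^bsub>N\<^esub>)" "(y, \<zero>\<^bsub>N\<^esub>)" for x y] u(3)[of r "(x, \<zero>\<^bsub>N\<^esub>)" for r x]
   by (auto simp: lsubmodule_def)
  then have 1: "carrier M \<subseteq> {x \<in> carrier M. (x, \<zero>\<^bsub>N\<^esub>) \<in> U}" by (rule S(3)) (use S(2) U(2) in auto)
  have "lsubmodule R N {y \<in> carrier N. (\<zero>\<^bsub>M\<^esub>, y) \<in> U}"
   using u(2) u(1)[of "(\<zero>\<^bsub>M\<^esub>, x)" "(\<zero>\<^bsub>M\<^esub>, y)" for x y] u(3)[of r "(\<zero>\<^bsub>M\<^esub>, x)" for r x]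
   by (auto simp: lsubmodule_def)
  then have 2: "carrier N \<subseteq> {y \<in> carrier N. (\<zero>\<^bsub>M\<^esub>, y) \<in> U}" by (rule T(3)) (use T(2) U(2) in auto)
  show ?thesis
  proof
   fix p assume "p \<in> carrier (prod_module M N)"
   then obtain x y where p: "p = (x, y)" "x \<in> carrier M" "y \<in> carrier N" by auto
   then have "(x, \<zero>\<^bsub>N\<^esub>) \<oplus>\<^bsub>prod_module M N\<^esub> (\<zero>\<^bsub>M\<^esub>, y) \<in> U" using 1 2 by (intro u(1)) auto
   then show "p \<in> U" using p by simp
  qed
 qed
 then show ?thesis unfolding P.fin_gen_iff using S(1,2) T(1,2)
  by (intro exI[of _ ?A]) auto
qed

text \<open>Pairs do not fit into the carrier type of \<open>mod_cat\<close>, so the direct sum is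
  the small copy of \<open>prod_module\<close>, with structure maps conjugated by
  \<open>small_iso\<close>. The zero module is carried by the zero function.\<close>

lemma (in fd_kalg) additive_cat_mod_cat: "additive_cat (mod_cat R)"
proof -
 interpret lc: lin_cat "mod_cat R" by (rule lin_cat_mod_cat)
 show ?thesis
 proof
  let ?z = "%_::nat. 0::'k"
  define Z :: "('k, 'r) smod" where "Z = \<lparr>carrier = {?z}, monoid.mult = undefined, monoid.one = undefined,
   ring.zero = ?z, ring.add = (%_ _. ?z), module.smult = (%_ _. ?z)\<rparr>"
  have "abelian_group Z" by (rule abelian_groupI) (auto simp: Z_def)
  then have Z: "left_module R Z" unfolding lmod_iff
   by (intro lmod.intro lmod_axioms.intro ring_axioms) (auto simp: Z_def)
  then interpret Z: lmod R Z by (simp add: lmod_iff)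
  have "fin_gen R Z" unfolding Z.fin_gen_iff
   by (rule exI[of _ "{}"]) (auto simp: lsubmodule_def Z_def)
  then show "\<exists>Z\<in>ob (mod_cat R). idm (mod_cat R) Z = mzero (mod_cat R) Z Z"
   using Z by (intro bexI[of _ Z]) (auto simp: Z_def intro!: restrict_ext)
 next
  fix M N :: "('k, 'r) smod" assume "M \<in> ob (mod_cat R)" "N \<in> ob (mod_cat R)"
  then have MN: "left_module R M" "left_module R N" "fin_gen R M" "fin_gen R N" by auto
  interpret M: lmod R M using MN by (simp add: lmod_iff)
  interpret N: lmod R N using MN by (simp add: lmod_iff)
  let ?T = "prod_module M N"
  have T: "fgmod R ?T" using MN by (simp add: fgmod_def left_module_prod fin_gen_prod)
  then have TL: "left_module R ?T" by (simp add: fgmod_def)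
  let ?B = "small_copy R ?T"
  let ?e = "small_iso R ?T"
  define d where "d = (\<lambda>y\<in>carrier ?B. inv_into (carrier ?T) ?e y)"
  have d: "d \<in> mod_hom R ?B ?T"
   unfolding d_def using T TL by (intro mod_iso_hom mod_iso_inverse small_iso_iso)
  have de: "d (?e x) = x" if "x \<in> carrier ?T" for x
   using that T by (simp add: d_def small_iso_inv small_iso_closed del: prod_module_simps)
  have ed: "?e (d y) = y" "d y \<in> carrier ?T" if "y \<in> carrier ?B" for y
   using that small_iso_bij[OF T] by (auto simp: d_def bij_betw_def f_inv_into_f inv_into_into simp del: prod_module_simps)
  have e: "?e \<in> mod_hom R ?T ?B" using T by (rule small_iso_hom)
  note eD = mod_homD(1-3)[OF e]
  define i where "i = (\<lambda>x\<in>carrier M. (x, \<zero>\<^bsub>N\<^esub>))"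
  define j where "j = (\<lambda>y\<in>carrier N. (\<zero>\<^bsub>M\<^esub>, y))"
  define p where "p = (\<lambda>z\<in>carrier ?T. fst z)"
  define q where "q = (\<lambda>z\<in>carrier ?T. snd z)"
  have m: "i \<in> mod_hom R M ?T" "j \<in> mod_hom R N ?T" "p \<in> mod_hom R ?T M" "q \<in> mod_hom R ?T N"
   by (auto simp: i_def j_def p_def q_def intro!: mod_homI)
  have "is_biproduct (mod_cat R) [M, N] ?B"
  proof (rule lc.is_biproduct_pairI, unfold pair_data_def, intro conjI)
   show "M \<in> ob (mod_cat R)" "N \<in> ob (mod_cat R)" using MN by auto
   show B: "?B \<in> ob (mod_cat R)" by (rule small_copy_ob[OF T])
   show "compose (carrier M) ?e i \<in> mor (mod_cat R) M ?B" "compose (carrier N) ?e j \<in> mor (mod_cat R) N ?B"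
    "compose (carrier ?B) p d \<in> mor (mod_cat R) ?B M" "compose (carrier ?B) q d \<in> mor (mod_cat R) ?B N"
    using MN B m d e by (auto intro: mod_hom_compose)
   show "cmp (mod_cat R) M ?B M (compose (carrier ?B) p d) (compose (carrier M) ?e i) = idm (mod_cat R) M"
    "cmp (mod_cat R) N ?B N (compose (carrier ?B) q d) (compose (carrier N) ?e j) = idm (mod_cat R) N"
    "cmp (mod_cat R) M ?B N (compose (carrier ?B) q d) (compose (carrier M) ?e i) = mzero (mod_cat R) M N"
    "cmp (mod_cat R) N ?B M (compose (carrier ?B) p d) (compose (carrier N) ?e j) = mzero (mod_cat R) N M"
    using eD(1) by (auto simp: compose_def i_def j_def de p_def q_def intro!: restrict_ext)
   have "?e (x, \<zero>\<^bsub>N\<^esub>) \<oplus>\<^bsub>?B\<^esub> ?e (\<zero>\<^bsub>M\<^esub>, y) = ?e (x, y)" if "x \<in> carrier M" "y \<in> carrier N" for x y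
    using that by (subst eD(2)[symmetric]) auto
   then show "madd (mod_cat R) ?B ?B (cmp (mod_cat R) ?B M ?B (compose (carrier M) ?e i) (compose (carrier ?B) p d))
    (cmp (mod_cat R) ?B N ?B (compose (carrier N) ?e j) (compose (carrier ?B) q d)) = idm (mod_cat R) ?B"
    using ed by (force simp: compose_def i_def j_def p_def q_def intro!: restrict_ext)
  qed
  then show "\<exists>B. is_biproduct (mod_cat R) [M, N] B" by blast
 qed
qed

section \<open>Tensoring with ideals and transformations between projection functors\<close>

section \<open>Tensor products\<close>

abbreviation "keys \<equiv> Poly_Mapping.keys"
abbreviation "lookup \<equiv> Poly_Mapping.lookup"

locale tensor_product = M: lmod R M for R :: "('r, 'm) ring_scheme" and M :: "('r, 'u) module" +
 fixes I assumes I: "ideal I R"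
begin

sublocale I: ideal I R by (rule I)

abbreviation "F \<equiv> free_Abelian_group (I \<times> carrier M)"
abbreviation "K \<equiv> generate F (tensor_rels R I M)"
abbreviation "T \<equiv> tensor R I M"
abbreviation "cls \<equiv> tensor_class R I M"

text \<open>The elementary tensor of \<open>x\<close> and \<open>m\<close>.\<close>

definition tens :: "'r => 'u => (('r \<times> 'u) \<Rightarrow>\<^sub>0 int) set" where
 "tens x m = cls (frag_of (x, m))"

lemma rels_subset: "tensor_rels R I M \<subseteq> carrier F"
proof
 fix c assume c: "c \<in> tensor_rels R I M"
 have d: "keys (a - b) \<subseteq> S" if "keys a \<subseteq> S" "keys b \<subseteq> S"
  for a b :: "('r \<times> 'u) \<Rightarrow>\<^sub>0 int" and S
  using that keys_diff[of a b] by blast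
 from c have "keys c \<subseteq> I \<times> carrier M"
  unfolding tensor_rels_def
  by (elim UnE CollectE exE conjE; simp only:; intro d) (simp_all add: I.I_r_closed)
 then show "c \<in> carrier F" by simp
qed

lemma normal_K: "normal K F"
proof -
 interpret F: comm_group F by (rule abelian_free_Abelian_group)
 show ?thesis using rels_subset F.generate_is_subgroup by (intro F.subgroup_imp_normal) auto
qed

lemma mem_K_carrier: "c \<in> K ==> keys c \<subseteq> I \<times> carrier M"
proof -
 interpret F: comm_group F by (rule abelian_free_Abelian_group)
 assume "c \<in> K" then have "c \<in> carrier F" using rels_subset F.generate_in_carrier by blast
 then show ?thesis by simp
qed

lemma K_0: "0 \<in> K" using generate.one[of F] by simp

lemma K_add: "a \<in> K ==> b \<in> K ==> a + b \<in> K" using generate.eng[of a F] by simp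

lemma K_uminus: "a \<in> K ==> - a \<in> K"
proof -
 interpret N: normal K F by (rule normal_K)
 assume "a \<in> K" then show ?thesis using N.m_inv_closed[of a] mem_K_carrier[of a] by simp
qed

lemma K_rel: "a \<in> tensor_rels R I M ==> a \<in> K" by (rule generate.incl)

lemma cls_eq: "cls a = {k + a | k. k \<in> K}"
 by (auto simp: tensor_class_def r_coset_def)

lemma mem_cls: "c \<in> cls a \<longleftrightarrow> c - a \<in> K"
 unfolding cls_eq by (auto intro: exI[of _ "c - a"])

lemma cls_eq_iff: "cls a = cls b \<longleftrightarrow> a - b \<in> K"
proof
 assume "cls a = cls b"
 then show "a - b \<in> K" using mem_cls[of a a] mem_cls[of a b] K_0 by simp
next
 assume ab: "a - b \<in> K"
 have "c - a \<in> K \<longleftrightarrow> c - b \<in> K" for c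
  using K_add[OF ab, of "c - a"] K_add[OF K_uminus[OF ab], of "c - b"] by (auto simp: algebra_simps)
 then show "cls a = cls b" by (auto simp: mem_cls)
qed

lemma carrier_T: "carrier T = cls ` {c. keys c \<subseteq> I \<times> carrier M}"
proof -
 have "carrier T = carrier (F Mod K)" by (simp add: tensor_def Let_def)
 also have "... = (%x. K #>\<^bsub>F\<^esub> x) ` carrier F" by (rule carrier_FactGroup)
 also have "(%x. K #>\<^bsub>F\<^esub> x) = cls" by (simp add: tensor_class_def fun_eq_iff)
 also have "carrier F = {c. keys c \<subseteq> I \<times> carrier M}" by (rule Set.set_eqI) simp
 finally show ?thesis .
qed

lemma zero_T: "\<zero>\<^bsub>T\<^esub> = cls 0"
proof -
 have "\<zero>\<^bsub>T\<^esub> = K" by (simp add: tensor_def Let_def)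
 also have "K = cls 0" by (rule Set.set_eqI) (simp add: mem_cls)
 finally show ?thesis .
qed

lemma add_T: assumes "keys a \<subseteq> I \<times> carrier M" "keys b \<subseteq> I \<times> carrier M"
 shows "cls a \<oplus>\<^bsub>T\<^esub> cls b = cls (a + b)"
proof -
 interpret N: normal K F by (rule normal_K)
 have "cls a \<oplus>\<^bsub>T\<^esub> cls b = cls a <#>\<^bsub>F\<^esub> cls b" by (simp add: tensor_def Let_def)
 then show ?thesis using N.rcos_sum[of a b] assms by (simp add: tensor_class_def)
qed

lemma keys_add_sub: "keys a \<subseteq> S ==> keys b \<subseteq> S ==> keys (a + b) \<subseteq> S"
 for a b :: "'z \<Rightarrow>\<^sub>0 int"
 using Poly_Mapping.keys_add[of a b] by blast

lemma abelian_group_T: "abelian_group T"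
proof (rule abelian_groupI; unfold carrier_T zero_T)
 fix x assume "x \<in> cls ` {c. keys c \<subseteq> I \<times> carrier M}"
 then obtain c where "x = cls c" "keys c \<subseteq> I \<times> carrier M" by blast
 then show "\<exists>y\<in>cls ` {c. keys c \<subseteq> I \<times> carrier M}. y \<oplus>\<^bsub>T\<^esub> x = cls 0"
  by (intro bexI[of _ "cls (- c)"]) (auto simp: add_T)
qed (auto simp: add_T keys_add_sub algebra_simps)

lemma tens_closed [simp, intro]: "x \<in> I ==> m \<in> carrier M ==> tens x m \<in> carrier T"
 unfolding tens_def carrier_T by (intro imageI) simp

lemma tens_add_left: assumes "x \<in> I" "y \<in> I" "m \<in> carrier M"
 shows "tens (x \<oplus>\<^bsub>R\<^esub> y) m = tens x m \<oplus>\<^bsub>T\<^esub> tens y m"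
proof -
 have "frag_of (x \<oplus>\<^bsub>R\<^esub> y, m) - frag_of (x, m) - frag_of (y, m) \<in> K"
  by (rule K_rel) (use assms in "auto simp: tensor_rels_def")
 then show ?thesis unfolding tens_def using assms
  by (subst add_T) (auto simp: cls_eq_iff algebra_simps)
qed

lemma tens_add_right: assumes "x \<in> I" "m \<in> carrier M" "n \<in> carrier M"
 shows "tens x (m \<oplus>\<^bsub>M\<^esub> n) = tens x m \<oplus>\<^bsub>T\<^esub> tens x n"
proof -
 have "frag_of (x, m \<oplus>\<^bsub>M\<^esub> n) - frag_of (x, m) - frag_of (x, n) \<in> K"
  by (rule K_rel) (use assms in "auto simp: tensor_rels_def")
 then show ?thesis unfolding tens_def using assms
  by (subst add_T) (auto simp: cls_eq_iff algebra_simps)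
qed

lemma tens_balanced: assumes "x \<in> I" "r \<in> carrier R" "m \<in> carrier M"
 shows "tens (x \<otimes>\<^bsub>R\<^esub> r) m = tens x (r \<odot>\<^bsub>M\<^esub> m)"
proof -
 have "frag_of (x \<otimes>\<^bsub>R\<^esub> r, m) - frag_of (x, r \<odot>\<^bsub>M\<^esub> m) \<in> K"
  by (rule K_rel) (use assms in "auto simp: tensor_rels_def")
 then show ?thesis unfolding tens_def by (simp add: cls_eq_iff)
qed

lemma tens_zero_left: assumes "m \<in> carrier M" shows "tens \<zero>\<^bsub>R\<^esub> m = \<zero>\<^bsub>T\<^esub>"
proof -
 interpret T: abelian_group T by (rule abelian_group_T)
 have "tens \<zero>\<^bsub>R\<^esub> m \<oplus>\<^bsub>T\<^esub> tens \<zero>\<^bsub>R\<^esub> m = tens \<zero>\<^bsub>R\<^esub> m"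
  using tens_add_left[of "\<zero>\<^bsub>R\<^esub>" "\<zero>\<^bsub>R\<^esub>" m] assms I.zero_closed by simp
 then show ?thesis using assms I.zero_closed by (metis T.add.l_cancel_one tens_closed)
qed

text \<open>Both sides are the negative of \<open>tens x m\<close>. Hence inverses of generators are
  elementary tensors again, and the induction principle below has no case for negatives.\<close>

lemma tens_neg: assumes "x \<in> I" "m \<in> carrier M" shows "tens (\<ominus>\<^bsub>R\<^esub> x) m = cls (- frag_of (x, m))"
proof -
 interpret T: abelian_group T by (rule abelian_group_T)
 have xR: "x \<in> carrier R" "\<ominus>\<^bsub>R\<^esub> x \<in> I" using assms I.a_subset I.a_inv_closed by auto
 have "tens (\<ominus>\<^bsub>R\<^esub> x) m \<oplus>\<^bsub>T\<^esub> tens x m = \<zero>\<^bsub>T\<^esub>"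
  using tens_add_left[of "\<ominus>\<^bsub>R\<^esub> x" x m] assms xR tens_zero_left by (simp add: M.R.l_neg)
 moreover have "cls (- frag_of (x, m)) \<oplus>\<^bsub>T\<^esub> tens x m = \<zero>\<^bsub>T\<^esub>"
  unfolding tens_def using assms by (subst add_T) (auto simp: zero_T)
 moreover have "cls (- frag_of (x, m)) \<in> carrier T" using assms by (auto simp: carrier_T)
 ultimately show ?thesis using assms xR T.minus_equality[of "tens (\<ominus>\<^bsub>R\<^esub> x) m" "tens x m"]
   T.minus_equality[of "cls (- frag_of (x, m))" "tens x m"] by simp
qed

lemma tensor_induct [consumes 1, case_names zero add tens]:
 assumes "t \<in> carrier T" "P \<zero>\<^bsub>T\<^esub>"
  "!!s t. s \<in> carrier T ==> t \<in> carrier T ==> P s ==> P t ==> P (s \<oplus>\<^bsub>T\<^esub> t)"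
  "!!x m. x \<in> I ==> m \<in> carrier M ==> P (tens x m)"
 shows "P t"
proof -
 \<comment> \<open>The free abelian group is built up by differences, so the claim for
   \<open>c\<close> has to be accompanied by the one for \<open>- c\<close>.\<close>
 have "P (cls c) \<and> P (cls (- c))" if "keys c \<subseteq> I \<times> carrier M" for c
  using that
 proof (induction c rule: free_Abelian_group_induct[consumes 1, case_names zero diff single])
  case zero then show ?case using assms(2) by (simp add: zero_T)
 next
  case (diff a b)
  then have ca: "cls a \<in> carrier T" "cls (- a) \<in> carrier T" "cls b \<in> carrier T" "cls (- b) \<in> carrier T"
   by (auto simp: carrier_T)
  have "cls (a - b) = cls a \<oplus>\<^bsub>T\<^esub> cls (- b)" using diff(1,2) by (subst add_T) auto
  moreover have "cls (- (a - b)) = cls b \<oplus>\<^bsub>T\<^esub> cls (- a)" using diff(1,2) by (subst add_T) auto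
  ultimately show ?case using assms(3) diff ca by simp
 next
  case (single p)
  then obtain x m where p: "p = (x, m)" "x \<in> I" "m \<in> carrier M" by auto
  then have "P (tens x m)" "P (tens (\<ominus>\<^bsub>R\<^esub> x) m)" using assms(4) I.a_inv_closed by auto
  then show ?case using p tens_neg by (simp add: tens_def)
 qed
 then show ?thesis using assms(1) by (auto simp: carrier_T)
qed

text \<open>The values at zero agree because zero is an elementary tensor. \<open>ad\<close> may be
  any binary operation, so the target need not be known to be a group yet.\<close>

lemma tensor_ext:
 assumes "!!x m. x \<in> I ==> m \<in> carrier M ==> f (tens x m) = g (tens x m)"
  and "!!s t. s \<in> carrier T ==> t \<in> carrier T ==> f (s \<oplus>\<^bsub>T\<^esub> t) = ad (f s) (f t)"
  and "!!s t. s \<in> carrier T ==> t \<in> carrier T ==> g (s \<oplus>\<^bsub>T\<^esub> t) = ad (g s) (g t)"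
  and "t \<in> carrier T"
 shows "f t = g t"
proof -
 interpret T: abelian_group T by (rule abelian_group_T)
 show ?thesis using assms(4)
 proof (induction t rule: tensor_induct)
  case zero
  have "\<zero>\<^bsub>T\<^esub> = tens \<zero>\<^bsub>R\<^esub> \<zero>\<^bsub>M\<^esub>" by (simp add: tens_zero_left)
  then show ?case using assms(1)[of "\<zero>\<^bsub>R\<^esub>" "\<zero>\<^bsub>M\<^esub>"] I.zero_closed by simp
 qed (use assms in auto)
qed

text \<open>Universal property. The extension of \<open>b\<close> to the free abelian group kills
  the three families of relations by \<open>l\<close>, \<open>r\<close> and \<open>bal\<close>, and
  so is constant on classes.\<close>

lemma tensor_lift:
 fixes N :: "('b, 'c) ring_scheme"
 assumes N: "abelian_group N"
  and b: "!!x m. x \<in> I ==> m \<in> carrier M ==> b x m \<in> carrier N"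
  and l: "!!x y m. x \<in> I ==> y \<in> I ==> m \<in> carrier M ==> b (x \<oplus>\<^bsub>R\<^esub> y) m = b x m \<oplus>\<^bsub>N\<^esub> b y m"
  and r: "!!x m n. x \<in> I ==> m \<in> carrier M ==> n \<in> carrier M ==> b x (m \<oplus>\<^bsub>M\<^esub> n) = b x m \<oplus>\<^bsub>N\<^esub> b x n"
  and bal: "!!x r m. x \<in> I ==> r \<in> carrier R ==> m \<in> carrier M ==> b (x \<otimes>\<^bsub>R\<^esub> r) m = b x (r \<odot>\<^bsub>M\<^esub> m)"
 shows "\<exists>h. (\<forall>t\<in>carrier T. h t \<in> carrier N) \<and>
  (\<forall>s\<in>carrier T. \<forall>t\<in>carrier T. h (s \<oplus>\<^bsub>T\<^esub> t) = h s \<oplus>\<^bsub>N\<^esub> h t) \<and>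
  (\<forall>x\<in>I. \<forall>m\<in>carrier M. h (tens x m) = b x m)"
proof -
 interpret N: abelian_group N by (rule N)
 interpret Fg: group F by simp
 have "(%(x, m). b x m) ` (I \<times> carrier M) \<subseteq> carrier (add_monoid N)" using b by auto
 from comm_group.free_Abelian_group_universal[OF N.a_comm_group this]
 obtain g where g: "g \<in> hom F (add_monoid N)" "!!p. p \<in> I \<times> carrier M ==> g (frag_of p) = (%(x, m). b x m) p"
  by blast
 have gc: "g c \<in> carrier N" if "keys c \<subseteq> I \<times> carrier M" for c
  using hom_in_carrier[OF g(1), of c] that by simp
 have gadd: "g (c + d) = g c \<oplus>\<^bsub>N\<^esub> g d"
  if "keys c \<subseteq> I \<times> carrier M" "keys d \<subseteq> I \<times> carrier M" for c d
  using hom_mult[OF g(1), of c d] that by simp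
 have g0: "g 0 = \<zero>\<^bsub>N\<^esub>"
 proof -
  have "g 0 \<oplus>\<^bsub>N\<^esub> g 0 = g 0" using gadd[of 0 0] by simp
  then show ?thesis using gc[of 0] by (simp add: N.add.l_cancel_one)
 qed
 have gneg: "g (- c) = \<ominus>\<^bsub>N\<^esub> g c" if "keys c \<subseteq> I \<times> carrier M" for c
  using gadd[of "- c" c] that gc[of c] gc[of "- c"] g0 N.minus_equality[of "g (- c)" "g c"] by simp
 have gdiff: "g (c - d) = g c \<ominus>\<^bsub>N\<^esub> g d"
  if "keys c \<subseteq> I \<times> carrier M" "keys d \<subseteq> I \<times> carrier M" for c d
  using gadd[of c "- d"] gneg[of d] that by (simp add: N.minus_eq)
 have of: "g (frag_of (x, m)) = b x m" if "x \<in> I" "m \<in> carrier M" for x m using g(2) that by auto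
 have kd: "keys (c - d) \<subseteq> I \<times> carrier M"
  if "keys c \<subseteq> I \<times> carrier M" "keys d \<subseteq> I \<times> carrier M" for c d :: "('r \<times> 'u) \<Rightarrow>\<^sub>0 int"
  using that keys_diff[of c d] by blast
 have rel: "g c = \<zero>\<^bsub>N\<^esub>" if "c \<in> tensor_rels R I M" for c
 proof -
  have cancel: "a \<oplus>\<^bsub>N\<^esub> d \<ominus>\<^bsub>N\<^esub> a \<ominus>\<^bsub>N\<^esub> d = \<zero>\<^bsub>N\<^esub>" if "a \<in> carrier N" "d \<in> carrier N" for a d
   using that by (simp add: N.minus_eq N.a_ac N.r_neg) (metis N.a_comm N.r_neg1 N.r_neg N.a_inv_closed N.a_closed)
  have cancel': "a \<ominus>\<^bsub>N\<^esub> a = \<zero>\<^bsub>N\<^esub>" if "a \<in> carrier N" for a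
   using that by (simp add: N.minus_eq N.r_neg)
  from that show ?thesis unfolding tensor_rels_def
  proof (elim UnE CollectE exE conjE)
   fix x y m assume "c = frag_of (x \<oplus>\<^bsub>R\<^esub> y, m) - frag_of (x, m) - frag_of (y, m)" "x \<in> I" "y \<in> I" "m \<in> carrier M"
   then show ?thesis by (simp add: gdiff kd of l b cancel I.a_closed)
  next
   fix x m n assume "c = frag_of (x, m \<oplus>\<^bsub>M\<^esub> n) - frag_of (x, m) - frag_of (x, n)" "x \<in> I" "m \<in> carrier M" "n \<in> carrier M"
   then show ?thesis by (simp add: gdiff kd of r b cancel)
  next
   fix x s m assume "c = frag_of (x \<otimes>\<^bsub>R\<^esub> s, m) - frag_of (x, s \<odot>\<^bsub>M\<^esub> m)" "x \<in> I" "s \<in> carrier R" "m \<in> carrier M"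
   then show ?thesis by (simp add: gdiff kd of bal b cancel' I.I_r_closed)
  qed
 qed
 have gK: "g c = \<zero>\<^bsub>N\<^esub>" if "c \<in> K" for c
  using that
 proof (induction c rule: generate.induct)
  case (inv h)
  then have "keys h \<subseteq> I \<times> carrier M" using subsetD[OF rels_subset] by simp
  then show ?case using rel[OF inv] gneg[of h] by simp
 next
  case (eng h k)
  then show ?case using gadd[of h k] mem_K_carrier by simp
 qed (use g0 rel in auto)
 define h where "h t = g (SOME c. c \<in> t)" for t
 have h: "h (cls c) = g c" if "keys c \<subseteq> I \<times> carrier M" for c
 proof -
  have "c \<in> cls c" using K_0 by (simp add: mem_cls)
  then have "(SOME d. d \<in> cls c) \<in> cls c" by (rule someI)
  then obtain k where k: "k \<in> K" "(SOME d. d \<in> cls c) = k + c" by (auto simp: cls_eq)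
  then show ?thesis using gadd[of k c] gK[of k] that gc[of c] mem_K_carrier[of k] by (simp add: h_def)
 qed
 show ?thesis
 proof (intro exI[of _ h] conjI ballI)
  fix s t assume "s \<in> carrier T" "t \<in> carrier T"
  then show "h s \<in> carrier N" "h (s \<oplus>\<^bsub>T\<^esub> t) = h s \<oplus>\<^bsub>N\<^esub> h t"
   by (auto simp: carrier_T h gc add_T gadd keys_add_sub)
 next
  fix x m assume "x \<in> I" "m \<in> carrier M"
  then show "h (tens x m) = b x m" by (simp add: tens_def h of)
 qed
qed

end

text \<open>
  The action of the ring and the functoriality of the tensor product are defined on
  representatives; this computes both.
\<close>

lemma tensor_class_map:
 assumes T: "tensor_product R M I" and T': "tensor_product R M' I'"
  and h: "!!x m. x \<in> I ==> m \<in> carrier M ==> h x m \<in> I' \<times> carrier M'"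
  and rel: "!!c. c \<in> tensor_rels R I M ==>
   frag_extend (%(x, m). frag_of (h x m)) c \<in> generate (free_Abelian_group (I' \<times> carrier M')) (tensor_rels R I' M')"
  and a: "keys a \<subseteq> I \<times> carrier M"
 shows "(\<Union>c\<in>tensor_class R I M a. tensor_class R I' M' (frag_extend (%(x, m). frag_of (h x m)) c)) =
  tensor_class R I' M' (frag_extend (%(x, m). frag_of (h x m)) a)"
proof -
 interpret T: tensor_product R M I by (rule T)
 interpret T': tensor_product R M' I' by (rule T')
 let ?f = "frag_extend (%(x, m). frag_of (h x m))"
 have K: "?f c \<in> T'.K" if "c \<in> T.K" for c
  using that
 proof (induction c rule: generate.induct)
  case one then show ?case by (simp add: T'.K_0)
 next
  case (inv c)
  then have "keys c \<subseteq> I \<times> carrier M" using subsetD[OF T.rels_subset] by simp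
  then show ?case using rel[OF inv] by (simp add: frag_extend_minus T'.K_uminus)
 next
  case (eng c d)
  then show ?case by (simp add: frag_extend_add T'.K_add)
 qed (rule rel)
 have "T'.cls (?f c) = T'.cls (?f a)" if "c \<in> T.cls a" for c
  using that K[of "c - a"] by (simp add: T.mem_cls T'.cls_eq_iff frag_extend_diff)
 moreover have "a \<in> T.cls a" by (simp add: T.mem_cls T.K_0)
 ultimately show ?thesis by blast
qed

text \<open>The tensor product of \<open>f\<close> and \<open>g\<close> takes each defining relation
  to a defining relation. The scalar action is the case where \<open>f\<close> is left
  multiplication and \<open>g\<close> the identity, functoriality in the module the case where
  \<open>f\<close> is the identity.\<close>

lemma tensor_class_map':
 assumes T: "tensor_product R M I" and T': "tensor_product R M' I'"
  and f: "!!x. x \<in> I ==> f x \<in> I'" "!!x y. x \<in> I ==> y \<in> I ==> f (x \<oplus>\<^bsub>R\<^esub> y) = f x \<oplus>\<^bsub>R\<^esub> f y"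
   "!!x r. x \<in> I ==> r \<in> carrier R ==> f (x \<otimes>\<^bsub>R\<^esub> r) = f x \<otimes>\<^bsub>R\<^esub> r"
  and g: "!!m. m \<in> carrier M ==> g m \<in> carrier M'"
   "!!m n. m \<in> carrier M ==> n \<in> carrier M ==> g (m \<oplus>\<^bsub>M\<^esub> n) = g m \<oplus>\<^bsub>M'\<^esub> g n"
   "!!m r. m \<in> carrier M ==> r \<in> carrier R ==> g (r \<odot>\<^bsub>M\<^esub> m) = r \<odot>\<^bsub>M'\<^esub> g m"
  and a: "keys a \<subseteq> I \<times> carrier M"
 shows "(\<Union>c\<in>tensor_class R I M a. tensor_class R I' M' (frag_extend (%(x, m). frag_of (f x, g m)) c)) =
  tensor_class R I' M' (frag_extend (%(x, m). frag_of (f x, g m)) a)"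
proof -
 interpret T: tensor_product R M I by (rule T)
 interpret T': tensor_product R M' I' by (rule T')
 let ?f = "frag_extend (%(x, m). frag_of (f x, g m))"
 let ?S = "{frag_of (x \<oplus>\<^bsub>R\<^esub> y, m) - frag_of (x, m) - frag_of (y, m) |x y m. x \<in> I' \<and> y \<in> I' \<and> m \<in> carrier M'} \<union>
    {frag_of (x, m \<oplus>\<^bsub>M'\<^esub> n) - frag_of (x, m) - frag_of (x, n) |x m n. x \<in> I' \<and> m \<in> carrier M' \<and> n \<in> carrier M'} \<union>
    {frag_of (x \<otimes>\<^bsub>R\<^esub> r, m) - frag_of (x, r \<odot>\<^bsub>M'\<^esub> m) |x r m. x \<in> I' \<and> r \<in> carrier R \<and> m \<in> carrier M'}"
 show ?thesis
 proof (rule tensor_class_map[OF T T' _ _ a])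
  fix c assume "c \<in> tensor_rels R I M"
  then have "?f c \<in> tensor_rels R I' M'"
   unfolding tensor_rels_def
  proof (elim UnE CollectE exE conjE)
   fix x y m assume "c = frag_of (x \<oplus>\<^bsub>R\<^esub> y, m) - frag_of (x, m) - frag_of (y, m)" "x \<in> I" "y \<in> I" "m \<in> carrier M"
   then show "?f c \<in> ?S"
    by (intro UnI1 CollectI exI[of _ "f x"] exI[of _ "f y"] exI[of _ "g m"])
     (simp add: frag_extend_diff f g)
  next
   fix x m n assume "c = frag_of (x, m \<oplus>\<^bsub>M\<^esub> n) - frag_of (x, m) - frag_of (x, n)" "x \<in> I" "m \<in> carrier M" "n \<in> carrier M"
   then show "?f c \<in> ?S"
    by (intro UnI1 UnI2 CollectI exI[of _ "f x"] exI[of _ "g m"] exI[of _ "g n"])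
     (simp add: frag_extend_diff f g)
  next
   fix x s m assume "c = frag_of (x \<otimes>\<^bsub>R\<^esub> s, m) - frag_of (x, s \<odot>\<^bsub>M\<^esub> m)" "x \<in> I" "s \<in> carrier R" "m \<in> carrier M"
   then show "?f c \<in> ?S"
    by (intro UnI2 CollectI exI[of _ "f x"] exI[of _ s] exI[of _ "g m"])
     (simp add: frag_extend_diff f g)
  qed
  then show "?f c \<in> T'.K" by (rule T'.K_rel)
 qed (use f g in auto)
qed

section \<open>The left module structure of the tensor product\<close>

context tensor_product begin

lemma smult_T:
 assumes r: "r \<in> carrier R" and a: "keys a \<subseteq> I \<times> carrier M"
 shows "r \<odot>\<^bsub>T\<^esub> cls a = cls (frag_extend (%(x, m). frag_of (r \<otimes>\<^bsub>R\<^esub> x, m)) a)"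
proof -
 have "r \<odot>\<^bsub>T\<^esub> cls a = (\<Union>c\<in>cls a. cls (frag_extend (%(x, m). frag_of (r \<otimes>\<^bsub>R\<^esub> x, m)) c))"
  by (simp add: tensor_def Let_def)
 also have "... = cls (frag_extend (%(x, m). frag_of (r \<otimes>\<^bsub>R\<^esub> x, m)) a)"
  by (rule tensor_class_map'[OF tensor_product_axioms tensor_product_axioms _ _ _ _ _ _ a])
   (use r I.I_l_closed I.a_subset in "auto simp: M.R.r_distr subset_iff M.R.m_assoc")
 finally show ?thesis .
qed

lemma smult_tens:
 "r \<in> carrier R ==> x \<in> I ==> m \<in> carrier M ==> r \<odot>\<^bsub>T\<^esub> tens x m = tens (r \<otimes>\<^bsub>R\<^esub> x) m"
 unfolding tens_def by (subst smult_T) auto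

lemma keys_frag_extend_sub:
 assumes "!!x m. x \<in> I ==> m \<in> carrier M ==> h x m \<in> S" "keys a \<subseteq> I \<times> carrier M"
 shows "keys (frag_extend (%(x, m). frag_of (h x m)) a) \<subseteq> S"
 using keys_frag_extend[of "%(x, m). frag_of (h x m)" a] assms by (auto 4 3)

lemma smult_T_closed: "r \<in> carrier R ==> t \<in> carrier T ==> r \<odot>\<^bsub>T\<^esub> t \<in> carrier T"
proof -
 assume r: "r \<in> carrier R" and "t \<in> carrier T"
 then obtain a where a: "t = cls a" "keys a \<subseteq> I \<times> carrier M" by (auto simp: carrier_T)
 have "keys (frag_extend (%(x, m). frag_of (r \<otimes>\<^bsub>R\<^esub> x, m)) a) \<subseteq> I \<times> carrier M"
  by (rule keys_frag_extend_sub[OF _ a(2)]) (use r in "simp add: I.I_l_closed")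
 then show ?thesis using r a by (simp add: smult_T carrier_T)
qed

lemma smult_T_add: "r \<in> carrier R ==> s \<in> carrier T ==> t \<in> carrier T ==>
  r \<odot>\<^bsub>T\<^esub> (s \<oplus>\<^bsub>T\<^esub> t) = r \<odot>\<^bsub>T\<^esub> s \<oplus>\<^bsub>T\<^esub> r \<odot>\<^bsub>T\<^esub> t"
 by (auto simp: carrier_T add_T smult_T keys_add_sub keys_frag_extend_sub I.I_l_closed frag_extend_add)

lemma left_module_T: "left_module R T"
proof -
 interpret T: abelian_group T by (rule abelian_group_T)
 have IR: "x \<in> I ==> x \<in> carrier R" for x using I.a_subset by blast
 have "lmod_axioms R T"
 proof
  fix r s t assume a: "r \<in> carrier R" "s \<in> carrier R" and t: "t \<in> carrier T"
  show "r \<odot>\<^bsub>T\<^esub> t \<in> carrier T" using a t by (simp add: smult_T_closed)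
  show "(r \<oplus>\<^bsub>R\<^esub> s) \<odot>\<^bsub>T\<^esub> t = r \<odot>\<^bsub>T\<^esub> t \<oplus>\<^bsub>T\<^esub> s \<odot>\<^bsub>T\<^esub> t"
   by (rule tensor_ext[where ad = "ring.add T"])
    (use a t in "simp_all add: smult_tens M.R.l_distr IR tens_add_left I.I_l_closed smult_T_add smult_T_closed T.a_ac")
  show "(r \<otimes>\<^bsub>R\<^esub> s) \<odot>\<^bsub>T\<^esub> t = r \<odot>\<^bsub>T\<^esub> (s \<odot>\<^bsub>T\<^esub> t)"
   by (rule tensor_ext[where ad = "ring.add T"])
    (use a t in "simp_all add: smult_tens M.R.m_assoc IR I.I_l_closed smult_T_add smult_T_closed")
 next
  fix t assume t: "t \<in> carrier T"
  show "\<one>\<^bsub>R\<^esub> \<odot>\<^bsub>T\<^esub> t = t"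
   by (rule tensor_ext[where ad = "ring.add T"])
    (use t in "simp_all add: smult_tens IR smult_T_add")
 qed (simp add: smult_T_add)
 then show ?thesis by (simp add: lmod_iff lmod_def M.R.ring_axioms abelian_group_T)
qed

lemma lmod_T: "lmod R T" using left_module_T by (simp add: lmod_iff)

lemma mod_hom_T_eqI:
 assumes "f \<in> mod_hom R T N" "g \<in> mod_hom R T N"
  "!!x m. x \<in> I ==> m \<in> carrier M ==> f (tens x m) = g (tens x m)"
 shows "f = g"
proof (rule mod_hom_eqI[OF assms(1,2)])
 fix t assume "t \<in> carrier T"
 then show "f t = g t"
  by (rule tensor_ext[where ad = "ring.add N", rotated -1])
   (use assms(3) mod_homD(2)[OF assms(1)] mod_homD(2)[OF assms(2)] in auto)
qed

lemma tensor_lift_hom: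
 assumes N: "left_module R N"
  and b: "!!x m. x \<in> I ==> m \<in> carrier M ==> b x m \<in> carrier N"
  and l: "!!x y m. x \<in> I ==> y \<in> I ==> m \<in> carrier M ==> b (x \<oplus>\<^bsub>R\<^esub> y) m = b x m \<oplus>\<^bsub>N\<^esub> b y m"
  and r: "!!x m n. x \<in> I ==> m \<in> carrier M ==> n \<in> carrier M ==> b x (m \<oplus>\<^bsub>M\<^esub> n) = b x m \<oplus>\<^bsub>N\<^esub> b x n"
  and bal: "!!x r m. x \<in> I ==> r \<in> carrier R ==> m \<in> carrier M ==> b (x \<otimes>\<^bsub>R\<^esub> r) m = b x (r \<odot>\<^bsub>M\<^esub> m)"
  and lin: "!!x r m. x \<in> I ==> r \<in> carrier R ==> m \<in> carrier M ==> b (r \<otimes>\<^bsub>R\<^esub> x) m = r \<odot>\<^bsub>N\<^esub> b x m"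
 shows "\<exists>h \<in> mod_hom R T N. \<forall>x\<in>I. \<forall>m\<in>carrier M. h (tens x m) = b x m"
proof -
 interpret N: lmod R N using N by (simp add: lmod_iff)
 interpret T: lmod R T by (rule lmod_T)
 have "\<exists>h. (\<forall>t\<in>carrier T. h t \<in> carrier N) \<and>
  (\<forall>s\<in>carrier T. \<forall>t\<in>carrier T. h (s \<oplus>\<^bsub>T\<^esub> t) = h s \<oplus>\<^bsub>N\<^esub> h t) \<and>
  (\<forall>x\<in>I. \<forall>m\<in>carrier M. h (tens x m) = b x m)"
  by (rule tensor_lift[OF N.M.abelian_group_axioms]) (simp_all add: b l r bal)
 then obtain h where "(\<forall>t\<in>carrier T. h t \<in> carrier N) \<and>
  (\<forall>s\<in>carrier T. \<forall>t\<in>carrier T. h (s \<oplus>\<^bsub>T\<^esub> t) = h s \<oplus>\<^bsub>N\<^esub> h t) \<and>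
  (\<forall>x\<in>I. \<forall>m\<in>carrier M. h (tens x m) = b x m)" ..
 then have h: "!!t. t \<in> carrier T ==> h t \<in> carrier N"
  "!!s t. s \<in> carrier T ==> t \<in> carrier T ==> h (s \<oplus>\<^bsub>T\<^esub> t) = h s \<oplus>\<^bsub>N\<^esub> h t"
  "!!x m. x \<in> I ==> m \<in> carrier M ==> h (tens x m) = b x m"
  by simp_all
 have sm: "h (s \<odot>\<^bsub>T\<^esub> t) = s \<odot>\<^bsub>N\<^esub> h t" if s: "s \<in> carrier R" and t: "t \<in> carrier T" for s t
  by (rule tensor_ext[where ad = "ring.add N"])
   (use s t in "simp_all add: smult_tens h lin I.I_l_closed T.smult_add N.smult_add")
 show ?thesis
  by (rule bexI[of _ "restrict h (carrier T)"], simp add: h, rule mod_homI) (simp_all add: h sm)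
qed

end

section \<open>Functoriality of the tensor product in the module and in the ideal\<close>

lemma tensor_map_hom:
 assumes T: "tensor_product R M I" and T': "tensor_product R N I" and f: "f \<in> mod_hom R M N"
 shows "tensor_map R I M N f \<in> mod_hom R (tensor R I M) (tensor R I N)"
  and "x \<in> I ==> m \<in> carrier M ==>
   tensor_map R I M N f (tensor_product.tens R M I x m) = tensor_product.tens R N I x (f m)"
proof -
 interpret T: tensor_product R M I by (rule T)
 interpret T': tensor_product R N I by (rule T')
 note fD = mod_homD(1-3)[OF f]
 let ?t = "tensor_map R I M N f"
 have *: "?t (T.cls a) = T'.cls (frag_extend (%(x, m). frag_of (x, f m)) a)"
  if a: "keys a \<subseteq> I \<times> carrier M" for a
 proof -
  have "?t (T.cls a) = (\<Union>c\<in>T.cls a. T'.cls (frag_extend (%(x, m). frag_of (x, f m)) c))"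
   using a by (simp add: tensor_map_def T.carrier_T)
  also have "... = T'.cls (frag_extend (%(x, m). frag_of (x, f m)) a)"
   by (rule tensor_class_map'[OF T T', where f = "%x. x"]) (use fD a in auto)
  finally show ?thesis .
 qed
 have tens: "?t (T.tens x m) = T'.tens x (f m)" if "x \<in> I" "m \<in> carrier M" for x m
  unfolding T.tens_def T'.tens_def using that by (subst *) auto
 then show "x \<in> I ==> m \<in> carrier M ==> ?t (T.tens x m) = T'.tens x (f m)" by blast
 have kf: "keys (frag_extend (%(x, m). frag_of (x, f m)) a) \<subseteq> I \<times> carrier N"
  if "keys a \<subseteq> I \<times> carrier M" for a
  by (rule T.keys_frag_extend_sub) (use that fD in auto)
 have c: "?t t \<in> carrier T'.T" if "t \<in> carrier T.T" for t
  using that * kf by (auto simp: T.carrier_T T'.carrier_T)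
 have add: "?t (s \<oplus>\<^bsub>T.T\<^esub> t) = ?t s \<oplus>\<^bsub>T'.T\<^esub> ?t t" if "s \<in> carrier T.T" "t \<in> carrier T.T" for s t
  using that kf by (auto simp: T.carrier_T T.add_T T'.add_T * T.keys_add_sub frag_extend_add)
 interpret N: lmod R T'.T by (rule T'.lmod_T)
 have "?t (r \<odot>\<^bsub>T.T\<^esub> t) = r \<odot>\<^bsub>T'.T\<^esub> ?t t" if r: "r \<in> carrier R" and t: "t \<in> carrier T.T" for r t
  by (rule T.tensor_ext[where ad = "ring.add T'.T"])
   (use r t in "simp_all add: T.smult_tens T'.smult_tens tens T.I.I_l_closed fD add c T.smult_T_closed T.smult_T_add N.smult_add")
 then show "?t \<in> mod_hom R T.T T'.T"
  by (intro mod_homI) (simp_all add: c add, simp add: tensor_map_def)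
qed

text \<open>Not extensional, unlike \<open>mod_hom\<close>: values outside \<open>I\<close> are
  unconstrained, and homomorphisms are compared on \<open>I\<close> only.\<close>

definition bimod_hom :: "('r, 'm) ring_scheme => 'r set => 'r set => ('r => 'r) => bool" where
 "bimod_hom R I J f \<longleftrightarrow> (\<forall>x\<in>I. f x \<in> J) \<and> (\<forall>x\<in>I. \<forall>y\<in>I. f (x \<oplus>\<^bsub>R\<^esub> y) = f x \<oplus>\<^bsub>R\<^esub> f y) \<and>
   (\<forall>x\<in>I. \<forall>r\<in>carrier R. f (r \<otimes>\<^bsub>R\<^esub> x) = r \<otimes>\<^bsub>R\<^esub> f x) \<and>
   (\<forall>x\<in>I. \<forall>r\<in>carrier R. f (x \<otimes>\<^bsub>R\<^esub> r) = f x \<otimes>\<^bsub>R\<^esub> r)"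

lemma bimod_homD:
 assumes "bimod_hom R I J f"
 shows "x \<in> I ==> f x \<in> J" "x \<in> I ==> y \<in> I ==> f (x \<oplus>\<^bsub>R\<^esub> y) = f x \<oplus>\<^bsub>R\<^esub> f y"
  "x \<in> I ==> r \<in> carrier R ==> f (r \<otimes>\<^bsub>R\<^esub> x) = r \<otimes>\<^bsub>R\<^esub> f x"
  "x \<in> I ==> r \<in> carrier R ==> f (x \<otimes>\<^bsub>R\<^esub> r) = f x \<otimes>\<^bsub>R\<^esub> r"
 using assms by (auto simp: bimod_hom_def)

text \<open>The map induced by \<open>f\<close> on the ideal factor. It is selected by its values on
  elementary tensors, which determine it, rather than computed on representatives.\<close>

definition bimod_tensor :: "('r, 'm) ring_scheme => 'r set => 'r set => ('r, 'u) module => ('r => 'r) =>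
  (('r \<times> 'u) \<Rightarrow>\<^sub>0 int) set => (('r \<times> 'u) \<Rightarrow>\<^sub>0 int) set" where
 "bimod_tensor R I J M f = (SOME h. h \<in> mod_hom R (tensor R I M) (tensor R J M) \<and>
   (\<forall>x\<in>I. \<forall>m\<in>carrier M. h (tensor_product.tens R M I x m) = tensor_product.tens R M J (f x) m))"

lemma bimod_tensor_hom:
 assumes T: "tensor_product R M I" and T': "tensor_product R M J" and f: "bimod_hom R I J f"
 shows "bimod_tensor R I J M f \<in> mod_hom R (tensor R I M) (tensor R J M)"
  and "x \<in> I ==> m \<in> carrier M ==>
   bimod_tensor R I J M f (tensor_product.tens R M I x m) = tensor_product.tens R M J (f x) m"
proof -
 interpret T: tensor_product R M I by (rule T)
 interpret T': tensor_product R M J by (rule T')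
 note fD = bimod_homD[OF f]
 have "\<exists>h \<in> mod_hom R T.T T'.T. \<forall>x\<in>I. \<forall>m\<in>carrier M. h (T.tens x m) = T'.tens (f x) m"
  by (rule T.tensor_lift_hom[OF T'.left_module_T])
   (simp_all add: fD T'.tens_add_left T'.tens_add_right T'.tens_balanced T'.smult_tens)
 then have "\<exists>h. h \<in> mod_hom R T.T T'.T \<and> (\<forall>x\<in>I. \<forall>m\<in>carrier M. h (T.tens x m) = T'.tens (f x) m)" by blast
 from someI_ex[OF this]
 show "bimod_tensor R I J M f \<in> mod_hom R T.T T'.T"
  "x \<in> I ==> m \<in> carrier M ==> bimod_tensor R I J M f (T.tens x m) = T'.tens (f x) m"
  unfolding bimod_tensor_def by auto
qed

section \<open>Principal left modules\<close>

lemma left_principal_simps [simp]: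
 "carrier (left_principal R e) = {x \<otimes>\<^bsub>R\<^esub> e | x. x \<in> carrier R}"
 "\<zero>\<^bsub>left_principal R e\<^esub> = \<zero>\<^bsub>R\<^esub>" "x \<oplus>\<^bsub>left_principal R e\<^esub> y = x \<oplus>\<^bsub>R\<^esub> y"
 "r \<odot>\<^bsub>left_principal R e\<^esub> x = r \<otimes>\<^bsub>R\<^esub> x"
 by (simp_all add: left_principal_def)

context kalg begin

lemma left_module_left_principal: assumes e: "e \<in> carrier R" shows "left_module R (left_principal R e)"
proof -
 have "abelian_group (left_principal R e)"
 proof (rule abelian_groupI)
  fix x assume "x \<in> carrier (left_principal R e)"
  then obtain a where a: "a \<in> carrier R" "x = a \<otimes> e" by auto
  then show "\<exists>y\<in>carrier (left_principal R e). y \<oplus>\<^bsub>left_principal R e\<^esub> x = \<zero>\<^bsub>left_principal R e\<^esub>"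
   using e by (intro bexI[of _ "(\<ominus> a) \<otimes> e"]) (auto simp: l_neg simp flip: l_distr intro: exI[of _ "\<ominus> a"])
 next
  fix x y assume "x \<in> carrier (left_principal R e)" "y \<in> carrier (left_principal R e)"
  then obtain a b where "a \<in> carrier R" "x = a \<otimes> e" "b \<in> carrier R" "y = b \<otimes> e" by auto
  then show "x \<oplus>\<^bsub>left_principal R e\<^esub> y \<in> carrier (left_principal R e)"
   using e by (auto intro!: exI[of _ "a \<oplus> b"] simp: l_distr)
 next
  show "\<zero>\<^bsub>left_principal R e\<^esub> \<in> carrier (left_principal R e)" using e by (auto intro!: exI[of _ \<zero>])
 qed (use e in "auto simp: a_ac")
 then show ?thesis unfolding lmod_iff
 proof (intro lmod.intro ring_axioms lmod_axioms.intro)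
  fix r x assume "r \<in> carrier R" "x \<in> carrier (left_principal R e)"
  then obtain a where "a \<in> carrier R" "x = a \<otimes> e" by auto
  then show "r \<odot>\<^bsub>left_principal R e\<^esub> x \<in> carrier (left_principal R e)"
   using e \<open>r \<in> carrier R\<close> by (auto intro!: exI[of _ "r \<otimes> a"] simp: m_assoc)
 qed (use e in "auto simp: l_distr r_distr m_assoc")
qed

lemma fgmod_left_principal: assumes e: "e \<in> carrier R" shows "fgmod R (left_principal R e)"
proof -
 interpret P: lmod R "left_principal R e" using left_module_left_principal[OF e] by (simp add: lmod_iff)
 have "fin_gen R (left_principal R e)" unfolding P.fin_gen_iff
 proof (intro exI[of _ "{e}"] conjI allI impI)
  show "{e} \<subseteq> carrier (left_principal R e)" using e by (auto intro!: exI[of _ \<one>])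
  fix N assume "lsubmodule R (left_principal R e) N" "{e} \<subseteq> N"
  then show "carrier (left_principal R e) \<subseteq> N" by (auto simp: lsubmodule_def)
 qed simp
 then show ?thesis by (simp add: fgmod_def left_module_left_principal e)
qed

lemma carrier_left_principal_one: "carrier (left_principal R \<one>) = carrier R"
 by auto (metis r_one)

end

section \<open>Projection functors\<close>

context fd_kalg begin

lemma small_mor_compose:
 assumes "fgmod R T" "fgmod R T'" "f \<in> mod_hom R T T'"
 shows "compose (carrier (small_copy R T)) (small_mor R T' T'' g) (small_mor R T T' f) =
  small_mor R T T'' (compose (carrier T) g f)"
 by (rule small_copy_eqI[OF assms(1)])
  (use assms mod_homD(1)[OF assms(3)] in "simp_all add: small_mor_apply small_mor_ext compose_def small_iso_closed")

lemma small_mor_id: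
 assumes "fgmod R T"
 shows "small_mor R T T (\<lambda>x\<in>carrier T. x) = (\<lambda>x\<in>carrier (small_copy R T). x)"
 by (rule small_copy_eqI[OF assms]) (use assms in "simp_all add: small_mor_apply small_mor_ext small_iso_closed")

lemma small_mor_add:
 assumes "fgmod R T" "fgmod R T'" "f \<in> mod_hom R T T'" "g \<in> mod_hom R T T'"
 shows "small_mor R T T' (\<lambda>x\<in>carrier T. f x \<oplus>\<^bsub>T'\<^esub> g x) =
  (\<lambda>x\<in>carrier (small_copy R T). small_mor R T T' f x \<oplus>\<^bsub>small_copy R T'\<^esub> small_mor R T T' g x)"
 by (rule small_copy_eqI[OF assms(1)])
  (use assms mod_homD(1)[OF assms(3)] mod_homD(1)[OF assms(4)] mod_homD(2)[OF small_iso_hom[OF assms(2)]]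
   in "simp_all add: small_mor_apply small_mor_ext small_iso_closed")

lemma small_mor_scale:
 assumes "fgmod R T" "fgmod R T'" "f \<in> mod_hom R T T'"
 shows "small_mor R T T' (\<lambda>x\<in>carrier T. (c \<odot> \<one>) \<odot>\<^bsub>T'\<^esub> f x) =
  (\<lambda>x\<in>carrier (small_copy R T). (c \<odot> \<one>) \<odot>\<^bsub>small_copy R T'\<^esub> small_mor R T T' f x)"
 by (rule small_copy_eqI[OF assms(1)])
  (use assms mod_homD(1)[OF assms(3)] mod_homD(3)[OF small_iso_hom[OF assms(2)]]
   in "simp_all add: small_mor_apply small_mor_ext small_iso_closed")

lemma small_mor_zero:
 assumes "fgmod R T" "fgmod R T'"
 shows "small_mor R T T' (\<lambda>x\<in>carrier T. \<zero>\<^bsub>T'\<^esub>) = (\<lambda>x\<in>carrier (small_copy R T). \<zero>\<^bsub>small_copy R T'\<^esub>)"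
 by (rule small_copy_eqI[OF assms(1)])
  (use assms mod_hom_zero[OF _ _ small_iso_hom[OF assms(2)]] small_copy_module[OF assms(2)]
   in "simp_all add: small_mor_apply small_mor_ext small_iso_closed fgmod_def")

end

text \<open>Finite dimensional ideals keep the tensor products finitely generated, so that
  \<open>Dp\<close> is a functor into \<open>mod_cat\<close>. For incidence algebras the basis
  vectors in an ideal provide the spanning set.\<close>

locale fd_kalg_ideals = fd_kalg R for R :: "('k::field, 'r) module" (structure) +
 assumes ideal_span: "ideal I R ==> \<exists>B. finite B \<and> B \<subseteq> I \<and>
  (\<forall>N. lsubmodule field_ring R N --> B \<subseteq> N --> I \<subseteq> N)"
begin

lemma tensor_productI: "left_module R M ==> ideal I R ==> tensor_product R M I"
 by (simp add: tensor_product_def tensor_product_axioms_def lmod_iff)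

text \<open>Tensors of a spanning set of \<open>I\<close> with generators of \<open>M\<close>
  suffice: for fixed \<open>s\<close> the \<open>x\<close> with \<open>tens x s\<close> in a
  submodule \<open>U\<close> form a subspace, and by balancedness the \<open>m\<close> with all
  \<open>tens x m\<close> in \<open>U\<close> form a submodule of \<open>M\<close>.\<close>

lemma fgmod_tensor:
 assumes I: "ideal I R" and M: "left_module R M" "fin_gen R M"
 shows "fgmod R (tensor R I M)"
proof -
 interpret T: tensor_product R M I using I M by (intro tensor_productI)
 interpret TM: lmod R T.T by (rule T.lmod_T)
 have IR: "x \<in> I ==> x \<in> carrier R" for x using T.I.a_subset by blast
 obtain B where B: "finite B" "B \<subseteq> I" "!!N. lsubmodule field_ring R N ==> B \<subseteq> N ==> I \<subseteq> N"
  using ideal_span[OF I] by blast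
 obtain S where S: "finite S" "S \<subseteq> carrier M" "!!N. lsubmodule R M N ==> S \<subseteq> N ==> carrier M \<subseteq> N"
  using M(2) unfolding T.M.fin_gen_iff by blast
 let ?A = "(%(b, s). T.tens b s) ` (B \<times> S)"
 have "carrier T.T \<subseteq> U" if U: "lsubmodule R T.T U" "?A \<subseteq> U" for U
 proof -
  have u: "\<zero>\<^bsub>T.T\<^esub> \<in> U" "!!x y. x \<in> U ==> y \<in> U ==> x \<oplus>\<^bsub>T.T\<^esub> y \<in> U"
   "!!r x. r \<in> carrier R ==> x \<in> U ==> r \<odot>\<^bsub>T.T\<^esub> x \<in> U" using U(1) by (auto simp: lsubmodule_def)
  have 1: "T.tens x s \<in> U" if s: "s \<in> S" and x: "x \<in> I" for x s
  proof -
   have sM: "s \<in> carrier M" using s S(2) by blast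
   have cI: "c \<odot> x \<in> I" if "x \<in> I" for c x
    using T.I.I_l_closed[OF that, of "c \<odot> \<one>"] IR[OF that] by (simp add: sc_mult)
   have ct: "T.tens (c \<odot> x) s = (c \<odot> \<one>) \<odot>\<^bsub>T.T\<^esub> T.tens x s" if "x \<in> I" for c x
    using that sM IR by (simp add: T.smult_tens sc_mult)
   have "lsubmodule field_ring R {x \<in> I. T.tens x s \<in> U}"
    unfolding lsubmodule_def using u sM IR cI T.I.zero_closed T.I.a_closed
    by (auto simp: T.tens_zero_left T.tens_add_left ct)
   then have "I \<subseteq> {x \<in> I. T.tens x s \<in> U}" by (rule B(3)) (use B(2) s U(2) in auto)
   then show ?thesis using x by blast
  qed
  have t0: "T.tens x \<zero>\<^bsub>M\<^esub> = \<zero>\<^bsub>T.T\<^esub>" if "x \<in> I" for x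
   using T.tens_balanced[OF that zero_closed, of "\<zero>\<^bsub>M\<^esub>"] T.tens_zero_left[of "\<zero>\<^bsub>M\<^esub>"] IR[OF that] by simp
  have "lsubmodule R M {m \<in> carrier M. \<forall>x\<in>I. T.tens x m \<in> U}"
   unfolding lsubmodule_def using u T.I.I_r_closed
   by (auto simp: t0 T.tens_add_right simp flip: T.tens_balanced)
  then have "carrier M \<subseteq> {m \<in> carrier M. \<forall>x\<in>I. T.tens x m \<in> U}" by (rule S(3)) (use S(2) 1 in auto)
  then have 2: "T.tens x m \<in> U" if "x \<in> I" "m \<in> carrier M" for x m using that by blast
  show ?thesis
  proof
   fix t assume "t \<in> carrier T.T"
   then show "t \<in> U" by (induction t rule: T.tensor_induct) (use u 2 in auto)
  qed
 qed
 then have "fin_gen R T.T" unfolding TM.fin_gen_iff using B(1,2) S(1,2)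
  by (intro exI[of _ ?A]) (auto simp: subset_iff)
 then show ?thesis by (simp add: fgmod_def T.left_module_T)
qed

abbreviation "CC \<equiv> mod_cat R"
abbreviation "EE \<equiv> functor_cat (mod_cat R) (mod_cat R)"

lemma fgmod_tensor': "ideal I R ==> M \<in> ob CC ==> fgmod R (tensor R I M)"
 by (rule fgmod_tensor) auto

lemma fob_Dp: "M \<in> ob CC ==> fob (Dp R I) M = small_copy R (tensor R I M)"
 unfolding Dp_def by (rule mk_functor_simps)

lemma fmor_Dp: "M \<in> ob CC ==> N \<in> ob CC ==> f \<in> mod_hom R M N ==>
  fmor (Dp R I) M N f = small_mor R (tensor R I M) (tensor R I N) (tensor_map R I M N f)"
 unfolding Dp_def by (subst mk_functor_simps) (simp_all add: small_mor_def)

lemma tensor_map_compose: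
 assumes I: "ideal I R" and L: "left_module R L" and M: "left_module R M" and N: "left_module R N"
  and f: "f \<in> mod_hom R L M" and g: "g \<in> mod_hom R M N"
 shows "tensor_map R I L N (compose (carrier L) g f) =
  compose (carrier (tensor R I L)) (tensor_map R I M N g) (tensor_map R I L M f)"
proof -
 interpret TL: tensor_product R L I by (rule tensor_productI[OF L I])
 interpret TM: tensor_product R M I by (rule tensor_productI[OF M I])
 interpret TN: tensor_product R N I by (rule tensor_productI[OF N I])
 note t = TL.tensor_product_axioms TM.tensor_product_axioms TN.tensor_product_axioms
 note gf = mod_hom_compose[OF L f g]
 show ?thesis
  by (rule TL.mod_hom_T_eqI[OF tensor_map_hom(1)[OF t(1,3) gf]
    mod_hom_compose[OF TL.left_module_T tensor_map_hom(1)[OF t(1,2) f] tensor_map_hom(1)[OF t(2,3) g]]])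
   (simp add: tensor_map_hom(2)[OF t(1,3) gf] compose_eq tensor_map_hom(2)[OF t(1,2) f]
    tensor_map_hom(2)[OF t(2,3) g] mod_homD(1)[OF f])
qed

text \<open>Homomorphisms out of a tensor product are compared on elementary tensors, where each law
  is immediate, and \<open>small_mor\<close> carries the result to the copies.\<close>

lemma linear_functor_Dp:
 assumes I: "ideal I R" shows "linear_functor CC CC (Dp R I)"
proof (rule linear_functorI)
 fix M assume M: "M \<in> ob CC"
 then have Ml: "left_module R M" by simp
 interpret T: tensor_product R M I by (rule tensor_productI[OF Ml I])
 note fg = fgmod_tensor'[OF I M]
 show "fob (Dp R I) M \<in> ob CC" using small_copy_ob[OF fg] by (simp add: fob_Dp M del: mod_cat_simps)
 have "tensor_map R I M M (\<lambda>x\<in>carrier M. x) = (\<lambda>t\<in>carrier T.T. t)"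
  by (rule T.mod_hom_T_eqI[OF tensor_map_hom(1)[OF T.tensor_product_axioms T.tensor_product_axioms mod_hom_id[OF Ml]]
     mod_hom_id[OF T.left_module_T]])
   (simp add: tensor_map_hom(2)[OF T.tensor_product_axioms T.tensor_product_axioms mod_hom_id[OF Ml]])
 then show "fmor (Dp R I) M M (idm CC M) = idm CC (fob (Dp R I) M)"
  using M mod_hom_id[OF Ml] fg by (simp add: fob_Dp fmor_Dp small_mor_id)
next
 fix M N f assume a: "M \<in> ob CC" "N \<in> ob CC" "f \<in> mor CC M N"
 then have l: "left_module R M" "left_module R N" and f: "f \<in> mod_hom R M N" by auto
 interpret T: tensor_product R M I by (rule tensor_productI[OF l(1) I])
 interpret T': tensor_product R N I by (rule tensor_productI[OF l(2) I])
 note t = T.tensor_product_axioms T'.tensor_product_axioms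
 note fg = fgmod_tensor'[OF I a(1)] fgmod_tensor'[OF I a(2)]
 note tf = tensor_map_hom[OF t f]
 interpret T'm: lmod R T'.T by (rule T'.lmod_T)
 interpret N: lmod R N using l by (simp add: lmod_iff)
 show "fmor (Dp R I) M N f \<in> mor CC (fob (Dp R I) M) (fob (Dp R I) N)"
  using small_mor_hom[OF fg tf(1)] a by (simp add: fob_Dp fmor_Dp)
 {
  fix g assume "g \<in> mor CC M N" then have g: "g \<in> mod_hom R M N" by simp
  note tg = tensor_map_hom[OF t g]
  note fpg = mod_hom_madd[OF l f g] note tfpg = tensor_map_hom[OF t fpg]
  have "tensor_map R I M N (\<lambda>x\<in>carrier M. f x \<oplus>\<^bsub>N\<^esub> g x) =
    (\<lambda>x\<in>carrier T.T. tensor_map R I M N f x \<oplus>\<^bsub>T'.T\<^esub> tensor_map R I M N g x)"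
   by (rule T.mod_hom_T_eqI[OF tfpg(1) mod_hom_madd[OF T.left_module_T T'.left_module_T tf(1) tg(1)]])
    (simp add: tfpg(2) tf(2) tg(2) T'.tens_add_right mod_homD(1)[OF f] mod_homD(1)[OF g])
  then show "fmor (Dp R I) M N (madd CC M N f g) =
    madd CC (fob (Dp R I) M) (fob (Dp R I) N) (fmor (Dp R I) M N f) (fmor (Dp R I) M N g)"
   using a fpg f g by (simp add: fob_Dp fmor_Dp small_mor_add[OF fg tf(1) tg(1)])
 }
 fix c
 note cf = mod_hom_mscale[OF l f, of c] note tcf = tensor_map_hom[OF t cf]
 \<comment> \<open>\<open>c\<close> times the unit is central, so it can be moved across the tensor
   sign and then to the left of \<open>x\<close>.\<close>
 have sc: "T'.tens x ((c \<odot> \<one>) \<odot>\<^bsub>N\<^esub> n) = (c \<odot> \<one>) \<odot>\<^bsub>T'.T\<^esub> T'.tens x n" if "x \<in> I" "n \<in> carrier N" for x n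
 proof -
  have x: "x \<in> carrier R" using that T.I.a_subset by blast
  have "T'.tens x ((c \<odot> \<one>) \<odot>\<^bsub>N\<^esub> n) = T'.tens (x \<otimes> (c \<odot> \<one>)) n" using that by (simp add: T'.tens_balanced)
  also have "x \<otimes> (c \<odot> \<one>) = (c \<odot> \<one>) \<otimes> x" using x by (simp add: sc_mult mult_sc)
  finally show ?thesis using that by (simp add: T'.smult_tens)
 qed
 have "tensor_map R I M N (\<lambda>x\<in>carrier M. (c \<odot> \<one>) \<odot>\<^bsub>N\<^esub> f x) =
   (\<lambda>x\<in>carrier T.T. (c \<odot> \<one>) \<odot>\<^bsub>T'.T\<^esub> tensor_map R I M N f x)"
  by (rule T.mod_hom_T_eqI[OF tcf(1) mod_hom_mscale[OF T.left_module_T T'.left_module_T tf(1)]])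
   (simp add: tcf(2) tf(2) sc mod_homD(1)[OF f])
 then show "fmor (Dp R I) M N (mscale CC M N c f) =
   mscale CC (fob (Dp R I) M) (fob (Dp R I) N) c (fmor (Dp R I) M N f)"
  using a cf f by (simp add: fob_Dp fmor_Dp small_mor_scale[OF fg tf(1)])
next
 fix L M N f g assume a: "L \<in> ob CC" "M \<in> ob CC" "N \<in> ob CC" "f \<in> mor CC L M" "g \<in> mor CC M N"
 then have l: "left_module R L" "left_module R M" "left_module R N"
  and f: "f \<in> mod_hom R L M" and g: "g \<in> mod_hom R M N" by auto
 note fg = fgmod_tensor'[OF I a(1)] fgmod_tensor'[OF I a(2)] fgmod_tensor'[OF I a(3)]
 note tf = tensor_map_hom(1)[OF tensor_productI[OF l(1) I] tensor_productI[OF l(2) I] f]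
 show "fmor (Dp R I) L N (cmp CC L M N g f) =
  cmp CC (fob (Dp R I) L) (fob (Dp R I) M) (fob (Dp R I) N) (fmor (Dp R I) M N g) (fmor (Dp R I) L M f)"
  using a f g mod_hom_compose[OF l(1) f g] tensor_map_compose[OF I l f g]
  by (simp add: fob_Dp fmor_Dp small_mor_compose[OF fg(1,2) tf])
qed

lemma Dp_ob: "ideal I R ==> Dp R I \<in> ob EE"
 using linear_functor_Dp[of I] by (simp add: Dp_def mk_functor_idem)

definition Dp_trans :: "'r set => 'r set => ('r => 'r) => ('k, 'r) smod => 'k smor" where
 "Dp_trans I J f = (\<lambda>M\<in>ob CC. small_mor R (tensor R I M) (tensor R J M) (bimod_tensor R I J M f))"

lemma bimod_tensor_nat:
 assumes I: "ideal I R" "ideal J R" and f: "bimod_hom R I J f" and M: "left_module R M" "left_module R N"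
  and h: "h \<in> mod_hom R M N"
 shows "compose (carrier (tensor R I M)) (bimod_tensor R I J N f) (tensor_map R I M N h) =
  compose (carrier (tensor R I M)) (tensor_map R J M N h) (bimod_tensor R I J M f)"
proof -
 note t = tensor_productI[OF M(1) I(1)] tensor_productI[OF M(2) I(1)] tensor_productI[OF M(1) I(2)] tensor_productI[OF M(2) I(2)]
 interpret TM: tensor_product R M I by (rule t)
 interpret TN: tensor_product R N I by (rule t)
 interpret SM: tensor_product R M J by (rule t)
 interpret SN: tensor_product R N J by (rule t)
 note hI = tensor_map_hom[OF t(1,2) h] and hJ = tensor_map_hom[OF t(3,4) h]
  and fM = bimod_tensor_hom[OF t(1,3) f] and fN = bimod_tensor_hom[OF t(2,4) f]
 show ?thesis
  by (rule TM.mod_hom_T_eqI[OF mod_hom_compose[OF TM.left_module_T hI(1) fN(1)] mod_hom_compose[OF TM.left_module_T fM(1) hJ(1)]])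
   (simp add: compose_eq hI(2) hJ(2) fM(2) fN(2) mod_homD(1)[OF h] bimod_homD(1)[OF f])
qed

lemma Dp_trans_mor:
 assumes I: "ideal I R" "ideal J R" and f: "bimod_hom R I J f"
 shows "Dp_trans I J f \<in> mor EE (Dp R I) (Dp R J)"
 unfolding functor_cat_simps
proof (rule nat_transI)
 fix M assume M: "M \<in> ob CC"
 then have l: "left_module R M" by simp
 note fM = bimod_tensor_hom[OF tensor_productI[OF l I(1)] tensor_productI[OF l I(2)] f]
 show "Dp_trans I J f M \<in> mor CC (fob (Dp R I) M) (fob (Dp R J) M)"
  using small_mor_hom[OF fgmod_tensor'[OF I(1) M] fgmod_tensor'[OF I(2) M] fM(1)] M
  by (simp add: Dp_trans_def fob_Dp)
 fix N h assume N: "N \<in> ob CC" and "h \<in> mor CC M N"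
 then have l': "left_module R N" and h: "h \<in> mod_hom R M N" by auto
 note hI = tensor_map_hom(1)[OF tensor_productI[OF l I(1)] tensor_productI[OF l' I(1)] h]
 show "cmp CC (fob (Dp R I) M) (fob (Dp R I) N) (fob (Dp R J) N) (Dp_trans I J f N) (fmor (Dp R I) M N h) =
   cmp CC (fob (Dp R I) M) (fob (Dp R J) M) (fob (Dp R J) N) (fmor (Dp R J) M N h) (Dp_trans I J f M)"
  using M N h bimod_tensor_nat[OF I f l l' h]
  by (simp add: fob_Dp fmor_Dp Dp_trans_def small_mor_compose[OF fgmod_tensor'[OF I(1) M] fgmod_tensor'[OF I(1) N] hI]
    small_mor_compose[OF fgmod_tensor'[OF I(1) M] fgmod_tensor'[OF I(2) M] fM(1)])
qed (simp add: Dp_trans_def)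

text \<open>This uniqueness shows that identities, composites, sums and multiples of bimodule
  homomorphisms induce those of transformations.\<close>

lemma bimod_tensor_eqI:
 assumes I: "ideal I R" "ideal J R" and f: "bimod_hom R I J f" and M: "left_module R M"
  and h: "h \<in> mod_hom R (tensor R I M) (tensor R J M)"
  and eq: "!!x m. x \<in> I ==> m \<in> carrier M ==>
   h (tensor_product.tens R M I x m) = tensor_product.tens R M J (f x) m"
 shows "bimod_tensor R I J M f = h"
proof -
 note t = tensor_productI[OF M I(1)] tensor_productI[OF M I(2)]
 interpret TM: tensor_product R M I by (rule t)
 show ?thesis
  by (rule TM.mod_hom_T_eqI[OF bimod_tensor_hom(1)[OF t f] h]) (simp add: bimod_tensor_hom(2)[OF t f] eq)
qed

lemma Dp_trans_cong:
 assumes I: "ideal I R" "ideal J R" and f: "bimod_hom R I J f" "bimod_hom R I J g"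
  and eq: "!!x. x \<in> I ==> f x = g x"
 shows "Dp_trans I J f = Dp_trans I J g"
 unfolding Dp_trans_def
proof (rule restrict_ext)
 fix M assume "M \<in> ob CC"
 then have l: "left_module R M" by simp
 note t = tensor_productI[OF l I(1)] tensor_productI[OF l I(2)]
 have "bimod_tensor R I J M f = bimod_tensor R I J M g"
  by (rule bimod_tensor_eqI[OF I f(1) l bimod_tensor_hom(1)[OF t f(2)]]) (simp add: bimod_tensor_hom(2)[OF t f(2)] eq)
 then show "small_mor R (tensor R I M) (tensor R J M) (bimod_tensor R I J M f) =
  small_mor R (tensor R I M) (tensor R J M) (bimod_tensor R I J M g)" by simp
qed

lemma Dp_trans_id:
 assumes I: "ideal I R" and f: "bimod_hom R I I f" "!!x. x \<in> I ==> f x = x"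
 shows "Dp_trans I I f = idm EE (Dp R I)"
 unfolding functor_cat_simps Dp_trans_def
proof (rule restrict_ext)
 fix M assume M: "M \<in> ob CC"
 then have l: "left_module R M" by simp
 interpret TM: tensor_product R M I by (rule tensor_productI[OF l I])
 have "bimod_tensor R I I M f = (\<lambda>x\<in>carrier TM.T. x)"
  by (rule bimod_tensor_eqI[OF I I f(1) l mod_hom_id[OF TM.left_module_T]]) (simp add: f(2))
 then show "small_mor R (tensor R I M) (tensor R I M) (bimod_tensor R I I M f) = idm CC (fob (Dp R I) M)"
  using M small_mor_id[OF fgmod_tensor'[OF I M]] by (simp add: fob_Dp)
qed

lemma Dp_trans_compose:
 assumes I: "ideal I R" "ideal J R" "ideal L R" and f: "bimod_hom R I J f" and g: "bimod_hom R J L g"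
  and h: "bimod_hom R I L h" "!!x. x \<in> I ==> h x = g (f x)"
 shows "cmp EE (Dp R I) (Dp R J) (Dp R L) (Dp_trans J L g) (Dp_trans I J f) = Dp_trans I L h"
 unfolding functor_cat_simps Dp_trans_def
proof (rule restrict_ext)
 fix M assume M: "M \<in> ob CC"
 then have l: "left_module R M" by simp
 note t = tensor_productI[OF l I(1)] tensor_productI[OF l I(2)] tensor_productI[OF l I(3)]
 interpret T: tensor_product R M I by (rule t)
 interpret T': tensor_product R M J by (rule t)
 note fM = bimod_tensor_hom[OF t(1,2) f] and gM = bimod_tensor_hom[OF t(2,3) g]
 have "bimod_tensor R I L M h = compose (carrier T.T) (bimod_tensor R J L M g) (bimod_tensor R I J M f)"
  by (rule bimod_tensor_eqI[OF I(1,3) h(1) l mod_hom_compose[OF T.left_module_T fM(1) gM(1)]])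
   (simp add: compose_eq fM(2) gM(2) h(2) bimod_homD(1)[OF f])
 then show "cmp CC (fob (Dp R I) M) (fob (Dp R J) M) (fob (Dp R L) M)
   ((\<lambda>M\<in>ob CC. small_mor R (tensor R J M) (tensor R L M) (bimod_tensor R J L M g)) M)
   ((\<lambda>M\<in>ob CC. small_mor R (tensor R I M) (tensor R J M) (bimod_tensor R I J M f)) M) =
  small_mor R (tensor R I M) (tensor R L M) (bimod_tensor R I L M h)"
  using M by (simp add: fob_Dp small_mor_compose[OF fgmod_tensor'[OF I(1) M] fgmod_tensor'[OF I(2) M] fM(1)])
qed

lemma Dp_trans_add:
 assumes I: "ideal I R" "ideal J R" and f: "bimod_hom R I J f" and g: "bimod_hom R I J g"
  and h: "bimod_hom R I J h" "!!x. x \<in> I ==> h x = f x \<oplus> g x"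
 shows "madd EE (Dp R I) (Dp R J) (Dp_trans I J f) (Dp_trans I J g) = Dp_trans I J h"
 unfolding functor_cat_simps Dp_trans_def
proof (rule restrict_ext)
 fix M assume M: "M \<in> ob CC"
 then have l: "left_module R M" by simp
 note t = tensor_productI[OF l I(1)] tensor_productI[OF l I(2)]
 interpret T: tensor_product R M I by (rule t)
 interpret T': tensor_product R M J by (rule t)
 note fM = bimod_tensor_hom[OF t f] and gM = bimod_tensor_hom[OF t g]
 have "bimod_tensor R I J M h = (\<lambda>x\<in>carrier T.T. bimod_tensor R I J M f x \<oplus>\<^bsub>T'.T\<^esub> bimod_tensor R I J M g x)"
  by (rule bimod_tensor_eqI[OF I h(1) l mod_hom_madd[OF T.left_module_T T'.left_module_T fM(1) gM(1)]])
   (simp add: fM(2) gM(2) h(2) bimod_homD(1)[OF f] bimod_homD(1)[OF g] T'.tens_add_left)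
 then show "madd CC (fob (Dp R I) M) (fob (Dp R J) M)
   ((\<lambda>M\<in>ob CC. small_mor R (tensor R I M) (tensor R J M) (bimod_tensor R I J M f)) M)
   ((\<lambda>M\<in>ob CC. small_mor R (tensor R I M) (tensor R J M) (bimod_tensor R I J M g)) M) =
  small_mor R (tensor R I M) (tensor R J M) (bimod_tensor R I J M h)"
  using M by (simp add: fob_Dp small_mor_add[OF fgmod_tensor'[OF I(1) M] fgmod_tensor'[OF I(2) M] fM(1) gM(1)])
qed

lemma Dp_trans_scale:
 assumes I: "ideal I R" "ideal J R" and f: "bimod_hom R I J f"
  and h: "bimod_hom R I J h" "!!x. x \<in> I ==> h x = c \<odot> f x"
 shows "mscale EE (Dp R I) (Dp R J) c (Dp_trans I J f) = Dp_trans I J h"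
 unfolding functor_cat_simps Dp_trans_def
proof (rule restrict_ext)
 fix M assume M: "M \<in> ob CC"
 then have l: "left_module R M" by simp
 note t = tensor_productI[OF l I(1)] tensor_productI[OF l I(2)]
 interpret T: tensor_product R M I by (rule t)
 interpret T': tensor_product R M J by (rule t)
 note fM = bimod_tensor_hom[OF t f]
 have JR: "x \<in> J ==> x \<in> carrier R" for x using T'.I.a_subset by blast
 have "bimod_tensor R I J M h = (\<lambda>x\<in>carrier T.T. (c \<odot> \<one>) \<odot>\<^bsub>T'.T\<^esub> bimod_tensor R I J M f x)"
  by (rule bimod_tensor_eqI[OF I h(1) l mod_hom_mscale[OF T.left_module_T T'.left_module_T fM(1)]])
   (simp add: fM(2) h(2) bimod_homD(1)[OF f] JR T'.smult_tens sc_mult)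
 then show "mscale CC (fob (Dp R I) M) (fob (Dp R J) M) c
   ((\<lambda>M\<in>ob CC. small_mor R (tensor R I M) (tensor R J M) (bimod_tensor R I J M f)) M) =
  small_mor R (tensor R I M) (tensor R J M) (bimod_tensor R I J M h)"
  using M by (simp add: fob_Dp small_mor_scale[OF fgmod_tensor'[OF I(1) M] fgmod_tensor'[OF I(2) M] fM(1)])
qed

section \<open>The regular module and the Eilenberg--Watts argument\<close>

definition reg :: "('k, 'r) smod" where "reg = small_copy R (left_principal R \<one>)"

definition reg_elt :: "'r => nat => 'k" where "reg_elt = small_iso R (left_principal R \<one>)"

lemma reg_ob: "reg \<in> ob CC" unfolding reg_def by (rule small_copy_ob[OF fgmod_left_principal]) simp

lemma reg_elt_closed [simp]: "a \<in> carrier R ==> reg_elt a \<in> carrier reg"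
 unfolding reg_def reg_elt_def
 by (rule small_iso_closed[OF fgmod_left_principal]) (simp_all only: carrier_left_principal_one one_closed)

lemma reg_cases: assumes "y \<in> carrier reg" obtains a where "a \<in> carrier R" "y = reg_elt a"
 by (rule small_copy_cases[OF fgmod_left_principal[OF one_closed] assms[unfolded reg_def],
    unfolded carrier_left_principal_one])
  (rule that, simp_all add: reg_elt_def)

lemma reg_elt_inj: "a \<in> carrier R ==> b \<in> carrier R ==> reg_elt a = reg_elt b \<longleftrightarrow> a = b"
 unfolding reg_elt_def
 by (rule small_iso_inj[OF fgmod_left_principal[OF one_closed]]) (simp_all only: carrier_left_principal_one)

lemma reg_elt_add: "a \<in> carrier R ==> b \<in> carrier R ==> reg_elt a \<oplus>\<^bsub>reg\<^esub> reg_elt b = reg_elt (a \<oplus> b)"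
 using mod_homD(2)[OF small_iso_hom[OF fgmod_left_principal[OF one_closed]], unfolded carrier_left_principal_one, of a b]
 by (simp add: reg_elt_def reg_def)

lemma reg_elt_smult: "a \<in> carrier R ==> b \<in> carrier R ==> a \<odot>\<^bsub>reg\<^esub> reg_elt b = reg_elt (a \<otimes> b)"
 using mod_homD(3)[OF small_iso_hom[OF fgmod_left_principal[OF one_closed]], unfolded carrier_left_principal_one, of a b]
 by (simp add: reg_elt_def reg_def)

text \<open>The regular module is free on the copy of the unit; \<open>THE\<close> recovers a ring
  element from its copy.\<close>

lemma reg_hom_exists:
 assumes M: "left_module R M" and m: "m \<in> carrier M"
 shows "\<exists>h \<in> mod_hom R reg M. \<forall>a\<in>carrier R. h (reg_elt a) = a \<odot>\<^bsub>M\<^esub> m"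
proof -
 interpret M: lmod R M using M by (simp add: lmod_iff)
 define h where "h = (\<lambda>y\<in>carrier reg. (THE a. a \<in> carrier R \<and> y = reg_elt a) \<odot>\<^bsub>M\<^esub> m)"
 have h: "h (reg_elt a) = a \<odot>\<^bsub>M\<^esub> m" if "a \<in> carrier R" for a
 proof -
  have "(THE b. b \<in> carrier R \<and> reg_elt a = reg_elt b) = a"
   using that by (intro the_equality) (auto simp: reg_elt_inj)
  then show ?thesis using that by (simp add: h_def)
 qed
 have "h \<in> mod_hom R reg M"
 proof (rule mod_homI)
  fix x y assume "x \<in> carrier reg" "y \<in> carrier reg"
  then obtain a b where "a \<in> carrier R" "x = reg_elt a" "b \<in> carrier R" "y = reg_elt b"
   by (metis reg_cases)
  then show "h (x \<oplus>\<^bsub>reg\<^esub> y) = h x \<oplus>\<^bsub>M\<^esub> h y" using m by (simp add: reg_elt_add h M.add_smult)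
 next
  fix r x assume "r \<in> carrier R" "x \<in> carrier reg"
  then obtain a where "a \<in> carrier R" "x = reg_elt a" by (metis reg_cases)
  then show "h (r \<odot>\<^bsub>reg\<^esub> x) = r \<odot>\<^bsub>M\<^esub> h x"
   using m \<open>r \<in> carrier R\<close> by (simp add: reg_elt_smult h M.mult_smult)
 next
  fix x assume "x \<in> carrier reg"
  then obtain a where "a \<in> carrier R" "x = reg_elt a" by (metis reg_cases)
  then show "h x \<in> carrier M" using m by (simp add: h)
 qed (simp add: h_def)
 then show ?thesis using h by blast
qed

text \<open>\<open>\<mu>\<close> is the isomorphism from \<open>J\<close> tensor \<open>R\<close> to
  \<open>J\<close> given by multiplication; every tensor can be normalised to have the unit as its
  right factor.\<close>

lemma tensor_reg:
 assumes J: "ideal J R"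
 obtains \<mu> where "!!w. w \<in> carrier (tensor R J reg) ==> \<mu> w \<in> J"
  "!!w. w \<in> carrier (tensor R J reg) ==> w = tensor_product.tens R reg J (\<mu> w) (reg_elt \<one>)"
  "!!y. y \<in> J ==> \<mu> (tensor_product.tens R reg J y (reg_elt \<one>)) = y"
  "!!v w. v \<in> carrier (tensor R J reg) ==> w \<in> carrier (tensor R J reg) ==>
   \<mu> (v \<oplus>\<^bsub>tensor R J reg\<^esub> w) = \<mu> v \<oplus> \<mu> w"
proof -
 have regl: "left_module R reg" using reg_ob by simp
 interpret T: tensor_product R reg J by (rule tensor_productI[OF regl J])
 have JR: "x \<in> J ==> x \<in> carrier R" for x using T.I.a_subset by blast
 define i where "i y = (THE a. a \<in> carrier R \<and> y = reg_elt a)" for y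
 have i: "i (reg_elt a) = a" if "a \<in> carrier R" for a
  unfolding i_def using that by (intro the_equality) (auto simp: reg_elt_inj)
 have "\<exists>h. (\<forall>t\<in>carrier T.T. h t \<in> carrier R) \<and>
  (\<forall>s\<in>carrier T.T. \<forall>t\<in>carrier T.T. h (s \<oplus>\<^bsub>T.T\<^esub> t) = h s \<oplus> h t) \<and>
  (\<forall>x\<in>J. \<forall>m\<in>carrier reg. h (T.tens x m) = x \<otimes> i m)"
 proof (rule T.tensor_lift[OF abelian_group_axioms])
  fix x m assume "x \<in> J" "m \<in> carrier reg"
  moreover obtain a where "a \<in> carrier R" "m = reg_elt a" using \<open>m \<in> carrier reg\<close> by (rule reg_cases)
  ultimately show "x \<otimes> i m \<in> carrier R" using i JR by simp
 next
  fix x y m assume "x \<in> J" "y \<in> J" "m \<in> carrier reg"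
  moreover obtain a where "a \<in> carrier R" "m = reg_elt a" using \<open>m \<in> carrier reg\<close> by (rule reg_cases)
  ultimately show "(x \<oplus> y) \<otimes> i m = x \<otimes> i m \<oplus> y \<otimes> i m" using i JR by (simp add: l_distr)
 next
  fix x m n assume "x \<in> J" "m \<in> carrier reg" "n \<in> carrier reg"
  moreover obtain a where "a \<in> carrier R" "m = reg_elt a" using \<open>m \<in> carrier reg\<close> by (rule reg_cases)
  moreover obtain b where "b \<in> carrier R" "n = reg_elt b" using \<open>n \<in> carrier reg\<close> by (rule reg_cases)
  ultimately show "x \<otimes> i (m \<oplus>\<^bsub>reg\<^esub> n) = x \<otimes> i m \<oplus> x \<otimes> i n" using i JR by (simp add: r_distr reg_elt_add)
 next
  fix x r m assume "x \<in> J" "r \<in> carrier R" "m \<in> carrier reg"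
  moreover obtain a where "a \<in> carrier R" "m = reg_elt a" using \<open>m \<in> carrier reg\<close> by (rule reg_cases)
  ultimately show "x \<otimes> r \<otimes> i m = x \<otimes> i (r \<odot>\<^bsub>reg\<^esub> m)" using i JR by (simp add: m_assoc reg_elt_smult)
 qed
 then obtain h where "(\<forall>t\<in>carrier T.T. h t \<in> carrier R) \<and>
  (\<forall>s\<in>carrier T.T. \<forall>t\<in>carrier T.T. h (s \<oplus>\<^bsub>T.T\<^esub> t) = h s \<oplus> h t) \<and>
  (\<forall>x\<in>J. \<forall>m\<in>carrier reg. h (T.tens x m) = x \<otimes> i m)" ..
 then have h: "!!s t. s \<in> carrier T.T ==> t \<in> carrier T.T ==> h (s \<oplus>\<^bsub>T.T\<^esub> t) = h s \<oplus> h t"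
  "!!x m. x \<in> J ==> m \<in> carrier reg ==> h (T.tens x m) = x \<otimes> i m" by simp_all
 interpret TM: lmod R T.T by (rule T.lmod_T)
 have 3: "h (T.tens y (reg_elt \<one>)) = y" if "y \<in> J" for y using that h(2) i JR by simp
 have hx: "h (T.tens x (reg_elt a)) = x \<otimes> a" if "x \<in> J" "a \<in> carrier R" for x a using that h(2) i by simp
 have "h w \<in> J \<and> w = T.tens (h w) (reg_elt \<one>)" if "w \<in> carrier T.T" for w
  using that
 proof (induction w rule: T.tensor_induct)
  case zero
  have z: "\<zero>\<^bsub>T.T\<^esub> = T.tens \<zero> (reg_elt \<one>)" by (simp add: T.tens_zero_left)
  then have "h \<zero>\<^bsub>T.T\<^esub> = \<zero>" using 3 T.I.zero_closed by simp
  then show ?case using z T.I.zero_closed by simp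
 next
  case (add s t)
  then show ?case using T.I.a_closed h(1) T.tens_add_left[of "h s" "h t" "reg_elt \<one>"] by simp
 next
  case (tens x m)
  obtain a where a: "a \<in> carrier R" "m = reg_elt a" using tens(2) by (rule reg_cases)
  then have "T.tens x m = T.tens (x \<otimes> a) (reg_elt \<one>)"
   using tens by (simp add: T.tens_balanced reg_elt_smult)
  then show ?case using a tens hx T.I.I_r_closed by simp
 qed
 then show ?thesis using that[of h] h(1) 3 by blast
qed

text \<open>
  The Eilenberg--Watts argument: a natural transformation is determined by its component at the
  regular module, which commutes with right multiplications.
\<close>

lemma Dp_trans_surj:
 assumes I: "ideal I R" and J: "ideal J R" and \<tau>: "\<tau> \<in> mor EE (Dp R I) (Dp R J)"
 shows "\<exists>f. bimod_hom R I J f \<and> \<tau> = Dp_trans I J f"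
proof -
 note n = nat_transD[OF \<tau>[unfolded functor_cat_simps]]
 have tp: "tensor_product R M I" "tensor_product R M J" if "M \<in> ob CC" for M
  using that I J by (auto intro: tensor_productI)
 have "\<exists>t. t \<in> mod_hom R (tensor R I M) (tensor R J M) \<and> \<tau> M = small_mor R (tensor R I M) (tensor R J M) t"
  if M: "M \<in> ob CC" for M
  using n(2)[OF M] small_mor_surj[OF fgmod_tensor'[OF I M] fgmod_tensor'[OF J M], of "\<tau> M"] M
  by (auto simp: fob_Dp)
 then obtain t where t: "!!M. M \<in> ob CC ==> t M \<in> mod_hom R (tensor R I M) (tensor R J M)"
  "!!M. M \<in> ob CC ==> \<tau> M = small_mor R (tensor R I M) (tensor R J M) (t M)" by metis
 \<comment> \<open>Naturality of \<open>\<tau>\<close>, freed from the small copies by injectivity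
   of \<open>small_mor\<close>.\<close>
 have nat: "t N (tensor_map R I M N h w) = tensor_map R J M N h (t M w)"
  if M: "M \<in> ob CC" and N: "N \<in> ob CC" and h: "h \<in> mod_hom R M N" and w: "w \<in> carrier (tensor R I M)" for M N h w
 proof -
  note hI = tensor_map_hom(1)[OF tp(1)[OF M] tp(1)[OF N] h]
  note hJ = tensor_map_hom(1)[OF tp(2)[OF M] tp(2)[OF N] h]
  have TI: "left_module R (tensor R I M)" using fgmod_tensor'[OF I M] by (simp add: fgmod_def)
  have "small_mor R (tensor R I M) (tensor R J N) (compose (carrier (tensor R I M)) (t N) (tensor_map R I M N h)) =
   small_mor R (tensor R I M) (tensor R J N) (compose (carrier (tensor R I M)) (tensor_map R J M N h) (t M))"
   using n(3)[OF M N, of h] h M N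
   by (simp add: fob_Dp fmor_Dp t(2) small_mor_compose[OF fgmod_tensor'[OF I M] fgmod_tensor'[OF I N] hI]
    small_mor_compose[OF fgmod_tensor'[OF I M] fgmod_tensor'[OF J M] t(1)[OF M]])
  then have "compose (carrier (tensor R I M)) (t N) (tensor_map R I M N h) =
    compose (carrier (tensor R I M)) (tensor_map R J M N h) (t M)"
   using small_mor_inj[OF fgmod_tensor'[OF I M] fgmod_tensor'[OF J N]
    mod_hom_compose[OF TI hI t(1)[OF N]] mod_hom_compose[OF TI t(1)[OF M] hJ]] by blast
  then have "compose (carrier (tensor R I M)) (t N) (tensor_map R I M N h) w =
    compose (carrier (tensor R I M)) (tensor_map R J M N h) (t M) w" by simp
  then show ?thesis using w by (simp add: compose_eq)
 qed
 interpret TI: tensor_product R reg I by (rule tp[OF reg_ob])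
 interpret TJ: tensor_product R reg J by (rule tp[OF reg_ob])
 obtain \<mu> where \<mu>: "!!w. w \<in> carrier TJ.T ==> \<mu> w \<in> J"
  "!!w. w \<in> carrier TJ.T ==> w = TJ.tens (\<mu> w) (reg_elt \<one>)"
  "!!y. y \<in> J ==> \<mu> (TJ.tens y (reg_elt \<one>)) = y"
  "!!v w. v \<in> carrier TJ.T ==> w \<in> carrier TJ.T ==> \<mu> (v \<oplus>\<^bsub>TJ.T\<^esub> w) = \<mu> v \<oplus> \<mu> w"
  by (rule tensor_reg[OF J], rule that; assumption)
 define f where "f x = \<mu> (t reg (TI.tens x (reg_elt \<one>)))" for x
 note tr = mod_homD(1-3)[OF t(1)[OF reg_ob]]
 have f: "t reg (TI.tens x (reg_elt \<one>)) = TJ.tens (f x) (reg_elt \<one>)" "f x \<in> J" if "x \<in> I" for x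
  using \<mu>(1,2) tr(1) that unfolding f_def by auto
 \<comment> \<open>Naturality along the homomorphism that sends the unit to \<open>m\<close> carries
   the formula from the regular module to \<open>M\<close>.\<close>
 have fM: "t M (tensor_product.tens R M I x m) = tensor_product.tens R M J (f x) m"
  if M: "M \<in> ob CC" and x: "x \<in> I" and m: "m \<in> carrier M" for M x m
 proof -
  have "left_module R M" using M by simp
  then interpret M: lmod R M by (simp add: lmod_iff)
  obtain h where h: "h \<in> mod_hom R reg M" "!!a. a \<in> carrier R ==> h (reg_elt a) = a \<odot>\<^bsub>M\<^esub> m"
   using reg_hom_exists[OF \<open>left_module R M\<close> m] by blast
  have h1: "h (reg_elt \<one>) = m" using h(2) m by simp
  have "t M (tensor_map R I reg M h (TI.tens x (reg_elt \<one>))) = tensor_map R J reg M h (t reg (TI.tens x (reg_elt \<one>)))"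
   using x by (intro nat[OF reg_ob M h(1)]) simp
  then show ?thesis using x f[OF x] h1
   by (simp add: tensor_map_hom(2)[OF tp(1)[OF reg_ob] tp(1)[OF M] h(1)] tensor_map_hom(2)[OF tp(2)[OF reg_ob] tp(2)[OF M] h(1)])
 qed
 have "bimod_hom R I J f" unfolding bimod_hom_def
 proof (intro conjI ballI)
  fix x assume x: "x \<in> I"
  then show "f x \<in> J" by (rule f)
  {
   fix y assume y: "y \<in> I"
   have "t reg (TI.tens (x \<oplus> y) (reg_elt \<one>)) = TJ.tens (f x) (reg_elt \<one>) \<oplus>\<^bsub>TJ.T\<^esub> TJ.tens (f y) (reg_elt \<one>)"
    using x y f by (simp add: TI.tens_add_left tr(2))
   also have "... = TJ.tens (f x \<oplus> f y) (reg_elt \<one>)" using x y f by (simp add: TJ.tens_add_left)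
   finally have eq: "t reg (TI.tens (x \<oplus> y) (reg_elt \<one>)) = TJ.tens (f x \<oplus> f y) (reg_elt \<one>)" .
   show "f (x \<oplus> y) = f x \<oplus> f y" unfolding f_def[of "x \<oplus> y"] eq
    by (rule \<mu>(3)) (use x y f(2) TJ.I.a_closed in simp)
  }
  fix r assume r: "r \<in> carrier R"
  have "t reg (TI.tens (r \<otimes> x) (reg_elt \<one>)) = r \<odot>\<^bsub>TJ.T\<^esub> TJ.tens (f x) (reg_elt \<one>)"
   using x r f by (simp add: TI.smult_tens[symmetric] tr(3))
  also have "... = TJ.tens (r \<otimes> f x) (reg_elt \<one>)" using x r f by (simp add: TJ.smult_tens)
  finally have eq: "t reg (TI.tens (r \<otimes> x) (reg_elt \<one>)) = TJ.tens (r \<otimes> f x) (reg_elt \<one>)" .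
  show "f (r \<otimes> x) = r \<otimes> f x" unfolding f_def[of "r \<otimes> x"] eq
   by (rule \<mu>(3)) (use x r f(2) TJ.I.I_l_closed in simp)
  \<comment> \<open>Right linearity: \<open>r\<close> is moved into the module factor, and
    \<open>fM\<close> is applied at the element \<open>reg_elt r\<close> of the regular module
    itself.\<close>
  have "t reg (TI.tens (x \<otimes> r) (reg_elt \<one>)) = t reg (TI.tens x (reg_elt r))"
   using x r by (simp add: TI.tens_balanced reg_elt_smult)
  also have "... = TJ.tens (f x) (reg_elt r)" by (rule fM[OF reg_ob x]) (simp add: r)
  also have "... = TJ.tens (f x \<otimes> r) (reg_elt \<one>)" using x r f by (simp add: TJ.tens_balanced reg_elt_smult)
  finally have eq: "t reg (TI.tens (x \<otimes> r) (reg_elt \<one>)) = TJ.tens (f x \<otimes> r) (reg_elt \<one>)" .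
  show "f (x \<otimes> r) = f x \<otimes> r" unfolding f_def[of "x \<otimes> r"] eq
   by (rule \<mu>(3)) (use x r f(2) TJ.I.I_r_closed in simp)
 qed
 moreover have "\<tau> = Dp_trans I J f"
 proof (rule extensionalityI[OF n(1)])
  fix M assume M: "M \<in> ob CC"
  have "bimod_tensor R I J M f = t M"
   by (rule bimod_tensor_eqI[OF I J \<open>bimod_hom R I J f\<close> _ t(1)[OF M] fM[OF M]]) (use M in auto)
  then show "\<tau> M = Dp_trans I J f M" using M t(2) by (simp add: Dp_trans_def)
 qed (simp add: Dp_trans_def)
 ultimately show ?thesis by blast
qed

text \<open>The component at the regular module gives \<open>f\<close> back, as \<open>J\<close>
  tensor \<open>R\<close> is \<open>J\<close>.\<close>

lemma Dp_trans_inj: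
 assumes I: "ideal I R" and J: "ideal J R" and f: "bimod_hom R I J f" and g: "bimod_hom R I J g"
  and eq: "Dp_trans I J f = Dp_trans I J g" and x: "x \<in> I"
 shows "f x = g x"
proof -
 have regl: "left_module R reg" using reg_ob by simp
 note t = tensor_productI[OF regl I] tensor_productI[OF regl J]
 interpret TI: tensor_product R reg I by (rule t)
 interpret TJ: tensor_product R reg J by (rule t)
 note fr = bimod_tensor_hom[OF t f] and gr = bimod_tensor_hom[OF t g]
 obtain \<mu> where \<mu>: "!!y. y \<in> J ==> \<mu> (TJ.tens y (reg_elt \<one>)) = y"
  by (rule tensor_reg[OF J], rule that; assumption)
 have "small_mor R TI.T TJ.T (bimod_tensor R I J reg f) = small_mor R TI.T TJ.T (bimod_tensor R I J reg g)"
  using fun_cong[OF eq, of reg] reg_ob by (simp add: Dp_trans_def)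
 then have "bimod_tensor R I J reg f = bimod_tensor R I J reg g"
  by (rule small_mor_inj[OF fgmod_tensor'[OF I reg_ob] fgmod_tensor'[OF J reg_ob] fr(1) gr(1)])
 then have "TJ.tens (f x) (reg_elt \<one>) = TJ.tens (g x) (reg_elt \<one>)"
  using x fr(2)[OF x, of "reg_elt \<one>"] gr(2)[OF x, of "reg_elt \<one>"] by simp
 then show ?thesis using \<mu> x bimod_homD(1)[OF f] bimod_homD(1)[OF g] by metis
qed

end

section \<open>Incidence algebras: idempotents, radical, ideals and bimodule homomorphisms\<close>

section \<open>Incidence algebras\<close>

text \<open>
  An algebra with a basis \<open>e\<^sub>u\<^sub>v\<close> indexed by the pairs with \<open>rel u v\<close> (there is a path
  from \<open>u\<close> to \<open>v\<close>), given by its coefficient functions. Since paths are composed right to left,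
  \<open>e\<^sub>w\<^sub>v \<otimes> e\<^sub>u\<^sub>w = e\<^sub>u\<^sub>v\<close>.
\<close>

locale inc_alg =
 fixes R :: "('k::field, 'r) module" (structure) and V :: "'i set" and rel :: "'i => 'i => bool"
  and coef :: "'r => 'i => 'i => 'k"
 assumes finite_V: "finite V"
  and rel_V: "rel u v ==> u \<in> V \<and> v \<in> V"
  and rel_refl: "u \<in> V ==> rel u u"
  and rel_trans: "rel u v ==> rel v w ==> rel u w"
  and rel_antisym: "rel u v ==> rel v u ==> u = v"
  and coef_inj: "x \<in> carrier R ==> y \<in> carrier R ==> coef x = coef y ==> x = y"
  and coef_surj: "(!!u v. d u v ~= 0 ==> rel u v) ==> \<exists>x\<in>carrier R. coef x = d"
  and coef_rel: "x \<in> carrier R ==> coef x u v ~= 0 ==> rel u v"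
  and zero_in: "\<zero> \<in> carrier R" and one_in: "\<one> \<in> carrier R"
  and add_in: "x \<in> carrier R ==> y \<in> carrier R ==> x \<oplus> y \<in> carrier R"
  and mult_in: "x \<in> carrier R ==> y \<in> carrier R ==> x \<otimes> y \<in> carrier R"
  and smult_in: "x \<in> carrier R ==> c \<odot> x \<in> carrier R"
  and coef_zero: "coef \<zero> u v = 0"
  and coef_one: "coef \<one> u v = (if u = v \<and> u \<in> V then 1 else 0)"
  and coef_add: "x \<in> carrier R ==> y \<in> carrier R ==> coef (x \<oplus> y) u v = coef x u v + coef y u v"
  and coef_mult: "x \<in> carrier R ==> y \<in> carrier R ==>
   coef (x \<otimes> y) u v = (\<Sum>w\<in>V. coef y u w * coef x w v)"
  and coef_smult: "x \<in> carrier R ==> coef (c \<odot> x) u v = c * coef x u v"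
begin

lemma eqI: "x \<in> carrier R ==> y \<in> carrier R ==> (!!u v. coef x u v = coef y u v) ==> x = y"
 by (rule coef_inj) auto

lemmas in_carrier = zero_in one_in add_in mult_in smult_in

lemma coef_out: "x \<in> carrier R ==> \<not> rel u v ==> coef x u v = 0"
 using coef_rel by blast

lemma sum_delta_left: "x \<in> carrier R ==>
  (\<Sum>w\<in>V. (if u = w \<and> u \<in> V then 1 else 0) * coef x w v) = coef x u v"
 using finite_V coef_out[of x u v] rel_V[of u v]
 by (cases "u \<in> V") (auto simp: if_distrib[of "%a. a * _"] sum.delta cong: if_cong)

lemma sum_delta_right: "x \<in> carrier R ==> (\<Sum>w\<in>V. coef x u w * (if w = v then 1 else 0)) = coef x u v"
 using finite_V coef_out[of x u v] rel_V[of u v] by (auto simp: if_distrib cong: if_cong)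

text \<open>\<open>coef\<close> is injective and turns the operations into those of matrices, so
  every axiom is a matrix identity.\<close>

lemma k_algebra_R: "k_algebra R"
proof -
 have "ring R"
 proof (rule ringI)
  show "abelian_group R"
  proof (rule abelian_groupI)
   fix x assume x: "x \<in> carrier R"
   have "(- 1) \<odot> x \<oplus> x = \<zero>" by (rule eqI) (simp_all add: x in_carrier coef_add coef_smult coef_zero)
   then show "\<exists>y\<in>carrier R. y \<oplus> x = \<zero>" using smult_in[OF x] by blast
   show "\<zero> \<oplus> x = x" by (rule eqI) (simp_all add: x in_carrier coef_add coef_zero)
   fix y assume y: "y \<in> carrier R"
   show "x \<oplus> y = y \<oplus> x" by (rule eqI) (simp_all add: x y in_carrier coef_add)
   fix z assume z: "z \<in> carrier R"
   show "x \<oplus> y \<oplus> z = x \<oplus> (y \<oplus> z)" by (rule eqI) (simp_all add: x y z in_carrier coef_add)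
  qed (auto intro: in_carrier)
  show "monoid R"
  proof (rule monoidI)
   fix x assume x: "x \<in> carrier R"
   show "\<one> \<otimes> x = x" by (rule eqI) (simp_all add: x in_carrier coef_mult coef_one sum_delta_right)
   show "x \<otimes> \<one> = x" by (rule eqI) (simp_all add: x in_carrier coef_mult coef_one sum_delta_left)
   fix y z assume y: "y \<in> carrier R" and z: "z \<in> carrier R"
   show "x \<otimes> y \<otimes> z = x \<otimes> (y \<otimes> z)"
   proof (rule eqI)
    fix u v
    have "coef (x \<otimes> y \<otimes> z) u v = (\<Sum>w\<in>V. \<Sum>t\<in>V. coef z u w * (coef y w t * coef x t v))"
     by (simp add: x y z in_carrier coef_mult sum_distrib_left)
    also have "... = (\<Sum>t\<in>V. \<Sum>w\<in>V. coef z u w * (coef y w t * coef x t v))" by (rule sum.swap)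
    also have "... = coef (x \<otimes> (y \<otimes> z)) u v"
     by (simp add: x y z in_carrier coef_mult sum_distrib_right mult.assoc)
    finally show "coef (x \<otimes> y \<otimes> z) u v = coef (x \<otimes> (y \<otimes> z)) u v" .
   qed (simp_all add: x y z in_carrier)
  qed (auto intro: in_carrier)
  fix x y z assume x: "x \<in> carrier R" and y: "y \<in> carrier R" and z: "z \<in> carrier R"
  show "(x \<oplus> y) \<otimes> z = x \<otimes> z \<oplus> y \<otimes> z" "z \<otimes> (x \<oplus> y) = z \<otimes> x \<oplus> z \<otimes> y"
   by (rule eqI; simp add: x y z in_carrier coef_mult coef_add sum.distrib algebra_simps)+
 qed
 moreover have "c \<odot> x \<otimes> y = c \<odot> (x \<otimes> y)" "x \<otimes> (c \<odot> y) = c \<odot> (x \<otimes> y)"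
  if "x \<in> carrier R" "y \<in> carrier R" for c x y
  by (rule eqI; simp add: that in_carrier coef_mult coef_smult sum_distrib_left algebra_simps)+
 moreover have "(c + d) \<odot> x = c \<odot> x \<oplus> d \<odot> x" "(c * d) \<odot> x = c \<odot> (d \<odot> x)" "1 \<odot> x = x"
  if "x \<in> carrier R" for c d x
  by (rule eqI; simp add: that in_carrier coef_smult coef_add algebra_simps)+
 moreover have "c \<odot> (x \<oplus> y) = c \<odot> x \<oplus> c \<odot> y" if "x \<in> carrier R" "y \<in> carrier R" for c x y
  by (rule eqI; simp add: that in_carrier coef_smult coef_add algebra_simps)+
 ultimately show ?thesis unfolding k_algebra_def by (auto intro: in_carrier)
qed

sublocale kalg R by (rule kalg.intro[OF k_algebra_R])

definition E :: "'i => 'i => 'r" where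
 "E u v = (SOME x. x \<in> carrier R \<and> coef x = (%a b. if a = u \<and> b = v then 1 else 0))"

lemma
 assumes "rel u v"
 shows E_in [simp, intro]: "E u v \<in> carrier R"
  and coef_E: "coef (E u v) a b = (if a = u \<and> b = v then 1 else 0)"
proof -
 have "\<exists>x\<in>carrier R. coef x = (%a b. if a = u \<and> b = v then 1 else 0)"
  by (rule coef_surj) (auto simp: assms split: if_splits)
 then have "\<exists>x. x \<in> carrier R \<and> coef x = (%a b. if a = u \<and> b = v then 1 else 0)" by blast
 from someI_ex[OF this] have "E u v \<in> carrier R \<and> coef (E u v) = (%a b. if a = u \<and> b = v then 1 else 0)"
  unfolding E_def .
 then show "E u v \<in> carrier R" "coef (E u v) a b = (if a = u \<and> b = v then 1 else 0)" by auto
qed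

lemma E_mult: assumes "rel u w" "rel w v" shows "E w v \<otimes> E u w = E u v"
proof (rule eqI)
 fix a b
 have "(\<Sum>t\<in>V. (if a = u \<and> t = w then 1 else 0) * (if t = w \<and> b = v then 1 else 0)) =
  (\<Sum>t\<in>V. if t = w then (if a = u \<and> b = v then 1 else 0::'k) else 0)" by (rule sum.cong) auto
 then show "coef (E w v \<otimes> E u w) a b = coef (E u v) a b"
  using assms rel_trans[OF assms] rel_V finite_V by (simp add: coef_mult coef_E)
qed (use assms rel_trans[OF assms] in auto)

text \<open>Besides the corners, where \<open>u' = u\<close> and \<open>v' = v\<close>, this covers
  the passage from \<open>(u, v)\<close> to a longer path, on which the eigenvalue argument for
  bimodule homomorphisms rests.\<close>

lemma E_mult_mult: assumes x: "x \<in> carrier R" and r: "rel v v'" "rel u' u"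
 shows "coef (E v v' \<otimes> x \<otimes> E u' u) a b = (if a = u' \<and> b = v' then coef x u v else 0)"
proof -
 have V: "u \<in> V" "v \<in> V" using r rel_V by auto
 have 1: "coef (E v v' \<otimes> x) a b = (if b = v' then coef x a v else 0)" for a b
 proof -
  have "coef (E v v' \<otimes> x) a b = (\<Sum>w\<in>V. if w = v then (if b = v' then coef x a v else 0) else 0)"
   unfolding coef_mult[OF E_in[OF r(1)] x] by (rule sum.cong) (auto simp: coef_E r)
  then show ?thesis using V finite_V by simp
 qed
 have "coef (E v v' \<otimes> x \<otimes> E u' u) a b = (\<Sum>w\<in>V. if w = u then (if a = u' \<and> b = v' then coef x u v else 0) else 0)"
  unfolding coef_mult[OF m_closed[OF E_in[OF r(1)] x] E_in[OF r(2)]] 1 by (rule sum.cong) (auto simp: coef_E r)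
 then show ?thesis using V finite_V by simp
qed

lemma E_idem_mult: assumes x: "x \<in> carrier R" and uv: "rel u v"
 shows "E v v \<otimes> x \<otimes> E u u = coef x u v \<odot> E u v"
proof (rule eqI)
 have r: "rel v v" "rel u u" using uv rel_V rel_refl by auto
 show "E v v \<otimes> x \<otimes> E u u \<in> carrier R" using x r by auto
 show "coef x u v \<odot> E u v \<in> carrier R" using uv by auto
 show "coef (E v v \<otimes> x \<otimes> E u u) a b = coef (coef x u v \<odot> E u v) a b" for a b
  using E_mult_mult[OF x r] uv by (simp add: coef_smult coef_E)
qed

lemma E_idem_mult_zero: assumes x: "x \<in> carrier R" and uv: "\<not> rel u v" "u \<in> V" "v \<in> V"
 shows "E v v \<otimes> x \<otimes> E u u = \<zero>"
proof (rule eqI)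
 have r: "rel v v" "rel u u" using uv rel_refl by auto
 show "E v v \<otimes> x \<otimes> E u u \<in> carrier R" using x r by auto
 show "coef (E v v \<otimes> x \<otimes> E u u) a b = coef \<zero> a b" for a b
  using E_mult_mult[OF x r] coef_out[OF x uv(1)] by (simp add: coef_zero)
qed simp

lemma coef_finsum: "f \<in> S \<rightarrow> carrier R ==> coef (finsum R f S) u v = (\<Sum>s\<in>S. coef (f s) u v)"
proof (induction S rule: infinite_finite_induct)
 case (insert s S)
 then show ?case by (subst finsum_insert) (auto simp: coef_add)
qed (auto simp: finsum_infinite coef_zero)

lemma finite_rel: "finite {(u, v). rel u v}"
 by (rule finite_subset[of _ "V \<times> V"]) (use rel_V finite_V in auto)

lemma expansion:
 assumes x: "x \<in> carrier R" shows "x = finsum R (%(u, v). coef x u v \<odot> E u v) {(u, v). rel u v}"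
proof (rule eqI)
 have c: "(%(u, v). coef x u v \<odot> E u v) \<in> {(u, v). rel u v} \<rightarrow> carrier R" by auto
 then show "finsum R (%(u, v). coef x u v \<odot> E u v) {(u, v). rel u v} \<in> carrier R" by (rule finsum_closed)
 fix a b
 have "coef (finsum R (%(u, v). coef x u v \<odot> E u v) {(u, v). rel u v}) a b =
  (\<Sum>p\<in>{(u, v). rel u v}. if p = (a, b) then coef x a b else 0)"
  unfolding coef_finsum[OF c] by (rule sum.cong) (auto simp: coef_smult coef_E split: if_splits)
 then show "coef x a b = coef (finsum R (%(u, v). coef x u v \<odot> E u v) {(u, v). rel u v}) a b"
  using finite_rel coef_out[OF x, of a b] by (cases "rel a b") (auto simp: sum.delta)
qed (rule x)

lemma fin_dim_R: "fin_dim R"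
 unfolding fin_dim_iff kvec.fin_gen_iff
proof (intro exI[of _ "(%(u, v). E u v) ` {(u, v). rel u v}"] conjI allI impI subsetI)
 show "finite ((%(u, v). E u v) ` {(u, v). rel u v})" using finite_rel by simp
 fix N x assume N: "lsubmodule field_ring R N" "(%(u, v). E u v) ` {(u, v). rel u v} \<subseteq> N" and x: "x \<in> carrier R"
 have "finsum R (%(u, v). coef x u v \<odot> E u v) {(u, v). rel u v} \<in> N"
  by (rule kvec.lsubmodule_finsum[OF N(1)]) (use N in "auto simp: lsubmodule_def")
 then show "x \<in> N" using expansion[OF x] by simp
qed auto

sublocale fd_kalg R by unfold_locales (rule fin_dim_R)

lemma coef_minus: "x \<in> carrier R ==> coef (\<ominus> x) u v = - coef x u v"
 using coef_add[of "\<ominus> x" x u v] by (simp add: l_neg coef_zero eq_neg_iff_add_eq_0)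

lemma E_nonzero: "rel u v ==> E u v ~= \<zero>"
 using coef_E[of u v u v] coef_zero[of u v] by auto

lemma E_eq_iff: "rel u v ==> rel a b ==> E u v = E a b \<longleftrightarrow> u = a \<and> v = b"
 using coef_E[of u v u v] coef_E[of a b u v] by (auto split: if_splits)

lemma E_orth: assumes "rel u v" "rel a b" "b ~= u" shows "E u v \<otimes> E a b = \<zero>"
proof (rule eqI)
 fix c d
 have "(\<Sum>w\<in>V. coef (E a b) c w * coef (E u v) w d) = (\<Sum>w\<in>V. 0)"
  by (rule sum.cong) (use assms in "auto simp: coef_E")
 then show "coef (E u v \<otimes> E a b) c d = coef \<zero> c d" using assms by (simp add: coef_mult coef_zero)
qed (use assms in auto)

lemma inj_E: "inj_on (%v. E v v) V"
 using rel_refl by (auto simp: inj_on_def E_eq_iff)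

lemma smult_E_eq_zero: "rel u v ==> c \<odot> E u v = \<zero> \<longleftrightarrow> c = 0"
 using coef_smult[OF E_in, of u v c u v] kvec.zero_smult[of "E u v"] by (auto simp: coef_E coef_zero)

text \<open>An idempotent summand \<open>f\<close> of \<open>E v v\<close> is fixed by
  \<open>E v v\<close> on both sides, so it is a scalar multiple of \<open>E v v\<close>, and
  idempotency forces the scalar to be 0 or 1.\<close>

lemma primitive_E: assumes v: "v \<in> V" shows "primitive_idem R (E v v)"
proof -
 have r: "rel v v" using v rel_refl by simp
 have "f = \<zero> \<or> g = \<zero>" if f: "idem R f" and g: "idem R g" and fg: "f \<otimes> g = \<zero>" "g \<otimes> f = \<zero>" "f \<oplus> g = E v v" for f g
 proof -
  have c: "f \<in> carrier R" "g \<in> carrier R" and i: "f \<otimes> f = f" "g \<otimes> g = g" using f g by (auto simp: idem_def)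
  have ef: "E v v \<otimes> f = f" "f \<otimes> E v v = f"
   using c i fg by (simp_all flip: fg(3) add: l_distr r_distr)
  have fe: "f = coef f v v \<odot> E v v" using E_idem_mult[OF c(1) r] ef by simp
  have "f \<otimes> f = (coef f v v * coef f v v) \<odot> E v v"
   using fe r by (metis E_in E_mult kmult_ksmult kmult_smult ksmult_closed ksmult_mult)
  then have "coef (f \<otimes> f) v v = coef f v v * coef f v v" using r by (simp add: coef_smult coef_E)
  then have "coef f v v * (coef f v v - 1) = 0" using i by (simp add: algebra_simps)
  then have "coef f v v = 0 \<or> coef f v v = 1" by auto
  then show ?thesis
  proof
   assume "coef f v v = 0" then show ?thesis using fe r kvec.zero_smult[of "E v v"] by auto
  next
   assume "coef f v v = 1"
   then have "f = E v v" using fe r kone_smult[of "E v v"] by auto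
   then show ?thesis using fg(3) c by (metis add.l_cancel_one)
  qed
 qed
 then show ?thesis using r by (auto simp: primitive_idem_def idem_def E_mult E_nonzero)
qed

lemma complete_E: "complete_primitive_idems R ((%v. E v v) ` V)"
proof -
 have "finsum R (%e. e) ((%v. E v v) ` V) = finsum R (%v. E v v) V"
  using rel_refl by (intro finsum_reindex) (auto simp: inj_E)
 also have "... = \<one>"
 proof (rule eqI)
  have c: "(%v. E v v) \<in> V \<rightarrow> carrier R" using rel_refl by auto
  then show "finsum R (%v. E v v) V \<in> carrier R" by (rule finsum_closed)
  fix a b
  have "coef (finsum R (%v. E v v) V) a b = (\<Sum>v\<in>V. if v = a then (if a = b then 1 else 0) else 0)"
   unfolding coef_finsum[OF c] by (rule sum.cong) (use rel_refl in "auto simp: coef_E")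
  then show "coef (finsum R (%v. E v v) V) a b = coef \<one> a b" using finite_V by (simp add: coef_one)
 qed simp
 finally have one: "finsum R (%e. e) ((%v. E v v) ` V) = \<one>" .
 have "E a a \<otimes> E b b = \<zero>" if "a \<in> V" "b \<in> V" "E a a ~= E b b" for a b
  by (rule E_orth) (use that rel_refl in auto)
 then show ?thesis using finite_V primitive_E one
  by (auto simp: complete_primitive_idems_def)
qed

text \<open>A homomorphism from \<open>R (E u u)\<close> is determined by the image of
  \<open>E u u\<close>, which lies in the corner \<open>(E u u) R (E v v)\<close>; this corner
  vanishes unless there is a path from \<open>v\<close> to \<open>u\<close>.\<close>

lemma mod_iso_E_rel:
 assumes u: "u \<in> V" and v: "v \<in> V" and \<phi>: "\<phi> \<in> mod_iso R (left_principal R (E u u)) (left_principal R (E v v))"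
 shows "rel v u"
proof (rule ccontr)
 assume nr: "\<not> rel v u"
 have r: "rel u u" "rel v v" using u v rel_refl by auto
 have lu: "left_module R (left_principal R (E u u))" "left_module R (left_principal R (E v v))"
  using r by (auto intro!: left_module_left_principal)
 have e: "E u u \<in> carrier (left_principal R (E u u))" using r by (auto intro!: exI[of _ \<one>])
 have h: "\<phi> \<in> mod_hom R (left_principal R (E u u)) (left_principal R (E v v))" by (rule mod_iso_hom[OF \<phi>])
 obtain a where a: "a \<in> carrier R" "\<phi> (E u u) = a \<otimes> E v v" using mod_homD(1)[OF h e] by auto
 have "\<phi> (E u u) = \<phi> (E u u \<otimes> E u u)" using r by (simp add: E_mult)
 also have "... = E u u \<otimes> \<phi> (E u u)" using mod_homD(3)[OF h _ e, of "E u u"] r by simp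
 also have "... = E u u \<otimes> a \<otimes> E v v" using a r by (simp add: m_assoc)
 also have "... = \<zero>" using E_idem_mult_zero[OF a(1) nr v u] by simp
 finally have "\<phi> (E u u) = \<phi> \<zero>" using mod_hom_zero[OF lu h] by simp
 moreover have "\<zero> \<in> carrier (left_principal R (E u u))" using r by (auto intro!: exI[of _ \<zero>])
 ultimately have "E u u = \<zero>" using mod_iso_bij[OF \<phi>] e by (auto simp: bij_betw_def inj_on_def)
 then show False using E_nonzero r by blast
qed

text \<open>An isomorphism and its inverse give \<open>rel\<close> in both directions, so by
  antisymmetry distinct vertices have non-isomorphic projectives.\<close>

lemma basic_R: "basic_fd_algebra R"
proof -
 have "mod_iso R (left_principal R (E u u)) (left_principal R (E v v)) = {}" if uv: "u \<in> V" "v \<in> V" "u ~= v" for u v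
 proof (rule ccontr)
  assume "mod_iso R (left_principal R (E u u)) (left_principal R (E v v)) ~= {}"
  then obtain \<phi> where \<phi>: "\<phi> \<in> mod_iso R (left_principal R (E u u)) (left_principal R (E v v))" by blast
  have "left_module R (left_principal R (E u u))" using uv rel_refl by (intro left_module_left_principal) auto
  from mod_iso_E_rel[OF uv(2,1) mod_iso_inverse[OF this \<phi>]] mod_iso_E_rel[OF uv(1,2) \<phi>]
  show False using rel_antisym uv(3) by blast
 qed
 then show ?thesis unfolding basic_fd_algebra_def using k_algebra_R fin_dim_R complete_E
  by (intro conjI exI[of _ "(%v. E v v) ` V"]) auto
qed

subsection \<open>The radical and the quiver\<close>

text \<open>The span of the \<open>E u v\<close> with \<open>u\<close> different from
  \<open>v\<close>; it turns out to be the Jacobson radical.\<close>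

definition diag_zero :: "'r set" where "diag_zero = {x \<in> carrier R. \<forall>u. coef x u u = 0}"

text \<open>By antisymmetry only \<open>w = u\<close> lies between \<open>u\<close> and
  \<open>u\<close>. Hence the diagonal coefficient at a vertex is a character of the
  algebra.\<close>

lemma coef_mult_diag: assumes "x \<in> carrier R" "y \<in> carrier R"
 shows "coef (x \<otimes> y) u u = coef y u u * coef x u u"
proof (cases "u \<in> V")
 case True
 have "(\<Sum>w\<in>V. coef y u w * coef x w u) = (\<Sum>w\<in>V. if w = u then coef y u u * coef x u u else 0)"
 proof (rule sum.cong)
  fix w
  show "coef y u w * coef x w u = (if w = u then coef y u u * coef x u u else 0)"
   using coef_rel[OF assms(2), of u w] coef_rel[OF assms(1), of w u] rel_antisym[of u w] by auto
 qed simp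
 then show ?thesis using assms True finite_V by (simp add: coef_mult)
next
 case False
 then have "\<not> rel u u" using rel_V by blast
 then show ?thesis using coef_out assms by (auto simp: in_carrier)
qed

lemma left_ideal_subgroup: assumes "left_ideal R L"
 shows "\<zero> \<in> L" "x \<in> L ==> y \<in> L ==> x \<oplus> y \<in> L" "x \<in> L ==> r \<in> carrier R ==> r \<otimes> x \<in> L" "L \<subseteq> carrier R"
  "x \<in> L ==> \<ominus> x \<in> L"
proof -
 interpret L: additive_subgroup L R using assms by (simp add: left_ideal_def)
 show "\<zero> \<in> L" "x \<in> L ==> y \<in> L ==> x \<oplus> y \<in> L" "L \<subseteq> carrier R" "x \<in> L ==> \<ominus> x \<in> L"
  using L.a_subset by auto
 show "x \<in> L ==> r \<in> carrier R ==> r \<otimes> x \<in> L" using assms by (simp add: left_ideal_def)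
qed

lemma left_idealI: assumes "L \<subseteq> carrier R" "\<zero> \<in> L" "!!x y. x \<in> L ==> y \<in> L ==> x \<oplus> y \<in> L"
  "!!r x. r \<in> carrier R ==> x \<in> L ==> r \<otimes> x \<in> L"
 shows "left_ideal R L"
proof -
 have "\<ominus> x \<in> L" if "x \<in> L" for x
  using assms(4)[of "\<ominus> \<one>" x] that assms(1) by (auto simp: l_minus)
 then have "subgroup L (add_monoid R)"
  using assms by (intro add.subgroupI) (auto simp: a_inv_def)
 then show ?thesis using assms(4) by (simp add: left_ideal_def additive_subgroup_def)
qed

lemma left_ideal_finsum:
 assumes "left_ideal R L" "!!s. s \<in> S ==> f s \<in> L" shows "finsum R f S \<in> L"
 using assms(2)
proof (induction S rule: infinite_finite_induct)
 case (insert s S)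
 have "f \<in> insert s S \<rightarrow> carrier R" using insert left_ideal_subgroup(4)[OF assms(1)] by auto
 then have "finsum R f (insert s S) = f s \<oplus> finsum R f S" using insert by (intro finsum_insert) auto
 then show ?case using insert left_ideal_subgroup(2)[OF assms(1)] by simp
qed (simp_all add: finsum_infinite left_ideal_subgroup(1)[OF assms(1)])

text \<open>
  A left ideal \<open>L\<close> with \<open>1 - n \<in> L\<close>, \<open>n\<close> with zero diagonal, contains all vertex idempotents, by
  induction along the order.
\<close>

lemma left_ideal_unipotent:
 assumes L: "left_ideal R L" and n: "n \<in> diag_zero" and l: "\<one> \<oplus> n \<in> L"
 shows "L = carrier R"
proof -
 note Ls = left_ideal_subgroup[OF L]
 have nR: "n \<in> carrier R" and nd: "!!u. coef n u u = 0" using n by (auto simp: diag_zero_def)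
 let ?S = "{(u, w). rel u w \<and> u ~= w}"
 have "wf ?S"
 proof (rule finite_acyclic_wf)
  show "finite ?S" by (rule finite_subset[OF _ finite_rel]) auto
  have "trans ?S" using rel_trans rel_antisym by (auto simp: trans_def)
  then show "acyclic ?S" by (auto simp: acyclic_def trancl_id)
 qed
 have Ew: "w \<in> V --> E w w \<in> L" for w
 proof (induction w rule: wf_induct[OF \<open>wf ?S\<close>])
  case (1 w)
  show ?case
  proof
   assume w: "w \<in> V"
   have r: "rel w w" using w rel_refl by simp
   \<comment> \<open>This sum is \<open>E w w\<close> times \<open>n\<close>. Each of its terms is a
     left multiple of some \<open>E u u\<close> with \<open>u\<close> strictly before
     \<open>w\<close>, hence lies in \<open>L\<close> by induction, and can be subtracted to leave
     \<open>E w w\<close>.\<close>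
   let ?s = "finsum R (%u. coef n u w \<odot> E u w) {u. rel u w \<and> u ~= w}"
   have f: "(%u. coef n u w \<odot> E u w) \<in> {u. rel u w \<and> u ~= w} \<rightarrow> carrier R" by auto
   have fin: "finite {u. rel u w \<and> u ~= w}" by (rule finite_subset[OF _ finite_V]) (use rel_V in auto)
   have m: "coef n u w \<odot> E u w \<in> L" if "u \<in> {u. rel u w \<and> u ~= w}" for u
   proof -
    have u: "rel u w" "u ~= w" "u \<in> V" "rel u u" using that rel_V rel_refl by auto
    then have "E u u \<in> L" using 1 by auto
    then have "(coef n u w \<odot> E u w) \<otimes> E u u \<in> L" using u by (intro Ls(3)) auto
    moreover have "(coef n u w \<odot> E u w) \<otimes> E u u = coef n u w \<odot> E u w"
     using u by (simp add: ksmult_mult E_mult)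
    ultimately show ?thesis by simp
   qed
   have s: "?s \<in> L" using m by (rule left_ideal_finsum[OF L])
   have eq: "E w w \<otimes> n = ?s"
   proof (rule eqI)
    show "?s \<in> carrier R" using f by (rule finsum_closed)
    fix a b
    have "(\<Sum>t\<in>V. coef n a t * coef (E w w) t b) = (\<Sum>t\<in>V. if t = w then (if b = w then coef n a w else 0) else 0)"
     by (rule sum.cong) (auto simp: coef_E r)
    then have 1: "coef (E w w \<otimes> n) a b = (if b = w then coef n a w else 0)"
     using w finite_V r nR by (simp add: coef_mult)
    have "coef ?s a b = (\<Sum>u\<in>{u. rel u w \<and> u ~= w}. if u = a then (if b = w then coef n a w else 0) else 0)"
     unfolding coef_finsum[OF f] by (rule sum.cong) (auto simp: coef_E coef_smult)
    also have "... = (if b = w then coef n a w else 0)"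
     using fin coef_out[OF nR, of a w] nd[of w] by (auto simp: sum.delta)
    finally show "coef (E w w \<otimes> n) a b = coef ?s a b" using 1 by simp
   qed (use r nR in auto)
   have "E w w \<otimes> (\<one> \<oplus> n) \<in> L" using l r by (intro Ls(3)) auto
   then have "E w w \<oplus> ?s \<in> L" using r nR eq by (simp add: r_distr)
   have "E w w \<oplus> t \<in> L ==> t \<in> L ==> E w w \<in> L" for t
   proof -
    assume t: "E w w \<oplus> t \<in> L" "t \<in> L"
    then have "E w w \<oplus> t \<oplus> \<ominus> t \<in> L" by (rule Ls(2)[OF _ Ls(5)])
    moreover have "E w w \<oplus> t \<oplus> \<ominus> t = E w w" using subsetD[OF Ls(4) t(2)] r by (simp add: a_assoc r_neg)
    ultimately show ?thesis by simp
   qed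
   from this[OF \<open>E w w \<oplus> ?s \<in> L\<close> s] show "E w w \<in> L" .
  qed
 qed
 have "finsum R (%e. e) ((%v. E v v) ` V) \<in> L" by (rule left_ideal_finsum[OF L]) (use Ew in auto)
 then have "\<one> \<in> L" using complete_E by (simp add: complete_primitive_idems_def)
 then show ?thesis using Ls(3,4) by (metis r_one subsetI subset_antisym)
qed

text \<open>The kernel of the diagonal character at \<open>u\<close> is a maximal left ideal, which
  bounds the radical from above. Conversely, a maximal left ideal missing some \<open>x\<close> in
  \<open>diag_zero\<close> would together with \<open>diag_zero\<close> give everything, hence
  contain \<open>1 - n\<close> with \<open>n\<close> in \<open>diag_zero\<close>, against
  \<open>left_ideal_unipotent\<close>.\<close>

lemma jacobson_radical_eq: "jacobson_radical R = diag_zero"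
proof
 show "jacobson_radical R \<subseteq> diag_zero"
 proof
  fix x assume x: "x \<in> jacobson_radical R"
  then have xR: "x \<in> carrier R" by (simp add: jacobson_radical_def)
  have "coef x u u = 0" for u
  proof (cases "u \<in> V")
   case True
   then have r: "rel u u" by (rule rel_refl)
   let ?L = "{x \<in> carrier R. coef x u u = 0}"
   have L: "left_ideal R ?L"
    by (rule left_idealI) (auto simp: coef_zero coef_add coef_mult_diag)
   have ne: "?L ~= carrier R" using coef_E[OF r, of u u] E_in[OF r] by force
   have "L' = ?L \<or> L' = carrier R" if L': "left_ideal R L'" "?L \<subseteq> L'" for L'
   proof (rule disjCI)
    note L's = left_ideal_subgroup[OF L'(1)]
    assume "L' ~= carrier R"
    have "y \<in> ?L" if y: "y \<in> L'" for y
    proof (rule ccontr)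
     assume "y \<notin> ?L"
     then have c: "coef y u u ~= 0" and yR: "y \<in> carrier R" using y L's(4) by auto
     \<comment> \<open>Scaled to have diagonal coefficient 1 at \<open>u\<close>, so that
       subtracting a multiple of it moves any \<open>z\<close> into the kernel.\<close>
     let ?y = "inverse (coef y u u) \<odot> y"
     have "(inverse (coef y u u) \<odot> \<one>) \<otimes> y \<in> L'" using y by (intro L's(3)) auto
     then have y': "?y \<in> L'" using yR by (simp add: sc_mult)
     have "z \<in> L'" if z: "z \<in> carrier R" for z
     proof -
      let ?c = "coef z u u \<odot> ?y"
      have "(coef z u u \<odot> \<one>) \<otimes> ?y \<in> L'" using y' by (intro L's(3)) auto
      then have 1: "?c \<in> L'" using yR by (simp add: sc_mult)
      have "z \<oplus> \<ominus> ?c \<in> ?L" using z yR c by (simp add: coef_add coef_minus coef_smult)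
      then have "z \<oplus> \<ominus> ?c \<in> L'" using L'(2) by blast
      then have "z \<oplus> \<ominus> ?c \<oplus> ?c \<in> L'" using 1 by (rule L's(2))
      then show ?thesis using z yR by (simp add: a_assoc l_neg)
     qed
     then show False using \<open>L' ~= carrier R\<close> L's(4) by blast
    qed
    then show "L' = ?L" using L'(2) by blast
   qed
   then have "x \<in> ?L" using x L ne unfolding jacobson_radical_def by blast
   then show ?thesis by simp
  next
   case False
   then show ?thesis using coef_out[OF xR] rel_V by blast
  qed
  then show "x \<in> diag_zero" using xR by (simp add: diag_zero_def)
 qed
next
 show "diag_zero \<subseteq> jacobson_radical R"
 proof
  fix x assume x: "x \<in> diag_zero"
  then have xR: "x \<in> carrier R" by (simp add: diag_zero_def)
  have "x \<in> L" if L: "left_ideal R L" "L ~= carrier R" "\<forall>L'. left_ideal R L' \<and> L \<subseteq> L' --> L' = L \<or> L' = carrier R" for L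
  proof (rule ccontr)
   assume xL: "x \<notin> L"
   note Ls = left_ideal_subgroup[OF L(1)]
   \<comment> \<open>The left ideal \<open>L + diag_zero\<close>; it contains \<open>x\<close>, so
     by maximality of \<open>L\<close> it is the whole algebra.\<close>
   let ?M = "{l \<oplus> n | l n. l \<in> L \<and> n \<in> diag_zero}"
   have dz: "\<zero> \<in> diag_zero" "!!a b. a \<in> diag_zero ==> b \<in> diag_zero ==> a \<oplus> b \<in> diag_zero"
    "!!r a. r \<in> carrier R ==> a \<in> diag_zero ==> r \<otimes> a \<in> diag_zero" "!!a. a \<in> diag_zero ==> \<ominus> a \<in> diag_zero"
    "!!a. a \<in> diag_zero ==> a \<in> carrier R"
    by (auto simp: diag_zero_def coef_zero coef_add coef_mult_diag coef_minus)
   have "left_ideal R ?M"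
   proof (rule left_idealI)
    show "?M \<subseteq> carrier R" using Ls(4) dz(5) by auto
    show "\<zero> \<in> ?M" using Ls(1) dz(1) by (intro CollectI exI[of _ \<zero>]) auto
    fix a b assume "a \<in> ?M" "b \<in> ?M"
    then obtain l n l' n' where ab: "a = l \<oplus> n" "b = l' \<oplus> n'" "l \<in> L" "n \<in> diag_zero" "l' \<in> L" "n' \<in> diag_zero" by blast
    then have "l \<in> carrier R" "l' \<in> carrier R" "n \<in> carrier R" "n' \<in> carrier R" using Ls(4) dz(5) by auto
    then have "a \<oplus> b = (l \<oplus> l') \<oplus> (n \<oplus> n')" using ab by (simp add: a_ac)
    then show "a \<oplus> b \<in> ?M" using ab Ls(2) dz(2) by blast
   next
    fix r a assume r: "r \<in> carrier R" and "a \<in> ?M"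
    then obtain l n where a: "a = l \<oplus> n" "l \<in> L" "n \<in> diag_zero" by blast
    then have "r \<otimes> a = r \<otimes> l \<oplus> r \<otimes> n" using r Ls(4) dz(5) by (auto intro!: r_distr)
    then show "r \<otimes> a \<in> ?M" using a r Ls(3) dz(3) by blast
   qed
   moreover have "L \<subseteq> ?M"
   proof
    fix l assume "l \<in> L" then show "l \<in> ?M" using dz(1) Ls(4)
     by (intro CollectI exI[of _ l] exI[of _ \<zero>]) auto
   qed
   moreover have "x \<in> ?M" using x xR Ls(1) by (intro CollectI exI[of _ \<zero>] exI[of _ x]) auto
   ultimately have "?M = carrier R" using L(3) xL by blast
   then have "\<one> \<in> ?M" by simp
   then obtain l n where ln: "\<one> = l \<oplus> n" "l \<in> L" "n \<in> diag_zero" by blast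
   have c: "l \<in> carrier R" "n \<in> carrier R" using ln Ls(4) dz(5) by auto
   have "\<one> \<oplus> \<ominus> n = l" unfolding ln(1) using c by (simp add: a_assoc r_neg)
   then have "L = carrier R" using left_ideal_unipotent[OF L(1) dz(4)[OF ln(3)]] ln(2) by simp
   then show False using L(2) by blast
  qed
  then show "x \<in> jacobson_radical R" using xR by (simp add: jacobson_radical_def)
 qed
qed

text \<open>A nonzero coefficient of a product comes from a path through some \<open>w\<close>, and
  the vanishing diagonals rule out both ends as \<open>w\<close>.\<close>

lemma ideal_prod_diag_zero:
 assumes "x \<in> ideal_prod R diag_zero diag_zero"
 shows "x \<in> carrier R \<and> (\<forall>u v. coef x u v ~= 0 --> (\<exists>w. rel u w \<and> rel w v \<and> w ~= u \<and> w ~= v))"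
 using assms
proof (induction rule: ideal_prod.induct)
 case (prod x y)
 then have xy: "x \<in> carrier R" "y \<in> carrier R" and d: "!!u. coef x u u = 0" "!!u. coef y u u = 0"
  by (auto simp: diag_zero_def)
 have "\<exists>w. rel u w \<and> rel w v \<and> w ~= u \<and> w ~= v" if nz: "coef (x \<otimes> y) u v ~= 0" for u v
 proof -
  have "\<exists>w\<in>V. coef y u w * coef x w v ~= 0"
   using nz xy by (metis (no_types, lifting) coef_mult sum.neutral)
  then obtain w where "coef y u w ~= 0" "coef x w v ~= 0" by auto
  then show ?thesis using coef_rel xy d by metis
 qed
 then show ?case using xy by auto
next
 case (sum x y)
 have "\<exists>w. rel u w \<and> rel w v \<and> w ~= u \<and> w ~= v" if "coef (x \<oplus> y) u v ~= 0" for u v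
 proof -
  have "coef x u v ~= 0 \<or> coef y u v ~= 0" using that sum by (auto simp: coef_add)
  then show ?thesis using sum.IH by blast
 qed
 then show ?case using sum by auto
qed

definition cov :: "'i => 'i => bool" where
 "cov u v \<longleftrightarrow> rel u v \<and> u ~= v \<and> \<not> (\<exists>w. rel u w \<and> rel w v \<and> w ~= u \<and> w ~= v)"

lemma E_mem_diag_zero: "rel u v ==> u ~= v ==> c \<odot> E u v \<in> diag_zero"
 by (auto simp: diag_zero_def coef_smult coef_E)

lemma zero_mem_diag_zero: "\<zero> \<in> diag_zero" by (simp add: diag_zero_def coef_zero)

lemma quot_dim_empty: assumes "U \<subseteq> W" "U \<subseteq> carrier R" shows "quot_dim R U W 0"
proof -
 have "x \<ominus> \<zero> \<in> W" if "x \<in> U" for x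
 proof -
  have "x \<in> carrier R" "x \<in> W" using assms that by auto
  then show ?thesis by (simp add: minus_eq)
 qed
 then show ?thesis unfolding quot_dim_def
  by (intro exI[of _ "{}"]) auto
qed

text \<open>The corner of the radical is spanned by \<open>E u v\<close> when there is a path from
  \<open>u\<close> to a different \<open>v\<close>, and is zero otherwise. In the former case it
  lies in the square of the radical exactly when some \<open>w\<close> is strictly between, because
  \<open>E u v\<close> is then the product of \<open>E w v\<close> and \<open>E u w\<close>.\<close>

lemma quot_dim_corner:
 assumes u: "u \<in> V" and v: "v \<in> V"
 shows "quot_dim R (corner R (E v v) (jacobson_radical R) (E u u))
   (corner R (E v v) (ideal_prod R (jacobson_radical R) (jacobson_radical R)) (E u u)) (if cov u v then 1 else 0)"
proof -
 have r: "rel u u" "rel v v" using u v rel_refl by auto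
 let ?U = "corner R (E v v) diag_zero (E u u)"
 let ?W = "corner R (E v v) (ideal_prod R diag_zero diag_zero) (E u u)"
 have dzR: "x \<in> diag_zero ==> x \<in> carrier R" for x by (simp add: diag_zero_def)
 have U: "?U \<subseteq> carrier R" using r dzR by (auto simp: corner_def)
 have zero_W: "\<zero> \<in> ?W"
 proof -
  have "\<zero> \<otimes> \<zero> \<in> ideal_prod R diag_zero diag_zero" by (intro ideal_prod.prod zero_mem_diag_zero)
  then show ?thesis using r by (auto simp: corner_def intro!: exI[of _ \<zero>])
 qed
 consider "cov u v" | "\<not> rel u v \<or> u = v" | w where "rel u w" "rel w v" "w ~= u" "w ~= v" "u ~= v"
  unfolding cov_def by blast
 then show ?thesis unfolding jacobson_radical_eq
 proof cases
  case 1
  then have uv: "rel u v" "u ~= v" by (auto simp: cov_def)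
  have Ue: "?U = {c \<odot> E u v | c. True}"
  proof
   show "?U \<subseteq> {c \<odot> E u v | c. True}" using dzR by (auto simp: corner_def E_idem_mult uv)
   show "{c \<odot> E u v | c. True} \<subseteq> ?U"
   proof clarify
    fix c
    have "E v v \<otimes> (c \<odot> E u v) \<otimes> E u u = c \<odot> E u v"
     using uv by (simp add: E_idem_mult coef_smult coef_E)
    then show "c \<odot> E u v \<in> ?U" using E_mem_diag_zero[OF uv, of c] unfolding corner_def
     by (intro CollectI exI[of _ "c \<odot> E u v"]) simp
   qed
  qed
  have We: "?W = {\<zero>}"
  proof -
   have "x = \<zero>" if "x \<in> ?W" for x
   proof -
    obtain y where y: "y \<in> ideal_prod R diag_zero diag_zero" "x = E v v \<otimes> y \<otimes> E u u" using \<open>x \<in> ?W\<close> by (auto simp: corner_def)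
    have yR: "y \<in> carrier R" and y0: "coef y u v = 0" using ideal_prod_diag_zero[OF y(1)] 1 by (auto simp: cov_def)
    show ?thesis using y(2) E_idem_mult[OF yR uv(1)] y0 uv kvec.zero_smult[of "E u v"] by simp
   qed
   then show ?thesis using zero_W by blast
  qed
  have ER: "E u v \<in> carrier R" using uv by blast
  have fs: "finsum R (%b. c b \<odot> b) {E u v} = c (E u v) \<odot> E u v" for c
   using ER by (simp add: finsum_insert[of "{}"])
  have "\<exists>!c. c \<in> {E u v} \<rightarrow>\<^sub>E UNIV \<and> x \<ominus> finsum R (%b. c b \<odot> b) {E u v} \<in> ?W" if "x \<in> ?U" for x
  proof -
   obtain d where d: "x = d \<odot> E u v" using \<open>x \<in> ?U\<close> Ue by blast
   have "x \<ominus> c \<odot> E u v = (d - c) \<odot> E u v" for c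
    using ER kadd_smult[OF ER, of "d - c" c] d by (simp add: minus_eq a_assoc r_neg)
   then have *: "x \<ominus> c \<odot> E u v \<in> ?W \<longleftrightarrow> c = d" for c using We smult_E_eq_zero[OF uv(1)] by auto
   show ?thesis unfolding fs *
   proof (rule ex1I[of _ "\<lambda>b\<in>{E u v}. d"])
    fix c assume "c \<in> {E u v} \<rightarrow>\<^sub>E UNIV \<and> c (E u v) = d"
    then show "c = (\<lambda>b\<in>{E u v}. d)" by (auto simp: fun_eq_iff PiE_def extensional_def)
   qed auto
  qed
  moreover have "E u v \<in> ?U" unfolding Ue by (intro CollectI exI[of _ 1]) (simp add: kone_smult[OF ER])
  ultimately show "quot_dim R ?U ?W (if cov u v then 1 else 0)" unfolding quot_dim_def using 1
   by (intro exI[of _ "{E u v}"]) auto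
 next
  case 2
  have "x = \<zero>" if "x \<in> ?U" for x
  proof -
   obtain y where y: "y \<in> diag_zero" "x = E v v \<otimes> y \<otimes> E u u" using \<open>x \<in> ?U\<close> by (auto simp: corner_def)
   show ?thesis
   proof (cases "rel u v")
    case True
    then show ?thesis using 2 y E_idem_mult[OF dzR[OF y(1)] True] kvec.zero_smult[of "E u v"]
     by (simp add: diag_zero_def)
   next
    case False
    then show ?thesis using y E_idem_mult_zero[OF dzR[OF y(1)] False u v] by simp
   qed
  qed
  then have "?U \<subseteq> ?W" using zero_W by blast
  moreover have "\<not> cov u v" using 2 by (auto simp: cov_def)
  ultimately show "quot_dim R ?U ?W (if cov u v then 1 else 0)" using quot_dim_empty[OF _ U] by simp
 next
  case 3
  have uv: "rel u v" using 3 rel_trans by blast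
  have "?U \<subseteq> ?W"
  proof
   fix x assume "x \<in> ?U"
   then obtain y where y: "y \<in> carrier R" "x = E v v \<otimes> y \<otimes> E u u" using dzR by (auto simp: corner_def)
   let ?p = "(coef y u v \<odot> E w v) \<otimes> (1 \<odot> E u w)"
   have p: "?p \<in> ideal_prod R diag_zero diag_zero" using 3 by (intro ideal_prod.prod E_mem_diag_zero) auto
   have pe: "?p = coef y u v \<odot> E u v" using 3 by (simp add: kone_smult ksmult_mult E_mult)
   have "E v v \<otimes> ?p \<otimes> E u u = x" unfolding pe y(2) E_idem_mult[OF y(1) uv]
    using uv by (simp add: E_idem_mult coef_smult coef_E)
   then show "x \<in> ?W" using p unfolding corner_def by force
  qed
  moreover have "\<not> cov u v" using 3 by (auto simp: cov_def)
  ultimately show "quot_dim R ?U ?W (if cov u v then 1 else 0)" using quot_dim_empty[OF _ U] by simp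
 qed
qed

lemma quiver_of_algebra_R:
 assumes "fin_digraph G" "verts G = V"
  and "!!u v. u \<in> V ==> v \<in> V ==> card {a \<in> arcs G. tail G a = u \<and> head G a = v} = (if cov u v then 1 else 0)"
  and "!!v. v \<in> V ==> e v = E v v"
 shows "quiver_of_algebra R G e"
proof -
 have "e ` V = (%v. E v v) ` V" using assms(4) by auto
 moreover have "inj_on e V" using inj_E assms(4) by (simp add: inj_on_def)
 ultimately show ?thesis unfolding quiver_of_algebra_def assms(2)
  using assms complete_E quot_dim_corner by auto
qed

subsection \<open>Ideals and bimodule homomorphisms\<close>

text \<open>Ideals correspond to sets of pairs closed under prolonging paths at both ends;
  \<open>supp\<close> and \<open>idl\<close> are the two directions.\<close>

definition supp :: "'r set => ('i \<times> 'i) set" where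
 "supp I = {(u, v). rel u v \<and> E u v \<in> I}"

definition idl :: "('i \<times> 'i) set => 'r set" where
 "idl U = {x \<in> carrier R. \<forall>u v. coef x u v ~= 0 --> (u, v) \<in> U}"

lemma ideal_smult: assumes "ideal I R" "x \<in> I" shows "c \<odot> x \<in> I"
proof -
 interpret I: ideal I R by fact
 show ?thesis using I.I_l_closed[OF assms(2), of "c \<odot> \<one>"] I.Icarr[OF assms(2)] by (simp add: sc_mult)
qed

text \<open>Cutting \<open>x\<close> down to the corner at \<open>(u, v)\<close> leaves
  \<open>E u v\<close> times the nonzero coefficient, which can be inverted.\<close>

lemma ideal_coef_E: assumes I: "ideal I R" and x: "x \<in> I" and nz: "coef x u v ~= 0"
 shows "E u v \<in> I"
proof -
 interpret I: ideal I R by fact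
 have xR: "x \<in> carrier R" using x by (rule I.Icarr)
 have uv: "rel u v" using coef_rel[OF xR nz] .
 then have "rel u u" "rel v v" using rel_V rel_refl by blast+
 then have "E v v \<otimes> x \<otimes> E u u \<in> I" using x by (intro I.I_l_closed I.I_r_closed) auto
 then have "inverse (coef x u v) \<odot> (coef x u v \<odot> E u v) \<in> I"
  using E_idem_mult[OF xR uv] ideal_smult[OF I] by simp
 then show ?thesis using uv nz kmult_smult[OF E_in[OF uv], of "inverse (coef x u v)" "coef x u v"]
  by (simp add: kone_smult)
qed

lemma lsubmodule_E_span:
 assumes N: "lsubmodule field_ring R N" and x: "x \<in> carrier R" "!!u v. coef x u v ~= 0 ==> E u v \<in> N"
 shows "x \<in> N"
proof -
 have "finsum R (%(u, v). coef x u v \<odot> E u v) {(u, v). rel u v} \<in> N"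
 proof (rule kvec.lsubmodule_finsum[OF N])
  fix p assume "p \<in> {(u, v). rel u v}"
  then obtain u v where p: "p = (u, v)" "rel u v" by auto
  show "(case p of (u, v) => coef x u v \<odot> E u v) \<in> N"
  proof (cases "coef x u v = 0")
   case True
   then show ?thesis using p N kvec.zero_smult[of "E u v"] by (auto simp: lsubmodule_def)
  next
   case False
   then show ?thesis using p N x(2) by (auto simp: lsubmodule_def)
  qed
 qed
 then show ?thesis using expansion[OF x(1)] by simp
qed

lemma lsubmodule_ideal: assumes I: "ideal I R" shows "lsubmodule field_ring R I"
proof -
 interpret I: ideal I R by fact
 show ?thesis unfolding lsubmodule_def using I.a_subset I.zero_closed I.a_closed ideal_smult[OF I] by auto
qed

lemma ideal_mem_iff: assumes I: "ideal I R"
 shows "x \<in> I \<longleftrightarrow> x \<in> carrier R \<and> (\<forall>u v. coef x u v ~= 0 --> (u, v) \<in> supp I)"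
proof
 assume x: "x \<in> I"
 then have "x \<in> carrier R" using I ideal.Icarr by metis
 then show "x \<in> carrier R \<and> (\<forall>u v. coef x u v ~= 0 --> (u, v) \<in> supp I)"
  using ideal_coef_E[OF I x] coef_rel by (auto simp: supp_def)
next
 assume "x \<in> carrier R \<and> (\<forall>u v. coef x u v ~= 0 --> (u, v) \<in> supp I)"
 then have x: "x \<in> carrier R" "!!u v. coef x u v ~= 0 ==> E u v \<in> I" by (auto simp: supp_def)
 show "x \<in> I" by (rule lsubmodule_E_span[OF lsubmodule_ideal[OF I] x])
qed

lemma idl_supp: "ideal I R ==> idl (supp I) = I"
 using ideal_mem_iff by (auto simp: idl_def)

lemma supp_upclosed: assumes I: "ideal I R" and uv: "(u, v) \<in> supp I" and r: "rel u' u" "rel v v'"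
 shows "(u', v') \<in> supp I" "E u' v' = E v v' \<otimes> E u v \<otimes> E u' u"
proof -
 interpret I: ideal I R by fact
 have "rel u v" "E u v \<in> I" using uv by (auto simp: supp_def)
 then have "E v v' \<otimes> E u v \<otimes> E u' u \<in> I" "rel u v'" "rel u' v'"
  using r rel_trans[OF \<open>rel u v\<close> r(2)] rel_trans[OF r(1)]
   I.I_r_closed[OF I.I_l_closed[OF \<open>E u v \<in> I\<close> E_in[OF r(2)]] E_in[OF r(1)]] by auto
 moreover have "E v v' \<otimes> E u v \<otimes> E u' u = E u' v'"
  using \<open>rel u v\<close> \<open>rel u v'\<close> r by (simp add: E_mult)
 ultimately show "(u', v') \<in> supp I" "E u' v' = E v v' \<otimes> E u v \<otimes> E u' u" by (auto simp: supp_def)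
qed

lemma ideal_idl:
 assumes up: "!!u v u' v'. (u, v) \<in> U ==> rel u' u ==> rel v v' ==> (u', v') \<in> U"
 shows "ideal (idl U) R"
proof (rule idealI[OF ring_axioms])
 show "subgroup (idl U) (add_monoid R)"
 proof (rule add.subgroupI)
  show "idl U ~= {}" using zero_in by (auto simp: idl_def coef_zero intro!: exI[of _ \<zero>])
  fix x y assume xy: "x \<in> idl U" "y \<in> idl U"
  then have "coef x u v + coef y u v ~= 0 ==> coef x u v ~= 0 \<or> coef y u v ~= 0" for u v by auto
  then show "x \<oplus> y \<in> idl U" using xy by (fastforce simp: idl_def coef_add)
 qed (auto simp: idl_def coef_minus a_inv_def[symmetric])
next
 fix x y assume x: "x \<in> idl U" and y: "y \<in> carrier R"
 then have xR: "x \<in> carrier R" by (simp add: idl_def)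
 have "(u, v) \<in> U" if nz: "coef (y \<otimes> x) u v ~= 0" for u v
 proof -
  have "\<exists>w\<in>V. coef x u w * coef y w v ~= 0"
   using nz xR y by (metis (no_types, lifting) coef_mult sum.neutral)
  then obtain w where w: "coef x u w ~= 0" "coef y w v ~= 0" by auto
  then have "(u, w) \<in> U" "rel w v" "rel u u" using x y coef_rel rel_V rel_refl xR by (auto simp: idl_def, blast)
  then show ?thesis using up by blast
 qed
 then show "y \<otimes> x \<in> idl U" using xR y by (simp add: idl_def)
 have "(u, v) \<in> U" if nz: "coef (x \<otimes> y) u v ~= 0" for u v
 proof -
  have "\<exists>w\<in>V. coef y u w * coef x w v ~= 0"
   using nz xR y by (metis (no_types, lifting) coef_mult sum.neutral)
  then obtain w where w: "coef y u w ~= 0" "coef x w v ~= 0" by auto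
  then have "(w, v) \<in> U" "rel u w" "rel v v" using x y coef_rel rel_V rel_refl xR by (auto simp: idl_def, blast)
  then show ?thesis using up by blast
 qed
 then show "x \<otimes> y \<in> idl U" using xR y by (simp add: idl_def)
qed

text \<open>An ideal is determined by its support. Finiteness allows induction on the number of
  smaller ideals and makes the ideal quiver finite.\<close>

lemma finite_ideals: "finite {I. ideal I R}"
proof (rule finite_imageD)
 show "finite (supp ` {I. ideal I R})"
  by (rule finite_subset[of _ "Pow {(u, v). rel u v}"]) (use finite_rel in "auto simp: supp_def")
 show "inj_on supp {I. ideal I R}" by (rule inj_onI) (metis idl_supp mem_Collect_eq)
qed

sublocale fd_kalg_ideals R
proof
 fix I assume I: "ideal I R"
 show "\<exists>B. finite B \<and> B \<subseteq> I \<and> (\<forall>N. lsubmodule field_ring R N --> B \<subseteq> N --> I \<subseteq> N)"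
 proof (intro exI[of _ "(%(u, v). E u v) ` supp I"] conjI allI impI subsetI)
  show "finite ((%(u, v). E u v) ` supp I)"
   by (rule finite_imageI, rule finite_subset[OF _ finite_rel]) (auto simp: supp_def)
  fix N x assume N: "lsubmodule field_ring R N" "(%(u, v). E u v) ` supp I \<subseteq> N" and x: "x \<in> I"
  then have "x \<in> carrier R" "!!u v. coef x u v ~= 0 ==> E u v \<in> N" using ideal_mem_iff[OF I, of x] by auto
  then show "x \<in> N" by (rule lsubmodule_E_span[OF N(1)])
 qed (auto simp: supp_def)
qed

section \<open>Homomorphisms between ideals and decompositions of ideals\<close>

lemma bimod_hom_smult:
 assumes I: "ideal I R" and J: "ideal J R" and c: "c ~= 0 ==> I \<subseteq> J"
 shows "bimod_hom R I J (%x. c \<odot> x)"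
proof -
 have IR: "x \<in> I ==> x \<in> carrier R" for x using ideal.Icarr[OF I] .
 have "c \<odot> x \<in> J" if "x \<in> I" for x
 proof (cases "c = 0")
  case True
  then show ?thesis using kvec.zero_smult[of x] IR[OF that] J by (simp add: additive_subgroup.zero_closed ideal.axioms(1))
 next
  case False
  then show ?thesis using c that ideal_smult[OF J] by blast
 qed
 then show ?thesis unfolding bimod_hom_def using IR by (auto simp: ksmult_add ksmult_mult kmult_ksmult)
qed

text \<open>\<open>f\<close> commutes with cutting down to the corner at \<open>(u, v)\<close>,
  where \<open>x\<close> becomes a multiple of \<open>E u v\<close>.\<close>

lemma bimod_hom_diagonal:
 assumes I: "ideal I R" and J: "ideal J R" and f: "bimod_hom R I J f" and x: "x \<in> I" and uv: "(u, v) \<in> supp I"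
 shows "coef (f x) u v = coef x u v * coef (f (E u v)) u v"
proof -
 note fD = bimod_homD[OF f]
 have xR: "x \<in> carrier R" using x ideal.Icarr[OF I] by blast
 have fxR: "f x \<in> carrier R" using fD(1)[OF x] ideal.Icarr[OF J] by blast
 have uv': "rel u v" "E u v \<in> I" using uv by (auto simp: supp_def)
 have fR: "f (E u v) \<in> carrier R" using fD(1)[OF uv'(2)] ideal.Icarr[OF J] by blast
 have r: "rel u u" "rel v v" using uv' rel_V rel_refl by blast+
 interpret I: ideal I R by (rule I)
 have "coef (f x) u v \<odot> E u v = E v v \<otimes> f x \<otimes> E u u" using E_idem_mult[OF fxR uv'(1)] by simp
 also have "... = f (E v v \<otimes> x \<otimes> E u u)" using x r I.I_l_closed by (simp add: fD)
 also have "... = f ((coef x u v \<odot> \<one>) \<otimes> E u v)" using E_idem_mult[OF xR uv'(1)] uv' by (simp add: sc_mult)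
 also have "... = coef x u v \<odot> f (E u v)"
  using fD(3)[OF uv'(2), of "coef x u v \<odot> \<one>"] fR by (simp add: sc_mult)
 finally have "coef (coef (f x) u v \<odot> E u v) u v = coef (coef x u v \<odot> f (E u v)) u v" by simp
 then show ?thesis using uv' fR by (simp add: coef_smult coef_E)
qed

text \<open>
  Since \<open>e\<^sub>v R e\<^sub>u\<close> is at most one dimensional, a bimodule homomorphism acts on the basis
  vectors of \<open>I\<close> by scalars, and the ideal \<open>I\<close> is the direct sum of the eigenspaces.
\<close>

lemma bimod_hom_indecomposable:
 assumes I: "indecomposable_ideal R I" and J: "ideal J R" and f: "bimod_hom R I J f"
 shows "\<exists>c. (\<forall>x\<in>I. f x = c \<odot> x) \<and> (c ~= 0 --> I \<subseteq> J)"
proof -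
 have idI: "ideal I R" and I0: "I ~= {\<zero>}" using I by (auto simp: indecomposable_ideal_def)
 interpret I: ideal I R by (rule idI)
 note fD = bimod_homD[OF f]
 define c where "c u v = coef (f (E u v)) u v" for u v
 have fx: "coef (f x) u v = coef x u v * c u v" if "x \<in> I" "(u, v) \<in> supp I" for x u v
  using bimod_hom_diagonal[OF idI J f that] by (simp add: c_def)
 have fxI: "f x \<in> carrier R" if "x \<in> I" for x using fD(1)[OF that] ideal.Icarr[OF J] by blast
 \<comment> \<open>The eigenvalue does not change when the path is prolonged, so each eigenspace is
   closed under prolongation and thus an ideal.\<close>
 have cup: "c u' v' = c u v" if uv: "(u, v) \<in> supp I" and r: "rel u' u" "rel v v'" for u v u' v'
 proof -
  have up: "(u', v') \<in> supp I" "E u' v' = E v v' \<otimes> E u v \<otimes> E u' u" using supp_upclosed[OF idI that] by auto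
  have e: "E u v \<in> I" "rel u v" using uv by (auto simp: supp_def)
  have "f (E u' v') = E v v' \<otimes> f (E u v) \<otimes> E u' u"
   unfolding up(2) using e r I.I_l_closed by (simp add: fD)
  then show ?thesis using E_mult_mult[OF fxI[OF e(1)] r(2,1), of u' v'] by (simp add: c_def)
 qed
 obtain x0 where x0: "x0 \<in> I" "x0 ~= \<zero>" using I0 I.zero_closed by blast
 then obtain u0 v0 where "coef x0 u0 v0 ~= 0" using eqI[of x0 \<zero>] I.Icarr by (auto simp: coef_zero)
 then have s0: "(u0, v0) \<in> supp I" using ideal_mem_iff[OF idI] x0 by blast
 let ?c = "c u0 v0"
 define U where "U = {(u, v) \<in> supp I. c u v = ?c}"
 \<comment> \<open>All eigenvalues other than that of \<open>(u0, v0)\<close> are put together,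
   since indecomposability speaks of two summands. As \<open>idl U\<close> is nonzero,
   \<open>idl W\<close> has to vanish.\<close>
 define W where "W = {(u, v) \<in> supp I. c u v ~= ?c}"
 have idU: "ideal (idl U) R" "ideal (idl W) R"
  by (rule ideal_idl, auto simp: U_def W_def supp_upclosed(1)[OF idI] cup)+
 have "idl U <+>\<^bsub>R\<^esub> idl W = I"
 proof
  have "x \<in> I" if "x \<in> idl U \<or> x \<in> idl W" for x
   using that ideal_mem_iff[OF idI, of x] by (auto simp: idl_def U_def W_def)
  then show "idl U <+>\<^bsub>R\<^esub> idl W \<subseteq> I" using I.a_closed by (auto simp: set_add_def' set_add_def set_mult_def)
  show "I \<subseteq> idl U <+>\<^bsub>R\<^esub> idl W"
  proof
   fix x assume x: "x \<in> I"
   have s: "coef x u v ~= 0 ==> (u, v) \<in> supp I" for u v using ideal_mem_iff[OF idI] x by blast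
   have xR: "x \<in> carrier R" using x by (rule I.Icarr)
   have "\<exists>y\<in>carrier R. coef y = (%u v. if (u, v) \<in> U then coef x u v else 0)"
    by (rule coef_surj) (use coef_rel[OF xR] in "auto split: if_splits")
   then obtain y where y: "y \<in> carrier R" "coef y = (%u v. if (u, v) \<in> U then coef x u v else 0)" by blast
   have "\<exists>z\<in>carrier R. coef z = (%u v. if (u, v) \<in> W then coef x u v else 0)"
    by (rule coef_surj) (use coef_rel[OF xR] in "auto split: if_splits")
   then obtain z where z: "z \<in> carrier R" "coef z = (%u v. if (u, v) \<in> W then coef x u v else 0)" by blast
   have "x = y \<oplus> z"
    by (rule eqI) (use xR y z s in "auto simp: coef_add U_def W_def")
   moreover have "y \<in> idl U" "z \<in> idl W" using y z by (auto simp: idl_def)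
   ultimately show "x \<in> idl U <+>\<^bsub>R\<^esub> idl W" by (auto simp: set_add_def set_mult_def)
  qed
 qed
 moreover have "idl U \<inter> idl W = {\<zero>}"
 proof -
  have "x = \<zero>" if "x \<in> idl U" "x \<in> idl W" for x
   by (rule eqI) (use that in "auto simp: idl_def coef_zero U_def W_def")
  moreover have "\<zero> \<in> idl U \<inter> idl W" by (simp add: idl_def coef_zero)
  ultimately show ?thesis by blast
 qed
 moreover have "idl U ~= {\<zero>}"
 proof -
  have "rel u0 v0" using s0 by (simp add: supp_def)
  then have "E u0 v0 \<in> idl U" "E u0 v0 ~= \<zero>" using s0 E_nonzero by (auto simp: idl_def coef_E U_def)
  then show ?thesis by blast
 qed
 ultimately have W0: "idl W = {\<zero>}" using I idU by (auto simp: indecomposable_ideal_def)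
 have cc: "c u v = ?c" if uv: "(u, v) \<in> supp I" for u v
 proof (rule ccontr)
  assume "c u v ~= ?c"
  moreover have "rel u v" using uv by (simp add: supp_def)
  ultimately have "E u v \<in> idl W" "E u v ~= \<zero>" using uv E_nonzero by (auto simp: idl_def coef_E W_def)
  then show False using W0 by blast
 qed
 have "f x = ?c \<odot> x" if x: "x \<in> I" for x
 proof (rule eqI)
  have xR: "x \<in> carrier R" using x by (rule I.Icarr)
  show "f x \<in> carrier R" "?c \<odot> x \<in> carrier R" using fxI[OF x] xR by auto
  fix u v
  show "coef (f x) u v = coef (?c \<odot> x) u v"
  proof (cases "(u, v) \<in> supp I")
   case True
   then show ?thesis using fx[OF x True] cc[OF True] xR by (simp add: coef_smult)
  next
   case False
   \<comment> \<open>\<open>f x\<close> is only known to lie in \<open>J\<close>, so coefficients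
     outside the support of \<open>I\<close> have to be excluded separately.\<close>
   have "coef (f x) u v = 0"
   proof (rule ccontr)
    assume nz: "coef (f x) u v ~= 0"
    have uv: "rel u v" using coef_rel[OF fxI[OF x] nz] .
    then have r: "rel u u" "rel v v" using rel_V rel_refl by blast+
    have x0: "coef x u v = 0" using False ideal_mem_iff[OF idI, of x] x by blast
    have "coef (f x) u v \<odot> E u v = f (E v v \<otimes> x \<otimes> E u u)"
     using x r I.I_l_closed E_idem_mult[OF fxI[OF x] uv] by (simp add: fD)
    also have "E v v \<otimes> x \<otimes> E u u = \<zero> \<otimes> \<zero>" using E_idem_mult[OF xR uv] x0 uv kvec.zero_smult[of "E u v"] by simp
    also have "f (\<zero> \<otimes> \<zero>) = \<zero>" using fD(3)[OF I.zero_closed zero_closed] fxI[OF I.zero_closed] by simp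
    finally show False using smult_E_eq_zero[OF uv] nz by blast
   qed
   then show ?thesis using False ideal_mem_iff[OF idI, of x] x xR by (auto simp: coef_smult)
  qed
 qed
 moreover have "I \<subseteq> J" if "?c ~= 0"
 proof
  fix x assume x: "x \<in> I"
  have "inverse ?c \<odot> f x \<in> J" using ideal_smult[OF J] fD(1)[OF x] by blast
  moreover have "inverse ?c \<odot> f x = x" using calculation(1) \<open>!!x. x \<in> I ==> f x = ?c \<odot> x\<close>[OF x] that
   kmult_smult[OF I.Icarr[OF x], of "inverse ?c" ?c] kone_smult[OF I.Icarr[OF x]] by simp
  ultimately show "x \<in> J" by simp
 qed
 ultimately show ?thesis by blast
qed

text \<open>\<open>p\<close> and \<open>q\<close> are the projections of a nontrivial decomposition;
  they are bimodule homomorphisms because components are unique. The inclusions are strict, which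
  drives the induction that reduces \<open>Dp I\<close> to indecomposable ideals.\<close>

lemma ideal_decomposition:
 assumes I: "ideal I R" "\<not> indecomposable_ideal R I" "I ~= {\<zero>}"
 shows "\<exists>J K p q. ideal J R \<and> ideal K R \<and> J \<subset> I \<and> K \<subset> I \<and> bimod_hom R I J p \<and> bimod_hom R I K q \<and>
  (\<forall>x\<in>I. x = p x \<oplus> q x)"
proof -
 obtain J K where J: "ideal J R" and K: "ideal K R" and JK: "J <+>\<^bsub>R\<^esub> K = I" "J \<inter> K = {\<zero>}" "J ~= {\<zero>}" "K ~= {\<zero>}"
  using I unfolding indecomposable_ideal_def by blast
 interpret J: ideal J R by (rule J)
 interpret K: ideal K R by (rule K)
 have mem: "j \<oplus> k \<in> I" if "j \<in> J" "k \<in> K" for j k using that JK(1) by (auto simp: set_add_def set_mult_def)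
 have sub: "J \<subseteq> I" "K \<subseteq> I"
  using mem[OF _ K.zero_closed] mem[OF J.zero_closed] J.Icarr K.Icarr by fastforce+
 have ex: "\<exists>j\<in>J. \<exists>k\<in>K. x = j \<oplus> k" if "x \<in> I" for x using that JK(1) by (auto simp: set_add_def set_mult_def)
 have uniq: "j = j' \<and> k = k'" if "j \<in> J" "j' \<in> J" "k \<in> K" "k' \<in> K" "j \<oplus> k = j' \<oplus> k'" for j j' k k'
 proof -
  have c: "j \<in> carrier R" "j' \<in> carrier R" "k \<in> carrier R" "k' \<in> carrier R" using that J.Icarr K.Icarr by auto
  have "j \<ominus> j' = (j \<oplus> k) \<oplus> (\<ominus> k \<oplus> \<ominus> j')" using c by (simp add: minus_eq a_assoc r_neg2)
  also have "... = (\<ominus> k \<oplus> \<ominus> j') \<oplus> (j' \<oplus> k')" unfolding that(5) using c by (intro a_comm) auto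
  also have "... = \<ominus> k \<oplus> k'" using c by (simp add: a_assoc r_neg1)
  also have "... = k' \<ominus> k" using c by (simp add: minus_eq a_comm)
  finally have e: "j \<ominus> j' = k' \<ominus> k" .
  have "j \<ominus> j' \<in> J" "k' \<ominus> k \<in> K" using that by (auto simp: minus_eq)
  then have z: "j \<ominus> j' = \<zero>" "k' \<ominus> k = \<zero>" using e JK(2) by auto
  have "j = j \<ominus> j' \<oplus> j'" "k' = k' \<ominus> k \<oplus> k" using c by (auto simp: minus_eq a_assoc l_neg)
  then show ?thesis using z c by simp
 qed
 have "\<forall>x. \<exists>j k. x \<in> I --> j \<in> J \<and> k \<in> K \<and> x = j \<oplus> k" using ex by blast
 then obtain p q where pq0: "\<forall>x. x \<in> I --> p x \<in> J \<and> q x \<in> K \<and> x = p x \<oplus> q x" by metis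
 then have pq: "p x \<in> J" "q x \<in> K" "x = p x \<oplus> q x" if "x \<in> I" for x using that by blast+
 have pqc: "p x \<in> carrier R" "q x \<in> carrier R" if "x \<in> I" for x using pq[OF that] J.Icarr K.Icarr by blast+
 interpret I: ideal I R by (rule I)
 have eq: "p x = j \<and> q x = k" if "x \<in> I" "j \<in> J" "k \<in> K" "x = j \<oplus> k" for x j k
  using uniq[of "p x" j "q x" k] that pq[OF that(1)] by simp
 have add: "p (x \<oplus> y) = p x \<oplus> p y \<and> q (x \<oplus> y) = q x \<oplus> q y" if xy: "x \<in> I" "y \<in> I" for x y
 proof (rule eq)
  have "x \<oplus> y = (p x \<oplus> q x) \<oplus> (p y \<oplus> q y)" using pq(3)[OF xy(1)] pq(3)[OF xy(2)] by simp
  then show "x \<oplus> y = p x \<oplus> p y \<oplus> (q x \<oplus> q y)" using pqc[OF xy(1)] pqc[OF xy(2)] by (simp add: a_ac)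
 qed (use xy pq in auto)
 have l: "p (r \<otimes> x) = r \<otimes> p x \<and> q (r \<otimes> x) = r \<otimes> q x" if x: "x \<in> I" and r: "r \<in> carrier R" for x r
 proof (rule eq)
  have "r \<otimes> x = r \<otimes> (p x \<oplus> q x)" using pq(3)[OF x] by simp
  then show "r \<otimes> x = r \<otimes> p x \<oplus> r \<otimes> q x" using pqc[OF x] r by (simp add: r_distr)
 qed (use x r pq in "auto intro: I.I_l_closed J.I_l_closed K.I_l_closed")
 have rr: "p (x \<otimes> r) = p x \<otimes> r \<and> q (x \<otimes> r) = q x \<otimes> r" if x: "x \<in> I" and r: "r \<in> carrier R" for x r
 proof (rule eq)
  have "x \<otimes> r = (p x \<oplus> q x) \<otimes> r" using pq(3)[OF x] by simp
  then show "x \<otimes> r = p x \<otimes> r \<oplus> q x \<otimes> r" using pqc[OF x] r by (simp add: l_distr)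
 qed (use x r pq in "auto intro: I.I_r_closed J.I_r_closed K.I_r_closed")
 have "bimod_hom R I J p" "bimod_hom R I K q" unfolding bimod_hom_def using pq(1,2) add l rr by simp_all
 moreover have "J ~= I" "K ~= I" using JK sub by blast+
 ultimately show ?thesis using J K sub pq(3) by blast
qed

end

section \<open>Cokernels of \<open>Hom(G, X) -> Hom(G, Y)\<close> as an equivalence\<close>

section \<open>Quotient modules\<close>

definition mod_cls :: "('r, 'u) module => 'u set => 'u => 'u set" where
 "mod_cls M N x = {y \<in> carrier M. y \<ominus>\<^bsub>M\<^esub> x \<in> N}"

definition quot_mod :: "('r, 'u) module => 'u set => ('r, 'u set) module" where
 "quot_mod M N = \<lparr>carrier = mod_cls M N ` carrier M, monoid.mult = undefined, monoid.one = undefined,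
   ring.zero = mod_cls M N \<zero>\<^bsub>M\<^esub>,
   ring.add = (%A B. mod_cls M N ((SOME a. a \<in> A) \<oplus>\<^bsub>M\<^esub> (SOME b. b \<in> B))),
   module.smult = (%r A. mod_cls M N (r \<odot>\<^bsub>M\<^esub> (SOME a. a \<in> A)))\<rparr>"

locale quot_module = M: lmod R M for R :: "('r, 'm) ring_scheme" and M :: "('r, 'u) module" +
 fixes N assumes N: "lsubmodule R M N"
begin

abbreviation "cl \<equiv> mod_cls M N"
abbreviation "Q \<equiv> quot_mod M N"

lemma N_props: "N \<subseteq> carrier M" "\<zero>\<^bsub>M\<^esub> \<in> N" "x \<in> N ==> y \<in> N ==> x \<oplus>\<^bsub>M\<^esub> y \<in> N"
 "r \<in> carrier R ==> x \<in> N ==> r \<odot>\<^bsub>M\<^esub> x \<in> N" "x \<in> N ==> \<ominus>\<^bsub>M\<^esub> x \<in> N"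
 using N M.lsubmodule_neg[OF N] by (auto simp: lsubmodule_def)

lemma cl_eq_iff: assumes x: "x \<in> carrier M" and y: "y \<in> carrier M"
 shows "cl x = cl y \<longleftrightarrow> x \<ominus>\<^bsub>M\<^esub> y \<in> N"
proof
 assume "cl x = cl y"
 moreover have "x \<in> cl x" using x N_props by (simp add: mod_cls_def M.M.minus_eq M.M.r_neg)
 ultimately show "x \<ominus>\<^bsub>M\<^esub> y \<in> N" by (simp add: mod_cls_def)
next
 assume xy: "x \<ominus>\<^bsub>M\<^esub> y \<in> N"
 have "z \<ominus>\<^bsub>M\<^esub> x \<in> N \<longleftrightarrow> z \<ominus>\<^bsub>M\<^esub> y \<in> N" if z: "z \<in> carrier M" for z
 proof
  assume "z \<ominus>\<^bsub>M\<^esub> x \<in> N"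
  then have "(z \<ominus>\<^bsub>M\<^esub> x) \<oplus>\<^bsub>M\<^esub> (x \<ominus>\<^bsub>M\<^esub> y) \<in> N" using xy by (rule N_props)
  then show "z \<ominus>\<^bsub>M\<^esub> y \<in> N" using x y z by (simp add: M.M.minus_eq M.M.a_assoc M.M.r_neg1)
 next
  assume "z \<ominus>\<^bsub>M\<^esub> y \<in> N"
  then have "(z \<ominus>\<^bsub>M\<^esub> y) \<oplus>\<^bsub>M\<^esub> \<ominus>\<^bsub>M\<^esub> (x \<ominus>\<^bsub>M\<^esub> y) \<in> N" using xy N_props(5) by (intro N_props(3)) auto
  moreover have "\<ominus>\<^bsub>M\<^esub> (x \<ominus>\<^bsub>M\<^esub> y) = y \<oplus>\<^bsub>M\<^esub> \<ominus>\<^bsub>M\<^esub> x"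
   using x y by (simp add: M.M.minus_eq M.M.minus_add M.M.a_comm)
  ultimately show "z \<ominus>\<^bsub>M\<^esub> x \<in> N" using x y z by (simp add: M.M.minus_eq M.M.a_assoc M.M.r_neg1)
 qed
 then show "cl x = cl y" by (auto simp: mod_cls_def)
qed

lemma rep: assumes x: "x \<in> carrier M"
 shows "(SOME a. a \<in> cl x) \<in> carrier M" "cl (SOME a. a \<in> cl x) = cl x"
proof -
 have "x \<in> cl x" using x N_props by (simp add: mod_cls_def M.M.minus_eq M.M.r_neg)
 then have "(SOME a. a \<in> cl x) \<in> cl x" by (rule someI)
 then have s: "(SOME a. a \<in> cl x) \<in> carrier M" "(SOME a. a \<in> cl x) \<ominus>\<^bsub>M\<^esub> x \<in> N" by (auto simp: mod_cls_def)
 then show "(SOME a. a \<in> cl x) \<in> carrier M" "cl (SOME a. a \<in> cl x) = cl x" using cl_eq_iff x by auto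
qed

text \<open>Maps on quotients are evaluated at the representative chosen by \<open>SOME\<close>; a
  homomorphism that respects the submodules gives the same class for every choice.\<close>

lemma cl_map:
 assumes M': "left_module R M'" and N': "lsubmodule R M' N'" and f: "f \<in> mod_hom R M M'"
  and fN: "!!x. x \<in> N ==> f x \<in> N'" and x: "x \<in> carrier M"
 shows "mod_cls M' N' (f (SOME a. a \<in> cl x)) = mod_cls M' N' (f x)"
proof -
 interpret Q': quot_module R M' N'
  using M' N' by (simp add: quot_module_def quot_module_axioms_def lmod_iff)
 have Mm: "left_module R M" by (simp add: lmod_iff M.lmod_axioms)
 let ?a = "SOME a. a \<in> cl x"
 have a: "?a \<in> carrier M" "?a \<ominus>\<^bsub>M\<^esub> x \<in> N" using rep[OF x] cl_eq_iff x by auto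
 have "f ?a \<ominus>\<^bsub>M'\<^esub> f x = f (?a \<ominus>\<^bsub>M\<^esub> x)"
  using a x mod_homD(2)[OF f] mod_hom_minus[OF Mm M' f x] by (simp add: M.M.minus_eq Q'.M.M.minus_eq)
 then show ?thesis using fN[OF a(2)] a x mod_homD(1)[OF f] by (simp add: Q'.cl_eq_iff)
qed

lemma carrier_Q: "carrier Q = cl ` carrier M" and zero_Q: "\<zero>\<^bsub>Q\<^esub> = cl \<zero>\<^bsub>M\<^esub>"
 by (simp_all add: quot_mod_def)

lemma minus_add_add:
 assumes "a \<in> carrier M" "b \<in> carrier M" "x \<in> carrier M" "y \<in> carrier M"
 shows "(a \<oplus>\<^bsub>M\<^esub> b) \<ominus>\<^bsub>M\<^esub> (x \<oplus>\<^bsub>M\<^esub> y) = (a \<ominus>\<^bsub>M\<^esub> x) \<oplus>\<^bsub>M\<^esub> (b \<ominus>\<^bsub>M\<^esub> y)"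
 using assms by (simp add: M.M.minus_eq M.M.minus_add M.M.a_ac)

lemma add_Q: assumes "x \<in> carrier M" "y \<in> carrier M" shows "cl x \<oplus>\<^bsub>Q\<^esub> cl y = cl (x \<oplus>\<^bsub>M\<^esub> y)"
proof -
 let ?a = "SOME a. a \<in> cl x" and ?b = "SOME b. b \<in> cl y"
 have a: "?a \<in> carrier M" "?a \<ominus>\<^bsub>M\<^esub> x \<in> N" and b: "?b \<in> carrier M" "?b \<ominus>\<^bsub>M\<^esub> y \<in> N"
  using rep[OF assms(1)] rep[OF assms(2)] cl_eq_iff assms by auto
 have "cl x \<oplus>\<^bsub>Q\<^esub> cl y = cl (?a \<oplus>\<^bsub>M\<^esub> ?b)" by (simp add: quot_mod_def)
 also have "... = cl (x \<oplus>\<^bsub>M\<^esub> y)" using a b assms minus_add_add[OF a(1) b(1) assms] by (simp add: cl_eq_iff N_props)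
 finally show ?thesis .
qed

lemma smult_Q: assumes r: "r \<in> carrier R" and x: "x \<in> carrier M" shows "r \<odot>\<^bsub>Q\<^esub> cl x = cl (r \<odot>\<^bsub>M\<^esub> x)"
proof -
 let ?a = "SOME a. a \<in> cl x"
 have a: "?a \<in> carrier M" "?a \<ominus>\<^bsub>M\<^esub> x \<in> N" using rep[OF x] cl_eq_iff x by auto
 have "r \<odot>\<^bsub>M\<^esub> ?a \<ominus>\<^bsub>M\<^esub> r \<odot>\<^bsub>M\<^esub> x = r \<odot>\<^bsub>M\<^esub> (?a \<ominus>\<^bsub>M\<^esub> x)"
  using r x a by (simp add: M.M.minus_eq M.smult_add M.smult_neg)
 then have "cl (r \<odot>\<^bsub>M\<^esub> ?a) = cl (r \<odot>\<^bsub>M\<^esub> x)" using r x a by (simp add: cl_eq_iff N_props)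
 then show ?thesis by (simp add: quot_mod_def)
qed

lemma left_module_Q: "left_module R Q"
proof -
 have "abelian_group Q"
 proof (rule abelian_groupI; unfold carrier_Q zero_Q)
  fix x assume "x \<in> cl ` carrier M"
  then obtain a where a: "a \<in> carrier M" "x = cl a" by blast
  then show "\<exists>y\<in>cl ` carrier M. y \<oplus>\<^bsub>Q\<^esub> x = cl \<zero>\<^bsub>M\<^esub>"
   by (intro bexI[of _ "cl (\<ominus>\<^bsub>M\<^esub> a)"]) (auto simp: add_Q M.M.l_neg)
 qed (auto simp: add_Q M.M.a_ac)
 then show ?thesis unfolding lmod_iff
  by (intro lmod.intro lmod_axioms.intro M.R.ring_axioms)
   (auto simp: carrier_Q add_Q smult_Q M.add_smult M.smult_add M.mult_smult)
qed

lemma proj_hom: "(\<lambda>x\<in>carrier M. cl x) \<in> mod_hom R M Q"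
 by (rule mod_homI) (auto simp: carrier_Q add_Q smult_Q)

lemma fin_gen_Q: assumes "fin_gen R M" shows "fin_gen R Q"
 by (rule fin_gen_surj[OF _ left_module_Q proj_hom _ assms])
  (auto simp: carrier_Q lmod_iff M.lmod_axioms)

end

section \<open>Modules over the endomorphism algebra of a generator\<close>

text \<open>\<open>\<rho>\<close> identifies \<open>R\<close> with the opposite of the endomorphism
  algebra of \<open>G\<close>. The assumption \<open>retract\<close> makes \<open>Hom(G, _)\<close>
  fully faithful, and \<open>power\<close> supplies the objects from which presentations are
  built.\<close>

locale gen_cat = lin_cat C + fd_kalg R
 for C :: "('k::field, 'o, 'm) lincat" and R :: "('k, 'r) module" (structure) +
 fixes G :: 'o and \<rho> :: "'r => 'm"
 assumes G: "G \<in> ob C"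
  and rho_bij: "bij_betw \<rho> (carrier R) (mor C G G)"
  and rho_add: "x \<in> carrier R ==> y \<in> carrier R ==> \<rho> (x \<oplus> y) = madd C G G (\<rho> x) (\<rho> y)"
  and rho_mult: "x \<in> carrier R ==> y \<in> carrier R ==> \<rho> (x \<otimes> y) = cmp C G G G (\<rho> y) (\<rho> x)"
  and rho_one: "\<rho> \<one> = idm C G"
  and rho_smult: "x \<in> carrier R ==> \<rho> (c \<odot> x) = mscale C G G c (\<rho> x)"
  and retract: "X \<in> ob C ==> \<exists>n a b. (\<forall>i<n. a i \<in> mor C G X \<and> b i \<in> mor C X G) \<and>
   idm C X = msum C X X (%i. cmp C X G X (a i) (b i)) {..<n::nat}"
  and power: "\<exists>B \<iota> \<pi>. biprod_data C n (%_. G) B \<iota> \<pi>"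
begin

lemma rho_in [simp]: "r \<in> carrier R ==> \<rho> r \<in> mor C G G"
 using rho_bij bij_betwE by blast

definition rho_inv :: "'m => 'r" where "rho_inv = inv_into (carrier R) \<rho>"

lemma rho_inv: "u \<in> mor C G G ==> rho_inv u \<in> carrier R" "u \<in> mor C G G ==> \<rho> (rho_inv u) = u"
 using rho_bij by (auto simp: rho_inv_def bij_betw_def inv_into_into f_inv_into_f)

text \<open>\<open>Hom(G, Y)\<close> as a module. Precomposition is a left action because
  \<open>\<rho>\<close> reverses products.\<close>

definition hmod :: "'o => ('r, 'm) module" where
 "hmod Y = \<lparr>carrier = mor C G Y, monoid.mult = undefined, monoid.one = undefined,
   ring.zero = mzero C G Y, ring.add = madd C G Y, module.smult = (%r y. cmp C G G Y y (\<rho> r))\<rparr>"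

lemma hmod_simps [simp]:
 "carrier (hmod Y) = mor C G Y" "\<zero>\<^bsub>hmod Y\<^esub> = mzero C G Y" "x \<oplus>\<^bsub>hmod Y\<^esub> y = madd C G Y x y"
 "r \<odot>\<^bsub>hmod Y\<^esub> y = cmp C G G Y y (\<rho> r)"
 by (simp_all add: hmod_def)

lemma finsum_hmod: "finsum (hmod Y) f S = msum C G Y f S"
 by (simp add: finsum_def finprod_def hmod_def homv_def)

lemma left_module_hmod: assumes Y: "Y \<in> ob C" shows "left_module R (hmod Y)"
proof -
 interpret H: lmod field_ring "homv C G Y" using G Y by (rule lmod_homv)
 have "abelian_group (hmod Y)"
 proof (rule abelian_groupI)
  fix x assume "x \<in> carrier (hmod Y)"
  then show "\<exists>y\<in>carrier (hmod Y). y \<oplus>\<^bsub>hmod Y\<^esub> x = \<zero>\<^bsub>hmod Y\<^esub>"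
   using H.M.a_inv_closed[of x] H.M.l_neg[of x] by (auto simp del: homv_simps(4))
 next
  fix x y assume "x \<in> carrier (hmod Y)" "y \<in> carrier (hmod Y)"
  then show "x \<oplus>\<^bsub>hmod Y\<^esub> y = y \<oplus>\<^bsub>hmod Y\<^esub> x" using G Y madd_comm by simp
 qed (use G Y in "simp_all add: madd_mor mzero_mor madd_assoc mzero_madd")
 then show ?thesis unfolding lmod_iff
  by (intro lmod.intro lmod_axioms.intro ring_axioms)
   (use G Y in "simp_all add: cmp_mor rho_add rho_mult rho_one cmp_madd_right cmp_madd_left cmp_assoc cmp_idm")
qed

lemma lmod_hmod: "Y \<in> ob C ==> lmod R (hmod Y)"
 using left_module_hmod by (simp add: lmod_iff)

lemma retract_expand:
 assumes X: "X \<in> ob C" "Z \<in> ob C" and ab: "!!i. i < n ==> a i \<in> mor C G X \<and> b i \<in> mor C X G"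
  and id: "idm C X = msum C X X (%i. cmp C X G X (a i) (b i)) {..<n}"
 shows "y \<in> mor C Z X ==> y = msum C Z X (%i. cmp C Z G X (a i) (cmp C Z X G (b i) y)) {..<n}"
  and "k \<in> mor C X Z ==> k = msum C X Z (%i. cmp C X G Z (cmp C G X Z k (a i)) (b i)) {..<n}"
 using biprod_expand[OF X, of n "%_. G" a b] ab id G by simp_all

text \<open>The maps \<open>a i\<close> of \<open>retract\<close> generate: \<open>y\<close> is the
  sum of the \<open>a i (b i y)\<close>, and each \<open>b i y\<close> is an endomorphism of
  \<open>G\<close>, hence comes from \<open>R\<close>.\<close>

lemma fin_gen_hmod: assumes Y: "Y \<in> ob C" shows "fin_gen R (hmod Y)"
proof -
 interpret H: lmod R "hmod Y" by (rule lmod_hmod[OF Y])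
 obtain n a b where ab: "!!i. i < n ==> a i \<in> mor C G Y \<and> b i \<in> mor C Y G"
  and id: "idm C Y = msum C Y Y (%i. cmp C Y G Y (a i) (b i)) {..<n::nat}" using retract[OF Y] by blast
 show ?thesis unfolding H.fin_gen_iff
 proof (intro exI[of _ "a ` {..<n}"] conjI allI impI subsetI)
  fix N y assume N: "lsubmodule R (hmod Y) N" "a ` {..<n} \<subseteq> N" and "y \<in> carrier (hmod Y)"
  then have y: "y \<in> mor C G Y" by simp
  have "finsum (hmod Y) (%i. cmp C G G Y (a i) (cmp C G Y G (b i) y)) {..<n} \<in> N"
  proof (rule H.lsubmodule_finsum[OF N(1)])
   fix i assume "i \<in> {..<n}"
   then have i: "a i \<in> N" "cmp C G Y G (b i) y \<in> mor C G G" using N(2) ab y G Y by (auto simp: cmp_mor)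
   have "r \<odot>\<^bsub>hmod Y\<^esub> x \<in> N" if "r \<in> carrier R" "x \<in> N" for r x
    using N(1) that by (simp add: lsubmodule_def)
   from this[OF rho_inv(1)[OF i(2)] i(1)] show "cmp C G G Y (a i) (cmp C G Y G (b i) y) \<in> N"
    using rho_inv(2)[OF i(2)] by simp
  qed
  then show "y \<in> N" using retract_expand(1)[OF Y G ab id y] by (simp add: finsum_hmod)
 qed (use ab in auto)
qed

lemma post_hom:
 assumes "Y \<in> ob C" "Y' \<in> ob C" "g \<in> mor C Y Y'"
 shows "(\<lambda>y\<in>mor C G Y. cmp C G Y Y' g y) \<in> mod_hom R (hmod Y) (hmod Y')"
 by (rule mod_homI) (use assms G in "simp_all add: cmp_mor madd_mor cmp_madd_right cmp_assoc")

definition img :: "'o \<times> 'o \<times> 'm => 'm set" where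
 "img A = (case A of (X, Y, \<alpha>) => cmp C G X Y \<alpha> ` mor C G X)"

definition cok :: "'o \<times> 'o \<times> 'm => ('r, 'm set) module" where
 "cok A = quot_mod (hmod (fst (snd A))) (img A)"

definition cokcl :: "'o \<times> 'o \<times> 'm => 'm => 'm set" where
 "cokcl A = mod_cls (hmod (fst (snd A))) (img A)"

text \<open>Only the component between the targets enters; the component between the sources is what
  makes the map well defined.\<close>

definition cokmap :: "'o \<times> 'o \<times> 'm => 'o \<times> 'o \<times> 'm => 'm => 'm set => 'm set" where
 "cokmap A A' g = (\<lambda>S\<in>carrier (cok A). cokcl A' (cmp C G (fst (snd A)) (fst (snd A')) g (SOME y. y \<in> S)))"

abbreviation "K \<equiv> arrow_cat C"

lemma K_ob: "(X, Y, \<alpha>) \<in> ob K \<longleftrightarrow> X \<in> ob C \<and> Y \<in> ob C \<and> \<alpha> \<in> mor C X Y"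
 by (simp add: arrow_cat_simps)

lemma lsubmodule_img: assumes "(X, Y, \<alpha>) \<in> ob K" shows "lsubmodule R (hmod Y) (img (X, Y, \<alpha>))"
proof -
 have o: "X \<in> ob C" "Y \<in> ob C" "\<alpha> \<in> mor C X Y" using assms by (simp_all add: K_ob)
 show ?thesis unfolding lsubmodule_def
 proof (intro conjI ballI)
  show "img (X, Y, \<alpha>) \<subseteq> carrier (hmod Y)" using o G by (auto simp: img_def cmp_mor)
  show "\<zero>\<^bsub>hmod Y\<^esub> \<in> img (X, Y, \<alpha>)" using o G
   by (auto simp: img_def cmp_mzero_right mzero_mor intro!: image_eqI[of _ _ "mzero C G X"])
 next
  fix x y assume "x \<in> img (X, Y, \<alpha>)" "y \<in> img (X, Y, \<alpha>)"
  then obtain a b where "a \<in> mor C G X" "b \<in> mor C G X" "x = cmp C G X Y \<alpha> a" "y = cmp C G X Y \<alpha> b"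
   by (auto simp: img_def)
  then show "x \<oplus>\<^bsub>hmod Y\<^esub> y \<in> img (X, Y, \<alpha>)" using o G
   by (auto simp: img_def cmp_madd_right madd_mor intro!: image_eqI[of _ _ "madd C G X a b"])
 next
  fix r x assume r: "r \<in> carrier R" and "x \<in> img (X, Y, \<alpha>)"
  then obtain a where "a \<in> mor C G X" "x = cmp C G X Y \<alpha> a" by (auto simp: img_def)
  then show "r \<odot>\<^bsub>hmod Y\<^esub> x \<in> img (X, Y, \<alpha>)" using o G r
   by (auto simp: img_def cmp_assoc cmp_mor intro!: image_eqI[of _ _ "cmp C G G X a (\<rho> r)"])
 qed
qed

lemma quot_module_img: "(X, Y, \<alpha>) \<in> ob K ==> quot_module R (hmod Y) (img (X, Y, \<alpha>))"
 using lsubmodule_img lmod_hmod by (simp add: quot_module_def quot_module_axioms_def K_ob)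

lemma cok_facts: assumes "(X, Y, \<alpha>) \<in> ob K"
 shows "carrier (cok (X, Y, \<alpha>)) = cokcl (X, Y, \<alpha>) ` mor C G Y"
  and "\<zero>\<^bsub>cok (X, Y, \<alpha>)\<^esub> = cokcl (X, Y, \<alpha>) (mzero C G Y)"
  and "y \<in> mor C G Y ==> y' \<in> mor C G Y ==>
   cokcl (X, Y, \<alpha>) y \<oplus>\<^bsub>cok (X, Y, \<alpha>)\<^esub> cokcl (X, Y, \<alpha>) y' = cokcl (X, Y, \<alpha>) (madd C G Y y y')"
  and "r \<in> carrier R ==> y \<in> mor C G Y ==>
   r \<odot>\<^bsub>cok (X, Y, \<alpha>)\<^esub> cokcl (X, Y, \<alpha>) y = cokcl (X, Y, \<alpha>) (cmp C G G Y y (\<rho> r))"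
  and "fgmod R (cok (X, Y, \<alpha>))" and "left_module R (cok (X, Y, \<alpha>))"
  and "(\<lambda>y\<in>mor C G Y. cokcl (X, Y, \<alpha>) y) \<in> mod_hom R (hmod Y) (cok (X, Y, \<alpha>))"
  and "y \<in> mor C G Y ==> cokcl (X, Y, \<alpha>) y = \<zero>\<^bsub>cok (X, Y, \<alpha>)\<^esub> \<longleftrightarrow> y \<in> img (X, Y, \<alpha>)"
proof -
 interpret Q: quot_module R "hmod Y" "img (X, Y, \<alpha>)" by (rule quot_module_img[OF assms])
 have Y: "Y \<in> ob C" using assms by (simp add: K_ob)
 note d = cok_def cokcl_def
 show "carrier (cok (X, Y, \<alpha>)) = cokcl (X, Y, \<alpha>) ` mor C G Y" "\<zero>\<^bsub>cok (X, Y, \<alpha>)\<^esub> = cokcl (X, Y, \<alpha>) (mzero C G Y)"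
  using Q.carrier_Q Q.zero_Q by (simp_all add: d)
 show "y \<in> mor C G Y ==> y' \<in> mor C G Y ==>
   cokcl (X, Y, \<alpha>) y \<oplus>\<^bsub>cok (X, Y, \<alpha>)\<^esub> cokcl (X, Y, \<alpha>) y' = cokcl (X, Y, \<alpha>) (madd C G Y y y')"
  using Q.add_Q by (simp add: d)
 show "r \<in> carrier R ==> y \<in> mor C G Y ==>
   r \<odot>\<^bsub>cok (X, Y, \<alpha>)\<^esub> cokcl (X, Y, \<alpha>) y = cokcl (X, Y, \<alpha>) (cmp C G G Y y (\<rho> r))"
  using Q.smult_Q by (simp add: d)
 show "fgmod R (cok (X, Y, \<alpha>))" "left_module R (cok (X, Y, \<alpha>))"
  using Q.left_module_Q Q.fin_gen_Q[OF fin_gen_hmod[OF Y]] by (simp_all add: d fgmod_def)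
 show "(\<lambda>y\<in>mor C G Y. cokcl (X, Y, \<alpha>) y) \<in> mod_hom R (hmod Y) (cok (X, Y, \<alpha>))"
  using Q.proj_hom by (simp add: d)
 assume y: "y \<in> mor C G Y"
 have m: "\<ominus>\<^bsub>hmod Y\<^esub> \<zero>\<^bsub>hmod Y\<^esub> = \<zero>\<^bsub>hmod Y\<^esub>" by (rule Q.M.M.minus_equality) (use Q.M.M.zero_closed Q.M.M.l_zero in blast)+
 have "y \<ominus>\<^bsub>hmod Y\<^esub> \<zero>\<^bsub>hmod Y\<^esub> = y" using y Q.M.M.r_zero[of y] unfolding a_minus_def m by simp
 then show "cokcl (X, Y, \<alpha>) y = \<zero>\<^bsub>cok (X, Y, \<alpha>)\<^esub> \<longleftrightarrow> y \<in> img (X, Y, \<alpha>)"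
  using Q.cl_eq_iff[of y "\<zero>\<^bsub>hmod Y\<^esub>"] y Q.zero_Q Q.M.M.zero_closed by (simp add: d)
qed

lemma cokmap_facts:
 assumes A: "(X, Y, \<alpha>) \<in> ob K" and A': "(X', Y', \<alpha>') \<in> ob K" and fg: "(f, g) \<in> mor K (X, Y, \<alpha>) (X', Y', \<alpha>')"
 shows "y \<in> mor C G Y ==> cokmap (X, Y, \<alpha>) (X', Y', \<alpha>') g (cokcl (X, Y, \<alpha>) y) = cokcl (X', Y', \<alpha>') (cmp C G Y Y' g y)"
  and "cokmap (X, Y, \<alpha>) (X', Y', \<alpha>') g \<in> mod_hom R (cok (X, Y, \<alpha>)) (cok (X', Y', \<alpha>'))"
proof -
 have o: "X \<in> ob C" "Y \<in> ob C" "\<alpha> \<in> mor C X Y" "X' \<in> ob C" "Y' \<in> ob C" "\<alpha>' \<in> mor C X' Y'"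
  using A A' by (simp_all add: K_ob)
 have m: "f \<in> mor C X X'" "g \<in> mor C Y Y'" "cmp C X Y Y' g \<alpha> = cmp C X X' Y' \<alpha>' f"
  using fg by (simp_all add: arrow_cat_simps)
 interpret Q: quot_module R "hmod Y" "img (X, Y, \<alpha>)" by (rule quot_module_img[OF A])
 let ?p = "\<lambda>y\<in>mor C G Y. cmp C G Y Y' g y"
 have p: "?p x \<in> img (X', Y', \<alpha>')" if "x \<in> img (X, Y, \<alpha>)" for x
 proof -
  obtain a where a: "a \<in> mor C G X" "x = cmp C G X Y \<alpha> a" using \<open>x \<in> img (X, Y, \<alpha>)\<close> by (auto simp: img_def)
  then have "?p x = cmp C G X' Y' \<alpha>' (cmp C G X X' f a)" using o m G
   by (simp add: cmp_mor cmp_assoc[symmetric])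
  then show ?thesis using a o m G by (auto simp: img_def cmp_mor)
 qed
 have *: "cokmap (X, Y, \<alpha>) (X', Y', \<alpha>') g (cokcl (X, Y, \<alpha>) y) = cokcl (X', Y', \<alpha>') (cmp C G Y Y' g y)"
  if y: "y \<in> mor C G Y" for y
 proof -
  have "mod_cls (hmod Y') (img (X', Y', \<alpha>')) (?p (SOME a. a \<in> Q.cl y)) = mod_cls (hmod Y') (img (X', Y', \<alpha>')) (?p y)"
   by (rule Q.cl_map[OF left_module_hmod[OF o(5)] lsubmodule_img[OF A'] post_hom[OF o(2,5) m(2)] p]) (simp_all add: y)
  then show ?thesis using y Q.rep[of y] by (simp add: cokmap_def cok_facts(1)[OF A]) (simp add: cokcl_def)
 qed
 then show "y \<in> mor C G Y ==> cokmap (X, Y, \<alpha>) (X', Y', \<alpha>') g (cokcl (X, Y, \<alpha>) y) = cokcl (X', Y', \<alpha>') (cmp C G Y Y' g y)" .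
 show "cokmap (X, Y, \<alpha>) (X', Y', \<alpha>') g \<in> mod_hom R (cok (X, Y, \<alpha>)) (cok (X', Y', \<alpha>'))"
 proof (rule mod_homI)
  show "cokmap (X, Y, \<alpha>) (X', Y', \<alpha>') g \<in> extensional (carrier (cok (X, Y, \<alpha>)))" by (simp add: cokmap_def)
 qed (use o m G in "auto simp: cok_facts[OF A] cok_facts(1,3,4)[OF A'] * cmp_mor madd_mor cmp_madd_right cmp_assoc")
qed

definition coker_functor :: "('o \<times> 'o \<times> 'm, 'm \<times> 'm, ('k, 'r) smod, 'k smor) cfunctor" where
 "coker_functor = \<lparr>fob = (%A. small_copy R (cok A)),
   fmor = (%A A' (f, g). small_mor R (cok A) (cok A') (cokmap A A' g))\<rparr>"

lemma coker_functor_simps: "fob coker_functor A = small_copy R (cok A)"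
 "fmor coker_functor A A' (f, g) = small_mor R (cok A) (cok A') (cokmap A A' g)"
 by (simp_all add: coker_functor_def)

lemma cok_eqI:
 assumes "(X, Y, \<alpha>) \<in> ob K" "f \<in> extensional (carrier (cok (X, Y, \<alpha>)))" "g \<in> extensional (carrier (cok (X, Y, \<alpha>)))"
  "!!y. y \<in> mor C G Y ==> f (cokcl (X, Y, \<alpha>) y) = g (cokcl (X, Y, \<alpha>) y)"
 shows "f = g"
 by (rule extensionalityI[OF assms(2,3)]) (use assms(4) in "auto simp: cok_facts(1)[OF assms(1)]")

lemma cokmap_ext: "cokmap A A' g \<in> extensional (carrier (cok A))" by (simp add: cokmap_def)

text \<open>On the class of \<open>y\<close> the induced map is composition with \<open>g\<close>,
  so all laws come from \<open>C\<close>, and \<open>small_mor\<close> carries them to the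
  copies.\<close>

lemma linear_coker_functor: "linear_functor K (mod_cat R) coker_functor"
proof (rule linear_functorI)
 interpret K: lin_cat K by (rule lin_cat_arrow_cat)
 {
  fix A assume A: "A \<in> ob K"
  obtain X Y \<alpha> where A_eq: "A = (X, Y, \<alpha>)" by (cases A)
  note A = A[unfolded A_eq]
  have o: "X \<in> ob C" "Y \<in> ob C" using A by (simp_all add: K_ob)
  note fg = cok_facts(5)[OF A]
  show "fob coker_functor A \<in> ob (mod_cat R)" unfolding A_eq coker_functor_simps by (rule small_copy_ob[OF fg])
  have i: "(idm C X, idm C Y) \<in> mor K (X, Y, \<alpha>) (X, Y, \<alpha>)" using K.idm_mor[OF A] by (simp add: arrow_cat_simps)
  have "cokmap (X, Y, \<alpha>) (X, Y, \<alpha>) (idm C Y) = (\<lambda>S\<in>carrier (cok (X, Y, \<alpha>)). S)"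
   by (rule cok_eqI[OF A cokmap_ext]) (use o G in "simp_all add: cokmap_facts(1)[OF A A i] idm_cmp cok_facts(1)[OF A]")
  then show "fmor coker_functor A A (idm K A) = idm (mod_cat R) (fob coker_functor A)"
   unfolding A_eq arrow_cat_simps coker_functor_simps by (simp add: small_mor_id[OF fg])
 }
 {
  fix A A' p assume A: "A \<in> ob K" and A': "A' \<in> ob K" and p: "p \<in> mor K A A'"
  obtain X Y \<alpha> where A_eq: "A = (X, Y, \<alpha>)" by (cases A)
  obtain X' Y' \<alpha>' where A'_eq: "A' = (X', Y', \<alpha>')" by (cases A')
  obtain f g where p_eq: "p = (f, g)" by (cases p)
  note A = A[unfolded A_eq] and A' = A'[unfolded A'_eq] and p = p[unfolded A_eq A'_eq p_eq]
  have o: "X \<in> ob C" "Y \<in> ob C" "X' \<in> ob C" "Y' \<in> ob C" using A A' by (simp_all add: K_ob)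
  have g: "g \<in> mor C Y Y'" using p by (simp add: arrow_cat_simps)
  note fg = cok_facts(5)[OF A] cok_facts(5)[OF A']
  note h = cokmap_facts[OF A A' p]
  show "fmor coker_functor A A' p \<in> mor (mod_cat R) (fob coker_functor A) (fob coker_functor A')"
   unfolding A_eq A'_eq p_eq coker_functor_simps using small_mor_hom[OF fg h(2)] by simp
  {
   fix q assume q: "q \<in> mor K A A'"
   obtain f' g' where q_eq: "q = (f', g')" by (cases q)
   note q = q[unfolded A_eq A'_eq q_eq]
   have g': "g' \<in> mor C Y Y'" using q by (simp add: arrow_cat_simps)
   note h' = cokmap_facts[OF A A' q]
   have pq: "(madd C X X' f f', madd C Y Y' g g') \<in> mor K (X, Y, \<alpha>) (X', Y', \<alpha>')"
    using K.madd_mor[OF A A' p q] by (simp add: arrow_cat_simps)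
   have "cokmap (X, Y, \<alpha>) (X', Y', \<alpha>') (madd C Y Y' g g') =
    (\<lambda>S\<in>carrier (cok (X, Y, \<alpha>)). cokmap (X, Y, \<alpha>) (X', Y', \<alpha>') g S \<oplus>\<^bsub>cok (X', Y', \<alpha>')\<^esub> cokmap (X, Y, \<alpha>) (X', Y', \<alpha>') g' S)"
    by (rule cok_eqI[OF A cokmap_ext])
     (use o G g g' in "simp_all add: cokmap_facts(1)[OF A A' pq] h(1) h'(1) cok_facts(1)[OF A] cok_facts(3)[OF A'] cmp_mor cmp_madd_left")
   then show "fmor coker_functor A A' (madd K A A' p q) =
     madd (mod_cat R) (fob coker_functor A) (fob coker_functor A') (fmor coker_functor A A' p) (fmor coker_functor A A' q)"
    unfolding A_eq A'_eq p_eq q_eq arrow_cat_simps coker_functor_simps by (simp add: small_mor_add[OF fg h(2) h'(2)])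
  }
  fix c
  have cp: "(mscale C X X' c f, mscale C Y Y' c g) \<in> mor K (X, Y, \<alpha>) (X', Y', \<alpha>')"
   using K.mscale_mor[OF A A' p, of c] by (simp add: arrow_cat_simps)
  have sc: "(c \<odot> \<one>) \<odot>\<^bsub>cok (X', Y', \<alpha>')\<^esub> cokcl (X', Y', \<alpha>') y = cokcl (X', Y', \<alpha>') (mscale C G Y' c y)" if "y \<in> mor C G Y'" for y
   using that o G by (simp add: cok_facts(4)[OF A'] rho_smult rho_one cmp_mscale_right idm_mor cmp_idm)
  have "cokmap (X, Y, \<alpha>) (X', Y', \<alpha>') (mscale C Y Y' c g) =
    (\<lambda>S\<in>carrier (cok (X, Y, \<alpha>)). (c \<odot> \<one>) \<odot>\<^bsub>cok (X', Y', \<alpha>')\<^esub> cokmap (X, Y, \<alpha>) (X', Y', \<alpha>') g S)"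
   by (rule cok_eqI[OF A cokmap_ext])
    (use o G g in "simp_all add: cokmap_facts(1)[OF A A' cp] h(1) cok_facts(1)[OF A] sc cmp_mor cmp_mscale_left")
  then show "fmor coker_functor A A' (mscale K A A' c p) =
     mscale (mod_cat R) (fob coker_functor A) (fob coker_functor A') c (fmor coker_functor A A' p)"
   unfolding A_eq A'_eq p_eq arrow_cat_simps coker_functor_simps by (simp add: small_mor_scale[OF fg h(2)])
 }
 fix A A' A'' p q assume A: "A \<in> ob K" and A': "A' \<in> ob K" and A'': "A'' \<in> ob K"
  and p: "p \<in> mor K A A'" and q: "q \<in> mor K A' A''"
 obtain X Y \<alpha> where A_eq: "A = (X, Y, \<alpha>)" by (cases A)
 obtain X' Y' \<alpha>' where A'_eq: "A' = (X', Y', \<alpha>')" by (cases A')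
 obtain X'' Y'' \<alpha>'' where A''_eq: "A'' = (X'', Y'', \<alpha>'')" by (cases A'')
 obtain f g where p_eq: "p = (f, g)" by (cases p)
 obtain f' g' where q_eq: "q = (f', g')" by (cases q)
 note A = A[unfolded A_eq] and A' = A'[unfolded A'_eq] and A'' = A''[unfolded A''_eq]
  and p = p[unfolded A_eq A'_eq p_eq] and q = q[unfolded A''_eq A'_eq q_eq]
 have o: "X \<in> ob C" "Y \<in> ob C" "X' \<in> ob C" "Y' \<in> ob C" "Y'' \<in> ob C" using A A' A'' by (simp_all add: K_ob)
 have g: "g \<in> mor C Y Y'" "g' \<in> mor C Y' Y''" using p q by (simp_all add: arrow_cat_simps)
 have pq: "(cmp C X X' X'' f' f, cmp C Y Y' Y'' g' g) \<in> mor K (X, Y, \<alpha>) (X'', Y'', \<alpha>'')"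
  using K.cmp_mor[OF A A' A'' p q] by (simp add: arrow_cat_simps)
 note fg = cok_facts(5)[OF A] cok_facts(5)[OF A'] cok_facts(5)[OF A'']
 note h = cokmap_facts[OF A A' p] and h' = cokmap_facts[OF A' A'' q]
 have "cokmap (X, Y, \<alpha>) (X'', Y'', \<alpha>'') (cmp C Y Y' Y'' g' g) =
  compose (carrier (cok (X, Y, \<alpha>))) (cokmap (X', Y', \<alpha>') (X'', Y'', \<alpha>'') g') (cokmap (X, Y, \<alpha>) (X', Y', \<alpha>') g)"
  by (rule cok_eqI[OF A cokmap_ext])
   (use o G g in "simp_all add: cokmap_facts(1)[OF A A'' pq] h(1) h'(1) cok_facts(1)[OF A] cmp_mor cmp_assoc compose_def")
 then show "fmor coker_functor A A'' (cmp K A A' A'' q p) =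
   cmp (mod_cat R) (fob coker_functor A) (fob coker_functor A') (fob coker_functor A'') (fmor coker_functor A' A'' q) (fmor coker_functor A A' p)"
  unfolding A_eq A'_eq A''_eq p_eq q_eq arrow_cat_simps coker_functor_simps by (simp add: small_mor_compose[OF fg(1,2) h(2)])
qed

text \<open>The identity of \<open>Z\<close> is the sum of the \<open>a i b i\<close>. Each
  \<open>k (a i)\<close> equals \<open>\<alpha>\<close> composed with some \<open>h i\<close> by
  assumption, so the sum of the \<open>h i b i\<close> is a factor. This is the projectivity of
  \<open>Hom(G, Z)\<close>.\<close>

lemma factor_through:
 assumes Z: "Z \<in> ob C" and A: "(X, Y, \<alpha>) \<in> ob K" and k: "k \<in> mor C Z Y"
  and im: "!!u. u \<in> mor C G Z ==> cmp C G Z Y k u \<in> img (X, Y, \<alpha>)"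
 shows "\<exists>h\<in>mor C Z X. k = cmp C Z X Y \<alpha> h"
proof -
 have o: "X \<in> ob C" "Y \<in> ob C" "\<alpha> \<in> mor C X Y" using A by (simp_all add: K_ob)
 obtain n a b where ab: "!!i. i < n ==> a i \<in> mor C G Z \<and> b i \<in> mor C Z G"
  and id: "idm C Z = msum C Z Z (%i. cmp C Z G Z (a i) (b i)) {..<n::nat}" using retract[OF Z] by blast
 have "\<exists>h. h \<in> mor C G X \<and> cmp C G Z Y k (a i) = cmp C G X Y \<alpha> h" if "i < n" for i
  using im[of "a i"] ab[OF that] by (auto simp: img_def)
 then obtain h where h: "!!i. i < n ==> h i \<in> mor C G X \<and> cmp C G Z Y k (a i) = cmp C G X Y \<alpha> (h i)" by metis
 let ?h = "msum C Z X (%i. cmp C Z G X (h i) (b i)) {..<n}"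
 have "k = msum C Z Y (%i. cmp C Z G Y (cmp C G Z Y k (a i)) (b i)) {..<n}" by (rule retract_expand(2)[OF Z o(2) ab id k])
 also have "... = msum C Z Y (%i. cmp C Z X Y \<alpha> (cmp C Z G X (h i) (b i))) {..<n}"
  using o G Z ab h by (intro msum_cong) (auto simp: cmp_mor cmp_assoc)
 also have "... = cmp C Z X Y \<alpha> ?h"
  using o G Z ab h by (intro cmp_msum_right[symmetric]) (auto simp: cmp_mor)
 finally show ?thesis using o G Z ab h by (intro bexI[of _ ?h] msum_mor) (auto simp: cmp_mor)
qed

text \<open>The induced map vanishes iff \<open>g\<close> takes \<open>Hom(G, Y)\<close> into the
  image of \<open>Hom(G, \<alpha>')\<close>. By \<open>factor_through\<close> this means that
  \<open>g\<close> factors through \<open>\<alpha>'\<close>, which is the condition in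
  \<open>null_maps\<close>.\<close>

lemma coker_kernel:
 assumes A: "A \<in> ob K" and A': "A' \<in> ob K"
 shows "null_maps C A A' = {p \<in> mor K A A'. fmor coker_functor A A' p = mzero (mod_cat R) (fob coker_functor A) (fob coker_functor A')}"
proof -
 obtain X Y \<alpha> where A_eq: "A = (X, Y, \<alpha>)" by (cases A)
 obtain X' Y' \<alpha>' where A'_eq: "A' = (X', Y', \<alpha>')" by (cases A')
 note A = A[unfolded A_eq] and A' = A'[unfolded A'_eq]
 have o: "X \<in> ob C" "Y \<in> ob C" "\<alpha> \<in> mor C X Y" "X' \<in> ob C" "Y' \<in> ob C" "\<alpha>' \<in> mor C X' Y'" using A A' by (simp_all add: K_ob)
 note fg = cok_facts(5)[OF A] cok_facts(5)[OF A']
 have eq: "(\<exists>h\<in>mor C Y X'. g = cmp C Y X' Y' \<alpha>' h) \<longleftrightarrow>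
  small_mor R (cok (X, Y, \<alpha>)) (cok (X', Y', \<alpha>')) (cokmap (X, Y, \<alpha>) (X', Y', \<alpha>') g) =
   (\<lambda>x\<in>carrier (small_copy R (cok (X, Y, \<alpha>))). \<zero>\<^bsub>small_copy R (cok (X', Y', \<alpha>'))\<^esub>)"
  if p: "(f, g) \<in> mor K (X, Y, \<alpha>) (X', Y', \<alpha>')" for f g
 proof -
  have g: "g \<in> mor C Y Y'" using p by (simp add: arrow_cat_simps)
  note h = cokmap_facts[OF A A' p]
  note z = mod_hom_mzero[OF cok_facts(6)[OF A] cok_facts(6)[OF A']]
  have "small_mor R (cok (X, Y, \<alpha>)) (cok (X', Y', \<alpha>')) (cokmap (X, Y, \<alpha>) (X', Y', \<alpha>') g) =
   (\<lambda>x\<in>carrier (small_copy R (cok (X, Y, \<alpha>))). \<zero>\<^bsub>small_copy R (cok (X', Y', \<alpha>'))\<^esub>) \<longleftrightarrow>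
   cokmap (X, Y, \<alpha>) (X', Y', \<alpha>') g = (\<lambda>x\<in>carrier (cok (X, Y, \<alpha>)). \<zero>\<^bsub>cok (X', Y', \<alpha>')\<^esub>)"
   using small_mor_inj[OF fg h(2) z] small_mor_zero[OF fg] by auto
  also have "... \<longleftrightarrow> (\<forall>y\<in>mor C G Y. cmp C G Y Y' g y \<in> img (X', Y', \<alpha>'))" (is "?l \<longleftrightarrow> ?r")
  proof
   assume l: ?l
   show ?r
   proof
    fix y assume y: "y \<in> mor C G Y"
    have "cokcl (X', Y', \<alpha>') (cmp C G Y Y' g y) = \<zero>\<^bsub>cok (X', Y', \<alpha>')\<^esub>"
     using fun_cong[OF l, of "cokcl (X, Y, \<alpha>) y"] y h(1)[OF y] by (simp add: cok_facts(1)[OF A])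
    then show "cmp C G Y Y' g y \<in> img (X', Y', \<alpha>')" using y g o G by (simp add: cok_facts(8)[OF A'] cmp_mor)
   qed
  next
   assume r: ?r
   have r': "cokcl (X', Y', \<alpha>') (cmp C G Y Y' g y) = \<zero>\<^bsub>cok (X', Y', \<alpha>')\<^esub>" if y: "y \<in> mor C G Y" for y
    using r y g o G by (subst cok_facts(8)[OF A']) (auto simp: cmp_mor)
   show ?l
    by (rule cok_eqI[OF A cokmap_ext]) (simp_all add: h(1) r' cok_facts(1)[OF A])
  qed
  also have "... \<longleftrightarrow> (\<exists>h\<in>mor C Y X'. g = cmp C Y X' Y' \<alpha>' h)"
  proof
   assume "\<forall>y\<in>mor C G Y. cmp C G Y Y' g y \<in> img (X', Y', \<alpha>')"
   then show "\<exists>h\<in>mor C Y X'. g = cmp C Y X' Y' \<alpha>' h" by (intro factor_through[OF o(2) A' g]) auto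
  next
   assume "\<exists>h\<in>mor C Y X'. g = cmp C Y X' Y' \<alpha>' h"
   then show "\<forall>y\<in>mor C G Y. cmp C G Y Y' g y \<in> img (X', Y', \<alpha>')"
    using o G by (auto simp: img_def cmp_assoc cmp_mor)
  qed
  finally show ?thesis by blast
 qed
 show ?thesis
 proof (rule Set.set_eqI)
  fix p :: "'m \<times> 'm"
  obtain f g where p: "p = (f, g)" by (cases p)
  show "p \<in> null_maps C A A' \<longleftrightarrow>
   p \<in> {p \<in> mor K A A'. fmor coker_functor A A' p = mzero (mod_cat R) (fob coker_functor A) (fob coker_functor A')}"
   unfolding A_eq A'_eq p null_maps_def
   by (cases "(f, g) \<in> mor K (X, Y, \<alpha>) (X', Y', \<alpha>')") (simp_all add: coker_functor_simps eq)
 qed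
qed

text \<open>With \<open>w i\<close> representing the image of the generator \<open>a i\<close>, the
  sum of the \<open>w i b i\<close> lifts \<open>\<phi>\<close> to a morphism \<open>g\<close> from
  \<open>Y\<close> to \<open>Y'\<close>. The lift respects the images, so \<open>g \<alpha>\<close>
  factors through \<open>\<alpha>'\<close>, which gives \<open>f\<close>.\<close>

lemma coker_full:
 assumes A: "A \<in> ob K" and A': "A' \<in> ob K"
  and s: "s \<in> mor (mod_cat R) (fob coker_functor A) (fob coker_functor A')"
 shows "\<exists>p\<in>mor K A A'. fmor coker_functor A A' p = s"
proof -
 obtain X Y \<alpha> where A_eq: "A = (X, Y, \<alpha>)" by (cases A)
 obtain X' Y' \<alpha>' where A'_eq: "A' = (X', Y', \<alpha>')" by (cases A')
 note A = A[unfolded A_eq] and A' = A'[unfolded A'_eq]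
 have o: "X \<in> ob C" "Y \<in> ob C" "\<alpha> \<in> mor C X Y" "X' \<in> ob C" "Y' \<in> ob C" "\<alpha>' \<in> mor C X' Y'" using A A' by (simp_all add: K_ob)
 note fg = cok_facts(5)[OF A] cok_facts(5)[OF A']
 have "s \<in> mod_hom R (small_copy R (cok (X, Y, \<alpha>))) (small_copy R (cok (X', Y', \<alpha>')))"
  using s by (simp add: A_eq A'_eq coker_functor_simps)
 from small_mor_surj[OF fg this] obtain \<phi> where \<phi>: "\<phi> \<in> mod_hom R (cok (X, Y, \<alpha>)) (cok (X', Y', \<alpha>'))"
  and s_eq: "s = small_mor R (cok (X, Y, \<alpha>)) (cok (X', Y', \<alpha>')) \<phi>" by blast
 let ?c = "\<lambda>y\<in>mor C G Y. cokcl (X, Y, \<alpha>) y" and ?c' = "\<lambda>y\<in>mor C G Y'. cokcl (X', Y', \<alpha>') y"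
 let ?\<psi> = "compose (mor C G Y) \<phi> ?c"
 have \<psi>: "?\<psi> \<in> mod_hom R (hmod Y) (cok (X', Y', \<alpha>'))"
  using mod_hom_compose[OF left_module_hmod[OF o(2)] cok_facts(7)[OF A] \<phi>] by simp
 obtain n a b where ab: "!!i. i < n ==> a i \<in> mor C G Y \<and> b i \<in> mor C Y G"
  and id: "idm C Y = msum C Y Y (%i. cmp C Y G Y (a i) (b i)) {..<n::nat}" using retract[OF o(2)] by blast
 have "\<exists>w. w \<in> mor C G Y' \<and> ?\<psi> (a i) = cokcl (X', Y', \<alpha>') w" if "i < n" for i
  using mod_homD(1)[OF \<psi>, of "a i"] ab[OF that] by (auto simp: cok_facts(1)[OF A'])
 then obtain w where w: "!!i. i < n ==> w i \<in> mor C G Y' \<and> ?\<psi> (a i) = cokcl (X', Y', \<alpha>') (w i)" by metis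
 define g where "g = msum C Y Y' (%i. cmp C Y G Y' (w i) (b i)) {..<n}"
 have g: "g \<in> mor C Y Y'" unfolding g_def using o G ab w by (intro msum_mor) (auto simp: cmp_mor)
 have \<phi>g: "\<phi> (cokcl (X, Y, \<alpha>) y) = cokcl (X', Y', \<alpha>') (cmp C G Y Y' g y)" if y: "y \<in> mor C G Y" for y
 proof -
  \<comment> \<open>The coordinates of \<open>y\<close> with respect to the generators
    \<open>a i\<close>, as ring elements.\<close>
  define r where "r i = rho_inv (cmp C G Y G (b i) y)" for i
  have r: "r i \<in> carrier R" "\<rho> (r i) = cmp C G Y G (b i) y" if "i < n" for i
   unfolding r_def using rho_inv[of "cmp C G Y G (b i) y"] ab[OF that] o G y by (auto simp: cmp_mor)
  have am: "cmp C G G Y (a i) (\<rho> (r i)) \<in> mor C G Y" "cmp C G G Y' (w i) (\<rho> (r i)) \<in> mor C G Y'" if "i < n" for i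
   using ab[OF that] w[OF that] rho_in[OF r(1)[OF that]] o G by (auto intro!: cmp_mor)
  have "y = msum C G Y (%i. cmp C G G Y (a i) (cmp C G Y G (b i) y)) {..<n}" by (rule retract_expand(1)[OF o(2) G ab id y])
  also have "... = msum C G Y (%i. cmp C G G Y (a i) (\<rho> (r i))) {..<n}"
   using o G am r by (intro msum_cong) auto
  finally have ye: "y = finsum (hmod Y) (%i. cmp C G G Y (a i) (\<rho> (r i))) {..<n}" by (simp add: finsum_hmod)
  have "cmp C G Y Y' g y = msum C G Y' (%i. cmp C G Y Y' (cmp C Y G Y' (w i) (b i)) y) {..<n}"
   unfolding g_def using o G ab w y by (intro cmp_msum_left) (auto simp: cmp_mor)
  also have "... = msum C G Y' (%i. cmp C G G Y' (w i) (\<rho> (r i))) {..<n}"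
   using o G ab w y am r by (intro msum_cong) (auto simp: cmp_assoc)
  finally have ge: "cmp C G Y Y' g y = finsum (hmod Y') (%i. cmp C G G Y' (w i) (\<rho> (r i))) {..<n}" by (simp add: finsum_hmod)
  interpret Q': lmod R "cok (X', Y', \<alpha>')" using cok_facts(6)[OF A'] by (simp add: lmod_iff)
  have e: "?\<psi> (cmp C G G Y (a i) (\<rho> (r i))) = ?c' (cmp C G G Y' (w i) (\<rho> (r i)))" if i: "i < n" for i
  proof -
   have "?\<psi> (r i \<odot>\<^bsub>hmod Y\<^esub> a i) = r i \<odot>\<^bsub>cok (X', Y', \<alpha>')\<^esub> ?\<psi> (a i)"
    using i ab r by (intro mod_homD(3)[OF \<psi>]) auto
   also have "... = cokcl (X', Y', \<alpha>') (cmp C G G Y' (w i) (\<rho> (r i)))" using i w r by (simp add: cok_facts(4)[OF A'])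
   finally show ?thesis using am[OF i] by simp
  qed
  have c'c: "?c' (cmp C G G Y' (w i) (\<rho> (r i))) \<in> carrier (cok (X', Y', \<alpha>'))" if "i < n" for i
   using am[OF that] by (simp add: cok_facts(1)[OF A'])
  have "\<phi> (cokcl (X, Y, \<alpha>) y) = ?\<psi> y" using y by (simp add: compose_eq)
  also have "... = finsum (cok (X', Y', \<alpha>')) (%i. ?\<psi> (cmp C G G Y (a i) (\<rho> (r i)))) {..<n}"
   by (subst ye, rule mod_hom_finsum[OF left_module_hmod[OF o(2)] cok_facts(6)[OF A'] \<psi>]) (use am in auto)
  also have "... = finsum (cok (X', Y', \<alpha>')) (%i. ?c' (cmp C G G Y' (w i) (\<rho> (r i)))) {..<n}"
   by (rule Q'.M.finsum_cong') (use e c'c in auto)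
  also have "... = ?c' (finsum (hmod Y') (%i. cmp C G G Y' (w i) (\<rho> (r i))) {..<n})"
   by (rule mod_hom_finsum[OF left_module_hmod[OF o(5)] cok_facts(6)[OF A'] cok_facts(7)[OF A'], symmetric]) (use am in auto)
  also have "... = cokcl (X', Y', \<alpha>') (cmp C G Y Y' g y)" using ge y g o G by (simp add: cmp_mor flip: ge)
  finally show ?thesis .
 qed
 have "\<exists>f\<in>mor C X X'. cmp C X Y Y' g \<alpha> = cmp C X X' Y' \<alpha>' f"
 proof (rule factor_through[OF o(1) A'])
  show "cmp C X Y Y' g \<alpha> \<in> mor C X Y'" using o g by (simp add: cmp_mor)
  fix u assume u: "u \<in> mor C G X"
  then have \<alpha>u: "cmp C G X Y \<alpha> u \<in> mor C G Y" "cmp C G X Y \<alpha> u \<in> img (X, Y, \<alpha>)" using o G by (auto simp: cmp_mor img_def)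
  then have "cokcl (X, Y, \<alpha>) (cmp C G X Y \<alpha> u) = \<zero>\<^bsub>cok (X, Y, \<alpha>)\<^esub>" using cok_facts(8)[OF A] by blast
  then have "cokcl (X', Y', \<alpha>') (cmp C G Y Y' g (cmp C G X Y \<alpha> u)) = \<zero>\<^bsub>cok (X', Y', \<alpha>')\<^esub>"
   using \<phi>g[OF \<alpha>u(1)] mod_hom_zero[OF cok_facts(6)[OF A] cok_facts(6)[OF A'] \<phi>] by simp
  then show "cmp C G X Y' (cmp C X Y Y' g \<alpha>) u \<in> img (X', Y', \<alpha>')"
   using cok_facts(8)[OF A'] \<alpha>u(1) u o G g by (simp add: cmp_mor cmp_assoc)
 qed
 then obtain f where f: "f \<in> mor C X X'" "cmp C X Y Y' g \<alpha> = cmp C X X' Y' \<alpha>' f" by blast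
 have p: "(f, g) \<in> mor K (X, Y, \<alpha>) (X', Y', \<alpha>')" using f g by (simp add: arrow_cat_simps)
 have "cokmap (X, Y, \<alpha>) (X', Y', \<alpha>') g = \<phi>"
  by (rule cok_eqI[OF A cokmap_ext mod_homD(4)[OF \<phi>]]) (simp add: cokmap_facts(1)[OF A A' p] \<phi>g)
 then have "fmor coker_functor (X, Y, \<alpha>) (X', Y', \<alpha>') (f, g) = s" by (simp add: coker_functor_simps s_eq)
 then show ?thesis using p unfolding A_eq A'_eq by blast
qed

end

section \<open>Density: presentations of finitely generated modules by powers of
  \<open>G\<close>\<close>

lemma (in abelian_group) minus_eq_zero_iff:
 assumes "x \<in> carrier G" "y \<in> carrier G"
 shows "x \<ominus> y = \<zero> \<longleftrightarrow> x = y"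
proof
 assume "x \<ominus> y = \<zero>"
 moreover have "x = (x \<ominus> y) \<oplus> y" using assms by (simp add: minus_eq a_assoc l_neg)
 ultimately show "x = y" using assms by simp
qed (use assms in "simp add: minus_eq r_neg")

text \<open>Induction on a spanning set: the vectors of \<open>N\<close> that can be written without
  \<open>v\<close> form a subspace to which the hypothesis applies, and if \<open>v\<close> occurs
  at all, one further generator suffices. The result is applied to the kernel of a map onto a
  module.\<close>

lemma fin_gen_subspace:
 assumes V: "lmod field_ring V" and fg: "fin_gen field_ring V" and N: "lsubmodule field_ring V N"
 shows "\<exists>B. finite B \<and> B \<subseteq> N \<and> (\<forall>U. lsubmodule field_ring V U --> B \<subseteq> U --> N \<subseteq> U)"
proof -
 interpret V: lmod field_ring V by (rule V)
 let ?f = "%S c. finsum V (%s. c s \<odot>\<^bsub>V\<^esub> s) S"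
 have cl: "?f S c \<in> carrier V" if "S \<subseteq> carrier V" for S c using that by (intro V.M.finsum_closed) auto
 have lin: "?f S c \<oplus>\<^bsub>V\<^esub> k \<odot>\<^bsub>V\<^esub> ?f S d = ?f S (%s. c s + k * d s)" if S: "S \<subseteq> carrier V" for S c d k
 proof -
  have "k \<odot>\<^bsub>V\<^esub> ?f S d = finsum V (%s. k \<odot>\<^bsub>V\<^esub> (d s \<odot>\<^bsub>V\<^esub> s)) S" using S by (intro V.smult_finsum) auto
  then have "?f S c \<oplus>\<^bsub>V\<^esub> k \<odot>\<^bsub>V\<^esub> ?f S d = finsum V (%s. c s \<odot>\<^bsub>V\<^esub> s \<oplus>\<^bsub>V\<^esub> k \<odot>\<^bsub>V\<^esub> (d s \<odot>\<^bsub>V\<^esub> s)) S"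
   using S by (simp only:) (intro V.M.finsum_addf[symmetric]; auto)
  also have "... = ?f S (%s. c s + k * d s)"
  proof (rule V.M.finsum_cong'[OF refl])
   fix s assume "s \<in> S"
   then have s: "s \<in> carrier V" using S by blast
   show "c s \<odot>\<^bsub>V\<^esub> s \<oplus>\<^bsub>V\<^esub> k \<odot>\<^bsub>V\<^esub> (d s \<odot>\<^bsub>V\<^esub> s) = (c s + k * d s) \<odot>\<^bsub>V\<^esub> s"
    using V.add_smult[of "c s" "k * d s" s] V.mult_smult[of k "d s" s] s by simp
  qed (use S in auto)
  finally show ?thesis .
 qed
 have zero: "?f S (%_. 0) = \<zero>\<^bsub>V\<^esub>" if S: "S \<subseteq> carrier V" for S
 proof -
  have "?f S (%_. 0) = finsum V (%_. \<zero>\<^bsub>V\<^esub>) S" using S V.zero_smult by (intro V.M.finsum_cong') auto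
  then show ?thesis by simp
 qed
 have sub: "N \<subseteq> carrier V" "x \<oplus>\<^bsub>V\<^esub> k \<odot>\<^bsub>V\<^esub> y \<in> N" if "lsubmodule field_ring V N" "x \<in> N" "y \<in> N" for N x y k
  using that by (auto simp: lsubmodule_def)
 have main: "\<exists>B. finite B \<and> B \<subseteq> N \<and> (\<forall>U. lsubmodule field_ring V U --> B \<subseteq> U --> N \<subseteq> U)"
  if "finite S" "S \<subseteq> carrier V" "lsubmodule field_ring V N" "!!x. x \<in> N ==> \<exists>c. x = ?f S c" for S N
  using that
 proof (induction S arbitrary: N)
  case empty
  then show ?case by (intro exI[of _ "{}"]) (auto simp: lsubmodule_def)
 next
  case (insert v S)
  have vS: "v \<in> carrier V" "S \<subseteq> carrier V" using insert.prems(1) by auto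
  have step: "?f (insert v S) c = c v \<odot>\<^bsub>V\<^esub> v \<oplus>\<^bsub>V\<^esub> ?f S c" for c
   using insert.hyps vS by (intro V.M.finsum_insert) auto
  have drop: "?f (insert v S) c = ?f S c" if "c v = 0" for c using that step[of c] cl[OF vS(2)] vS(1) V.zero_smult by simp
  let ?N = "{x \<in> N. \<exists>c. x = ?f S c}"
  have "lsubmodule field_ring V ?N" unfolding lsubmodule_def
  proof (intro conjI ballI)
   show "?N \<subseteq> carrier V" using insert.prems(2) by (auto simp: lsubmodule_def)
   show "\<zero>\<^bsub>V\<^esub> \<in> ?N" using insert.prems(2) zero[OF vS(2)] by (auto simp: lsubmodule_def intro!: exI[of _ "%_. 0"])
  next
   fix x y assume "x \<in> ?N" "y \<in> ?N"
   then obtain c d where c: "x \<in> N" "x = ?f S c" "y \<in> N" "y = ?f S d" by blast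
   then have "x \<oplus>\<^bsub>V\<^esub> 1 \<odot>\<^bsub>V\<^esub> y = ?f S (%s. c s + 1 * d s)" by (simp only: lin[OF vS(2)])
   moreover have "1 \<odot>\<^bsub>V\<^esub> y = y" using V.one_smult[of y] cl[OF vS(2)] c(4) by simp
   ultimately show "x \<oplus>\<^bsub>V\<^esub> y \<in> ?N" using sub(2)[OF insert.prems(2) c(1,3), of 1] by auto
  next
   fix k x assume "x \<in> ?N"
   then obtain c where c: "x \<in> N" "x = ?f S c" by blast
   have "k \<odot>\<^bsub>V\<^esub> x = ?f S (%s. 0 + k * c s)"
    using lin[OF vS(2), of "%_. 0" k c] cl[OF vS(2), of c] by (simp add: zero[OF vS(2)] c(2))
   moreover have "k \<odot>\<^bsub>V\<^esub> x \<in> N" using insert.prems(2) c(1) by (simp add: lsubmodule_def)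
   ultimately show "k \<odot>\<^bsub>V\<^esub> x \<in> ?N" by (intro CollectI conjI exI)
  qed
  from insert.IH[OF vS(2) this] obtain B where B: "finite B" "B \<subseteq> ?N"
   "!!U. lsubmodule field_ring V U ==> B \<subseteq> U ==> ?N \<subseteq> U" by blast
  show ?case
  proof (cases "\<exists>c. ?f (insert v S) c \<in> N \<and> c v ~= 0")
   case False
   have "x \<in> ?N" if x: "x \<in> N" for x
   proof -
    obtain c where c: "x = ?f (insert v S) c" using insert.prems(3)[OF x] by blast
    then have "c v = 0" using False x by blast
    then show ?thesis using drop c x by blast
   qed
   then show ?thesis using B by (intro exI[of _ B]) blast
  next
   case True
   then obtain d where d: "?f (insert v S) d \<in> N" "d v ~= 0" by blast
   let ?y = "?f (insert v S) d"
   have "x \<in> U" if U: "lsubmodule field_ring V U" "insert ?y B \<subseteq> U" and x: "x \<in> N" for U x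
   proof -
    obtain c where c: "x = ?f (insert v S) c" using insert.prems(3)[OF x] by blast
    \<comment> \<open>Subtracting this multiple of \<open>?y\<close> removes \<open>v\<close> from
      the combination.\<close>
    let ?k = "c v / d v"
    let ?z = "x \<oplus>\<^bsub>V\<^esub> (- ?k) \<odot>\<^bsub>V\<^esub> ?y"
    have "?z = ?f (insert v S) (%s. c s + - ?k * d s)" unfolding c by (rule lin) (use vS in auto)
    also have "... = ?f S (%s. c s + - ?k * d s)" by (rule drop) (simp add: d(2))
    finally have "?z \<in> ?N" using sub(2)[OF insert.prems(2) x d(1), of "- ?k"] by (intro CollectI conjI exI)
    then have zU: "?z \<in> U" using B(3)[OF U(1)] U(2) by blast
    have yV: "?y \<in> carrier V" "x \<in> carrier V" using d(1) x sub(1)[OF insert.prems(2) x x] by auto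
    have "?z \<oplus>\<^bsub>V\<^esub> ?k \<odot>\<^bsub>V\<^esub> ?y = x \<oplus>\<^bsub>V\<^esub> ((- ?k) \<odot>\<^bsub>V\<^esub> ?y \<oplus>\<^bsub>V\<^esub> ?k \<odot>\<^bsub>V\<^esub> ?y)"
     using yV by (intro V.M.a_assoc) auto
    also have "(- ?k) \<odot>\<^bsub>V\<^esub> ?y \<oplus>\<^bsub>V\<^esub> ?k \<odot>\<^bsub>V\<^esub> ?y = \<zero>\<^bsub>V\<^esub>"
     using V.add_smult[of "- ?k" ?k ?y, symmetric] V.zero_smult[OF yV(1)] yV by simp
    finally have "?z \<oplus>\<^bsub>V\<^esub> ?k \<odot>\<^bsub>V\<^esub> ?y = x" using yV by simp
    moreover have "?y \<in> U" using U(2) by simp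
    ultimately show ?thesis using sub(2)[OF U(1) zU, of ?y ?k] by simp
   qed
   then show ?thesis using B(1,2) d(1) by (intro exI[of _ "insert ?y B"]) blast
  qed
 qed
 have NV: "N \<subseteq> carrier V" using N by (simp add: lsubmodule_def)
 from fg[unfolded fin_gen_def] obtain S where S: "finite S" "S \<subseteq> carrier V"
  "\<forall>x\<in>carrier V. \<exists>c\<in>S \<rightarrow> carrier field_ring. x = ?f S c" by (elim exE conjE)
 have "\<exists>c. x = ?f S c" if "x \<in> N" for x
  using S(3)[THEN bspec, OF subsetD[OF NV that]] by (elim bexE) (rule exI)
 then show ?thesis by (rule main[OF S(1,2) N])
qed

lemma cat_iso_mod_iso:
 assumes M: "M \<in> ob (mod_cat R)" and N: "N \<in> ob (mod_cat R)" and f: "f \<in> mod_iso R M N"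
 shows "cat_iso (mod_cat R) M N f"
proof -
 have Ml: "left_module R M" using M by simp
 let ?g = "\<lambda>y\<in>carrier N. inv_into (carrier M) f y"
 have g: "?g \<in> mod_hom R N M" by (rule mod_iso_hom[OF mod_iso_inverse[OF Ml f]])
 note fh = mod_iso_hom[OF f] and b = mod_iso_bij[OF f]
 have 1: "compose (carrier M) ?g f = (\<lambda>x\<in>carrier M. x)"
  using b mod_homD(1)[OF fh] by (auto simp: compose_def bij_betw_def intro!: restrict_ext)
 have 2: "compose (carrier N) f ?g = (\<lambda>x\<in>carrier N. x)"
  using b by (auto simp: compose_def bij_betw_def f_inv_into_f intro!: restrict_ext)
 show ?thesis unfolding cat_iso_def using fh g 1 2 by auto
qed

context gen_cat begin

text \<open>The elements of \<open>D\<close> are the components of a map from a power of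
  \<open>G\<close> to \<open>Y\<close>, whose image is the submodule they generate.\<close>

lemma image_of_generated:
 assumes Y: "Y \<in> ob C" and D: "finite D" "D \<subseteq> mor C G Y"
 shows "\<exists>X \<alpha>. (X, Y, \<alpha>) \<in> ob K \<and> D \<subseteq> img (X, Y, \<alpha>) \<and>
  (\<forall>U. lsubmodule R (hmod Y) U --> D \<subseteq> U --> img (X, Y, \<alpha>) \<subseteq> U)"
proof -
 interpret H: lmod R "hmod Y" by (rule lmod_hmod[OF Y])
 obtain d where d: "bij_betw d {..<card D} D" using ex_bij_betw_nat_finite[OF D(1)] by (auto simp: atLeast0LessThan)
 let ?m = "card D"
 have dm: "d i \<in> D" "d i \<in> mor C G Y" if "i < ?m" for i using d that D(2) by (auto simp: bij_betw_def)
 obtain X \<iota> \<pi> where bd: "biprod_data C ?m (%_. G) X \<iota> \<pi>" using power by blast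
 note b = bd[unfolded biprod_data_def]
 have X: "X \<in> ob C" and ip: "!!i. i < ?m ==> \<iota> i \<in> mor C G X" "!!i. i < ?m ==> \<pi> i \<in> mor C X G"
  and delta: "!!i j. i < ?m ==> j < ?m ==> cmp C G X G (\<pi> j) (\<iota> i) = (if i = j then idm C G else mzero C G G)"
  using b by auto
 define \<alpha> where "\<alpha> = msum C X Y (%i. cmp C X G Y (d i) (\<pi> i)) {..<?m}"
 have \<alpha>: "\<alpha> \<in> mor C X Y" unfolding \<alpha>_def using X Y G dm ip by (intro msum_mor) (auto simp: cmp_mor)
 have \<alpha>x: "cmp C G X Y \<alpha> x = msum C G Y (%i. cmp C G G Y (d i) (cmp C G X G (\<pi> i) x)) {..<?m}" if x: "x \<in> mor C G X" for x
 proof -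
  have "cmp C G X Y \<alpha> x = msum C G Y (%i. cmp C G X Y (cmp C X G Y (d i) (\<pi> i)) x) {..<?m}"
   unfolding \<alpha>_def using X Y G dm ip x by (intro cmp_msum_left) (auto simp: cmp_mor)
  also have "... = msum C G Y (%i. cmp C G G Y (d i) (cmp C G X G (\<pi> i) x)) {..<?m}"
   using X Y G dm ip x by (intro msum_cong) (auto simp: cmp_mor cmp_assoc)
  finally show ?thesis .
 qed
 have "D \<subseteq> img (X, Y, \<alpha>)"
 proof
  fix e assume "e \<in> D"
  then obtain k where k: "k < ?m" "e = d k" using d by (auto simp: bij_betw_def)
  have "cmp C G X Y \<alpha> (\<iota> k) = msum C G Y (%i. cmp C G G Y (d i) (cmp C G X G (\<pi> i) (\<iota> k))) {..<?m}"
   using k ip by (intro \<alpha>x) auto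
  also have "... = cmp C G G Y (d k) (cmp C G X G (\<pi> k) (\<iota> k))"
   using k ip X Y G dm by (subst msum_delta[where j = k]) (auto simp: delta cmp_mzero_right cmp_idm)
  also have "... = e" using k dm G Y by (simp add: delta cmp_idm)
  finally show "e \<in> img (X, Y, \<alpha>)" using ip k by (force simp: img_def)
 qed
 moreover have "img (X, Y, \<alpha>) \<subseteq> U" if U: "lsubmodule R (hmod Y) U" "D \<subseteq> U" for U
 proof
  fix y assume "y \<in> img (X, Y, \<alpha>)"
  then obtain x where x: "x \<in> mor C G X" "y = cmp C G X Y \<alpha> x" by (auto simp: img_def)
  have "finsum (hmod Y) (%i. cmp C G G Y (d i) (cmp C G X G (\<pi> i) x)) {..<?m} \<in> U"
  proof (rule H.lsubmodule_finsum[OF U(1)])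
   fix i assume "i \<in> {..<?m}"
   then have i: "d i \<in> U" "cmp C G X G (\<pi> i) x \<in> mor C G G" using dm U(2) ip x G X by (auto simp: cmp_mor)
   have "r \<odot>\<^bsub>hmod Y\<^esub> u \<in> U" if "r \<in> carrier R" "u \<in> U" for r u
    using U(1) that by (simp add: lsubmodule_def)
   from this[OF rho_inv(1)[OF i(2)] i(1)] show "cmp C G G Y (d i) (cmp C G X G (\<pi> i) x) \<in> U"
    using rho_inv(2)[OF i(2)] by simp
  qed
  then show "y \<in> U" using x \<alpha>x by (simp add: finsum_hmod)
 qed
 ultimately show ?thesis using X Y \<alpha> by (intro exI[of _ X] exI[of _ \<alpha>]) (auto simp: K_ob)
qed

text \<open>Generators of \<open>M\<close> give a surjection from \<open>Hom(G, Y)\<close> with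
  \<open>Y\<close> a power of \<open>G\<close>. Its kernel is finite dimensional, hence generated by
  finitely many elements, and these are the components of the diagram that presents
  \<open>M\<close>.\<close>

lemma coker_dense:
 assumes M: "M \<in> ob (mod_cat R)"
 shows "\<exists>A\<in>ob K. \<exists>e. cat_iso (mod_cat R) (fob coker_functor A) M e"
proof -
 have Ml: "left_module R M" and Mf: "fin_gen R M" using M by auto
 interpret M: lmod R M using Ml by (simp add: lmod_iff)
 obtain S where S: "finite S" "S \<subseteq> carrier M" "!!N. lsubmodule R M N ==> S \<subseteq> N ==> carrier M \<subseteq> N"
  using Mf unfolding M.fin_gen_iff by blast
 let ?n = "card S"
 obtain \<beta> where \<beta>: "bij_betw \<beta> {..<?n} S" using ex_bij_betw_nat_finite[OF S(1)] by (auto simp: atLeast0LessThan)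
 have \<beta>M: "\<beta> i \<in> carrier M" if "i < ?n" for i using \<beta> that S(2) by (auto simp: bij_betw_def)
 obtain Y \<iota> \<pi> where bd: "biprod_data C ?n (%_. G) Y \<iota> \<pi>" using power by blast
 have Y: "Y \<in> ob C" and ip: "!!i. i < ?n ==> \<iota> i \<in> mor C G Y" "!!i. i < ?n ==> \<pi> i \<in> mor C Y G"
  and delta: "!!i j. i < ?n ==> j < ?n ==> cmp C G Y G (\<pi> j) (\<iota> i) = (if i = j then idm C G else mzero C G G)"
  using bd[unfolded biprod_data_def] by auto
 interpret H: lmod R "hmod Y" by (rule lmod_hmod[OF Y])
 note hY = left_module_hmod[OF Y]
 have rho_inv_eqI: "rho_inv u = r" if "r \<in> carrier R" "\<rho> r = u" for r u
  using rho_bij that by (auto simp: rho_inv_def bij_betw_def)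
 have ri_add: "rho_inv (madd C G G u v) = rho_inv u \<oplus> rho_inv v" if "u \<in> mor C G G" "v \<in> mor C G G" for u v
  by (rule rho_inv_eqI) (use that rho_inv in "auto simp: rho_add")
 have ri_mult: "rho_inv (cmp C G G G u (\<rho> r)) = r \<otimes> rho_inv u" if "u \<in> mor C G G" "r \<in> carrier R" for u r
  by (rule rho_inv_eqI) (use that rho_inv in "auto simp: rho_mult")
 have ri0: "rho_inv (mzero C G G) = \<zero>"
  by (rule rho_inv_eqI) (use rho_smult[of \<zero> 0] kvec.zero_smult[of \<zero>] G in "auto simp: mscale_zero")
 \<comment> \<open>With endomorphisms of \<open>G\<close> read as elements of \<open>R\<close>, an
   element \<open>y\<close> of \<open>Hom(G, Y)\<close> is a row of coefficients, by which
   \<open>q\<close> combines the generators \<open>\<beta> i\<close>.\<close>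
 define q where "q y = finsum M (%i. rho_inv (cmp C G Y G (\<pi> i) y) \<odot>\<^bsub>M\<^esub> \<beta> i) {..<?n}" for y
 have \<pi>y: "cmp C G Y G (\<pi> i) y \<in> mor C G G" "rho_inv (cmp C G Y G (\<pi> i) y) \<in> carrier R"
  if "y \<in> mor C G Y" "i < ?n" for y i
 proof -
  show "cmp C G Y G (\<pi> i) y \<in> mor C G G" using that G Y ip by (auto simp: cmp_mor)
  then show "rho_inv (cmp C G Y G (\<pi> i) y) \<in> carrier R" by (rule rho_inv)
 qed
 define p where "p = restrict q (mor C G Y)"
 have p: "p \<in> mod_hom R (hmod Y) M"
 proof (rule mod_homI)
  fix y assume "y \<in> carrier (hmod Y)"
  then have y: "y \<in> mor C G Y" by simp
  have f: "(%i. rho_inv (cmp C G Y G (\<pi> i) y) \<odot>\<^bsub>M\<^esub> \<beta> i) \<in> {..<?n} \<rightarrow> carrier M" using \<pi>y[OF y] \<beta>M by auto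
  show "p y \<in> carrier M" using y f by (simp add: p_def q_def M.M.finsum_closed)
  {
   fix z assume "z \<in> carrier (hmod Y)"
   then have z: "z \<in> mor C G Y" by simp
   have "q (madd C G Y y z) = finsum M (%i. rho_inv (cmp C G Y G (\<pi> i) y) \<odot>\<^bsub>M\<^esub> \<beta> i \<oplus>\<^bsub>M\<^esub> rho_inv (cmp C G Y G (\<pi> i) z) \<odot>\<^bsub>M\<^esub> \<beta> i) {..<?n}"
    unfolding q_def using y z \<pi>y[OF y] \<pi>y[OF z] \<beta>M ip G Y
    by (intro M.M.finsum_cong') (auto simp: cmp_madd_right ri_add M.add_smult)
   also have "... = q y \<oplus>\<^bsub>M\<^esub> q z" unfolding q_def using \<pi>y[OF y] \<pi>y[OF z] \<beta>M by (intro M.M.finsum_addf) auto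
   finally show "p (y \<oplus>\<^bsub>hmod Y\<^esub> z) = p y \<oplus>\<^bsub>M\<^esub> p z" using y z G Y by (simp add: p_def madd_mor)
  }
  fix r assume r: "r \<in> carrier R"
  have "q (cmp C G G Y y (\<rho> r)) = finsum M (%i. r \<odot>\<^bsub>M\<^esub> (rho_inv (cmp C G Y G (\<pi> i) y) \<odot>\<^bsub>M\<^esub> \<beta> i)) {..<?n}"
   unfolding q_def using y r \<pi>y[OF y] \<beta>M ip G Y
   by (intro M.M.finsum_cong') (auto simp: cmp_assoc[symmetric] ri_mult M.mult_smult)
  also have "... = r \<odot>\<^bsub>M\<^esub> q y" unfolding q_def using r f by (intro M.smult_finsum[symmetric]) auto
  finally show "p (r \<odot>\<^bsub>hmod Y\<^esub> y) = r \<odot>\<^bsub>M\<^esub> p y" using y r G Y by (simp add: p_def cmp_mor)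
 qed (simp add: p_def)
 have "carrier M \<subseteq> p ` mor C G Y"
 proof (rule S(3))
  have mem: "p y \<in> p ` mor C G Y" if "y \<in> carrier (hmod Y)" for y using that by simp
  show "lsubmodule R M (p ` mor C G Y)" unfolding lsubmodule_def
  proof (intro conjI ballI)
   show "p ` mor C G Y \<subseteq> carrier M" using mod_homD(1)[OF p] by auto
   show "\<zero>\<^bsub>M\<^esub> \<in> p ` mor C G Y" using mem[OF H.M.zero_closed] by (simp only: mod_hom_zero[OF hY Ml p])
  next
   fix x y assume "x \<in> p ` mor C G Y" "y \<in> p ` mor C G Y"
   then obtain a b where ab: "a \<in> carrier (hmod Y)" "x = p a" "b \<in> carrier (hmod Y)" "y = p b" by auto
   then show "x \<oplus>\<^bsub>M\<^esub> y \<in> p ` mor C G Y" using mem[OF H.M.a_closed[OF ab(1,3)]] by (simp only: mod_homD(2)[OF p])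
  next
   fix r x assume r: "r \<in> carrier R" and "x \<in> p ` mor C G Y"
   then obtain a where a: "a \<in> carrier (hmod Y)" "x = p a" by auto
   then show "r \<odot>\<^bsub>M\<^esub> x \<in> p ` mor C G Y" using mem[OF H.smult_closed[OF r a(1)]] r by (simp only: mod_homD(3)[OF p])
  qed
  show "S \<subseteq> p ` mor C G Y"
  proof
   fix s assume "s \<in> S"
   then obtain i where i: "i < ?n" "s = \<beta> i" using \<beta> by (auto simp: bij_betw_def)
   have "p (\<iota> i) = finsum M (%j. if i = j then \<beta> j else \<zero>\<^bsub>M\<^esub>) {..<?n}"
    unfolding p_def q_def using ip i \<beta>M rho_inv_eqI[OF one_closed rho_one]
    by (auto intro!: M.M.finsum_cong' simp: delta ri0)
   also have "... = s" using i \<beta>M by (subst M.M.finsum_singleton) auto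
   finally show "s \<in> p ` mor C G Y" using ip(1)[OF i(1)] by (intro image_eqI[of _ _ "\<iota> i"]) auto
  qed
 qed
 then have psurj: "\<exists>y\<in>mor C G Y. p y = x" if "x \<in> carrier M" for x using that by blast
 let ?N = "{y \<in> carrier (hmod Y). p y = \<zero>\<^bsub>M\<^esub>}"
 have kerp: "lsubmodule R (hmod Y) ?N"
  unfolding lsubmodule_def using mod_hom_zero[OF hY Ml p]
  by (auto simp del: hmod_simps simp: mod_homD(2,3)[OF p])
 have kmod_sub: "lsubmodule field_ring (kmod R (hmod Y)) U" if "lsubmodule R (hmod Y) U" for U
  using that by (auto simp: lsubmodule_def)
 obtain D where D: "finite D" "D \<subseteq> ?N" "!!U. lsubmodule field_ring (kmod R (hmod Y)) U ==> D \<subseteq> U ==> ?N \<subseteq> U"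
  using fin_gen_subspace[OF lmod_kmod[OF H.lmod_axioms] fin_gen_kmod[OF H.lmod_axioms fin_gen_hmod[OF Y] fin_dim] kmod_sub[OF kerp]]
  by blast
 have Dm: "D \<subseteq> mor C G Y" using D(2) by auto
 obtain X \<alpha> where A: "(X, Y, \<alpha>) \<in> ob K" and Di: "D \<subseteq> img (X, Y, \<alpha>)"
  and imin: "!!U. lsubmodule R (hmod Y) U ==> D \<subseteq> U ==> img (X, Y, \<alpha>) \<subseteq> U"
  using image_of_generated[OF Y D(1) Dm] by blast
 have img: "img (X, Y, \<alpha>) = ?N"
  using imin[OF kerp D(2)] D(3)[OF kmod_sub[OF lsubmodule_img[OF A]] Di] by (rule subset_antisym)
 interpret Q: quot_module R "hmod Y" "img (X, Y, \<alpha>)" by (rule quot_module_img[OF A])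
 let ?cl = "cokcl (X, Y, \<alpha>)"
 have cl_p: "?cl y = ?cl y' \<longleftrightarrow> p y = p y'" if y: "y \<in> mor C G Y" and y': "y' \<in> mor C G Y" for y y'
 proof -
  have c: "y \<in> carrier (hmod Y)" "y' \<in> carrier (hmod Y)" using y y' by auto
  have e: "p (y \<ominus>\<^bsub>hmod Y\<^esub> y') = p y \<ominus>\<^bsub>M\<^esub> p y'"
   unfolding a_minus_def using mod_homD(2)[OF p c(1) H.M.a_inv_closed[OF c(2)]] mod_hom_minus[OF hY Ml p c(2)] by simp
  have "?cl y = ?cl y' \<longleftrightarrow> p (y \<ominus>\<^bsub>hmod Y\<^esub> y') = \<zero>\<^bsub>M\<^esub>"
   using Q.cl_eq_iff[OF c] H.M.minus_closed[OF c] by (simp add: cokcl_def img)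
  also have "... \<longleftrightarrow> p y = p y'" unfolding e
   by (rule M.M.minus_eq_zero_iff[OF mod_homD(1)[OF p c(1)] mod_homD(1)[OF p c(2)]])
  finally show ?thesis .
 qed
 \<comment> \<open>The surjection \<open>p\<close> and the projection to the cokernel have the same
   fibres by \<open>cl_p\<close>, so the result is independent of the chosen preimage.\<close>
 define t where "t x = ?cl (SOME y. y \<in> mor C G Y \<and> p y = x)" for x
 have tp: "t (p y) = ?cl y" if y: "y \<in> mor C G Y" for y
 proof -
  have "(SOME y'. y' \<in> mor C G Y \<and> p y' = p y) \<in> mor C G Y \<and> p (SOME y'. y' \<in> mor C G Y \<and> p y' = p y) = p y"
   by (rule someI[of "%y'. y' \<in> mor C G Y \<and> p y' = p y" y]) (simp add: y)
  then show ?thesis unfolding t_def using cl_p y by blast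
 qed
 define T where "T = restrict t (carrier M)"
 have pc: "p y \<in> carrier M" if "y \<in> mor C G Y" for y using mod_homD(1)[OF p] that by simp
 have Tp: "T (p y) = ?cl y" if "y \<in> mor C G Y" for y using tp pc that by (simp add: T_def)
 have TM: "T \<in> mod_hom R M (cok (X, Y, \<alpha>))"
 proof (rule mod_homI)
  fix x x' assume "x \<in> carrier M" "x' \<in> carrier M"
  then obtain y y' where y: "y \<in> mor C G Y" "x = p y" "y' \<in> mor C G Y" "x' = p y'" using psurj by metis
  have "x \<oplus>\<^bsub>M\<^esub> x' = p (madd C G Y y y')" using mod_homD(2)[OF p, of y y'] y by simp
  then show "T (x \<oplus>\<^bsub>M\<^esub> x') = T x \<oplus>\<^bsub>cok (X, Y, \<alpha>)\<^esub> T x'"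
   using y G Y by (simp add: Tp cok_facts(3)[OF A] madd_mor)
 next
  fix r x assume r: "r \<in> carrier R" and "x \<in> carrier M"
  then obtain y where y: "y \<in> mor C G Y" "x = p y" using psurj by metis
  have "r \<odot>\<^bsub>M\<^esub> x = p (cmp C G G Y y (\<rho> r))" using mod_homD(3)[OF p r, of y] y by simp
  then show "T (r \<odot>\<^bsub>M\<^esub> x) = r \<odot>\<^bsub>cok (X, Y, \<alpha>)\<^esub> T x"
   using y G Y r by (simp add: Tp cok_facts(4)[OF A] cmp_mor)
 next
  fix x assume "x \<in> carrier M"
  then obtain y where y: "y \<in> mor C G Y" "x = p y" using psurj by metis
  then show "T x \<in> carrier (cok (X, Y, \<alpha>))" by (simp add: Tp cok_facts(1)[OF A])
 qed (simp add: T_def)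
 have "bij_betw T (carrier M) (carrier (cok (X, Y, \<alpha>)))" unfolding bij_betw_def
 proof
  show "inj_on T (carrier M)"
  proof (rule inj_onI)
   fix x x' assume "x \<in> carrier M" "x' \<in> carrier M" "T x = T x'"
   then obtain y y' where y: "y \<in> mor C G Y" "x = p y" "y' \<in> mor C G Y" "x' = p y'" using psurj by metis
   then show "x = x'" using \<open>T x = T x'\<close> by (simp add: Tp cl_p)
  qed
  have "S \<in> T ` carrier M" if S: "S \<in> carrier (cok (X, Y, \<alpha>))" for S
  proof -
   obtain y where "y \<in> mor C G Y" "S = ?cl y" using S by (auto simp: cok_facts(1)[OF A])
   then show ?thesis using Tp pc by (intro image_eqI[of _ _ "p y"]) auto
  qed
  then show "T ` carrier M = carrier (cok (X, Y, \<alpha>))" using mod_homD(1)[OF TM] by blast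
 qed
 then have "T \<in> mod_iso R M (cok (X, Y, \<alpha>))" using TM by (simp add: mod_iso_def)
 then have "compose (carrier M) (small_iso R (cok (X, Y, \<alpha>))) T \<in> mod_iso R M (small_copy R (cok (X, Y, \<alpha>)))"
  by (rule mod_iso_compose[OF Ml _ small_iso_iso[OF cok_facts(5)[OF A]]])
 from cat_iso_mod_iso[OF small_copy_ob[OF cok_facts(5)[OF A]] M mod_iso_inverse[OF Ml this]]
 show ?thesis using A by (intro bexI[of _ "(X, Y, \<alpha>)"]) (auto simp: coker_functor_simps)
qed

theorem coker_equivalence: "linear_equivalence (abelianization C) (mod_cat R) (quot_functor coker_functor)"
 unfolding abelianization_def
 by (rule linear_equivalence_quot_cat[OF lin_cat_arrow_cat lin_cat_mod_cat linear_coker_functor])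
  (use coker_kernel coker_full coker_dense in blast)+

text \<open>The cokernel of a zero map is \<open>Hom(G, Y)\<close> itself. Composing
  \<open>\<rho> x\<close> with \<open>p\<close> identifies \<open>R e\<close> with it, and
  composition with \<open>i\<close> goes back.\<close>

lemma coker_projective:
 assumes Z: "Z \<in> ob C" and Y: "Y \<in> ob C" and i: "i \<in> mor C Y G" and p: "p \<in> mor C G Y"
  and pi: "cmp C Y G Y p i = idm C Y" and e: "e \<in> carrier R" "\<rho> e = cmp C G Y G i p"
 shows "mod_iso R (fob (quot_functor coker_functor) (Z, Y, mzero C Z Y)) (left_principal R e) ~= {}"
proof -
 let ?A = "(Z, Y, mzero C Z Y)"
 have A: "?A \<in> ob K" using Z Y by (simp add: K_ob mzero_mor)
 have img: "img ?A = {mzero C G Y}"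
  using Z Y G mzero_mor[of G Z] by (auto simp: img_def cmp_mzero_left)
 interpret Q: quot_module R "hmod Y" "img ?A" by (rule quot_module_img[OF A])
 have inj: "cokcl ?A y = cokcl ?A y' \<longleftrightarrow> y = y'" if "y \<in> mor C G Y" "y' \<in> mor C G Y" for y y'
 proof -
  have "cokcl ?A y = cokcl ?A y' \<longleftrightarrow> y \<ominus>\<^bsub>hmod Y\<^esub> y' = \<zero>\<^bsub>hmod Y\<^esub>"
   using Q.cl_eq_iff[of y y'] that by (simp add: cokcl_def img)
  then show ?thesis using that Q.M.M.minus_eq_zero_iff[of y y'] by simp
 qed
 let ?P = "left_principal R e"
 define f where "f = (\<lambda>x\<in>carrier ?P. cokcl ?A (cmp C G G Y p (\<rho> x)))"
 have Pl: "left_module R ?P" by (rule left_module_left_principal[OF e(1)])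
 have xR: "x \<in> carrier R" if "x \<in> carrier ?P" for x using that e by auto
 have ee: "e \<otimes> e = e"
 proof -
  have "\<rho> (e \<otimes> e) = \<rho> e" using e i p pi Y G
   by (simp add: rho_mult) (metis cmp_assoc cmp_mor idm_cmp)
  then show ?thesis using rho_bij e by (auto simp: bij_betw_def inj_on_def)
 qed
 have xe: "x \<otimes> e = x" if "x \<in> carrier ?P" for x using that e ee by (auto simp: m_assoc)
 have m: "cmp C G G Y p (\<rho> x) \<in> mor C G Y" if "x \<in> carrier R" for x using that p G Y by (simp add: cmp_mor)
 have fh: "f \<in> mod_hom R ?P (cok ?A)"
 proof (rule mod_homI)
  fix x y assume xy: "x \<in> carrier ?P" "y \<in> carrier ?P"
  interpret P: lmod R ?P using Pl by (simp add: lmod_iff)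
  have "x \<oplus> y \<in> carrier ?P" using P.M.a_closed[OF xy] by (simp del: left_principal_simps(1))
  then show "f (x \<oplus>\<^bsub>?P\<^esub> y) = f x \<oplus>\<^bsub>cok ?A\<^esub> f y"
   using xy xR[OF xy(1)] xR[OF xy(2)] m p G Y
   by (simp add: f_def cok_facts(3)[OF A] rho_add cmp_madd_right del: left_principal_simps(1))
 next
  fix r x assume r: "r \<in> carrier R" and x: "x \<in> carrier ?P"
  interpret P: lmod R ?P using Pl by (simp add: lmod_iff)
  have "r \<otimes> x \<in> carrier ?P" using P.smult_closed[OF r x] by (simp del: left_principal_simps(1))
  then show "f (r \<odot>\<^bsub>?P\<^esub> x) = r \<odot>\<^bsub>cok ?A\<^esub> f x"
   using r x xR[OF x] m p G Y
   by (simp add: f_def cok_facts(4)[OF A] rho_mult cmp_assoc del: left_principal_simps(1))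
 next
  fix x assume "x \<in> carrier ?P"
  then show "f x \<in> carrier (cok ?A)" using xR m by (simp add: f_def cok_facts(1)[OF A] del: left_principal_simps(1))
 qed (simp add: f_def)
 have i_f: "cmp C G Y G i (cmp C G G Y p (\<rho> x)) = \<rho> x" if "x \<in> carrier ?P" for x
 proof -
  have "cmp C G Y G i (cmp C G G Y p (\<rho> x)) = \<rho> (x \<otimes> e)"
   using xR[OF that] e i p G Y by (simp add: rho_mult cmp_assoc)
  then show ?thesis by (simp only: xe[OF that])
 qed
 have "bij_betw f (carrier ?P) (carrier (cok ?A))" unfolding bij_betw_def
 proof
  show "inj_on f (carrier ?P)"
  proof (rule inj_onI)
   fix x y assume xy: "x \<in> carrier ?P" "y \<in> carrier ?P" "f x = f y"
   then have "cokcl ?A (cmp C G G Y p (\<rho> x)) = cokcl ?A (cmp C G G Y p (\<rho> y))"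
    by (simp add: f_def del: left_principal_simps(1))
   then have "cmp C G G Y p (\<rho> x) = cmp C G G Y p (\<rho> y)"
    by (rule iffD1[OF inj[OF m[OF xR[OF xy(1)]] m[OF xR[OF xy(2)]]]])
   then have "\<rho> x = \<rho> y" using trans[OF i_f[OF xy(1), symmetric]] i_f[OF xy(2)] by (simp only:)
   then show "x = y" by (rule inj_onD[OF bij_betw_imp_inj_on[OF rho_bij] _ xR[OF xy(1)] xR[OF xy(2)]])
  qed
  have "S \<in> f ` carrier ?P" if S: "S \<in> carrier (cok ?A)" for S
  proof -
   obtain y where y: "y \<in> mor C G Y" "S = cokcl ?A y" using S by (auto simp: cok_facts(1)[OF A])
   have iy: "cmp C G Y G i y \<in> mor C G G" using y i G Y by (simp add: cmp_mor)
   let ?x = "rho_inv (cmp C G Y G i y)"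
   have x: "?x \<in> carrier R" "\<rho> ?x = cmp C G Y G i y" using rho_inv[OF iy] by auto
   have py: "cmp C G G Y p (\<rho> ?x) = y" using x y i p pi G Y by (simp add: cmp_assoc[symmetric] idm_cmp)
   have "\<rho> (?x \<otimes> e) = cmp C G Y G i (cmp C G G Y p (\<rho> ?x))"
    using x(1) e i p G Y by (simp add: rho_mult cmp_assoc)
   also have "... = \<rho> ?x" by (simp only: py) (rule x(2)[symmetric])
   finally have "\<rho> (?x \<otimes> e) = \<rho> ?x" .
   then have "?x \<otimes> e = ?x" using rho_bij x(1) e by (auto simp: bij_betw_def inj_on_def)
   then have "?x \<in> carrier ?P" using x(1) by (auto intro!: exI[of _ ?x])
   then show ?thesis using y py by (intro image_eqI[of _ _ ?x]) (simp_all add: f_def del: left_principal_simps(1))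
  qed
  then show "f ` carrier ?P = carrier (cok ?A)" using mod_homD(1)[OF fh] by blast
 qed
 then have "f \<in> mod_iso R ?P (cok ?A)" using fh by (simp add: mod_iso_def)
 then have "compose (carrier ?P) (small_iso R (cok ?A)) f \<in> mod_iso R ?P (small_copy R (cok ?A))"
  by (rule mod_iso_compose[OF Pl _ small_iso_iso[OF cok_facts(5)[OF A]]])
 from mod_iso_inverse[OF Pl this] show ?thesis by (auto simp: quot_functor_def coker_functor_simps)
qed

end

section \<open>Path algebras, commutativity relations and walks in trees\<close>

section \<open>Path algebras\<close>

text \<open>The linear functional with values \<open>h\<close> on the basis. An element is
  determined by the values of all functionals (\<open>pm_eval_eqI\<close>), so identities in the
  path algebra become identities between scalars.\<close>

definition pm_eval :: "('p => 'k::field) => ('p \<Rightarrow>\<^sub>0 'k) => 'k" where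
 "pm_eval h f = (\<Sum>p\<in>keys f. h p * lookup f p)"

lemma pm_eval_superset: "finite S ==> keys f \<subseteq> S ==> pm_eval h f = (\<Sum>p\<in>S. h p * lookup f p)"
 unfolding pm_eval_def by (rule sum.mono_neutral_left) (auto simp: in_keys_iff)

lemma pm_eval_add: "pm_eval h (f + g) = pm_eval h f + pm_eval h g"
proof -
 let ?S = "keys f \<union> keys g"
 have "keys (f + g) \<subseteq> ?S" by (rule keys_add)
 then show ?thesis
  by (simp add: pm_eval_superset[of ?S] lookup_add distrib_left sum.distrib)
qed

lemma pm_eval_single: "pm_eval h (Poly_Mapping.single p c) = h p * c"
 by (simp add: pm_eval_def)

lemma pm_eval_zero: "pm_eval h 0 = 0"
 by (simp add: pm_eval_def)

lemma pm_eval_sum: "pm_eval h (\<Sum>i\<in>S. f i) = (\<Sum>i\<in>S. pm_eval h (f i))"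
 by (induction S rule: infinite_finite_induct) (simp_all add: pm_eval_zero pm_eval_add)

lemma pm_eval_scale: "pm_eval h (Poly_Mapping.map ((*) c) f) = c * pm_eval h f"
proof -
 have "keys (Poly_Mapping.map ((*) c) f) \<subseteq> keys f"
  by (auto simp: in_keys_iff map.rep_eq when_def)
 then have "pm_eval h (Poly_Mapping.map ((*) c) f) = (\<Sum>p\<in>keys f. h p * lookup (Poly_Mapping.map ((*) c) f) p)"
  by (intro pm_eval_superset) auto
 also have "... = c * pm_eval h f"
  by (simp add: pm_eval_def map.rep_eq when_def sum_distrib_left in_keys_iff ac_simps)
 finally show ?thesis .
qed

lemma pm_eval_delta: "pm_eval (%q. if q = p then 1 else 0) f = lookup f p"
 by (simp add: pm_eval_def if_distrib[of "%a. a * _"] in_keys_iff cong: if_cong)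

lemma pm_eval_cong: "(!!p. p \<in> keys f ==> h p = h' p) ==> pm_eval h f = pm_eval h' f"
 by (simp add: pm_eval_def)

lemma pm_eval_eqI: "(!!h. pm_eval h f = pm_eval h g) ==> f = g"
 by (rule poly_mapping_eqI) (metis pm_eval_delta)

lemma pm_eval_const_zero: "pm_eval (%_. 0) f = 0" by (simp add: pm_eval_def)

lemma pm_eval_add_left: "pm_eval (%p. h p + h' p) f = pm_eval h f + pm_eval h' f"
 by (simp add: pm_eval_def distrib_right sum.distrib)

lemma pm_eval_sum_left: "pm_eval (%p. \<Sum>i\<in>S. h i p) f = (\<Sum>i\<in>S. pm_eval (h i) f)"
 by (induction S rule: infinite_finite_induct) (simp_all add: pm_eval_const_zero pm_eval_add_left)

lemma pm_eval_scale_left: "pm_eval (%p. c * h p) f = c * pm_eval h f"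
 by (simp add: pm_eval_def sum_distrib_left ac_simps)

lemma keys_subset_iff: "keys f \<subseteq> S \<longleftrightarrow> (\<forall>p. p \<notin> S --> lookup f p = 0)"
 by (auto simp: in_keys_iff)

text \<open>\<open>q\<close> is traversed before \<open>p\<close>, as in the product of the path
  algebra.\<close>

definition qcat :: "('v, 'e) qpath => ('v, 'e) qpath => ('v, 'e) qpath" where
 "qcat p q = (fst q, snd q @ snd p)"

locale quiver_algebra = fin_digraph Q for Q :: "('v, 'e) pre_digraph" +
 fixes A :: "('k::field, ('v, 'e) qpath \<Rightarrow>\<^sub>0 'k) module" (structure)
 assumes A: "A = path_algebra Q"
begin

lemma A_simps [simp]: "f \<in> carrier A \<longleftrightarrow> keys f \<subseteq> qpaths Q" "\<zero> = 0" "f \<oplus> g = f + g"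
 "c \<odot> f = Poly_Mapping.map ((*) c) f"
 by (simp_all add: A path_algebra_def)

lemma qpaths_iff: "p \<in> qpaths Q \<longleftrightarrow> awalk (fst p) (snd p) (qtarget Q p)"
 unfolding qpaths_def qtarget_def by (cases p) auto

lemma qtarget_eq: "awalk u p v ==> qtarget Q (u, p) = v"
 by (auto simp: qtarget_def)

lemma qpathI: "awalk u p v ==> (u, p) \<in> qpaths Q" by (auto simp: qpaths_def)

lemma qpaths_verts: "p \<in> qpaths Q ==> fst p \<in> verts Q" "p \<in> qpaths Q ==> qtarget Q p \<in> verts Q"
 using awalk_hd_in_verts awalk_last_in_verts by (auto simp: qpaths_iff)

lemma qcat:
 assumes "p \<in> qpaths Q" "q \<in> qpaths Q" "fst p = qtarget Q q"
 shows "qcat p q \<in> qpaths Q" "qtarget Q (qcat p q) = qtarget Q p" "fst (qcat p q) = fst q"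
proof -
 have "awalk (fst q) (snd q @ snd p) (qtarget Q p)"
  using assms by (auto simp: qpaths_iff intro: awalk_appendI)
 then show "qcat p q \<in> qpaths Q" "qtarget Q (qcat p q) = qtarget Q p" "fst (qcat p q) = fst q"
  by (auto simp: qcat_def qpathI qtarget_eq)
qed

lemma trivial_path: "v \<in> verts Q ==> (v, []) \<in> qpaths Q" "qtarget Q (v, []) = v"
 by (auto simp: qpaths_iff qtarget_def awalk_Nil_iff)

text \<open>A functional on a product is an iterated evaluation over both factors; associativity and
  the unit laws then follow from those of concatenation.\<close>

lemma eval_mult:
 "pm_eval h (f \<otimes> g) = pm_eval (%p. pm_eval (%q. if fst p = qtarget Q q then h (qcat p q) else 0) g) f"
proof -
 have "pm_eval h (f \<otimes> g) = (\<Sum>p\<in>keys f. \<Sum>q\<in>keys g.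
   if fst p = qtarget Q q then h (qcat p q) * (lookup f p * lookup g q) else 0)"
  by (auto simp: A path_algebra_def pm_eval_sum pm_eval_single pm_eval_zero qcat_def intro!: sum.cong)
 also have "... = (\<Sum>p\<in>keys f. (\<Sum>q\<in>keys g.
   (if fst p = qtarget Q q then h (qcat p q) else 0) * lookup g q) * lookup f p)"
  by (intro sum.cong refl, subst sum_distrib_right, intro sum.cong) auto
 finally show ?thesis by (simp add: pm_eval_def)
qed

lemma eval_one: "pm_eval h \<one> = (\<Sum>v\<in>verts Q. h (v, []))"
 by (simp add: A path_algebra_def pm_eval_sum pm_eval_single)

lemma closed_one: "keys \<one> \<subseteq> qpaths Q"
 unfolding A path_algebra_def using keys_sum[of "%v. Poly_Mapping.single (v, []) 1" "verts Q"]
 by (auto simp: trivial_path)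

lemma closed_add: "keys f \<subseteq> qpaths Q ==> keys g \<subseteq> qpaths Q ==> keys (f + g) \<subseteq> qpaths Q"
 using keys_add[of f g] by blast

lemma closed_mult:
 assumes f: "keys f \<subseteq> qpaths Q" and g: "keys g \<subseteq> qpaths Q"
 shows "keys (f \<otimes> g) \<subseteq> qpaths Q"
 unfolding keys_subset_iff
proof (intro allI impI)
 fix r assume r: "r \<notin> qpaths Q"
 have "lookup (f \<otimes> g) r = pm_eval (%p. pm_eval (%q. 0) g) f"
  unfolding pm_eval_delta[symmetric] eval_mult
  using qcat(1) f g r by (intro pm_eval_cong) (metis subsetD)
 then show "lookup (f \<otimes> g) r = 0" by (simp add: pm_eval_const_zero)
qed

lemma closed_scale: "keys f \<subseteq> qpaths Q ==> keys (Poly_Mapping.map ((*) c) f) \<subseteq> qpaths Q"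
 by (auto simp: in_keys_iff map.rep_eq when_def subset_iff)

lemma mult_assoc':
 assumes f: "keys f \<subseteq> qpaths Q" and g: "keys g \<subseteq> qpaths Q" and k: "keys k \<subseteq> qpaths Q"
 shows "f \<otimes> g \<otimes> k = f \<otimes> (g \<otimes> k)"
proof (rule pm_eval_eqI)
 fix h
 show "pm_eval h (f \<otimes> g \<otimes> k) = pm_eval h (f \<otimes> (g \<otimes> k))" unfolding eval_mult
 proof (intro pm_eval_cong)
  fix p q assume "p \<in> keys f" "q \<in> keys g"
  then have p: "p \<in> qpaths Q" and q: "q \<in> qpaths Q" using f g by auto
  have "pm_eval (%s. if fst q = qtarget Q s then if fst p = qtarget Q (qcat q s) then h (qcat p (qcat q s)) else 0 else 0) k =
   pm_eval (%s. if fst p = qtarget Q q then if fst q = qtarget Q s then h (qcat (qcat p q) s) else 0 else 0) k"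
  proof (rule pm_eval_cong)
   fix s assume "s \<in> keys k"
   then have s: "s \<in> qpaths Q" using k by auto
   show "(if fst q = qtarget Q s then if fst p = qtarget Q (qcat q s) then h (qcat p (qcat q s)) else 0 else 0) =
    (if fst p = qtarget Q q then if fst q = qtarget Q s then h (qcat (qcat p q) s) else 0 else 0)"
    using qcat(2)[OF q s] by (auto simp: qcat_def)
  qed
  then show "(if fst p = qtarget Q q then pm_eval (%s. if fst (qcat p q) = qtarget Q s then h (qcat (qcat p q) s) else 0) k else 0) =
   pm_eval (%s. if fst q = qtarget Q s then if fst p = qtarget Q (qcat q s) then h (qcat p (qcat q s)) else 0 else 0) k"
   by (auto simp: qcat_def pm_eval_const_zero)
 qed
qed

lemma one_mult: assumes f: "keys f \<subseteq> qpaths Q" shows "\<one> \<otimes> f = f" "f \<otimes> \<one> = f"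
proof -
 show "\<one> \<otimes> f = f"
 proof (rule pm_eval_eqI)
  fix h
  have "pm_eval h (\<one> \<otimes> f) = pm_eval (%q. \<Sum>v\<in>verts Q. if v = qtarget Q q then h (qcat (v, []) q) else 0) f"
   by (simp add: eval_mult eval_one pm_eval_sum_left del: sum.delta sum.delta')
  also have "... = pm_eval h f"
   using f qpaths_verts(2) by (intro pm_eval_cong) (auto simp: qcat_def)
  finally show "pm_eval h (\<one> \<otimes> f) = pm_eval h f" .
 qed
 show "f \<otimes> \<one> = f"
 proof (rule pm_eval_eqI)
  fix h
  have "pm_eval h (f \<otimes> \<one>) = pm_eval (%p. \<Sum>v\<in>verts Q. if fst p = v then h (qcat p (v, [])) else 0) f"
   by (simp add: eval_mult eval_one trivial_path)
  also have "... = pm_eval h f"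
   using f qpaths_verts(1) by (intro pm_eval_cong) (auto simp: qcat_def)
  finally show "pm_eval h (f \<otimes> \<one>) = pm_eval h f" .
 qed
qed

lemma distrib: "(f + g) \<otimes> k = f \<otimes> k + g \<otimes> k" "k \<otimes> (f + g) = k \<otimes> f + k \<otimes> g"
 by (rule pm_eval_eqI; simp add: eval_mult pm_eval_add pm_eval_add_left)+

lemma ring_A: "ring A"
proof (rule ringI)
 show "abelian_group A"
 proof (rule abelian_groupI)
  fix x assume "x \<in> carrier A"
  then show "\<exists>y\<in>carrier A. y \<oplus> x = \<zero>" by (intro bexI[of _ "- x"]) simp_all
 qed (simp_all add: closed_add ac_simps)
 show "Group.monoid A"
  by (rule monoidI) (simp_all add: closed_mult closed_one mult_assoc' one_mult)
qed (simp_all add: distrib)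

text \<open>The sum of the coefficients of all paths from \<open>u\<close> to \<open>v\<close>. This
  forgets which path is taken: it is a homomorphism to matrices, injective when paths are unique,
  and in general its kernel is the ideal generated by the commutativity relations.\<close>

definition pcoef :: "(('v, 'e) qpath \<Rightarrow>\<^sub>0 'k) => 'v => 'v => 'k" where
 "pcoef f u v = pm_eval (%p. if fst p = u \<and> qtarget Q p = v then 1 else 0) f"

lemma pcoef_single: "pcoef (Poly_Mapping.single p c) u v = (if fst p = u \<and> qtarget Q p = v then c else 0)"
 by (simp add: pcoef_def pm_eval_single)

lemma pcoef_mult:
 assumes f: "keys f \<subseteq> qpaths Q" and g: "keys g \<subseteq> qpaths Q"
 shows "pcoef (f \<otimes> g) u v = (\<Sum>w\<in>verts Q. pcoef g u w * pcoef f w v)"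
proof -
 have "pcoef (f \<otimes> g) u v = pm_eval (%p. \<Sum>w\<in>verts Q. pcoef g u w * (if fst p = w \<and> qtarget Q p = v then 1 else 0)) f"
  unfolding pcoef_def eval_mult
 proof (rule pm_eval_cong)
  fix p assume "p \<in> keys f"
  then have p: "p \<in> qpaths Q" using f by blast
  have "(\<Sum>w\<in>verts Q. pcoef g u w * (if fst p = w \<and> qtarget Q p = v then 1 else 0)) =
   (\<Sum>w\<in>verts Q. if fst p = w then (if qtarget Q p = v then pcoef g u (fst p) else 0) else 0)"
   by (intro sum.cong) auto
  also have "... = (if qtarget Q p = v then pcoef g u (fst p) else 0)" using qpaths_verts(1)[OF p] by simp
  also have "... = pm_eval (%q. (if qtarget Q p = v then 1 else 0) * (if fst q = u \<and> qtarget Q q = fst p then 1 else 0)) g"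
   unfolding pm_eval_scale_left by (simp add: pcoef_def)
  also have "... = pm_eval (%q. if fst p = qtarget Q q then if fst (qcat p q) = u \<and> qtarget Q (qcat p q) = v then 1 else 0 else 0) g"
   using g qcat[OF p] by (intro pm_eval_cong) (auto split: if_splits)
  finally show "pm_eval (%q. if fst p = qtarget Q q then if fst (qcat p q) = u \<and> qtarget Q (qcat p q) = v then 1 else 0 else 0) g =
   (\<Sum>w\<in>verts Q. pm_eval (%p. if fst p = u \<and> qtarget Q p = w then 1 else 0) g * (if fst p = w \<and> qtarget Q p = v then 1 else 0))"
   unfolding pcoef_def by simp
 qed
 then show ?thesis by (simp add: pm_eval_sum_left pm_eval_scale_left pcoef_def)
qed

lemma pcoef_linear: "pcoef 0 u v = 0" "pcoef (f + g) u v = pcoef f u v + pcoef g u v"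
 "pcoef (Poly_Mapping.map ((*) c) f) u v = c * pcoef f u v"
 by (simp_all add: pcoef_def pm_eval_zero pm_eval_add pm_eval_scale)

lemma pcoef_minus: "pcoef (- f) u v = - pcoef f u v"
 using pcoef_linear(2)[of f "- f" u v] by (simp add: pcoef_linear(1) eq_neg_iff_add_eq_0 ac_simps)

lemma pcoef_diff: "pcoef (f - g) u v = pcoef f u v - pcoef g u v"
 using pcoef_linear(2)[of f "- g" u v] by (simp add: pcoef_minus)

lemma pcoef_one: "pcoef \<one> u v = (if u = v \<and> u \<in> verts Q then 1 else 0)"
proof -
 have "pcoef \<one> u v = (\<Sum>w\<in>verts Q. if w = u then (if u = v then 1 else 0) else 0)"
  unfolding pcoef_def eval_one by (intro sum.cong) (auto simp: trivial_path)
 then show ?thesis by simp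
qed

definition conn :: "'v => 'v => bool" where "conn u v \<longleftrightarrow> (\<exists>p. awalk u p v)"

lemma conn_refl: "u \<in> verts Q ==> conn u u"
 unfolding conn_def by (rule exI[of _ "[]"]) (simp add: awalk_Nil_iff)

lemma conn_trans: "conn u v ==> conn v w ==> conn u w"
 unfolding conn_def using awalk_appendI by blast

lemma conn_verts: "conn u v ==> u \<in> verts Q \<and> v \<in> verts Q"
 unfolding conn_def using awalk_hd_in_verts awalk_last_in_verts by blast

lemma conn_iff: "conn u v \<longleftrightarrow> (\<exists>p\<in>qpaths Q. fst p = u \<and> qtarget Q p = v)"
 unfolding conn_def by (metis fst_conv qpathI qpaths_iff qtarget_eq)

lemma pcoef_conn: assumes "keys f \<subseteq> qpaths Q" "pcoef f u v ~= 0" shows "conn u v"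
proof (rule ccontr)
 assume "\<not> conn u v"
 then have "pcoef f u v = pm_eval (%_. 0) f" unfolding pcoef_def
  using assms(1) by (intro pm_eval_cong) (auto simp: conn_iff)
 then show False using assms(2) by (simp add: pm_eval_const_zero)
qed

definition choice :: "'v => 'v => ('v, 'e) qpath" where
 "choice u v = (SOME p. p \<in> qpaths Q \<and> fst p = u \<and> qtarget Q p = v)"

lemma choice: "conn u v ==> choice u v \<in> qpaths Q \<and> fst (choice u v) = u \<and> qtarget Q (choice u v) = v"
 unfolding choice_def by (rule someI_ex) (auto simp: conn_iff)

text \<open>One chosen path for each connected pair carries the prescribed coefficient.\<close>

lemma pcoef_surj:
 assumes "!!u v. d u v ~= 0 ==> conn u v"
 shows "\<exists>f. keys f \<subseteq> qpaths Q \<and> pcoef f = d"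
proof -
 let ?S = "{(u, v). conn u v}"
 have fin: "finite ?S" by (rule finite_subset[of _ "verts Q \<times> verts Q"]) (use conn_verts in auto)
 define f where "f = (\<Sum>(u, v)\<in>?S. Poly_Mapping.single (choice u v) (d u v))"
 have "keys f \<subseteq> (\<Union>x\<in>?S. keys (case x of (u, v) => Poly_Mapping.single (choice u v) (d u v)))"
  unfolding f_def by (rule keys_sum)
 also have "... \<subseteq> qpaths Q" using choice by (auto split: if_splits)
 finally have "keys f \<subseteq> qpaths Q" .
 moreover have "pcoef f a b = d a b" for a b
 proof -
  have "pcoef f a b = (\<Sum>x\<in>?S. if x = (a, b) then d a b else 0)"
   unfolding f_def pcoef_def pm_eval_sum
   using choice by (intro sum.cong) (auto simp: pm_eval_single split: if_splits)
  then show ?thesis using assms[of a b] fin by auto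
 qed
 ultimately show ?thesis by blast
qed

text \<open>By uniqueness \<open>pcoef\<close> is the coefficient of the only path, whence
  injectivity, and a closed walk is the trivial one, whence antisymmetry.\<close>

lemma inc_alg_path_algebra:
 assumes unique: "!!u v p q. awalk u p v ==> awalk u q v ==> p = q"
 shows "inc_alg A (verts Q) conn pcoef"
proof
 show "finite (verts Q)" by simp
 fix u v assume "conn u v" "conn v u"
 then obtain p q where pq: "awalk u p v" "awalk v q u" by (auto simp: conn_def)
 then have "p @ q = []" using unique[of u "p @ q" u "[]"] awalk_hd_in_verts[of u p v]
  by (simp add: awalk_appendI awalk_Nil_iff)
 then show "u = v" using pq by (simp add: awalk_Nil_iff)
next
 fix x y assume x: "x \<in> carrier A" and y: "y \<in> carrier A" and e: "pcoef x = pcoef y"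
 have uq: "p = q" if "p \<in> qpaths Q" "q \<in> qpaths Q" "fst p = fst q" "qtarget Q p = qtarget Q q" for p q
  using that unique[of "fst p" "snd p" "qtarget Q p" "snd q"] by (auto simp: qpaths_iff prod_eq_iff)
 have l: "lookup f p = pcoef f (fst p) (qtarget Q p)"
  if "keys f \<subseteq> qpaths Q" "p \<in> qpaths Q" for f p
  unfolding pm_eval_delta[symmetric] pcoef_def
  by (intro pm_eval_cong) (use uq that in "metis subsetD")
 show "x = y"
 proof (rule poly_mapping_eqI)
  fix p show "lookup x p = lookup y p"
  proof (cases "p \<in> qpaths Q")
   case True then show ?thesis using l x y e by simp
  next
   case False
   then have "lookup x p = 0" "lookup y p = 0" using x y by (auto simp: in_keys_iff)
   then show ?thesis by simp
  qed
 qed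
next
 fix d :: "'v => 'v => 'k" assume "!!u v. d u v ~= 0 ==> conn u v"
 from pcoef_surj[of d, OF this] show "\<exists>x\<in>carrier A. pcoef x = d" by auto
qed (use conn_trans in "auto simp: conn_refl conn_verts pcoef_conn closed_one closed_add closed_mult closed_scale
 pcoef_linear pcoef_one pcoef_mult simp del: add.commute")

section \<open>Commutativity relations\<close>

definition kerp :: "(('v, 'e) qpath \<Rightarrow>\<^sub>0 'k) set" where
 "kerp = {f. keys f \<subseteq> qpaths Q \<and> (\<forall>u v. pcoef f u v = 0)}"

lemma ideal_kerp: "ideal kerp A"
proof (rule idealI[OF ring_A])
 have m: "x - y = x \<ominus> y" if "x \<in> carrier A" "y \<in> carrier A" for x y
 proof -
  interpret ring A by (rule ring_A)
  have "\<ominus> y = - y" using that by (intro minus_equality) simp_all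
  then show ?thesis by (simp add: a_minus_def)
 qed
 interpret ring A by (rule ring_A)
 show "subgroup kerp (add_monoid A)"
 proof (rule add.subgroupI)
  show "kerp ~= {}" by (auto simp: kerp_def pcoef_linear intro!: exI[of _ 0])
  fix a b assume a: "a \<in> kerp"
  have "\<ominus> a = - a" using a by (intro minus_equality) (simp_all add: kerp_def)
  then show "\<ominus> a \<in> kerp" using a by (simp add: kerp_def pcoef_minus)
  assume "b \<in> kerp"
  then show "a \<oplus> b \<in> kerp" using a by (simp add: kerp_def pcoef_linear closed_add)
 qed (auto simp: kerp_def)
qed (auto simp: kerp_def pcoef_mult closed_mult)

lemma relations_kerp: "commutativity_relations Q \<subseteq> kerp"
proof -
 have "keys (Poly_Mapping.single p 1 - Poly_Mapping.single q (1::'k)) \<subseteq> qpaths Q"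
  if "p \<in> qpaths Q" "q \<in> qpaths Q" for p q
  using that by (auto simp: in_keys_iff lookup_minus lookup_single when_def split: if_splits)
 then show ?thesis unfolding commutativity_relations_def kerp_def
  by (fastforce simp: pcoef_diff pcoef_single)
qed

text \<open>Modulo the relations, every path may be replaced by the chosen path with the same ends.\<close>

lemma commutativity_ideal_eq: "commutativity_ideal Q = kerp"
proof
 interpret ring A by (rule ring_A)
 let ?I = "genideal A (commutativity_relations Q)"
 have cI: "commutativity_ideal Q = ?I" by (simp add: commutativity_ideal_def A)
 have rel_carr: "commutativity_relations Q \<subseteq> carrier A" using relations_kerp by (auto simp: kerp_def)
 show "commutativity_ideal Q \<subseteq> kerp" unfolding cI by (rule genideal_minimal[OF ideal_kerp relations_kerp])
 interpret I: ideal ?I A by (rule genideal_ideal[OF rel_carr])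
 let ?c = "%p. choice (fst p) (qtarget Q p)"
 have cp: "?c p \<in> qpaths Q \<and> fst (?c p) = fst p \<and> qtarget Q (?c p) = qtarget Q p" if "p \<in> qpaths Q" for p
  by (rule choice) (use that in "auto simp: conn_iff")
 have red: "Poly_Mapping.single p a - Poly_Mapping.single (?c p) a \<in> ?I" if p: "p \<in> qpaths Q" for p and a :: 'k
 proof -
  let ?r = "Poly_Mapping.single p 1 - Poly_Mapping.single (?c p) (1::'k)"
  \<comment> \<open>The trivial path at the target, with coefficient \<open>a\<close>: multiplying
    the relation by it replaces scaling, under which ring ideals are not closed by
    definition.\<close>
  let ?e = "Poly_Mapping.single (qtarget Q p, []) a"
  have "?r \<in> commutativity_relations Q" unfolding commutativity_relations_def using p cp[OF p] by fastforce
  then have r: "?r \<in> ?I" using genideal_self[OF rel_carr] by blast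
  have "?e \<in> carrier A" using qpaths_verts(2)[OF p] by (simp add: trivial_path)
  from I.I_l_closed[OF r this] have "?e \<otimes> ?r \<in> ?I" .
  moreover have "?e \<otimes> ?r = Poly_Mapping.single p a - Poly_Mapping.single (?c p) a"
  proof (rule pm_eval_eqI)
   fix h :: "('v, 'e) qpath => 'k"
   have minus: "pm_eval h' (f - g) = pm_eval h' f - pm_eval h' g" for h' and f g :: "('v, 'e) qpath \<Rightarrow>\<^sub>0 'k"
    using pm_eval_add[of h' "f - g" g] by simp
   show "pm_eval h (?e \<otimes> ?r) = pm_eval h (Poly_Mapping.single p a - Poly_Mapping.single (?c p) a)"
    using cp[OF p] prod.collapse[of "?c p"] by (simp add: eval_mult minus pm_eval_single qcat_def algebra_simps)
  qed
  ultimately show ?thesis by simp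
 qed
 have sumI: "(\<Sum>p\<in>S. g p) \<in> ?I" if "!!p. p \<in> S ==> g p \<in> ?I" for S and g :: "('v, 'e) qpath => ('v, 'e) qpath \<Rightarrow>\<^sub>0 'k"
  using that by (induction S rule: infinite_finite_induct) (use I.zero_closed I.a_closed in auto)
 show "kerp \<subseteq> commutativity_ideal Q"
 proof
  fix f assume f: "f \<in> kerp"
  then have fp: "keys f \<subseteq> qpaths Q" and f0: "!!u v. pcoef f u v = 0" by (auto simp: kerp_def)
  \<comment> \<open>The result of replacing every path in \<open>f\<close> by the chosen one. The
    coefficients collected on \<open>choice u v\<close> add up to \<open>pcoef f u v\<close>, so it
    vanishes.\<close>
  let ?N = "\<Sum>p\<in>keys f. Poly_Mapping.single (?c p) (lookup f p)"
  have fs: "f = (\<Sum>p\<in>keys f. Poly_Mapping.single p (lookup f p))"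
   by (rule pm_eval_eqI) (simp only: pm_eval_sum pm_eval_single, simp add: pm_eval_def)
  have "?N = 0"
  proof (rule pm_eval_eqI)
   fix h :: "('v, 'e) qpath => 'k"
   have "pm_eval h ?N = pm_eval (%p. h (?c p)) f" unfolding pm_eval_sum pm_eval_single by (simp add: pm_eval_def)
   also have "... = pm_eval (%p. \<Sum>(u, v)\<in>verts Q \<times> verts Q. h (choice u v) * (if fst p = u \<and> qtarget Q p = v then 1 else 0)) f"
   proof (rule pm_eval_cong)
    fix p assume "p \<in> keys f"
    then have p: "fst p \<in> verts Q" "qtarget Q p \<in> verts Q" using fp qpaths_verts by blast+
    have "(\<Sum>(u, v)\<in>verts Q \<times> verts Q. h (choice u v) * (if fst p = u \<and> qtarget Q p = v then 1 else 0)) =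
     (\<Sum>x\<in>verts Q \<times> verts Q. if (fst p, qtarget Q p) = x then h (?c p) else 0)" by (intro sum.cong) (auto split: if_splits)
    also have "... = h (?c p)" using p by (subst sum.delta') auto
    finally show "h (?c p) = (\<Sum>(u, v)\<in>verts Q \<times> verts Q. h (choice u v) * (if fst p = u \<and> qtarget Q p = v then 1 else 0))" ..
   qed
   also have "... = (\<Sum>(u, v)\<in>verts Q \<times> verts Q. h (choice u v) * pcoef f u v)"
    unfolding case_prod_beta pm_eval_sum_left pm_eval_scale_left pcoef_def ..
   finally show "pm_eval h ?N = pm_eval h 0" by (simp add: f0 pm_eval_zero)
  qed
  then have "f = f - ?N" by simp
  also have "... = (\<Sum>p\<in>keys f. Poly_Mapping.single p (lookup f p) - Poly_Mapping.single (?c p) (lookup f p))"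
   unfolding sum_subtractf using fs by simp
  also have "... \<in> ?I" using fp by (intro sumI red) auto
  finally show "f \<in> commutativity_ideal Q" unfolding cI .
 qed
qed

section \<open>The commutative path algebra as an incidence algebra\<close>

definition qcoef :: "(('v, 'e) qpath \<Rightarrow>\<^sub>0 'k) set => 'v => 'v => 'k" where
 "qcoef S = pcoef (SOME f. f \<in> S)"

lemma qcoef_coset: assumes f: "f \<in> carrier A" shows "qcoef (kerp +> f) = pcoef f"
proof -
 interpret I: ideal kerp A by (rule ideal_kerp)
 have "f \<in> kerp +> f" using f by (rule I.a_rcos_self)
 then have "(SOME g. g \<in> kerp +> f) \<in> kerp +> f" by (rule someI)
 then obtain z where "z \<in> kerp" "(SOME g. g \<in> kerp +> f) = z + f" by (auto simp: a_r_coset_def')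
 then show ?thesis by (auto simp: qcoef_def kerp_def pcoef_linear fun_eq_iff)
qed

lemma coset_eq_iff: assumes "f \<in> carrier A" "g \<in> carrier A" shows "kerp +> f = kerp +> g \<longleftrightarrow> pcoef f = pcoef g"
proof
 assume "kerp +> f = kerp +> g"
 then show "pcoef f = pcoef g" using qcoef_coset assms by metis
next
 interpret I: ideal kerp A by (rule ideal_kerp)
 assume e: "pcoef f = pcoef g"
 have "keys (f - g) \<subseteq> qpaths Q"
  using assms by (auto simp: keys_subset_iff lookup_minus)
 then have "f - g \<in> kerp" using e by (simp add: kerp_def pcoef_diff)
 then have "f \<in> kerp +> g" by (force simp: a_r_coset_def')
 then show "kerp +> f = kerp +> g" using I.a_repr_independence' assms by metis
qed

abbreviation "B \<equiv> commutative_path_algebra Q :: ('k, (('v, 'e) qpath \<Rightarrow>\<^sub>0 'k) set) module"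

lemma B_eq: "B = quot_algebra A kerp" by (simp add: commutative_path_algebra_def A[symmetric] commutativity_ideal_eq)

lemma carrier_B: "carrier B = (%f. kerp +> f) ` carrier A"
 by (auto simp: B_eq quot_algebra_def FactRing_def A_RCOSETS_def' a_r_coset_def' simp del: A_simps)

lemma ops_B:
 assumes f: "f \<in> carrier A" and g: "g \<in> carrier A"
 shows "(kerp +> f) \<otimes>\<^bsub>B\<^esub> (kerp +> g) = kerp +> (f \<otimes> g)" "(kerp +> f) \<oplus>\<^bsub>B\<^esub> (kerp +> g) = kerp +> (f + g)"
  "c \<odot>\<^bsub>B\<^esub> (kerp +> f) = kerp +> (c \<odot> f)"
proof -
 interpret I: ideal kerp A by (rule ideal_kerp)
 show "(kerp +> f) \<otimes>\<^bsub>B\<^esub> (kerp +> g) = kerp +> (f \<otimes> g)"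
  using I.rcoset_mult_add[OF f g] by (simp add: B_eq quot_algebra_def FactRing_def)
 show "(kerp +> f) \<oplus>\<^bsub>B\<^esub> (kerp +> g) = kerp +> (f + g)"
  using I.a_rcos_sum[OF f g] by (simp add: B_eq quot_algebra_def FactRing_def)
 have "kerp +> (c \<odot> x) = kerp +> (c \<odot> f)" if x: "x \<in> kerp +> f" for x
 proof -
  have xA: "x \<in> carrier A" using I.a_elemrcos_carrier[OF f x] .
  have "kerp +> x = kerp +> f" using I.a_repr_independence'[OF x f] ..
  then have "pcoef x = pcoef f" using coset_eq_iff[OF xA f] by blast
  moreover have "c \<odot> x \<in> carrier A" "c \<odot> f \<in> carrier A" using xA f by (simp_all add: closed_scale)
  ultimately show ?thesis unfolding coset_eq_iff[OF \<open>c \<odot> x \<in> carrier A\<close> \<open>c \<odot> f \<in> carrier A\<close>]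
   by (simp add: pcoef_linear fun_eq_iff)
 qed
 then have "(\<Union>x\<in>kerp +> f. kerp +> (c \<odot> x)) = (\<Union>x\<in>kerp +> f. kerp +> (c \<odot> f))" by (rule SUP_cong[OF refl])
 also have "... = kerp +> (c \<odot> f)" using I.a_rcos_self[OF f] by blast
 finally show "c \<odot>\<^bsub>B\<^esub> (kerp +> f) = kerp +> (c \<odot> f)" by (simp add: B_eq quot_algebra_def del: A_simps)
qed

lemma zero_one_B: "\<zero>\<^bsub>B\<^esub> = kerp +> 0" "\<one>\<^bsub>B\<^esub> = kerp +> \<one>"
proof -
 interpret I: ideal kerp A by (rule ideal_kerp)
 have "kerp +> \<zero> = kerp" by (rule I.a_coset_add_zero[OF I.a_subset])
 then show "\<zero>\<^bsub>B\<^esub> = kerp +> 0" by (simp add: B_eq quot_algebra_def FactRing_def)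
 show "\<one>\<^bsub>B\<^esub> = kerp +> \<one>" by (simp add: B_eq quot_algebra_def FactRing_def)
qed

text \<open>Modulo \<open>kerp\<close> an element is the same as its matrix \<open>pcoef\<close>,
  and by \<open>pcoef_surj\<close> all matrices supported on reachability occur. The assumption
  makes reachability a partial order.\<close>

lemma inc_alg_commutative_path_algebra:
 assumes antisym: "!!u v. conn u v ==> conn v u ==> u = v"
 shows "inc_alg B (verts Q) conn qcoef"
proof
 have cA: "0 \<in> carrier A" "\<one> \<in> carrier A" "!!f g. f \<in> carrier A ==> g \<in> carrier A ==> f + g \<in> carrier A"
  "!!f g. f \<in> carrier A ==> g \<in> carrier A ==> f \<otimes> g \<in> carrier A"
  "!!c f. f \<in> carrier A ==> c \<odot> f \<in> carrier A"
  by (simp_all add: closed_one closed_add closed_mult closed_scale)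
 note q = qcoef_coset[OF cA(1)] qcoef_coset[OF cA(2)]
 show "finite (verts Q)" by simp
 show "\<zero>\<^bsub>B\<^esub> \<in> carrier B" "\<one>\<^bsub>B\<^esub> \<in> carrier B" using cA by (auto simp: carrier_B zero_one_B)
 fix u v show "qcoef \<zero>\<^bsub>B\<^esub> u v = 0" "qcoef \<one>\<^bsub>B\<^esub> u v = (if u = v \<and> u \<in> verts Q then 1 else 0)"
  by (simp_all add: zero_one_B q pcoef_linear pcoef_one)
 show "conn u v ==> conn v u ==> u = v" by (rule antisym)
 fix x assume "x \<in> carrier B"
 then obtain f where f: "f \<in> carrier A" "x = kerp +> f" by (auto simp: carrier_B simp del: A_simps)
 show "qcoef x u v ~= 0 ==> conn u v" using pcoef_conn[of f u v] f by (simp add: qcoef_coset)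
 fix c
 show "c \<odot>\<^bsub>B\<^esub> x \<in> carrier B" using f cA(5) by (auto simp: ops_B carrier_B simp del: A_simps)
 show "qcoef (c \<odot>\<^bsub>B\<^esub> x) u v = c * qcoef x u v"
  unfolding f(2) ops_B(3)[OF f(1) f(1)] qcoef_coset[OF f(1)] qcoef_coset[OF cA(5)[OF f(1)]] by (simp add: pcoef_linear)
 fix y assume "y \<in> carrier B"
 then obtain g where g: "g \<in> carrier A" "y = kerp +> g" by (auto simp: carrier_B simp del: A_simps)
 show "qcoef x = qcoef y ==> x = y"
  unfolding f(2) g(2) qcoef_coset[OF f(1)] qcoef_coset[OF g(1)] coset_eq_iff[OF f(1) g(1)] .
 show "x \<oplus>\<^bsub>B\<^esub> y \<in> carrier B" "x \<otimes>\<^bsub>B\<^esub> y \<in> carrier B"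
  unfolding f(2) g(2) ops_B[OF f(1) g(1)] carrier_B using cA f g by blast+
 show "qcoef (x \<oplus>\<^bsub>B\<^esub> y) u v = qcoef x u v + qcoef y u v"
  unfolding f(2) g(2) ops_B[OF f(1) g(1)] qcoef_coset[OF f(1)] qcoef_coset[OF g(1)] qcoef_coset[OF cA(3)[OF f(1) g(1)]]
  by (rule pcoef_linear)
 show "qcoef (x \<otimes>\<^bsub>B\<^esub> y) u v = (\<Sum>w\<in>verts Q. qcoef y u w * qcoef x w v)"
  unfolding f(2) g(2) ops_B[OF f(1) g(1)] qcoef_coset[OF f(1)] qcoef_coset[OF g(1)] qcoef_coset[OF cA(4)[OF f(1) g(1)]]
  using f g by (intro pcoef_mult) simp_all
next
 fix d :: "'v => 'v => 'k" assume "!!u v. d u v ~= 0 ==> conn u v"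
 then obtain f where f: "keys f \<subseteq> qpaths Q" "pcoef f = d" using pcoef_surj by blast
 then have "kerp +> f \<in> carrier B" by (auto simp: carrier_B)
 moreover have "qcoef (kerp +> f) = d" using qcoef_coset f by simp
 ultimately show "\<exists>x\<in>carrier B. qcoef x = d" by blast
qed (use conn_trans conn_verts conn_refl in blast)+

lemma vertex_idem_in: "v \<in> verts Q ==> vertex_idem Q v \<in> carrier B"
 and qcoef_vertex_idem: "v \<in> verts Q ==> qcoef (vertex_idem Q v) a b = (if a = v \<and> b = v then 1 else 0)"
proof -
 assume v: "v \<in> verts Q"
 have e: "vertex_idem Q v = kerp +> Poly_Mapping.single (v, []) 1"
  by (simp add: vertex_idem_def commutativity_ideal_eq A)
 have c: "Poly_Mapping.single (v, []) 1 \<in> carrier A" using v by (simp add: trivial_path)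
 show "vertex_idem Q v \<in> carrier B" unfolding e carrier_B using c by blast
 show "qcoef (vertex_idem Q v) a b = (if a = v \<and> b = v then 1 else 0)"
  unfolding e qcoef_coset[OF c] by (auto simp: pcoef_single trivial_path)
qed

end

section \<open>Paths in tree quivers\<close>

lemma double_quiver_simps: "verts (double_quiver Q) = verts Q" "arcs (double_quiver Q) = arcs Q \<times> UNIV"
 "tail (double_quiver Q) (a, d) = (if d then tail Q a else head Q a)"
 "head (double_quiver Q) (a, d) = (if d then head Q a else tail Q a)"
 by (simp_all add: double_quiver_def)

lemma ideal_quiver_simps: "verts (ideal_quiver R) = {I. indecomposable_ideal R I}"
 "a \<in> arcs (ideal_quiver R) \<longleftrightarrow> covers_in {I. indecomposable_ideal R I} (fst a) (snd a)"
 "tail (ideal_quiver R) = fst" "head (ideal_quiver R) = snd"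
 by (auto simp: ideal_quiver_def)

context pre_digraph begin

interpretation D: pre_digraph "double_quiver G" .

text \<open>Walks lift to the doubled quiver in their own direction and, reversed, against it. Two
  walks with common ends thus close up to one walk there.\<close>

lemma
 assumes "cas u p v"
 shows double_quiver_forward: "D.cas u (map (%a. (a, True)) p) v"
   "D.awalk_verts u (map (%a. (a, True)) p) = awalk_verts u p"
  and double_quiver_backward: "D.cas v (rev (map (%a. (a, False)) p)) u"
   "D.awalk_verts v (rev (map (%a. (a, False)) p)) = rev (awalk_verts u p)"
proof -
 show "D.cas u (map (%a. (a, True)) p) v" using assms
  by (induction p arbitrary: u) (auto simp: double_quiver_simps)
 show "D.awalk_verts u (map (%a. (a, True)) p) = awalk_verts u p"
  by (induction p arbitrary: u) (auto simp: double_quiver_simps)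
 have V: "D.awalk_verts w (rev (map (%a. (a, False)) q)) = (if q = [] then [w] else rev (map (head G) q) @ [tail G (hd q)])" for w q
  by (auto simp: D.awalk_verts_conv double_quiver_simps rev_map last_rev last_map comp_def)
 show "D.awalk_verts v (rev (map (%a. (a, False)) p)) = rev (awalk_verts u p)"
  using assms unfolding V awalk_verts_conv'[OF assms] by auto
 show "D.cas v (rev (map (%a. (a, False)) p)) u" using assms
 proof (induction p arbitrary: u)
  case (Cons e p)
  then have c: "D.cas v (rev (map (%a. (a, False)) p)) (head G e)" by simp
  have "last (D.awalk_verts v (rev (map (%a. (a, False)) p))) = head G e"
   using Cons.prems unfolding V by (cases p) auto
  then show ?case using c Cons.prems by (simp add: double_quiver_simps)
 qed simp
qed

end

lemma (in wf_digraph) wf_double_quiver: "wf_digraph (double_quiver G)"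
 by unfold_locales (auto simp: double_quiver_simps)

text \<open>In a pair of distinct walks with the same ends and least total length, the walks share
  no inner vertex and no arc. One followed by the reverse of the other is then a cycle of the
  underlying graph.\<close>

lemma (in wf_digraph) awalk_unique:
 assumes acyclic: "\<not> (\<exists>p. pre_digraph.cycle (double_quiver G) p \<and> distinct (map fst p))"
  and "awalk u p v" "awalk u q v"
 shows "p = q"
 using assms(2,3)
proof (induction "length p + length q" arbitrary: u v p q rule: less_induct)
 case less
 interpret D: wf_digraph "double_quiver G" by (rule wf_double_quiver)
 \<comment> \<open>A nonempty closed walk contains an oriented cycle, whose forward lift is already
   a forbidden cycle.\<close>
 have closed: "r = []" if r: "awalk w r w" for w r
 proof (rule ccontr)
  assume "r ~= []"
  then obtain c where "cycle c" using closed_w_imp_cycle[of r] r by (auto simp: closed_w_def)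
  then obtain x where c: "awalk x c x" "distinct (tl (awalk_verts x c))" "distinct c" "c ~= []" by (auto simp: cycle_conv)
  then have cs: "cas x c x" by blast
  have "D.cycle (map (%a. (a, True)) c)" unfolding D.cycle_def D.awalk_def
   using c double_quiver_forward[OF cs] awalk_hd_in_verts[OF c(1)]
   by (intro exI[of _ x]) (auto simp: double_quiver_simps awalk_def)
  moreover have "distinct (map fst (map (%a. (a, True)) c))" using c(3) by (simp add: comp_def)
  ultimately show False using acyclic by blast
 qed
 have dist: "distinct (awalk_verts x r)" if "awalk x r y" for x r y
  using awalk_not_distinct_decomp[OF that] closed by fastforce
 have pc: "cas u p v" and qc: "cas u q v" using less.prems by blast+
 show "p = q"
 proof (rule ccontr)
  assume ne: "p ~= q"
  have p0: "p ~= []" and q0: "q ~= []"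
   using ne closed less.prems by (metis awalk_empty_ends)+
  \<comment> \<open>A common vertex that cuts both walks into shorter pairs yields equal pieces by
    induction, hence \<open>p = q\<close>.\<close>
  have no_split: False if "p = p1 @ p2" "q = q1 @ q2" "awalk u p1 w" "awalk u q1 w" "awalk w p2 v" "awalk w q2 v"
   "length p1 + length q1 < length p + length q" "length p2 + length q2 < length p + length q" for p1 p2 q1 q2 w
   using less.hyps[OF that(7,3,4)] less.hyps[OF that(8,5,6)] that(1,2) ne by simp
  \<comment> \<open>The start is dropped from one vertex list and the end from the other, because
    both ends occur in both walks. In this form it gives distinct vertices in the combined
    walk.\<close>
  have V: "set (tl (awalk_verts u p)) \<inter> set (butlast (awalk_verts u q)) = {}"
  proof (rule ccontr)
   assume "\<not> ?thesis"
   then obtain w where w: "w \<in> set (tl (awalk_verts u p))" "w \<in> set (butlast (awalk_verts u q))" by blast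
   have "w \<in> head G ` set p" using w(1) p0 unfolding awalk_verts_conv'[OF pc] by simp
   then obtain e p1 p2 where p: "p = (p1 @ [e]) @ p2" "head G e = w" by (auto dest!: split_list)
   have "w \<in> tail G ` set q" using w(2) q0 unfolding awalk_verts_conv by simp
   then obtain f q1 q2 where q: "q = q1 @ f # q2" "tail G f = w" by (auto dest!: split_list)
   have "awalk u (p1 @ [e]) w" "awalk w p2 v"
    using less.prems(1) p by (auto simp: awalk_Cons_iff awalk_Nil_iff awalk_def)
   moreover have "awalk u q1 w" "awalk w (f # q2) v"
    using less.prems(2) q by (auto simp: awalk_Cons_iff)
   ultimately show False using p q by (intro no_split[of "p1 @ [e]" p2 q1 "f # q2" w]) auto
  qed
  \<comment> \<open>A common arc leaves shorter walks before and after it, which agree by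
    induction.\<close>
  have Ar: "set p \<inter> set q = {}"
  proof (rule ccontr)
   assume "\<not> ?thesis"
   then obtain e p1 p2 q1 q2 where e: "p = p1 @ e # p2" "q = q1 @ e # q2" by (metis disjoint_iff split_list)
   have "awalk u p1 (tail G e)" "awalk (tail G e) (e # p2) v" "awalk u q1 (tail G e)" "awalk (tail G e) (e # q2) v"
    using less.prems e by (auto simp: awalk_Cons_iff)
   moreover from this have "e # p2 = e # q2" if "p1 ~= [] \<or> q1 ~= []"
    using that e by (intro less.hyps) auto
   moreover have "p2 = q2"
    using less.hyps[of p2 q2 "head G e" v] less.prems e by (auto simp: awalk_Cons_iff)
   moreover have "p1 = q1"
    using less.hyps[of p1 q1 u "tail G e"] calculation e by auto
   ultimately show False using ne e by simp
  qed
  let ?c = "map (%a. (a, True)) p @ rev (map (%a. (a, False)) q)"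
  have cas: "D.cas u ?c u"
   using D.awlast_if_cas[OF double_quiver_forward(1)[OF pc]] double_quiver_forward(1)[OF pc] double_quiver_backward(1)[OF qc]
   by simp
  have "D.awalk_verts u ?c = awalk_verts u p @ rev (butlast (awalk_verts u q))"
   unfolding D.awalk_verts_append_cas[OF cas] D.awlast_if_cas[OF double_quiver_forward(1)[OF pc]]
    double_quiver_forward(2)[OF pc] double_quiver_backward(2)[OF qc] awlast_if_cas[OF pc]
   by (cases "awalk_verts u q" rule: rev_cases) simp_all
  then have "distinct (tl (D.awalk_verts u ?c))"
   using dist[OF less.prems(1)] dist[OF less.prems(2)] V by (simp add: distinct_tl distinct_butlast)
  then have "D.cycle ?c" unfolding D.cycle_def D.awalk_def
   using cas p0 less.prems by (intro exI[of _ u]) (auto simp: double_quiver_simps awalk_def)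
  moreover have "distinct (map fst ?c)"
   using Ar distinct_verts_imp_distinct[OF less.prems(1) dist[OF less.prems(1)]]
    distinct_verts_imp_distinct[OF less.prems(2) dist[OF less.prems(2)]]
   by (simp add: comp_def rev_map[symmetric])
  ultimately show False using acyclic by blast
 qed
qed

section \<open>The quiver of indecomposable ideals\<close>

context inc_alg begin

lemma fin_digraph_ideal_quiver: "fin_digraph (ideal_quiver R)"
proof
 have f: "finite {I. indecomposable_ideal R I}"
  by (rule finite_subset[OF _ finite_ideals]) (auto simp: indecomposable_ideal_def)
 then show "finite (verts (ideal_quiver R))" by (simp add: ideal_quiver_simps)
 have "arcs (ideal_quiver R) \<subseteq> {I. indecomposable_ideal R I} \<times> {I. indecomposable_ideal R I}"
  by (auto simp: ideal_quiver_simps covers_in_def)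
 then show "finite (arcs (ideal_quiver R))" by (rule finite_subset[OF _ finite_cartesian_product[OF f f]])
qed (auto simp: ideal_quiver_simps covers_in_def)

text \<open>Arrows descend, hence so do walks. Conversely, an indecomposable ideal \<open>K\<close>
  that is maximal among those containing \<open>J\<close> and strictly contained in \<open>I\<close>
  is covered by \<open>I\<close>, and induction on the number of indecomposable ideals below
  continues from \<open>K\<close>.\<close>

lemma ideal_quiver_walk_iff:
 "(\<exists>p. pre_digraph.awalk (ideal_quiver R) I p J) \<longleftrightarrow> indecomposable_ideal R I \<and> indecomposable_ideal R J \<and> J \<subseteq> I"
proof -
 let ?V = "{I. indecomposable_ideal R I}"
 interpret Q: fin_digraph "ideal_quiver R" by (rule fin_digraph_ideal_quiver)
 have fV: "finite ?V" using Q.finite_verts by (simp add: ideal_quiver_simps)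
 have "J \<subseteq> I" if "Q.awalk I p J" for I p
  using that
 proof (induction p arbitrary: I)
  case (Cons a p)
  then have a: "tail (ideal_quiver R) a = I" "a \<in> arcs (ideal_quiver R)" "Q.awalk (head (ideal_quiver R) a) p J"
   by (simp_all add: Q.awalk_Cons_iff)
  show ?case using Cons.IH[OF a(3)] a(1,2) unfolding ideal_quiver_simps covers_in_def by blast
 qed (simp add: Q.awalk_Nil_iff)
 moreover have "\<exists>p. Q.awalk I p J" if "I \<in> ?V" "J \<in> ?V" "J \<subseteq> I" for I
  using that
 proof (induction "card {K \<in> ?V. K \<subset> I}" arbitrary: I rule: less_induct)
  case less
  show ?case
  proof (cases "J = I")
   case True
   then show ?thesis using less.prems by (intro exI[of _ "[]"]) (simp add: Q.awalk_Nil_iff ideal_quiver_simps)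
  next
   case False
   let ?S = "{K \<in> ?V. J \<subseteq> K \<and> K \<subset> I}"
   have S: "finite ?S" "J \<in> ?S" using fV less.prems False by auto
   have "\<exists>K\<in>?S. \<forall>L\<in>?S. K \<subseteq> L --> K = L" by (rule finite_has_maximal[OF S(1)]) (use S(2) in blast)
   then obtain K where K: "K \<in> ?S" and "\<forall>L\<in>?S. K \<subseteq> L --> K = L" by (rule bexE)
   then have max: "L \<in> ?S ==> K \<subseteq> L ==> K = L" for L by simp
   have "{L \<in> ?V. L \<subset> K} \<subset> {L \<in> ?V. L \<subset> I}" using K(1) by auto
   then have "card {L \<in> ?V. L \<subset> K} < card {L \<in> ?V. L \<subset> I}" using fV by (intro psubset_card_mono) auto
   then obtain p where p: "Q.awalk K p J" using less.hyps[of K] K(1) less.prems by auto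
   have "False" if "L \<in> ?V" "K \<subset> L" "L \<subset> I" for L using max[of L] that K by blast
   then have "covers_in ?V I K" using K less.prems unfolding covers_in_def by blast
   then have "Q.awalk I ((I, K) # p) J" using p by (simp add: Q.awalk_Cons_iff ideal_quiver_simps)
   then show ?thesis by blast
  qed
 qed
 moreover have "I \<in> ?V \<and> J \<in> ?V" if "Q.awalk I p J" for I p
  using Q.awalk_hd_in_verts[OF that] Q.awalk_last_in_verts[OF that] by (simp add: ideal_quiver_simps)
 ultimately show ?thesis by blast
qed

end

section \<open>A generator of the category of projection functors\<close>

section \<open>Morphisms factoring through an object\<close>

text \<open>The sums of composites through \<open>G\<close>. The inductive form makes it easy to see
  that they are an ideal of the category; \<open>factors_expand\<close> recovers the finite sum
  demanded of a generator.\<close>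

inductive_set factors :: "('k, 'o, 'm) lincat => 'o => 'o => 'o => 'm set" for C G X Y where
 zero: "mzero C X Y \<in> factors C G X Y"
| step: "f \<in> factors C G X Y ==> a \<in> mor C G Y ==> b \<in> mor C X G ==>
  madd C X Y (cmp C X G Y a b) f \<in> factors C G X Y"

context lin_cat begin

context fixes G assumes G: "G \<in> ob C" begin

lemma factors_mor: "f \<in> factors C G X Y ==> X \<in> ob C ==> Y \<in> ob C ==> f \<in> mor C X Y"
 by (induction rule: factors.induct) (auto simp: G mzero_mor madd_mor cmp_mor)

lemma factors_cmp: "X \<in> ob C ==> Y \<in> ob C ==> a \<in> mor C G Y ==> b \<in> mor C X G ==> cmp C X G Y a b \<in> factors C G X Y"
 using factors.step[OF factors.zero, of a C G Y b X] by (simp add: G madd_mzero cmp_mor)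

lemma factors_add:
 assumes X: "X \<in> ob C" "Y \<in> ob C" and g: "g \<in> factors C G X Y" and f: "f \<in> factors C G X Y"
 shows "madd C X Y f g \<in> factors C G X Y"
 using f
proof induction
 case zero
 then show ?case using g X by (simp add: mzero_madd factors_mor)
next
 case (step f a b)
 have "madd C X Y (madd C X Y (cmp C X G Y a b) f) g = madd C X Y (cmp C X G Y a b) (madd C X Y f g)"
  using step g X G by (intro madd_assoc) (auto simp: factors_mor cmp_mor)
 then show ?case using factors.step[OF step.IH step.hyps(2,3)] by simp
qed

lemma factors_post:
 assumes X: "X \<in> ob C" "Y \<in> ob C" "Z \<in> ob C" and h: "h \<in> mor C Y Z" and f: "f \<in> factors C G X Y"
 shows "cmp C X Y Z h f \<in> factors C G X Z"
 using f
proof induction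
 case zero
 then show ?case using h X by (simp add: cmp_mzero_right factors.zero)
next
 case (step f a b)
 have "cmp C X Y Z h (madd C X Y (cmp C X G Y a b) f) = madd C X Z (cmp C X G Z (cmp C G Y Z h a) b) (cmp C X Y Z h f)"
  using step h X G by (simp add: cmp_madd_right factors_mor cmp_mor cmp_assoc)
 then show ?case using factors.step[OF step.IH, of "cmp C G Y Z h a" b] step h X G by (simp add: cmp_mor)
qed

lemma factors_pre:
 assumes X: "X \<in> ob C" "Y \<in> ob C" "Z \<in> ob C" and h: "h \<in> mor C Z X" and f: "f \<in> factors C G X Y"
 shows "cmp C Z X Y f h \<in> factors C G Z Y"
 using f
proof induction
 case zero
 then show ?case using h X by (simp add: cmp_mzero_left factors.zero)
next
 case (step f a b)
 have "cmp C Z X Y (madd C X Y (cmp C X G Y a b) f) h = madd C Z Y (cmp C Z G Y a (cmp C Z X G b h)) (cmp C Z X Y f h)"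
  using step h X G by (simp add: cmp_madd_left factors_mor cmp_mor cmp_assoc)
 then show ?case using factors.step[OF step.IH, of a "cmp C Z X G b h"] step h X G by (simp add: cmp_mor)
qed

lemma factors_sum:
 assumes X: "X \<in> ob C" "Y \<in> ob C" and f: "!!i. i \<in> S ==> f i \<in> factors C G X Y"
 shows "msum C X Y f S \<in> factors C G X Y"
 using f
proof (induction S rule: infinite_finite_induct)
 case (insert i S)
 have "msum C X Y f (insert i S) = madd C X Y (f i) (msum C X Y f S)"
  using insert X by (intro msum_insert) (auto intro: factors_mor)
 then show ?case using insert by (simp add: factors_add[OF X])
qed (simp_all add: X msum_infinite msum_empty factors.zero)

lemma factors_through:
 assumes X: "X \<in> ob C" "Y \<in> ob C" and a: "a \<in> mor C Y X" and b: "b \<in> mor C X Y" and id: "idm C Y \<in> factors C G Y Y"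
 shows "cmp C X Y X a b \<in> factors C G X X"
proof -
 have "cmp C X Y X a (cmp C X Y Y (idm C Y) b) \<in> factors C G X X"
  using X a b id by (intro factors_post[of X Y X] factors_pre[of Y Y X])
 then show ?thesis using X b by (simp add: idm_cmp)
qed

text \<open>Objects whose identity is a sum of maps through \<open>G\<close> are closed under direct
  sums. With \<open>idm_factors_summand\<close> they include the additive closure of any set of
  them.\<close>

lemma idm_factors_biproduct:
 assumes B: "is_biproduct C Ys B" and Y: "!!Y. Y \<in> set Ys ==> idm C Y \<in> factors C G Y Y"
 shows "idm C B \<in> factors C G B B"
proof -
 obtain \<iota> \<pi> where d: "biprod_data C (length Ys) (%i. Ys ! i) B \<iota> \<pi>" using B is_biproduct_iff by blast
 note d' = d[unfolded biprod_data_def]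
 have "msum C B B (%i. cmp C B (Ys ! i) B (\<iota> i) (\<pi> i)) {..<length Ys} \<in> factors C G B B"
  using d' Y by (intro factors_sum factors_through) auto
 then show ?thesis using d' by simp
qed

lemma idm_factors_summand:
 assumes B: "is_biproduct C [X, X'] B" and id: "idm C B \<in> factors C G B B"
 shows "idm C X \<in> factors C G X X"
proof -
 obtain \<iota> \<pi> where d: "biprod_data C 2 (%i. [X, X'] ! i) B \<iota> \<pi>" using B is_biproduct_iff[of "[X, X']"] by (auto simp: numeral_2_eq_2)
 note d' = d[unfolded biprod_data_def]
 have o: "X \<in> ob C" "B \<in> ob C" "\<iota> 0 \<in> mor C X B" "\<pi> 0 \<in> mor C B X" "cmp C X B X (\<pi> 0) (\<iota> 0) = idm C X"
  using d' by (fastforce dest: spec[of _ 0])+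
 show ?thesis using factors_through[OF o(1,2,4,3) id] o(5) by simp
qed

lemma factors_expand:
 assumes X: "X \<in> ob C" "Y \<in> ob C" and f: "f \<in> factors C G X Y"
 shows "\<exists>n a b. (\<forall>i<n. a i \<in> mor C G Y \<and> b i \<in> mor C X G) \<and> f = msum C X Y (%i. cmp C X G Y (a i) (b i)) {..<n::nat}"
 using f
proof induction
 case zero
 then show ?case using X by (intro exI[of _ 0]) (simp add: msum_empty)
next
 case (step f a b)
 then obtain n a' b' where ab: "!!i. i < n ==> a' i \<in> mor C G Y \<and> b' i \<in> mor C X G"
  and f: "f = msum C X Y (%i. cmp C X G Y (a' i) (b' i)) {..<n::nat}" by blast
 let ?a = "a'(n := a)" and ?b = "b'(n := b)"
 have "msum C X Y (%i. cmp C X G Y (?a i) (?b i)) {..<n} = f"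
  unfolding f using ab X G by (intro msum_cong) (auto simp: cmp_mor)
 moreover have "msum C X Y (%i. cmp C X G Y (?a i) (?b i)) (insert n {..<n}) =
   madd C X Y (cmp C X G Y (?a n) (?b n)) (msum C X Y (%i. cmp C X G Y (?a i) (?b i)) {..<n})"
  using ab step X G by (intro msum_insert) (auto simp: cmp_mor)
 ultimately have "madd C X Y (cmp C X G Y a b) f = msum C X Y (%i. cmp C X G Y (?a i) (?b i)) {..<Suc n}"
  by (simp add: lessThan_Suc)
 then show ?case using ab step by (intro exI[of _ "Suc n"] exI[of _ ?a] exI[of _ ?b]) (auto simp: less_Suc_eq)
qed

end
end

declare functor_cat_simps [simp del]

lemma (in lin_cat) biprod_data_cong:
 assumes d: "biprod_data C n Y B \<iota> \<pi>" and eq: "!!i. i < n ==> Y i = Y' i"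
 shows "biprod_data C n Y' B \<iota> \<pi>"
proof -
 have d': "B \<in> ob C" "!!i. i < n ==> Y' i \<in> ob C" "!!i. i < n ==> \<iota> i \<in> mor C (Y' i) B \<and> \<pi> i \<in> mor C B (Y' i)"
  using d eq unfolding biprod_data_def by simp_all
 have "msum C B B (%i. cmp C B (Y i) B (\<iota> i) (\<pi> i)) {..<n} = msum C B B (%i. cmp C B (Y' i) B (\<iota> i) (\<pi> i)) {..<n}"
  by (rule msum_cong[OF d'(1,1)]) (use d' eq in "simp_all add: cmp_mor")
 then show ?thesis using d d' eq unfolding biprod_data_def by simp
qed

text \<open>Matrix multiplication: the identity of \<open>B\<close> is inserted between
  \<open>g\<close> and \<open>f\<close> as the sum of the \<open>\<iota> k \<pi> k\<close>.\<close>

lemma (in lin_cat) biprod_matrix_cmp: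
 assumes d: "biprod_data C n Y B \<iota> \<pi>" and f: "f \<in> mor C B B" and g: "g \<in> mor C B B" and ij: "i < n" "j < n"
 shows "cmp C (Y i) B (Y j) (\<pi> j) (cmp C (Y i) B B (cmp C B B B g f) (\<iota> i)) =
  msum C (Y i) (Y j) (%k. cmp C (Y i) (Y k) (Y j) (cmp C (Y k) B (Y j) (\<pi> j) (cmp C (Y k) B B g (\<iota> k)))
   (cmp C (Y i) B (Y k) (\<pi> k) (cmp C (Y i) B B f (\<iota> i)))) {..<n}"
proof -
 note d' = d[unfolded biprod_data_def]
 have B: "B \<in> ob C" and Y: "!!i. i < n ==> Y i \<in> ob C" "!!i. i < n ==> \<iota> i \<in> mor C (Y i) B" "!!i. i < n ==> \<pi> i \<in> mor C B (Y i)"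
  and id: "msum C B B (%i. cmp C B (Y i) B (\<iota> i) (\<pi> i)) {..<n} = idm C B"
  using d' by auto
 let ?F = "cmp C (Y i) B B f (\<iota> i)" and ?P = "cmp C B B (Y j) (\<pi> j) g"
 have F: "?F \<in> mor C (Y i) B" and P: "?P \<in> mor C B (Y j)" using B Y ij f g by (auto simp: cmp_mor)
 have "cmp C (Y i) B (Y j) (\<pi> j) (cmp C (Y i) B B (cmp C B B B g f) (\<iota> i)) = cmp C (Y i) B (Y j) ?P ?F"
  using B Y ij f g by (simp add: cmp_assoc cmp_mor)
 also have "?F = msum C (Y i) B (%k. cmp C (Y i) (Y k) B (\<iota> k) (cmp C (Y i) B (Y k) (\<pi> k) ?F)) {..<n}"
  by (rule biprod_expand(1)[OF B Y(1)[OF ij(1)] _ id F, symmetric]) (use Y in blast)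
 also have "cmp C (Y i) B (Y j) ?P ... = msum C (Y i) (Y j) (%k. cmp C (Y i) B (Y j) ?P (cmp C (Y i) (Y k) B (\<iota> k) (cmp C (Y i) B (Y k) (\<pi> k) ?F))) {..<n}"
  using F P B Y ij by (intro cmp_msum_right) (auto simp: cmp_mor)
 also have "... = msum C (Y i) (Y j) (%k. cmp C (Y i) (Y k) (Y j) (cmp C (Y k) B (Y j) (\<pi> j) (cmp C (Y k) B B g (\<iota> k)))
   (cmp C (Y i) B (Y k) (\<pi> k) ?F)) {..<n}"
 proof (rule msum_cong)
  fix k assume "k \<in> {..<n}"
  then have k: "k < n" by simp
  have F': "cmp C (Y i) B (Y k) (\<pi> k) ?F \<in> mor C (Y i) (Y k)" using F k B Y ij by (simp add: cmp_mor)
  have "cmp C (Y i) B (Y j) ?P (cmp C (Y i) (Y k) B (\<iota> k) (cmp C (Y i) B (Y k) (\<pi> k) ?F)) =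
    cmp C (Y i) (Y k) (Y j) (cmp C (Y k) B (Y j) ?P (\<iota> k)) (cmp C (Y i) B (Y k) (\<pi> k) ?F)"
   using cmp_assoc[OF Y(1)[OF ij(1)] Y(1)[OF k] B Y(1)[OF ij(2)] F' Y(2)[OF k] P] by simp
  also have "cmp C (Y k) B (Y j) ?P (\<iota> k) = cmp C (Y k) B (Y j) (\<pi> j) (cmp C (Y k) B B g (\<iota> k))"
   using k ij B Y g by (intro cmp_assoc)
  finally show "cmp C (Y i) B (Y j) ?P (cmp C (Y i) (Y k) B (\<iota> k) (cmp C (Y i) B (Y k) (\<pi> k) ?F)) =
   cmp C (Y i) (Y k) (Y j) (cmp C (Y k) B (Y j) (\<pi> j) (cmp C (Y k) B B g (\<iota> k))) (cmp C (Y i) B (Y k) (\<pi> k) ?F)" .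
  show "cmp C (Y i) (Y k) (Y j) (cmp C (Y k) B (Y j) (\<pi> j) (cmp C (Y k) B B g (\<iota> k))) (cmp C (Y i) B (Y k) (\<pi> k) ?F) \<in> mor C (Y i) (Y j)"
   using F' k ij B Y g by (simp add: cmp_mor)
 qed (use Y ij in auto)
 finally show ?thesis .
qed

section \<open>The endomorphism algebra of the projection functors\<close>

text \<open>Abstracting from the ideal quiver, \<open>B\<close> is any incidence algebra on the
  indecomposable ideals of \<open>A\<close>, with paths running from larger ideals to smaller
  ones.\<close>

locale ideal_pair = A: inc_alg A V0 rel0 coef0 +
  B: inc_alg B "{I. indecomposable_ideal A I}" "%I J. indecomposable_ideal A I \<and> indecomposable_ideal A J \<and> J \<subseteq> I" coefB
 for A :: "('k::field, 'a) module" and V0 :: "'i set" and rel0 coef0 and B :: "('k, 'b) module" and coefB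
begin

abbreviation "\<F> \<equiv> functor_cat (mod_cat A) (mod_cat A)"
abbreviation "\<D> \<equiv> full_subcat \<F> (add_closure \<F> {Dp A I | I. ideal I A})"

sublocale E: additive_cat \<F>
 by (rule additive_functor_cat[OF A.lin_cat_mod_cat A.additive_cat_mod_cat])

text \<open>The transformation given by \<open>c\<close> times the inclusion. For
  \<open>c = 0\<close> no inclusion is required, which is why the lemmas below carry the condition
  \<open>c ~= 0 --> I \<subseteq> J\<close>.\<close>

definition h :: "'a set => 'a set => 'k => ('k, 'a) smod => 'k smor" where
 "h I J c = A.Dp_trans I J (%x. c \<odot>\<^bsub>A\<^esub> x)"

context
 fixes I J assumes I: "ideal I A" and J: "ideal J A"
begin

lemma scalar_bimod_hom: "c ~= 0 --> I \<subseteq> J ==> bimod_hom A I J (%x. c \<odot>\<^bsub>A\<^esub> x)"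
 using I J by (intro A.bimod_hom_smult) auto

lemma h_mor: "c ~= 0 --> I \<subseteq> J ==> h I J c \<in> mor \<F> (Dp A I) (Dp A J)"
 unfolding h_def by (rule A.Dp_trans_mor[OF I J scalar_bimod_hom])

lemma h_add:
 assumes "c ~= 0 --> I \<subseteq> J" "d ~= 0 --> I \<subseteq> J"
 shows "madd \<F> (Dp A I) (Dp A J) (h I J c) (h I J d) = h I J (c + d)"
proof -
 have "c + d ~= 0 --> I \<subseteq> J" using assms by (cases "c = 0") simp_all
 from A.Dp_trans_add[OF I J scalar_bimod_hom[OF assms(1)] scalar_bimod_hom[OF assms(2)] scalar_bimod_hom[OF this]]
 show ?thesis unfolding h_def using ideal.Icarr[OF I] A.kadd_smult by blast
qed

lemma h_scale:
 assumes "c ~= 0 --> I \<subseteq> J"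
 shows "mscale \<F> (Dp A I) (Dp A J) d (h I J c) = h I J (d * c)"
proof -
 have "d * c ~= 0 --> I \<subseteq> J" using assms by simp
 from A.Dp_trans_scale[OF I J scalar_bimod_hom[OF assms] scalar_bimod_hom[OF this]]
 show ?thesis unfolding h_def using ideal.Icarr[OF I] A.kmult_smult by blast
qed

lemma h_zero: "h I J 0 = mzero \<F> (Dp A I) (Dp A J)"
 using h_scale[of 0 0] E.mscale_zero[OF A.Dp_ob[OF I] A.Dp_ob[OF J] h_mor[of 0]] by simp

lemma h_sum:
 assumes "!!k. c k ~= 0 --> I \<subseteq> J"
 shows "msum \<F> (Dp A I) (Dp A J) (%k. h I J (c k)) S = h I J (\<Sum>k\<in>S. c k)"
proof (induction S rule: infinite_finite_induct)
 case (insert k S)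
 have "(\<Sum>k\<in>S. c k) ~= 0 --> I \<subseteq> J" using assms by (metis sum.neutral)
 then have "madd \<F> (Dp A I) (Dp A J) (h I J (c k)) (h I J (\<Sum>k\<in>S. c k)) = h I J (c k + (\<Sum>k\<in>S. c k))"
  using assms by (intro h_add)
 moreover have "msum \<F> (Dp A I) (Dp A J) (%k. h I J (c k)) (insert k S) =
   madd \<F> (Dp A I) (Dp A J) (h I J (c k)) (msum \<F> (Dp A I) (Dp A J) (%k. h I J (c k)) S)"
  by (rule E.msum_insert[OF A.Dp_ob[OF I] A.Dp_ob[OF J] insert.hyps h_mor[OF assms] h_mor[OF assms]])
 ultimately show ?case using insert by simp
qed (simp_all add: E.msum_infinite[OF A.Dp_ob[OF I] A.Dp_ob[OF J]] E.msum_empty[OF A.Dp_ob[OF I] A.Dp_ob[OF J]] h_zero)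

text \<open>A nonzero element of \<open>I\<close> has a nonzero coefficient, by which
  \<open>c\<close> can be read off.\<close>

lemma h_inj:
 assumes "I ~= {\<zero>\<^bsub>A\<^esub>}" "c ~= 0 --> I \<subseteq> J" "d ~= 0 --> I \<subseteq> J" and eq: "h I J c = h I J d"
 shows "c = d"
proof -
 interpret I: ideal I A by (rule I)
 obtain x where x: "x \<in> I" "x ~= \<zero>\<^bsub>A\<^esub>" using assms(1) I.zero_closed by blast
 then have xA: "x \<in> carrier A" using I.Icarr by blast
 then obtain u v where uv: "coef0 x u v ~= 0" using x(2) A.eqI[of x "\<zero>\<^bsub>A\<^esub>"] by (auto simp: A.coef_zero)
 have "c \<odot>\<^bsub>A\<^esub> x = d \<odot>\<^bsub>A\<^esub> x"
  by (rule A.Dp_trans_inj[OF I J scalar_bimod_hom[OF assms(2)] scalar_bimod_hom[OF assms(3)] eq[unfolded h_def] x(1)])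
 then have "c * coef0 x u v = d * coef0 x u v" using A.coef_smult[OF xA] by metis
 then show ?thesis using uv by simp
qed

lemma h_surj:
 assumes ind: "indecomposable_ideal A I" and f: "f \<in> mor \<F> (Dp A I) (Dp A J)"
 shows "\<exists>c. (c ~= 0 --> I \<subseteq> J) \<and> f = h I J c"
proof -
 obtain g where g: "bimod_hom A I J g" "f = A.Dp_trans I J g" using A.Dp_trans_surj[OF I J f] by blast
 obtain c where c: "\<forall>x\<in>I. g x = c \<odot>\<^bsub>A\<^esub> x" "c ~= 0 --> I \<subseteq> J"
  using A.bimod_hom_indecomposable[OF ind J g(1)] by blast
 have "f = h I J c" unfolding g(2) h_def
  by (rule A.Dp_trans_cong[OF I J g(1) scalar_bimod_hom[OF c(2)]]) (use c(1) in blast)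
 then show ?thesis using c by blast
qed

end

lemma h_id: assumes I: "ideal I A" shows "h I I 1 = idm \<F> (Dp A I)"
 unfolding h_def
 by (rule A.Dp_trans_id[OF I scalar_bimod_hom[OF I I]]) (simp_all add: A.kone_smult[OF ideal.Icarr[OF I]])

lemma h_cmp:
 assumes I: "ideal I A" "ideal J A" "ideal L A" and c: "c ~= 0 --> I \<subseteq> J" and d: "d ~= 0 --> J \<subseteq> L"
 shows "cmp \<F> (Dp A I) (Dp A J) (Dp A L) (h J L d) (h I J c) = h I L (d * c)"
proof -
 have "d * c ~= 0 --> I \<subseteq> L" using c d by auto
 from A.Dp_trans_compose[OF I scalar_bimod_hom[OF I(1,2) c] scalar_bimod_hom[OF I(2,3) d] scalar_bimod_hom[OF I(1,3) this]]
 show ?thesis unfolding h_def using ideal.Icarr[OF I(1)] A.kmult_smult by blast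
qed

text \<open>Induction on the number of ideals below \<open>I\<close>. For decomposable
  \<open>I\<close> the identity of \<open>Dp I\<close> is the sum of two transformations that pass
  through \<open>Dp J\<close> and \<open>Dp K\<close> for smaller ideals; for the zero ideal the
  identity is zero.\<close>

lemma idm_Dp_factors:
 assumes G: "G \<in> ob \<F>"
  and ind: "!!I. indecomposable_ideal A I ==> idm \<F> (Dp A I) \<in> factors \<F> G (Dp A I) (Dp A I)"
 shows "ideal I A ==> idm \<F> (Dp A I) \<in> factors \<F> G (Dp A I) (Dp A I)"
proof (induction "card {J. ideal J A \<and> J \<subset> I}" arbitrary: I rule: less_induct)
 case less
 note I = less.prems
 have o: "Dp A I \<in> ob \<F>" by (rule A.Dp_ob[OF I])
 show ?case
 proof (cases "indecomposable_ideal A I")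
  case True
  then show ?thesis by (rule ind)
 next
  case False
  show ?thesis
  proof (cases "I = {\<zero>\<^bsub>A\<^esub>}")
   case True
   have "h I I 1 = h I I 0" unfolding h_def
    by (rule A.Dp_trans_cong[OF I I scalar_bimod_hom[OF I I] scalar_bimod_hom[OF I I]])
     (use True in "simp_all add: A.kvec.smult_zero")
   then show ?thesis using h_id[OF I] h_zero[OF I I] factors.zero by metis
  next
   case nz: False
   obtain J K p q where JK: "ideal J A" "ideal K A" "J \<subset> I" "K \<subset> I" "bimod_hom A I J p" "bimod_hom A I K q"
    "!!x. x \<in> I ==> x = p x \<oplus>\<^bsub>A\<^esub> q x"
    using A.ideal_decomposition[OF I False nz] by blast
   have fin: "finite {J. ideal J A \<and> J \<subset> L}" for L by (rule finite_subset[OF _ A.finite_ideals]) blast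
   have lt: "card {L. ideal L A \<and> L \<subset> J'} < card {L. ideal L A \<and> L \<subset> I}" if "ideal J' A" "J' \<subset> I" for J'
    by (rule psubset_card_mono[OF fin]) (use that in blast)
   \<comment> \<open>An endomorphism of \<open>I\<close> with values in a smaller ideal
     \<open>J'\<close> is followed by the inclusion of \<open>J'\<close>, so its transformation
     passes through \<open>Dp J'\<close>.\<close>
   have part: "bimod_hom A I I r \<and> A.Dp_trans I I r \<in> factors \<F> G (Dp A I) (Dp A I)"
    if J': "ideal J' A" "J' \<subset> I" and r: "bimod_hom A I J' r" for J' r
   proof
    show rI: "bimod_hom A I I r" using r J'(2) unfolding bimod_hom_def by blast
    have rA: "r x \<in> carrier A" if "x \<in> I" for x using bimod_homD(1)[OF r that] ideal.Icarr[OF J'(1)] by blast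
    have "cmp \<F> (Dp A I) (Dp A J') (Dp A I) (h J' I 1) (A.Dp_trans I J' r) = A.Dp_trans I I r"
     unfolding h_def
     by (rule A.Dp_trans_compose[OF I J'(1) I r scalar_bimod_hom[OF J'(1) I] rI])
      (use J'(2) in "simp_all add: A.kone_smult[OF rA] psubset_imp_subset")
    moreover have "cmp \<F> (Dp A I) (Dp A J') (Dp A I) (h J' I 1) (A.Dp_trans I J' r) \<in> factors \<F> G (Dp A I) (Dp A I)"
     by (rule E.factors_through[OF G o A.Dp_ob[OF J'(1)] h_mor[OF J'(1) I] A.Dp_trans_mor[OF I J'(1) r] less.hyps[OF lt[OF J'] J'(1)]])
      (use J'(2) in blast)
    ultimately show "A.Dp_trans I I r \<in> factors \<F> G (Dp A I) (Dp A I)" by simp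
   qed
   have p: "bimod_hom A I I p" "A.Dp_trans I I p \<in> factors \<F> G (Dp A I) (Dp A I)" using part[OF JK(1,3,5)] by auto
   have q: "bimod_hom A I I q" "A.Dp_trans I I q \<in> factors \<F> G (Dp A I) (Dp A I)" using part[OF JK(2,4,6)] by auto
   have "madd \<F> (Dp A I) (Dp A I) (A.Dp_trans I I p) (A.Dp_trans I I q) = h I I 1"
    unfolding h_def
   proof (rule A.Dp_trans_add[OF I I p(1) q(1)])
    show "bimod_hom A I I (%x. 1 \<odot>\<^bsub>A\<^esub> x)" by (rule scalar_bimod_hom[OF I I]) simp
    fix x assume x: "x \<in> I"
    show "1 \<odot>\<^bsub>A\<^esub> x = p x \<oplus>\<^bsub>A\<^esub> q x" unfolding JK(7)[OF x, symmetric] by (rule A.kone_smult[OF ideal.Icarr[OF I x]])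
   qed
   then show ?thesis using E.factors_add[OF G o o q(2) p(2)] h_id[OF I] by simp
  qed
 qed
qed

text \<open>\<open>G\<close> is the direct sum of the \<open>Dp I\<close> over the indecomposable
  ideals. Its endomorphisms are matrices of scalars supported on inclusions, that is, elements of
  \<open>B\<close>; with \<open>retr\<close> and \<open>pow\<close> this is an instance of
  \<open>gen_cat\<close>.\<close>

theorem projection_equivalence:
 "\<exists>\<Phi>. linear_equivalence (abelianization \<D>) (mod_cat B) \<Phi> \<and>
   (\<forall>I. indecomposable_ideal A I -->
    mod_iso B (fob \<Phi> (proj_ob \<D> (Dp A I))) (left_principal B (B.E I I)) ~= {})"
proof -
 let ?V = "{I. indecomposable_ideal A I}" and ?S = "{Dp A I | I. ideal I A}"
 obtain Is where Is: "set Is = ?V" "distinct Is" using finite_distinct_list[OF B.finite_V] by blast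
 let ?n = "length Is"
 have VI: "indecomposable_ideal A (Is ! i)" if "i < ?n" for i using nth_mem[OF that] Is by auto
 have idI: "ideal (Is ! i) A" and nzI: "Is ! i ~= {\<zero>\<^bsub>A\<^esub>}" if "i < ?n" for i
  using VI[OF that] by (auto simp: indecomposable_ideal_def)
 let ?L = "map (Dp A) Is"
 have LS: "set ?L \<subseteq> ?S" using Is(1) by (auto simp: indecomposable_ideal_def)
 have LE: "set ?L \<subseteq> ob \<F>" using LS A.Dp_ob by blast
 obtain G where GL: "is_biproduct \<F> ?L G" using E.biproduct_list_exists[OF LE] by blast
 define Y where "Y i = Dp A (Is ! i)" for i
 obtain \<iota> \<pi> where "biprod_data \<F> (length ?L) (%i. ?L ! i) G \<iota> \<pi>" using iffD1[OF E.is_biproduct_iff GL] by (elim exE)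
 then have bd0: "biprod_data \<F> ?n (%i. ?L ! i) G \<iota> \<pi>" unfolding length_map .
 have bd: "biprod_data \<F> ?n Y G \<iota> \<pi>" by (rule E.biprod_data_cong[OF bd0]) (simp add: Y_def)
 then have G: "G \<in> ob \<F>" and ip: "!!i. i < ?n ==> \<iota> i \<in> mor \<F> (Y i) G \<and> \<pi> i \<in> mor \<F> G (Y i)"
  and delta: "!!i j. i < ?n ==> j < ?n ==> cmp \<F> (Y i) G (Y j) (\<pi> j) (\<iota> i) = (if i = j then idm \<F> (Y i) else mzero \<F> (Y i) (Y j))"
  unfolding biprod_data_def by simp_all
 have Yo: "Y i \<in> ob \<F>" if "i < ?n" for i unfolding Y_def by (rule A.Dp_ob[OF idI[OF that]])
 \<comment> \<open>The indices are exchanged: a basis vector of \<open>B\<close> runs from the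
   larger ideal to the smaller, whereas the corresponding transformation includes the smaller ideal
   in the larger.\<close>
 define m where "m r i j = h (Is ! i) (Is ! j) (coefB r (Is ! j) (Is ! i))" for r i j
 have mc: "coefB r (Is ! j) (Is ! i) ~= 0 --> Is ! i \<subseteq> Is ! j" if "r \<in> carrier B" for r i j
  using B.coef_rel[OF that] by blast
 have mm: "m r i j \<in> mor \<F> (Y i) (Y j)" if "r \<in> carrier B" "i < ?n" "j < ?n" for r i j
  unfolding m_def Y_def by (rule h_mor[OF idI[OF that(2)] idI[OF that(3)] mc[OF that(1)]])
 let ?c = "%f i j. cmp \<F> (Y i) G (Y j) (\<pi> j) (cmp \<F> (Y i) G G f (\<iota> i))"
 define \<rho> where "\<rho> r = (SOME f. f \<in> mor \<F> G G \<and> (\<forall>i<?n. \<forall>j<?n. ?c f i j = m r i j))" for r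
 have "\<exists>f. f \<in> mor \<F> G G \<and> (\<forall>i<?n. \<forall>j<?n. ?c f i j = m r i j)" if "r \<in> carrier B" for r
  using E.biprod_matrix_exists[OF bd mm[OF that]] by blast
 note ex = this
 have "\<rho> r \<in> mor \<F> G G \<and> (\<forall>i<?n. \<forall>j<?n. ?c (\<rho> r) i j = m r i j)" if "r \<in> carrier B" for r
  unfolding \<rho>_def by (rule someI_ex[OF ex[OF that]])
 then have \<rho>: "!!r. r \<in> carrier B ==> \<rho> r \<in> mor \<F> G G"
  and \<rho>c: "!!r i j. r \<in> carrier B ==> i < ?n ==> j < ?n ==> ?c (\<rho> r) i j = m r i j" by blast+
 have \<rho>_eqI: "\<rho> r = f" if "r \<in> carrier B" "f \<in> mor \<F> G G" "!!i j. i < ?n ==> j < ?n ==> ?c f i j = m r i j" for r f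
  by (rule E.biprod_matrix_unique[OF bd \<rho>[OF that(1)] that(2)]) (simp add: \<rho>c that(1,3))
 have \<rho>_bij: "bij_betw \<rho> (carrier B) (mor \<F> G G)"
  unfolding bij_betw_def
 proof
  show "inj_on \<rho> (carrier B)"
  proof (rule inj_onI)
   fix r s assume r: "r \<in> carrier B" and s: "s \<in> carrier B" and e: "\<rho> r = \<rho> s"
   have c: "coefB r (Is ! j) (Is ! i) = coefB s (Is ! j) (Is ! i)" if "i < ?n" "j < ?n" for i j
   proof (rule h_inj[OF idI[OF that(1)] idI[OF that(2)] nzI[OF that(1)] mc[OF r] mc[OF s]])
    show "h (Is ! i) (Is ! j) (coefB r (Is ! j) (Is ! i)) = h (Is ! i) (Is ! j) (coefB s (Is ! j) (Is ! i))"
     using \<rho>c[OF r that] \<rho>c[OF s that] e by (simp add: m_def)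
   qed
   show "r = s"
   proof (rule B.eqI[OF r s])
    fix u v show "coefB r u v = coefB s u v"
    proof (cases "u \<in> ?V \<and> v \<in> ?V")
     case True
     then obtain i j where "i < ?n" "j < ?n" "u = Is ! j" "v = Is ! i" using Is(1) by (metis in_set_conv_nth)
     then show ?thesis using c by simp
    next
     case False
     then show ?thesis using B.coef_out[OF r, of u v] B.coef_out[OF s, of u v] by auto
    qed
   qed
  qed
  have "f \<in> \<rho> ` carrier B" if f: "f \<in> mor \<F> G G" for f
  proof -
   have "\<exists>c. (c ~= 0 --> Is ! i \<subseteq> Is ! j) \<and> ?c f i j = h (Is ! i) (Is ! j) c" if ij: "i < ?n" "j < ?n" for i j
   proof (rule h_surj[OF idI[OF ij(1)] idI[OF ij(2)] VI[OF ij(1)]])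
    show "?c f i j \<in> mor \<F> (Dp A (Is ! i)) (Dp A (Is ! j))"
     unfolding Y_def[symmetric] using ij ip Yo G f by (intro E.cmp_mor[of _ G]) auto
   qed
   then have "\<forall>i j. \<exists>c. i < ?n \<and> j < ?n --> (c ~= 0 --> Is ! i \<subseteq> Is ! j) \<and> ?c f i j = h (Is ! i) (Is ! j) c" by blast
   then obtain c where c: "!!i j. i < ?n ==> j < ?n ==> (c i j ~= 0 --> Is ! i \<subseteq> Is ! j) \<and> ?c f i j = h (Is ! i) (Is ! j) (c i j)" by metis
   \<comment> \<open>The position of an ideal in the list, used to turn the scalars
     \<open>c i j\<close> into a function of ideals.\<close>
   define ix where "ix = inv_into {..<?n} (nth Is)"
   have inj: "inj_on (nth Is) {..<?n}" using Is(2) by (auto simp: inj_on_def nth_eq_iff_index_eq)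
   have ix: "ix (Is ! i) = i" if "i < ?n" for i unfolding ix_def using inv_into_f_f[OF inj] that by simp
   let ?d = "%u v. if u \<in> ?V \<and> v \<in> ?V then c (ix v) (ix u) else 0"
   have "\<exists>r\<in>carrier B. coefB r = ?d"
   proof (rule B.coef_surj)
    fix u v assume d: "?d u v ~= 0"
    then have uv: "u \<in> ?V" "v \<in> ?V" "c (ix v) (ix u) ~= 0" by (auto split: if_splits)
    then obtain i j where ij: "i < ?n" "j < ?n" "u = Is ! j" "v = Is ! i" using Is(1) by (metis in_set_conv_nth)
    then show "indecomposable_ideal A u \<and> indecomposable_ideal A v \<and> v \<subseteq> u" using c[OF ij(1,2)] uv ix by auto
   qed
   then obtain r where r: "r \<in> carrier B" "coefB r = ?d" by blast
   have "\<rho> r = f"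
   proof (rule \<rho>_eqI[OF r(1) f])
    fix i j assume ij: "i < ?n" "j < ?n"
    show "?c f i j = m r i j" unfolding m_def r(2) using c[OF ij] VI[OF ij(1)] VI[OF ij(2)] ix ij by simp
   qed
   then show ?thesis using r(1) by blast
  qed
  then show "\<rho> ` carrier B = mor \<F> G G" using \<rho> by blast
 qed
 have \<rho>_add: "\<rho> (r \<oplus>\<^bsub>B\<^esub> s) = madd \<F> G G (\<rho> r) (\<rho> s)" if r: "r \<in> carrier B" and s: "s \<in> carrier B" for r s
 proof (rule \<rho>_eqI[OF B.add_in[OF r s] E.madd_mor[OF G G \<rho>[OF r] \<rho>[OF s]]])
  fix i j assume ij: "i < ?n" "j < ?n"
  note Yi = Yo[OF ij(1)] Yo[OF ij(2)]
  have mi: "cmp \<F> (Y i) G G (\<rho> x) (\<iota> i) \<in> mor \<F> (Y i) G" if "x \<in> carrier B" for x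
   using E.cmp_mor[OF Yi(1) G G _ \<rho>[OF that]] ip[OF ij(1)] by blast
  have "?c (madd \<F> G G (\<rho> r) (\<rho> s)) i j = madd \<F> (Y i) (Y j) (?c (\<rho> r) i j) (?c (\<rho> s) i j)"
   using E.cmp_madd_left[OF Yi(1) G G _ \<rho>[OF r] \<rho>[OF s]] E.cmp_madd_right[OF Yi(1) G Yi(2) mi[OF r] mi[OF s]] ip ij by metis
  also have "... = m (r \<oplus>\<^bsub>B\<^esub> s) i j"
   unfolding \<rho>c[OF r ij] \<rho>c[OF s ij] unfolding m_def Y_def B.coef_add[OF r s]
   by (rule h_add[OF idI[OF ij(1)] idI[OF ij(2)] mc[OF r] mc[OF s]])
  finally show "?c (madd \<F> G G (\<rho> r) (\<rho> s)) i j = m (r \<oplus>\<^bsub>B\<^esub> s) i j" .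
 qed
 have \<rho>_smult: "\<rho> (c \<odot>\<^bsub>B\<^esub> r) = mscale \<F> G G c (\<rho> r)" if r: "r \<in> carrier B" for r c
 proof (rule \<rho>_eqI[OF B.smult_in[OF r] E.mscale_mor[OF G G \<rho>[OF r]]])
  fix i j assume ij: "i < ?n" "j < ?n"
  note Yi = Yo[OF ij(1)] Yo[OF ij(2)]
  have mi: "cmp \<F> (Y i) G G (\<rho> r) (\<iota> i) \<in> mor \<F> (Y i) G"
   using E.cmp_mor[OF Yi(1) G G _ \<rho>[OF r]] ip[OF ij(1)] by blast
  have "?c (mscale \<F> G G c (\<rho> r)) i j = mscale \<F> (Y i) (Y j) c (?c (\<rho> r) i j)"
   using E.cmp_mscale_left[OF Yi(1) G G _ \<rho>[OF r]] E.cmp_mscale_right[OF Yi(1) G Yi(2) mi] ip ij by metis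
  also have "... = m (c \<odot>\<^bsub>B\<^esub> r) i j"
   unfolding \<rho>c[OF r ij] unfolding m_def Y_def B.coef_smult[OF r]
   by (rule h_scale[OF idI[OF ij(1)] idI[OF ij(2)] mc[OF r]])
  finally show "?c (mscale \<F> G G c (\<rho> r)) i j = m (c \<odot>\<^bsub>B\<^esub> r) i j" .
 qed
 have \<rho>_one: "\<rho> \<one>\<^bsub>B\<^esub> = idm \<F> G"
 proof (rule \<rho>_eqI[OF B.one_in E.idm_mor[OF G]])
  fix i j assume ij: "i < ?n" "j < ?n"
  have "?c (idm \<F> G) i j = (if i = j then idm \<F> (Y i) else mzero \<F> (Y i) (Y j))"
   using E.idm_cmp[OF Yo[OF ij(1)] G] ip ij delta[OF ij] by simp
  also have "... = m \<one>\<^bsub>B\<^esub> i j"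
  proof (cases "i = j")
   case True
   then show ?thesis using VI[OF ij(1)] h_id[OF idI[OF ij(1)]] by (simp add: m_def Y_def B.coef_one)
  next
   case False
   then have "Is ! j ~= Is ! i" using nth_eq_iff_index_eq[OF Is(2) ij] by simp
   then show ?thesis using False h_zero[OF idI[OF ij(1)] idI[OF ij(2)]] by (simp add: m_def Y_def B.coef_one)
  qed
  finally show "?c (idm \<F> G) i j = m \<one>\<^bsub>B\<^esub> i j" .
 qed
 have \<rho>_mult: "\<rho> (r \<otimes>\<^bsub>B\<^esub> s) = cmp \<F> G G G (\<rho> s) (\<rho> r)" if r: "r \<in> carrier B" and s: "s \<in> carrier B" for r s
 proof (rule \<rho>_eqI[OF B.mult_in[OF r s] E.cmp_mor[OF G G G \<rho>[OF r] \<rho>[OF s]]])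
  fix i j assume ij: "i < ?n" "j < ?n"
  let ?e = "%k. coefB s (Is ! j) (Is ! k) * coefB r (Is ! k) (Is ! i)"
  have sub: "?e k ~= 0 --> Is ! i \<subseteq> Is ! j" for k
   using mc[OF r, of k i] mc[OF s, of j k] by auto
  have "?c (cmp \<F> G G G (\<rho> s) (\<rho> r)) i j = msum \<F> (Y i) (Y j) (%k. cmp \<F> (Y i) (Y k) (Y j) (?c (\<rho> s) k j) (?c (\<rho> r) i k)) {..<?n}"
   by (rule E.biprod_matrix_cmp[OF bd \<rho>[OF r] \<rho>[OF s] ij])
  also have "... = msum \<F> (Y i) (Y j) (%k. h (Is ! i) (Is ! j) (?e k)) {..<?n}"
  proof (rule E.msum_cong[OF Yo[OF ij(1)] Yo[OF ij(2)]])
   fix k assume "k \<in> {..<?n}"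
   then have k: "k < ?n" by simp
   show "h (Is ! i) (Is ! j) (?e k) \<in> mor \<F> (Y i) (Y j)"
    unfolding Y_def by (rule h_mor[OF idI[OF ij(1)] idI[OF ij(2)] sub])
   show "cmp \<F> (Y i) (Y k) (Y j) (?c (\<rho> s) k j) (?c (\<rho> r) i k) = h (Is ! i) (Is ! j) (?e k)"
    unfolding \<rho>c[OF s k ij(2)] \<rho>c[OF r ij(1) k] unfolding m_def Y_def
    by (rule h_cmp[OF idI[OF ij(1)] idI[OF k] idI[OF ij(2)] mc[OF r] mc[OF s]])
  qed
  also have "... = h (Is ! i) (Is ! j) (\<Sum>k<?n. ?e k)"
   unfolding Y_def by (rule h_sum[OF idI[OF ij(1)] idI[OF ij(2)] sub])
  also have "(\<Sum>k<?n. ?e k) = coefB (r \<otimes>\<^bsub>B\<^esub> s) (Is ! j) (Is ! i)"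
   unfolding B.coef_mult[OF r s] Is(1)[symmetric]
   by (rule sum.reindex_bij_betw[OF bij_betw_nth[OF Is(2) refl refl]])
  finally show "?c (cmp \<F> G G G (\<rho> s) (\<rho> r)) i j = m (r \<otimes>\<^bsub>B\<^esub> s) i j" by (simp add: m_def)
 qed
 obtain Z where Z: "Z \<in> ob \<F>" "idm \<F> Z = mzero \<F> Z Z" using E.zero_exists by blast
 \<comment> \<open>A direct sum of objects of \<open>?S\<close> is its own summand, with a zero
   object as complement.\<close>
 have addI: "X \<in> add_closure \<F> ?S" if "is_biproduct \<F> Ys X" "set Ys \<subseteq> ?S" for X Ys
 proof -
  have "X \<in> ob \<F>" using that(1) by (simp add: is_biproduct_def)
  then have "is_biproduct \<F> [X, Z] X" by (rule E.is_biproduct_zero[OF _ Z])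
  then show ?thesis unfolding add_closure_def using that by blast
 qed
 have G\<D>: "G \<in> ob \<D>" using G addI[OF GL LS] by simp
 have retr: "idm \<F> X \<in> factors \<F> G X X" if X: "X \<in> ob \<D>" for X
 proof -
  obtain Ys T X' where YT: "set Ys \<subseteq> ?S" "is_biproduct \<F> Ys T" "is_biproduct \<F> [X, X'] T"
   using X by (auto simp: add_closure_def)
  have "idm \<F> (Dp A I) \<in> factors \<F> G (Dp A I) (Dp A I)" if "indecomposable_ideal A I" for I
  proof -
   have "I \<in> set Is" using that Is(1) by simp
   then obtain i where i: "i < ?n" "I = Is ! i" by (auto simp: in_set_conv_nth)
   have "cmp \<F> (Y i) G (Y i) (\<pi> i) (\<iota> i) \<in> factors \<F> G (Y i) (Y i)"
    using ip i Yo by (intro E.factors_cmp[OF G]) auto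
   then show ?thesis unfolding delta[OF i(1) i(1)] i(2) by (simp add: Y_def)
  qed
  from idm_Dp_factors[OF G this] have "idm \<F> Y' \<in> factors \<F> G Y' Y'" if "Y' \<in> set Ys" for Y' using YT(1) that by blast
  from E.idm_factors_summand[OF G YT(3) E.idm_factors_biproduct[OF G YT(2) this]] show ?thesis .
 qed
 \<comment> \<open>The power has to be an object of the subcategory as well, so the same
   \<open>T\<close> is followed as a power of \<open>G\<close> and as a direct sum of functors
   \<open>Dp I\<close>.\<close>
 have pow: "\<exists>T. is_biproduct \<F> (replicate k G) T \<and> is_biproduct \<F> (concat (replicate k ?L)) T" for k
 proof (induction k)
  case 0
  then show ?case using Z E.is_biproduct_Nil by auto
 next
  case (Suc k)
  then obtain T where T: "is_biproduct \<F> (replicate k G) T" "is_biproduct \<F> (concat (replicate k ?L)) T" by blast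
  then have "T \<in> ob \<F>" by (simp add: is_biproduct_def)
  then obtain T' where T': "is_biproduct \<F> [G, T] T'" using E.biproduct_exists[OF G] by blast
  show ?case using E.is_biproduct_append[OF E.is_biproduct_single[OF G] T(1) T'] E.is_biproduct_append[OF GL T(2) T'] by auto
 qed
 interpret GC: gen_cat \<D> B G \<rho>
 proof (rule gen_cat.intro[OF E.lin_cat_full_subcat B.fd_kalg_axioms], unfold_locales)
  show "G \<in> ob \<D>" by (rule G\<D>)
  fix X assume X: "X \<in> ob \<D>"
  then have XE: "X \<in> ob \<F>" by simp
  show "\<exists>n a b. (\<forall>i<n. a i \<in> mor \<D> G X \<and> b i \<in> mor \<D> X G) \<and>
    idm \<D> X = msum \<D> X X (%i. cmp \<D> X G X (a i) (b i)) {..<n::nat}"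
   using E.factors_expand[OF G XE XE retr[OF X]] by (simp only: full_subcat_simps homv_full_subcat)
 next
  fix k
  obtain T where T: "is_biproduct \<F> (replicate k G) T" "is_biproduct \<F> (concat (replicate k ?L)) T" using pow by blast
  have T\<D>: "T \<in> ob \<D>" using T(1) addI[OF T(2)] LS by (auto simp: is_biproduct_def[of \<F> "replicate k G"])
  obtain \<iota>' \<pi>' where d: "biprod_data \<F> (length (replicate k G)) (%i. replicate k G ! i) T \<iota>' \<pi>'"
   using iffD1[OF E.is_biproduct_iff T(1)] by (elim exE)
  then have d: "biprod_data \<F> k (%i. replicate k G ! i) T \<iota>' \<pi>'" unfolding length_replicate .
  have "biprod_data \<F> k (%_. G) T \<iota>' \<pi>'" by (rule E.biprod_data_cong[OF d]) simp
  then have "biprod_data \<D> k (%_. G) T \<iota>' \<pi>'"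
   using T\<D> G\<D> unfolding biprod_data_def by simp
  then show "\<exists>T \<iota> \<pi>. biprod_data \<D> k (%_. G) T \<iota> \<pi>" by blast
 qed (simp_all add: \<rho>_bij \<rho>_add \<rho>_mult \<rho>_one \<rho>_smult)
 \<comment> \<open>\<open>zero_ob\<close> is a choice; the zero functor, as an empty direct sum,
   shows that there is something to choose in the subcategory.\<close>
 have "\<exists>Z. Z \<in> ob \<D> \<and> idm \<D> Z = mzero \<D> Z Z"
  using Z addI[of "[]" Z] E.is_biproduct_Nil[of Z] by (intro exI[of _ Z]) (simp)
 then have zo: "zero_ob \<D> \<in> ob \<D>" unfolding zero_ob_def by (metis (mono_tags, lifting) someI_ex)
 have "mod_iso B (fob (quot_functor GC.coker_functor) (proj_ob \<D> (Dp A I))) (left_principal B (B.E I I)) ~= {}"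
  if I: "indecomposable_ideal A I" for I
 proof -
  have "I \<in> set Is" using I Is(1) by simp
  then obtain k where k: "k < ?n" "I = Is ! k" by (auto simp: in_set_conv_nth)
  have Yk: "Dp A I = Y k" by (simp add: k Y_def)
  have ik: "\<iota> k \<in> mor \<F> (Y k) G" "\<pi> k \<in> mor \<F> G (Y k)" using ip[OF k(1)] by auto
  have Y\<D>: "Y k \<in> ob \<D>"
   using Yo[OF k(1)] addI[OF E.is_biproduct_single[OF Yo[OF k(1)]]] idI[OF k(1)] by (auto simp: Y_def)
  have EI: "B.E I I \<in> carrier B" using I by (intro B.E_in) auto
  \<comment> \<open>The idempotent at \<open>I\<close> corresponds to the projection of
    \<open>G\<close> onto its summand \<open>Dp I\<close>, so \<open>coker_projective\<close>
    applies.\<close>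
  have "\<rho> (B.E I I) = cmp \<F> G (Y k) G (\<iota> k) (\<pi> k)"
  proof (rule \<rho>_eqI[OF EI E.cmp_mor[OF G Yo[OF k(1)] G ik(2,1)]])
   fix i j assume ij: "i < ?n" "j < ?n"
   note o = Yo[OF ij(1)] Yo[OF ij(2)] Yo[OF k(1)] G and ii = ip[OF ij(1)] and jj = ip[OF ij(2)]
   have "?c (cmp \<F> G (Y k) G (\<iota> k) (\<pi> k)) i j =
     cmp \<F> (Y i) (Y k) (Y j) (cmp \<F> (Y k) G (Y j) (\<pi> j) (\<iota> k)) (cmp \<F> (Y i) G (Y k) (\<pi> k) (\<iota> i))"
    using o ii jj ik by (simp add: E.cmp_assoc E.cmp_mor)
   also have "... = (if i = k \<and> j = k then idm \<F> (Y k) else mzero \<F> (Y i) (Y j))"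
    using o unfolding delta[OF k(1) ij(2)] delta[OF ij(1) k(1)]
    by (auto simp: E.cmp_mzero_left E.cmp_mzero_right E.idm_mor E.idm_cmp E.mzero_mor)
   also have "... = m (B.E I I) i j"
    using ij I h_id[OF idI[OF k(1)]] h_zero[OF idI[OF ij(1)] idI[OF ij(2)]]
     nth_eq_iff_index_eq[OF Is(2) ij(1) k(1)] nth_eq_iff_index_eq[OF Is(2) ij(2) k(1)]
    by (auto simp: m_def Y_def B.coef_E k(2))
   finally show "?c (cmp \<F> G (Y k) G (\<iota> k) (\<pi> k)) i j = m (B.E I I) i j" .
  qed
  then show ?thesis unfolding proj_ob_def Yk
   using ik EI delta[OF k(1) k(1)] by (intro GC.coker_projective[OF zo Y\<D>]) (simp_all)
 qed
 then show ?thesis using GC.coker_equivalence by blast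
qed

end

text \<open>Incidence algebras enter twice: for \<open>A\<close> they describe the ideals and their
  homomorphisms, for \<open>R\<close> they give basicness, the radical and the quiver.\<close>

theorem mainTheorem6:
  fixes Q :: "('v, 'e) pre_digraph"
    and A :: "('k::alg_closed_field, ('v, 'e) qpath \<Rightarrow>\<^sub>0 'k) module"
  assumes "tree_quiver Q"
    and "A = path_algebra Q"
    and "D = projection_2cat A"
    and "P = principal_rep D ()"
    and "Q1 = ideal_quiver A"
    and "R = (commutative_path_algebra Q1 :: ('k, _) module)"
  shows "(\<exists>\<Phi>. underlying_algebra_via P () R \<Phi> \<and>
            (\<forall>I\<in>verts Q1. mod_iso R (fob \<Phi> (proj_ob (rep_ob P ()) (Dp A I)))
                             (left_principal R (vertex_idem Q1 I)) \<noteq> {})) \<and>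
         quiver_of_algebra R Q1 (vertex_idem Q1)"
proof -
 interpret QA: quiver_algebra Q A
  using assms(1,2) by (simp add: tree_quiver_def quiver_algebra_def quiver_algebra_axioms_def)
 have "inc_alg A (verts Q) QA.conn QA.pcoef"
  using assms(1) by (intro QA.inc_alg_path_algebra QA.awalk_unique) (auto simp: tree_quiver_def)
 then interpret A: inc_alg A "verts Q" QA.conn QA.pcoef .
 let ?V = "{I. indecomposable_ideal A I}"
 have V: "verts Q1 = ?V" by (simp add: assms(5) ideal_quiver_simps)
 have fQ1: "fin_digraph Q1" unfolding assms(5) by (rule A.fin_digraph_ideal_quiver)
 interpret Q1: quiver_algebra Q1 "path_algebra Q1 :: ('k, (_, _) qpath \<Rightarrow>\<^sub>0 'k) module"
  using fQ1 by (simp add: quiver_algebra_def quiver_algebra_axioms_def)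
 \<comment> \<open>Reachability in the ideal quiver is reverse inclusion, in particular a partial
   order.\<close>
 have conn: "Q1.conn = (%I J. indecomposable_ideal A I \<and> indecomposable_ideal A J \<and> J \<subseteq> I)"
  unfolding fun_eq_iff Q1.conn_def unfolding assms(5) A.ideal_quiver_walk_iff by simp
 have iB: "inc_alg R ?V (%I J. indecomposable_ideal A I \<and> indecomposable_ideal A J \<and> J \<subseteq> I) Q1.qcoef"
  using Q1.inc_alg_commutative_path_algebra unfolding assms(6) V conn by blast
 then interpret B: inc_alg R ?V "%I J. indecomposable_ideal A I \<and> indecomposable_ideal A J \<and> J \<subseteq> I" Q1.qcoef .
 \<comment> \<open>This matches the vertex idempotents of the statement with those for which the
   projective modules were computed.\<close>
 have vi: "vertex_idem Q1 I = B.E I I" if "I \<in> ?V" for I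
 proof (rule B.eqI)
  show "vertex_idem Q1 I \<in> carrier R" using Q1.vertex_idem_in that unfolding assms(6) V by blast
  show "B.E I I \<in> carrier R" using that by (intro B.E_in) simp
  fix u v show "Q1.qcoef (vertex_idem Q1 I) u v = Q1.qcoef (B.E I I) u v"
   using that Q1.qcoef_vertex_idem[of I u v] by (simp add: B.coef_E V)
 qed
 have "quiver_of_algebra R Q1 (vertex_idem Q1)"
 proof (rule B.quiver_of_algebra_R[OF fQ1 V _ vi])
  fix I J assume IJ: "I \<in> ?V" "J \<in> ?V"
  have "B.cov I J \<longleftrightarrow> covers_in ?V I J"
   using IJ unfolding B.cov_def covers_in_def by blast
  moreover have "{a \<in> arcs Q1. tail Q1 a = I \<and> head Q1 a = J} = (if covers_in ?V I J then {(I, J)} else {})"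
   unfolding assms(5) ideal_quiver_simps by auto
  ultimately show "card {a \<in> arcs Q1. tail Q1 a = I \<and> head Q1 a = J} = (if B.cov I J then 1 else 0)" by simp
 qed
 moreover interpret IP: ideal_pair A "verts Q" QA.conn QA.pcoef R Q1.qcoef
  using A.inc_alg_axioms iB by (simp add: ideal_pair_def)
 have rep: "rep_ob P () = IP.\<D>"
  by (simp add: assms(3,4) principal_rep_def projection_2cat_def Let_def)
 obtain \<Phi> where "linear_equivalence (abelianization IP.\<D>) (mod_cat R) \<Phi>"
  "!!I. I \<in> ?V ==> mod_iso R (fob \<Phi> (proj_ob IP.\<D> (Dp A I))) (left_principal R (B.E I I)) ~= {}"
  using IP.projection_equivalence by blast
 ultimately show ?thesis unfolding underlying_algebra_via_def rep V using B.basic_R vi by auto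
qed

end
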